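(* There is an absolute constant $C>0$, and for every $\beta>1$ there are constants $c_1,c_2>0$ depending only on $\beta$, such that the following holds. Let $\mathcal X\in\mathbb R^{n_1\times n_2\times n_3}$ be nonzero with $\operatorname{rank}_t(\mathcal X)=\mathbf r$, $\operatorname{rank}_{ct}(\mathcal X)=r$ and condition number $\kappa$, satisfying the tensor incoherence conditions with parameter $\mu_0$ and the tensor joint incoherence condition with constant $\mu_1$. Let $n=\max\{n_1,n_2,n_3\}\ge2$ and $n_{(1)}=\max\{n_1,n_2\}$. Let $k_1,k_2\ge0$ and $0<\epsilon_0<1$ satisfy $(1-4\epsilon_0)-k_1(1+4\epsilon_0)>0$ and $\gamma_1+\gamma_2<1$, where $$\gamma_1=\frac{18\epsilon_0-10k_1\epsilon_0(1+4\epsilon_0)}{(1-4\epsilon_0)-k_1(1+4\epsilon_0)}+\frac{4k_2\epsilon_0+k_1k_2}{1-4\epsilon_0},\qquad \gamma_2=\frac{8k_2\epsilon_0+2k_1k_2}{1-4\epsilon_0}.$$ Let $\Omega$ consist of $m\le n_1n_2n_3$ indices sampled independently and uniformly with replacement from $\{1,\dots,n_1\}\times\{1,\dots,n_2\}\times\{1,\dots,n_3\}$, and let $\mathcal X_0$ be the output of the initialization by tensor resampled Riemannian gradient descent and trimming with $L=\lceil 6\log(\beta n\log n/(24\epsilon_0))\rceil$ (where $L+1$ divides $m$). If $$m\ \ge\ C\max\left\{\frac{\mu_0r\kappa^2}{\epsilon_0^2},\ \mu_1^2r^2\kappa^6\right\}\beta\,n_{(1)}n_3\log(n_{(1)}n_3)\,\log\Big(\frac{\beta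 n\log n}{24\epsilon_0}\Big),$$ then, with probability at least $1-c_1(L+1)(n_{(1)}n_3)^{-c_2}$, the iterates of the restarted tensor Riemannian conjugate gradient descent method (with restart parameters $k_1,k_2$, sampling list $\Omega$) started at $\mathcal X_0$ converge to $\mathcal X$.
   Context: Tensor notation. $\widehat{\mathcal A}$ is obtained from $\mathcal A\in\mathbb R^{n_1\times n_2\times n_3}$ by applying the orthonormal DCT (a real orthogonal $n_3\times n_3$ matrix) to every tube $\mathcal A(i,j,:)$; $\widehat{\mathcal A}^{(k)}$ is the $k$-th frontal slice of $\widehat{\mathcal A}$; $\overline{\mathcal A}$ is the block diagonal matrix with blocks $\widehat{\mathcal A}^{(1)},\dots,\widehat{\mathcal A}^{(n_3)}$. $\mathcal A*\mathcal B$ and $\mathcal A^T$ are defined slicewise: $\widehat{\mathcal A*\mathcal B}^{(k)}=\widehat{\mathcal A}^{(k)}\widehat{\mathcal B}^{(k)}$, $\widehat{\mathcal A^T}^{(k)}=(\widehat{\mathcal A}^{(k)})^T$. $\langle\cdot,\cdot\rangle$, $\|\cdot\|_F$: entrywise Euclidean inner product and norm; $\|\mathcal A\|_\infty$: maximal absolute entry; $\|\mathcal A\|$: matrix spectral norm of $\overline{\mathcal A}$. $\operatorname{rank}_t(\mathcal A)=(\operatorname{rank}\widehat{\mathcal A}^{(k)})_{k=1}^{n_3}$ and $\operatorname{rank}_{ct}(\mathcal A)=\max_k\operatorname{rank}\widehat{\mathcal A}^{(k)}$. $\kappa$ is the ratio of the largest to the smallest nonzero singular value of $\overline{\mathcal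 X}$. Skinny t$_c$-SVD. If $\operatorname{rank}_t(\mathcal A)=\mathbf r=(r_1,\dots,r_{n_3})$, $r=\max_kr_k$: $\mathcal A=\mathcal U*\mathcal S*\mathcal V^T$, $\mathcal U\in\mathbb R^{n_1\times r\times n_3}$, $\mathcal V\in\mathbb R^{n_2\times r\times n_3}$, $\mathcal U^T*\mathcal U=\mathcal V^T*\mathcal V=\mathcal I_{\mathbf r}$ with $\widehat{\mathcal I_{\mathbf r}}^{(k)}=\mathrm{diag}(I_{r_k},0)$, $\mathcal S$ with diagonal frontal slices (slicewise SVD in the DCT domain). Incoherence. $\vec{\mathbf e}_i$ is the tensor with one lateral slice (size $n_1\times1\times n_3$ or $n_2\times1\times n_3$) whose DCT has $i$-th tube with all entries $1/\sqrt{n_3}$ and all other tubes zero. $\mathcal X=\mathcal U*\mathcal S*\mathcal V^T$ (skinny) satisfies the tensor incoherence conditions with parameter $\mu_0>0$ if $\max_{i\le n_1}\|\mathcal U^T*\vec{\mathbf e}_i\|_F\le\sqrt{\mu_0r/n_1}$ and $\max_{j\le n_2}\|\mathcal V^T*\vec{\mathbf e}_j\|_F\le\sqrt{\mu_0r/n_2}$. It satisfies the joint incoherence condition with $\mu_1>0$ if $\|\mathcal X\|_\infty\le\mu_1\sqrt{r/(n_1n_2n_3)}\,\|\mathcal X\|$. Manifold. $\mathcal M_{\mathbf r}=\{\mathcal Z:\operatorname{rank}_t(\mathcal Z)=\mathbf r\}$. The tangent space at a point with skinny t$_c$-SVD $\mathcal U*\mathcal S*\mathcal V^T$ is $\{\mathcal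 U*\mathcal Z_1^T+\mathcal Z_2*\mathcal V^T\}$, $\mathcal Z_1\in\mathbb R^{n_2\times r\times n_3}$, $\mathcal Z_2\in\mathbb R^{n_1\times r\times n_3}$ arbitrary, with orthogonal projection $P(\mathcal A)=\mathcal U*\mathcal U^T*\mathcal A+\mathcal A*\mathcal V*\mathcal V^T-\mathcal U*\mathcal U^T*\mathcal A*\mathcal V*\mathcal V^T$. $H_{\mathbf r}$ replaces each $\widehat{\mathcal W}^{(k)}$ by its best rank-$r_k$ approximation (truncated SVD). Sampling operator. For a list $\Omega$ of indices, $R_\Omega(\mathcal Z)=\sum_{(i,j,k)\in\Omega}\langle\mathcal E_{ijk},\mathcal Z\rangle\mathcal E_{ijk}$, counted with multiplicity, where $\mathcal E_{ijk}$ has a $1$ at $(i,j,k)$ and zeros elsewhere. Trimming. For $\mathcal Z=\mathcal U*\mathcal S*\mathcal V^T$ (skinny t$_c$-SVD), $\mathrm{trim}(\mathcal Z)=\mathcal A*\mathcal S*\mathcal B^T$, where the horizontal slices of $\mathcal A,\mathcal B$ are rescaled ones of $\mathcal U,\mathcal V$: $\mathcal A(i,:,:)=\mathcal U(i,:,:)\min\{1,\sqrt{\mu_0r/n_1}/\|\mathcal U^T*\vec{\mathbf e}_i\|_F\}$ and $\mathcal B(j,:,:)=\mathcal V(j,:,:)\min\{1,\sqrt{\mu_0r/n_2}/\|\mathcal V^T*\vec{\mathbf e}_j\|_F\}$ (zero slices stay zero). Note $\|\mathcal U^T*\vec{\mathbf e}_i\|_F=\|\mathcal U(i,:,:)\|_F/\sqrt{n_3}$.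 Initialization by tensor resampled Riemannian gradient descent and trimming. Partition the list $\Omega$ into $L+1$ groups $\Omega_0,\dots,\Omega_L$ of equal size $\hat m$. Set $\mathcal Z_0=H_{\mathbf r}\big(\frac{n_1n_2n_3}{\hat m}R_{\Omega_0}(\mathcal X)\big)$. For $l=0,\dots,L-1$: $\hat{\mathcal Z}_l=\mathrm{trim}(\mathcal Z_l)$ and $\mathcal Z_{l+1}=H_{\mathbf r}\big(\hat{\mathcal Z}_l+\frac{n_1n_2n_3}{\hat m}P_{\hat{\mathcal T}_l}R_{\Omega_{l+1}}(\mathcal X-\hat{\mathcal Z}_l)\big)$, with $\hat{\mathcal T}_l$ the tangent space of $\mathcal M_{\mathbf r}$ at $\hat{\mathcal Z}_l$. Output $\mathcal X_0=\mathcal Z_L$. Restarted tensor Riemannian conjugate gradient descent. Start from $\mathcal X_0\in\mathcal M_{\mathbf r}$, $\mathcal Q_{-1}=0$, $\beta_0=0$. For $l=0,1,\dots$, with $\mathcal T_l$ the tangent space of $\mathcal M_{\mathbf r}$ at $\mathcal X_l$: (1) $\mathcal G_l=R_\Omega(\mathcal X-\mathcal X_l)$; (2) for $l\ge1$, $\beta_l=-\frac{\langle P_{\mathcal T_l}(\mathcal G_l),R_\Omega P_{\mathcal T_l}(\mathcal Q_{l-1})\rangle}{\langle P_{\mathcal T_l}(\mathcal Q_{l-1}),R_\Omega P_{\mathcal T_l}(\mathcal Q_{l-1})\rangle}$ if both $\frac{|\langle P_{\mathcal T_l}(\mathcal G_l),P_{\mathcal T_l}(\mathcal Q_{l-1})\rangle|}{\|P_{\mathcal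 T_l}(\mathcal G_l)\|_F\|P_{\mathcal T_l}(\mathcal Q_{l-1})\|_F}\le k_1$ and $\|P_{\mathcal T_l}(\mathcal G_l)\|_F\le k_2\|P_{\mathcal T_l}(\mathcal Q_{l-1})\|_F$ hold, and $\beta_l=0$ otherwise (also if the quotient is undefined); (3) $\mathcal Q_l=P_{\mathcal T_l}(\mathcal G_l)+\beta_lP_{\mathcal T_l}(\mathcal Q_{l-1})$; (4) $\alpha_l=\frac{\langle P_{\mathcal T_l}(\mathcal G_l),P_{\mathcal T_l}(\mathcal Q_l)\rangle}{\langle P_{\mathcal T_l}(\mathcal Q_l),R_\Omega P_{\mathcal T_l}(\mathcal Q_l)\rangle}$; (5) $\mathcal W_l=\mathcal X_l+\alpha_l\mathcal Q_l$; (6) $\mathcal X_{l+1}=H_{\mathbf r}(\mathcal W_l)$. If $P_{\mathcal T_l}(\mathcal G_l)=0$ the method stops and all later iterates are taken equal to $\mathcal X_l$. (The probabilistic event includes that all iterates of both procedures are well defined.) *)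

theory Defs
  imports "HOL-Probability.Probability_Mass_Function"
    "Jordan_Normal_Form.DL_Rank" "Jordan_Normal_Form.Char_Poly"
begin

unbundle no vec_syntax
unbundle no inner_syntax
hide_const (open) Finite_Cartesian_Product.vec Finite_Cartesian_Product.mat
  Finite_Cartesian_Product.row Finite_Cartesian_Product.transpose

section \<open>Real matrices\<close>

definition mat_rank :: "real mat \<Rightarrow> nat" where
  "mat_rank A = vec_space.rank (dim_row A) A"

definition frob_norm :: "real mat \<Rightarrow> real" where
  "frob_norm A = sqrt (\<Sum>i<dim_row A. \<Sum>j<dim_col A. (A $$ (i, j))\<^sup>2)"

text \<open>If \<open>A\<close> has more columns than rows, this set contains an additional \<open>0\<close>, which affects
  neither the largest nor the smallest nonzero singular value.\<close>

definition singular_values :: "real mat \<Rightarrow> real set" where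
  "singular_values A = {\<sigma>. \<sigma> \<ge> 0 \<and> eigenvalue (transpose_mat A * A) (\<sigma>\<^sup>2)}"

definition spectral_norm :: "real mat \<Rightarrow> real" where
  "spectral_norm A = Max (singular_values A)"

definition cond_number :: "real mat \<Rightarrow> real" where
  "cond_number A = Max (singular_values A) / Min (singular_values A - {0})"

text \<open>The best approximations of rank at most \<open>s\<close> in Frobenius norm; by Eckart--Young these are
  the truncated singular value decompositions of \<open>W\<close>. There are several of them exactly when
  \<open>\<sigma>\<^sub>s = \<sigma>\<^sub>s\<^sub>+\<^sub>1 > 0\<close>.\<close>

definition best_rank_approx :: "nat \<Rightarrow> real mat \<Rightarrow> real mat \<Rightarrow> bool" where
  "best_rank_approx s W Y \<longleftrightarrow>
     Y \<in> carrier_mat (dim_row W) (dim_col W) \<and> mat_rank Y \<le> s \<and>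
     (\<forall>Y' \<in> carrier_mat (dim_row W) (dim_col W).
        mat_rank Y' \<le> s \<longrightarrow> frob_norm (W - Y) \<le> frob_norm (W - Y'))"


section \<open>Third-order tensors\<close>

text \<open>A tensor is the vector of its frontal slices, so that \<open>A $ k $$ (i, j)\<close> is the entry
  \<open>(i, j, k)\<close>. All indices start at \<open>0\<close>. Addition and subtraction are those of vectors of matrices.\<close>

type_synonym tensor = "real mat vec"

definition tensors :: "nat \<Rightarrow> nat \<Rightarrow> nat \<Rightarrow> tensor set" where
  "tensors n1 n2 n3 = {A. dim_vec A = n3 \<and> (\<forall>k<n3. A $ k \<in> carrier_mat n1 n2)}"

definition dim1 :: "tensor \<Rightarrow> nat" where "dim1 A = dim_row (A $ 0)"
definition dim2 :: "tensor \<Rightarrow> nat" where "dim2 A = dim_col (A $ 0)"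
definition dim3 :: "tensor \<Rightarrow> nat" where "dim3 A = dim_vec A"

definition tzero :: "nat \<Rightarrow> nat \<Rightarrow> nat \<Rightarrow> tensor" where
  "tzero n1 n2 n3 = vec n3 (\<lambda>k. 0\<^sub>m n1 n2)"

definition tscale :: "real \<Rightarrow> tensor \<Rightarrow> tensor" (infixr \<open>\<cdot>\<^sub>t\<close> 75) where
  "c \<cdot>\<^sub>t A = map_vec (\<lambda>M. c \<cdot>\<^sub>m M) A"

definition tinner :: "tensor \<Rightarrow> tensor \<Rightarrow> real" where
  "tinner A B = (\<Sum>k<dim3 A. \<Sum>i<dim1 A. \<Sum>j<dim2 A. A $ k $$ (i, j) * B $ k $$ (i, j))"

definition tnorm :: "tensor \<Rightarrow> real" where
  "tnorm A = sqrt (tinner A A)"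

definition tnorm_inf :: "tensor \<Rightarrow> real" where
  "tnorm_inf A = Max {\<bar>A $ k $$ (i, j)\<bar> | i j k. i < dim1 A \<and> j < dim2 A \<and> k < dim3 A}"

text \<open>The orthonormal DCT (of type II).\<close>

definition dct :: "nat \<Rightarrow> real mat" where
  "dct n = mat n n (\<lambda>(k, l).
     sqrt ((if k = 0 then 1 else 2) / n) * cos (pi * k * (2 * l + 1) / (2 * n)))"

definition tube :: "tensor \<Rightarrow> nat \<Rightarrow> nat \<Rightarrow> real vec" where
  "tube A i j = vec (dim3 A) (\<lambda>k. A $ k $$ (i, j))"

definition apply_tubes :: "real mat \<Rightarrow> tensor \<Rightarrow> tensor" where
  "apply_tubes D A =
     vec (dim3 A) (\<lambda>k. mat (dim1 A) (dim2 A) (\<lambda>(i, j). (D *\<^sub>v tube A i j) $ k))"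

definition hat :: "tensor \<Rightarrow> tensor" where
  "hat A = apply_tubes (dct (dim3 A)) A"

text \<open>As the DCT matrix is orthogonal, its transpose inverts it.\<close>

definition unhat :: "tensor \<Rightarrow> tensor" where
  "unhat A = apply_tubes (transpose_mat (dct (dim3 A))) A"

definition bar :: "tensor \<Rightarrow> real mat" where
  "bar A = diag_block_mat (list_of_vec (hat A))"

definition tspectral_norm :: "tensor \<Rightarrow> real" where
  "tspectral_norm A = spectral_norm (bar A)"

definition tprod :: "tensor \<Rightarrow> tensor \<Rightarrow> tensor" (infixl \<open>*\<^sub>t\<close> 70) where
  "A *\<^sub>t B = unhat (vec (dim3 A) (\<lambda>k. hat A $ k * hat B $ k))"

definition ttranspose :: "tensor \<Rightarrow> tensor" where
  "ttranspose A = unhat (map_vec transpose_mat (hat A))"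

definition rank_t :: "tensor \<Rightarrow> nat vec" where
  "rank_t A = map_vec mat_rank (hat A)"

definition max_entry :: "nat vec \<Rightarrow> nat" where
  "max_entry rs = Max {rs $ k | k. k < dim_vec rs}"

definition rank_ct :: "tensor \<Rightarrow> nat" where
  "rank_ct A = max_entry (rank_t A)"


section \<open>Skinny singular value decomposition and incoherence\<close>

definition tident :: "nat vec \<Rightarrow> tensor" where
  "tident rs = unhat (vec (dim_vec rs) (\<lambda>k. mat (max_entry rs) (max_entry rs)
     (\<lambda>(i, j). if i = j \<and> i < rs $ k then 1 else 0)))"

definition is_skinny_svd :: "tensor \<Rightarrow> tensor \<Rightarrow> tensor \<Rightarrow> tensor \<Rightarrow> bool" where
  "is_skinny_svd A U S V \<longleftrightarrow>
     (let r = rank_ct A; rs = rank_t A in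
       U \<in> tensors (dim1 A) r (dim3 A) \<and>
       S \<in> tensors r r (dim3 A) \<and>
       V \<in> tensors (dim2 A) r (dim3 A) \<and>
       ttranspose U *\<^sub>t U = tident rs \<and>
       ttranspose V *\<^sub>t V = tident rs \<and>
       (\<forall>k<dim3 A. diagonal_mat (S $ k)) \<and>
       (\<forall>k<dim3 A. \<forall>i<r.
          (if i < rs $ k then hat S $ k $$ (i, i) > 0 else hat S $ k $$ (i, i) = 0)) \<and>
       (\<forall>k<dim3 A. \<forall>i j. i \<le> j \<and> j < r \<longrightarrow> hat S $ k $$ (j, j) \<le> hat S $ k $$ (i, i)) \<and>
       A = U *\<^sub>t S *\<^sub>t ttranspose V)"

text \<open>An arbitrary skinny SVD. It is only used where the result does not depend on the choice:
  \<open>U * U\<^sup>T\<close>, \<open>V * V\<^sup>T\<close> and the norms of the horizontal slices of \<open>U\<close> and \<open>V\<close> are the same for all of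
  them.\<close>

definition skinny_svd :: "tensor \<Rightarrow> tensor \<times> tensor \<times> tensor" where
  "skinny_svd A = (SOME (U, S, V). is_skinny_svd A U S V)"

definition evec :: "nat \<Rightarrow> nat \<Rightarrow> nat \<Rightarrow> tensor" where
  "evec n n3 i = unhat (vec n3 (\<lambda>k. mat n 1 (\<lambda>(a, b). if a = i then 1 / sqrt n3 else 0)))"

definition tensor_incoherent :: "real \<Rightarrow> tensor \<Rightarrow> bool" where
  "tensor_incoherent \<mu>0 X \<longleftrightarrow>
     (\<exists>U S V. is_skinny_svd X U S V \<and>
       (\<forall>i<dim1 X. tnorm (ttranspose U *\<^sub>t evec (dim1 X) (dim3 X) i)
          \<le> sqrt (\<mu>0 * rank_ct X / dim1 X)) \<and>
       (\<forall>j<dim2 X. tnorm (ttranspose V *\<^sub>t evec (dim2 X) (dim3 X) j)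
          \<le> sqrt (\<mu>0 * rank_ct X / dim2 X)))"

definition joint_incoherent :: "real \<Rightarrow> tensor \<Rightarrow> bool" where
  "joint_incoherent \<mu>1 X \<longleftrightarrow>
     tnorm_inf X \<le> \<mu>1 * sqrt (rank_ct X / (real (dim1 X) * real (dim2 X) * real (dim3 X)))
       * tspectral_norm X"


section \<open>The fixed-rank manifold, thresholding and trimming\<close>

definition manifold :: "nat \<Rightarrow> nat \<Rightarrow> nat vec \<Rightarrow> tensor set" where
  "manifold n1 n2 rs = {Z \<in> tensors n1 n2 (dim_vec rs). rank_t Z = rs}"

text \<open>Orthogonal projection onto the tangent space at \<open>Z\<close> of the manifold through \<open>Z\<close>.\<close>

definition tangent_proj :: "tensor \<Rightarrow> tensor \<Rightarrow> tensor" where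
  "tangent_proj Z A = (case skinny_svd Z of (U, S, V) \<Rightarrow>
     U *\<^sub>t ttranspose U *\<^sub>t A + A *\<^sub>t V *\<^sub>t ttranspose V
       - U *\<^sub>t ttranspose U *\<^sub>t A *\<^sub>t V *\<^sub>t ttranspose V)"

definition threshold_defined :: "nat vec \<Rightarrow> tensor \<Rightarrow> bool" where
  "threshold_defined rs W \<longleftrightarrow> (\<forall>k<dim3 W. \<exists>!Y. best_rank_approx (rs $ k) (hat W $ k) Y)"

definition threshold :: "nat vec \<Rightarrow> tensor \<Rightarrow> tensor" where
  "threshold rs W = unhat (vec (dim3 W) (\<lambda>k. THE Y. best_rank_approx (rs $ k) (hat W $ k) Y))"

text \<open>Rescales the horizontal slices of \<open>U\<close>. Zero slices stay zero, irrespective of division by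
  zero.\<close>

definition trim_factor :: "real \<Rightarrow> nat \<Rightarrow> tensor \<Rightarrow> tensor" where
  "trim_factor \<mu>0 r U = map_vec (\<lambda>M. mat (dim_row M) (dim_col M) (\<lambda>(i, j).
     M $$ (i, j) * min 1 (sqrt (\<mu>0 * r / dim1 U)
       / tnorm (ttranspose U *\<^sub>t evec (dim1 U) (dim3 U) i)))) U"

definition trim :: "real \<Rightarrow> nat \<Rightarrow> tensor \<Rightarrow> tensor" where
  "trim \<mu>0 r Z = (case skinny_svd Z of (U, S, V) \<Rightarrow>
     trim_factor \<mu>0 r U *\<^sub>t S *\<^sub>t ttranspose (trim_factor \<mu>0 r V))"


section \<open>Sampling\<close>

type_synonym index = "nat \<times> nat \<times> nat"

definition basis_tensor :: "nat \<Rightarrow> nat \<Rightarrow> nat \<Rightarrow> index \<Rightarrow> tensor" where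
  "basis_tensor n1 n2 n3 = (\<lambda>(i, j, k).
     vec n3 (\<lambda>c. mat n1 n2 (\<lambda>(a, b). if a = i \<and> b = j \<and> c = k then 1 else 0)))"

definition sampling_op :: "index list \<Rightarrow> tensor \<Rightarrow> tensor" where
  "sampling_op \<Omega> Z = (let E = basis_tensor (dim1 Z) (dim2 Z) (dim3 Z) in
     foldr (\<lambda>\<omega> Y. tinner (E \<omega>) Z \<cdot>\<^sub>t E \<omega> + Y) \<Omega> (tzero (dim1 Z) (dim2 Z) (dim3 Z)))"

definition index_set :: "nat \<Rightarrow> nat \<Rightarrow> nat \<Rightarrow> index set" where
  "index_set n1 n2 n3 = {..<n1} \<times> {..<n2} \<times> {..<n3}"

definition uniform_samples :: "nat \<Rightarrow> nat \<Rightarrow> nat \<Rightarrow> nat \<Rightarrow> index list pmf" where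
  "uniform_samples m n1 n2 n3 = replicate_pmf m (pmf_of_set (index_set n1 n2 n3))"

text \<open>A partition of the positions of a list of length \<open>m\<close> into \<open>L + 1\<close> groups of equal size.\<close>

definition equal_groups :: "nat \<Rightarrow> nat \<Rightarrow> (nat \<Rightarrow> nat set) \<Rightarrow> bool" where
  "equal_groups m L G \<longleftrightarrow>
     disjoint_family_on G {..L} \<and> (\<Union>l\<in>{..L}. G l) = {..<m} \<and>
     (\<forall>l\<le>L. card (G l) * (L + 1) = m)"


section \<open>Initialization\<close>

text \<open>The tensor that is thresholded in the step from \<open>Zhat\<close>, where \<open>mh\<close> is the group size and \<open>\<Omega>\<close>
  the group used in that step.\<close>

definition init_step :: "real \<Rightarrow> tensor \<Rightarrow> index list \<Rightarrow> tensor \<Rightarrow> tensor" where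
  "init_step mh X \<Omega> Zhat =
     Zhat + (real (dim1 X) * real (dim2 X) * real (dim3 X) / mh)
       \<cdot>\<^sub>t tangent_proj Zhat (sampling_op \<Omega> (X - Zhat))"

definition init_start :: "real \<Rightarrow> tensor \<Rightarrow> index list \<Rightarrow> tensor" where
  "init_start mh X \<Omega> =
     (real (dim1 X) * real (dim2 X) * real (dim3 X) / mh) \<cdot>\<^sub>t sampling_op \<Omega> X"

primrec init_iter ::
  "real \<Rightarrow> nat vec \<Rightarrow> real \<Rightarrow> tensor \<Rightarrow> (nat \<Rightarrow> index list) \<Rightarrow> nat \<Rightarrow> tensor" where
  "init_iter \<mu>0 rs mh X \<Omega>s 0 = threshold rs (init_start mh X (\<Omega>s 0))"
| "init_iter \<mu>0 rs mh X \<Omega>s (Suc l) =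
     threshold rs (init_step mh X (\<Omega>s (Suc l))
       (trim \<mu>0 (max_entry rs) (init_iter \<mu>0 rs mh X \<Omega>s l)))"

definition init_well_defined ::
  "real \<Rightarrow> nat vec \<Rightarrow> real \<Rightarrow> tensor \<Rightarrow> (nat \<Rightarrow> index list) \<Rightarrow> nat \<Rightarrow> bool" where
  "init_well_defined \<mu>0 rs mh X \<Omega>s L \<longleftrightarrow>
     threshold_defined rs (init_start mh X (\<Omega>s 0)) \<and>
     (\<forall>l<L. let Zhat = trim \<mu>0 (max_entry rs) (init_iter \<mu>0 rs mh X \<Omega>s l) in
        Zhat \<in> manifold (dim1 X) (dim2 X) rs \<and>
        threshold_defined rs (init_step mh X (\<Omega>s (Suc l)) Zhat))"


section \<open>Restarted Riemannian conjugate gradient descent\<close>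

text \<open>In the following, \<open>Xl\<close> is the current iterate and \<open>Qp\<close> the previous search direction.\<close>

definition cg_grad :: "index list \<Rightarrow> tensor \<Rightarrow> tensor \<Rightarrow> tensor" where
  "cg_grad \<Omega> X Xl = tangent_proj Xl (sampling_op \<Omega> (X - Xl))"

text \<open>The undefined quotients are those with a zero denominator; if one of the two factors of the
  denominator in the first restart criterion vanishes, then so does the denominator of \<open>\<beta>\<close> or the
  method has stopped.\<close>

definition cg_beta ::
  "real \<Rightarrow> real \<Rightarrow> index list \<Rightarrow> tensor \<Rightarrow> nat \<Rightarrow> tensor \<Rightarrow> tensor \<Rightarrow> real" where
  "cg_beta k1 k2 \<Omega> X l Xl Qp =
     (let PG = cg_grad \<Omega> X Xl; PQ = tangent_proj Xl Qp; den = tinner PQ (sampling_op \<Omega> PQ) in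
      if l \<ge> 1 \<and> den \<noteq> 0 \<and>
         \<bar>tinner PG PQ\<bar> / (tnorm PG * tnorm PQ) \<le> k1 \<and> tnorm PG \<le> k2 * tnorm PQ
      then - (tinner PG (sampling_op \<Omega> PQ) / den)
      else 0)"

definition cg_dir ::
  "real \<Rightarrow> real \<Rightarrow> index list \<Rightarrow> tensor \<Rightarrow> nat \<Rightarrow> tensor \<Rightarrow> tensor \<Rightarrow> tensor" where
  "cg_dir k1 k2 \<Omega> X l Xl Qp =
     cg_grad \<Omega> X Xl + cg_beta k1 k2 \<Omega> X l Xl Qp \<cdot>\<^sub>t tangent_proj Xl Qp"

definition cg_alpha_den :: "index list \<Rightarrow> tensor \<Rightarrow> tensor \<Rightarrow> real" where
  "cg_alpha_den \<Omega> Xl Q = tinner (tangent_proj Xl Q) (sampling_op \<Omega> (tangent_proj Xl Q))"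

definition cg_update :: "index list \<Rightarrow> tensor \<Rightarrow> tensor \<Rightarrow> tensor \<Rightarrow> tensor" where
  "cg_update \<Omega> X Xl Q =
     Xl + (tinner (cg_grad \<Omega> X Xl) (tangent_proj Xl Q) / cg_alpha_den \<Omega> Xl Q) \<cdot>\<^sub>t Q"

definition cg_stopped :: "index list \<Rightarrow> tensor \<Rightarrow> tensor \<Rightarrow> bool" where
  "cg_stopped \<Omega> X Xl \<longleftrightarrow> cg_grad \<Omega> X Xl = tzero (dim1 X) (dim2 X) (dim3 X)"

text \<open>The \<open>l\<close>-th state is the pair of the iterate with index \<open>l\<close> and the search direction with index
  \<open>l - 1\<close>. Once stopped, the state does not change, so the method remains stopped.\<close>

primrec cg_state ::
  "real \<Rightarrow> real \<Rightarrow> nat vec \<Rightarrow> index list \<Rightarrow> tensor \<Rightarrow> tensor \<Rightarrow> nat \<Rightarrow> tensor \<times> tensor" where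
  "cg_state k1 k2 rs \<Omega> X X0 0 = (X0, tzero (dim1 X) (dim2 X) (dim3 X))"
| "cg_state k1 k2 rs \<Omega> X X0 (Suc l) =
     (case cg_state k1 k2 rs \<Omega> X X0 l of (Xl, Qp) \<Rightarrow>
       if cg_stopped \<Omega> X Xl then (Xl, Qp)
       else let Q = cg_dir k1 k2 \<Omega> X l Xl Qp in (threshold rs (cg_update \<Omega> X Xl Q), Q))"

definition cg_iter ::
  "real \<Rightarrow> real \<Rightarrow> nat vec \<Rightarrow> index list \<Rightarrow> tensor \<Rightarrow> tensor \<Rightarrow> nat \<Rightarrow> tensor" where
  "cg_iter k1 k2 rs \<Omega> X X0 l = fst (cg_state k1 k2 rs \<Omega> X X0 l)"

definition cg_well_defined ::
  "real \<Rightarrow> real \<Rightarrow> nat vec \<Rightarrow> index list \<Rightarrow> tensor \<Rightarrow> tensor \<Rightarrow> bool" where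
  "cg_well_defined k1 k2 rs \<Omega> X X0 \<longleftrightarrow>
     (\<forall>l. case cg_state k1 k2 rs \<Omega> X X0 l of (Xl, Qp) \<Rightarrow>
       Xl \<in> manifold (dim1 X) (dim2 X) rs \<and>
       (\<not> cg_stopped \<Omega> X Xl \<longrightarrow>
         (let Q = cg_dir k1 k2 \<Omega> X l Xl Qp in
           cg_alpha_den \<Omega> Xl Q \<noteq> 0 \<and> threshold_defined rs (cg_update \<Omega> X Xl Q))))"

definition tconverges :: "(nat \<Rightarrow> tensor) \<Rightarrow> tensor \<Rightarrow> bool" where
  "tconverges A B \<longleftrightarrow> (\<lambda>l. tnorm (A l - B)) \<longlonglongrightarrow> 0"

text \<open>The event that both procedures are well defined and the iterates converge to \<open>X\<close>; the group
  \<open>l\<close> of the initialization consists of the entries of the sampled list at the positions \<open>G l\<close>.\<close>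

definition recovers ::
  "real \<Rightarrow> real \<Rightarrow> real \<Rightarrow> tensor \<Rightarrow> nat \<Rightarrow> (nat \<Rightarrow> nat set) \<Rightarrow> index list \<Rightarrow> bool" where
  "recovers \<mu>0 k1 k2 X L G \<Omega> \<longleftrightarrow>
     (let rs = rank_t X;
          mh = real (length \<Omega>) / real (L + 1);
          \<Omega>s = (\<lambda>l. nths \<Omega> (G l));
          X0 = init_iter \<mu>0 rs mh X \<Omega>s L
      in init_well_defined \<mu>0 rs mh X \<Omega>s L \<and>
         cg_well_defined k1 k2 rs \<Omega> X X0 \<and>
         tconverges (cg_iter k1 k2 rs \<Omega> X X0) X)"

definition gamma1 :: "real \<Rightarrow> real \<Rightarrow> real \<Rightarrow> real" where
  "gamma1 k1 k2 \<epsilon>0 =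
     (18 * \<epsilon>0 - 10 * k1 * \<epsilon>0 * (1 + 4 * \<epsilon>0)) / ((1 - 4 * \<epsilon>0) - k1 * (1 + 4 * \<epsilon>0))
     + (4 * k2 * \<epsilon>0 + k1 * k2) / (1 - 4 * \<epsilon>0)"

definition gamma2 :: "real \<Rightarrow> real \<Rightarrow> real \<Rightarrow> real" where
  "gamma2 k1 k2 \<epsilon>0 = (8 * k2 * \<epsilon>0 + 2 * k1 * k2) / (1 - 4 * \<epsilon>0)"

end

theory Submission
  imports Defs
begin

text \<open>
  In the DCT domain a tensor is a block diagonal matrix, and everything becomes matrix algebra. Near \<open>X\<close>,
  thresholding at most doubles the distance to \<open>X\<close>, and the component of \<open>X\<close> normal to the tangent space at a
  point of distance \<open>e\<close> has norm at most \<open>e\<^sup>2 / \<sigma>\<close>, where \<open>\<sigma>\<close> is the smallest nonzero singular value. Hence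
  both procedures contract as soon as the sampling operator is close to a multiple of the identity on the tangent
  spaces that occur.

  All random estimates are instances of one concentration inequality for sums of independent rank-one operators,
  which is proved by the moment method: exchanging one sample for an independent copy gives a recursion for the
  traces of the even powers of the deviation. It is applied to the starting point (slice by slice), to every
  step of the initialization (the group used in a step is independent of the current iterate, which trimming keeps
  incoherent), to the tangent space at \<open>X\<close>, and to the norm of the sampling operator. The initialization halves the
  distance to \<open>X\<close> in each step and ends at a distance of order \<open>\<epsilon>0 / n\<close>. The restricted isometry property
  at \<open>X\<close> then passes to all tangent spaces met by the conjugate gradient method by a mere norm bound, so
  that no uniformity over the manifold is needed.
\<close>

section \<open>Finitely supported matrices\<close>

text \<open>Sampling with replacement may repeat an index, so the sampling operator is only bounded
  by about \<open>31 * \<rho> + 30 * p\<close>, where \<open>\<rho>\<close> is the sampling ratio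
  and \<open>p\<close> is of order \<open>ln NN\<close>; relative to \<open>\<rho>\<close> this may
  be of order \<open>n\<close>. The passage from the tangent space at \<open>X\<close> to a nearby
  one multiplies the distance by this norm, so the basin of the conjugate gradient method has radius
  of order \<open>\<epsilon>0 / n\<close>. This is why the initialization needs logarithmically many
  steps.

  The powers of \<open>\<kappa>\<close> come from trimming: it multiplies the distance by up to
  \<open>5 * \<kappa>\<close>, and the curvature error is quadratic in the result, so the invariant
  of the initialization bounds \<open>\<kappa>\<^sup>2\<close> times the distance. The starting
  point must therefore have spectral accuracy of order
  \<open>\<sigma> / (\<kappa>\<^sup>2 * sqrt (n3 * r))\<close>. Its variance is of order
  \<open>\<mu>1\<^sup>2 * r * \<kappa>\<^sup>2 * \<sigma>\<^sup>2 / n3\<close>, and the quotient of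
  the variance by the squared accuracy is \<open>\<mu>1\<^sup>2 * r\<^sup>2 * \<kappa> ^ 6\<close>.

  Moments of order \<open>2 * p\<close> give a tail \<open>NN powr (- 4)\<close> per dimension; the
  dimension is at most \<open>NN\<^sup>2\<close>, which leaves the exponent \<open>2\<close> of the
  final probability.\<close>

text \<open>On this type the products of matrices of arbitrary formats are total. The ring has no unit; identity
  matrices are the coordinate projections \<open>fId J\<close> below.\<close>

typedef 'a fmat = "{f :: 'a \<Rightarrow> 'a \<Rightarrow> real. finite {p. f (fst p) (snd p) \<noteq> 0}}"
  morphisms ent Abs_fmat
  by (rule exI[of _ "\<lambda>_ _. 0"]) simp

setup_lifting type_definition_fmat

lemma fmat_eqI: "(\<And>i j. ent A i j = ent B i j) \<Longrightarrow> A = B"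
  by (metis ent_inject ext)

definition fsupp :: "'a fmat \<Rightarrow> 'a set" where
  "fsupp A = {i. \<exists>j. ent A i j \<noteq> 0 \<or> ent A j i \<noteq> 0}"

lemma finite_ent_supp: "finite {p. ent A (fst p) (snd p) \<noteq> 0}"
  using ent[of A] by simp

lemma finite_fsupp [simp]: "finite (fsupp A)"
proof -
  have "fsupp A \<subseteq> fst ` {p. ent A (fst p) (snd p) \<noteq> 0} \<union> snd ` {p. ent A (fst p) (snd p) \<noteq> 0}"
    unfolding fsupp_def by (force simp: image_iff)
  then show ?thesis
    by (rule finite_subset) (simp add: finite_ent_supp)
qed

lemma ent_outside: "i \<notin> fsupp A \<or> j \<notin> fsupp A \<Longrightarrow> ent A i j = 0"
  unfolding fsupp_def by auto

lemma fsuppI: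
  "ent A i j \<noteq> 0 \<Longrightarrow> i \<in> fsupp A"
  "ent A i j \<noteq> 0 \<Longrightarrow> j \<in> fsupp A"
  using ent_outside[of i A j] by blast+

lemma finite_pair_subset:
  assumes "finite K" "\<And>i j. f i j \<noteq> 0 \<Longrightarrow> i \<in> K \<and> j \<in> K"
  shows "finite {p. f (fst p) (snd p) \<noteq> (0::real)}"
  by (rule finite_subset[of _ "K \<times> K"]) (use assms in auto)

instantiation fmat :: (type) "{zero, plus, minus, uminus, scaleR}"
begin

lift_definition zero_fmat :: "'a fmat" is "\<lambda>_ _. 0" by simp

lift_definition plus_fmat :: "'a fmat \<Rightarrow> 'a fmat \<Rightarrow> 'a fmat" is "\<lambda>f g i j. f i j + g i j"
proof -
  fix f g :: "'a \<Rightarrow> 'a \<Rightarrow> real"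
  assume "finite {p. f (fst p) (snd p) \<noteq> 0}" "finite {p. g (fst p) (snd p) \<noteq> 0}"
  then show "finite {p. f (fst p) (snd p) + g (fst p) (snd p) \<noteq> 0}"
    by (rule finite_subset[rotated, OF finite_UnI]) auto
qed

lift_definition minus_fmat :: "'a fmat \<Rightarrow> 'a fmat \<Rightarrow> 'a fmat" is "\<lambda>f g i j. f i j - g i j"
proof -
  fix f g :: "'a \<Rightarrow> 'a \<Rightarrow> real"
  assume "finite {p. f (fst p) (snd p) \<noteq> 0}" "finite {p. g (fst p) (snd p) \<noteq> 0}"
  then show "finite {p. f (fst p) (snd p) - g (fst p) (snd p) \<noteq> 0}"
    by (rule finite_subset[rotated, OF finite_UnI]) auto
qed

lift_definition uminus_fmat :: "'a fmat \<Rightarrow> 'a fmat" is "\<lambda>f i j. - f i j" by simp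

lift_definition scaleR_fmat :: "real \<Rightarrow> 'a fmat \<Rightarrow> 'a fmat" is "\<lambda>c f i j. c * f i j"
  by (rule finite_subset) auto

instance ..

end

lemma ent_simps [simp]:
  "ent 0 i j = 0" "ent (A + B) i j = ent A i j + ent B i j" "ent (A - B) i j = ent A i j - ent B i j"
  "ent (- A) i j = - ent A i j" "ent (c *\<^sub>R A) i j = c * ent A i j"
  by (transfer; simp)+

instance fmat :: (type) real_vector
  by standard (rule fmat_eqI, simp add: algebra_simps)+

lemma ent_sum [simp]: "ent (\<Sum>x\<in>X. f x) i j = (\<Sum>x\<in>X. ent (f x) i j)"
  by (induct X rule: infinite_finite_induct) auto

text \<open>Summing over the nonzero entries of a row of the first factor keeps the sum finite for
  any second factor.\<close>

definition fmult_ent :: "('a \<Rightarrow> 'a \<Rightarrow> real) \<Rightarrow> ('a \<Rightarrow> 'a \<Rightarrow> real) \<Rightarrow> 'a \<Rightarrow> 'a \<Rightarrow> real" where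
  "fmult_ent f g i j = (\<Sum>k | f i k \<noteq> 0. f i k * g k j)"

lemma finite_fmult_ent: "finite {p. fmult_ent (ent A) (ent B) (fst p) (snd p) \<noteq> 0}"
proof (rule finite_pair_subset)
  show "finite (fsupp A \<union> fsupp B)" by simp
next
  fix i j assume "fmult_ent (ent A) (ent B) i j \<noteq> 0"
  then obtain k where "ent A i k * ent B k j \<noteq> 0"
    unfolding fmult_ent_def using sum.not_neutral_contains_not_neutral by blast
  then have "ent A i k \<noteq> 0" "ent B k j \<noteq> 0" by auto
  then show "i \<in> fsupp A \<union> fsupp B \<and> j \<in> fsupp A \<union> fsupp B"
    using fsuppI(1)[of A i k] fsuppI(2)[of B k j] by simp
qed

instantiation fmat :: (type) times
begin

definition times_fmat :: "'a fmat \<Rightarrow> 'a fmat \<Rightarrow> 'a fmat" where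
  "times_fmat A B = Abs_fmat (fmult_ent (ent A) (ent B))"

instance ..

end

lemma ent_times_def: "ent (A * B) i j = (\<Sum>k | ent A i k \<noteq> 0. ent A i k * ent B k j)"
proof -
  have "ent (A * B) = fmult_ent (ent A) (ent B)"
    unfolding times_fmat_def using finite_fmult_ent[of A B] by (intro Abs_fmat_inverse) blast
  then show ?thesis by (simp only: fmult_ent_def)
qed

text \<open>Any finite set containing the indices at which both factors are nonzero may serve as the
  range of summation, so several products can be expanded over one common range.\<close>

lemma ent_times:
  assumes "finite K" "\<And>k. ent A i k \<noteq> 0 \<Longrightarrow> ent B k j \<noteq> 0 \<Longrightarrow> k \<in> K"
  shows "ent (A * B) i j = (\<Sum>k\<in>K. ent A i k * ent B k j)"
proof -
  have fin: "finite {k. ent A i k \<noteq> 0}"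
    by (rule finite_subset[OF _ finite_fsupp[of A]]) (auto simp: fsupp_def)
  have "ent (A * B) i j = (\<Sum>k | ent A i k \<noteq> 0. ent A i k * ent B k j)"
    by (rule ent_times_def)
  also have "... = (\<Sum>k\<in>{k. ent A i k \<noteq> 0} \<union> K. ent A i k * ent B k j)"
    by (rule sum.mono_neutral_left) (use fin assms(1) in auto)
  also have "... = (\<Sum>k\<in>K. ent A i k * ent B k j)"
  proof (rule sum.mono_neutral_right)
    show "\<forall>k\<in>({k. ent A i k \<noteq> 0} \<union> K) - K. ent A i k * ent B k j = 0"
      using assms(2) mult_eq_0_iff by blast
  qed (use fin assms(1) in auto)
  finally show ?thesis .
qed

lemma ent_times_left:
  assumes "finite K" "fsupp A \<subseteq> K"
  shows "ent (A * B) i j = (\<Sum>k\<in>K. ent A i k * ent B k j)"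
proof (rule ent_times)
  fix k assume "ent A i k \<noteq> 0"
  then have "k \<in> fsupp A" by (rule fsuppI(2))
  then show "k \<in> K" using assms(2) by (rule subsetD[rotated])
qed (rule assms(1))

lemma ent_times_right:
  assumes "finite K" "fsupp B \<subseteq> K"
  shows "ent (A * B) i j = (\<Sum>k\<in>K. ent A i k * ent B k j)"
proof (rule ent_times)
  fix k assume "ent B k j \<noteq> 0"
  then have "k \<in> fsupp B" by (rule fsuppI(1))
  then show "k \<in> K" using assms(2) by (rule subsetD[rotated])
qed (rule assms(1))

lemma fmat_mult_assoc: "(A * B) * C = A * (B * C :: 'a fmat)"
proof (rule fmat_eqI)
  fix i j
  obtain K where K: "finite K" "fsupp A \<subseteq> K" "fsupp C \<subseteq> K"
    by (rule that[of "fsupp A \<union> fsupp C"]) auto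
  have "ent ((A * B) * C) i j = (\<Sum>l\<in>K. (\<Sum>k\<in>K. ent A i k * ent B k l) * ent C l j)"
    unfolding ent_times_right[OF K(1,3)] ent_times_left[OF K(1,2)] ..
  also have "... = (\<Sum>k\<in>K. \<Sum>l\<in>K. ent A i k * (ent B k l * ent C l j))"
    unfolding sum_distrib_right by (subst sum.swap) (simp only: mult.assoc)
  also have "... = ent (A * (B * C)) i j"
    unfolding ent_times_right[OF K(1,3)] ent_times_left[OF K(1,2)] sum_distrib_left ..
  finally show "ent ((A * B) * C) i j = ent (A * (B * C)) i j" .
qed

instance fmat :: (type) real_algebra
proof
  fix a b c :: "'a fmat" and r :: real
  note L = ent_times_left[OF finite_fsupp order_refl] and R = ent_times_right[OF finite_fsupp order_refl]
  show "a * b * c = a * (b * c)" by (rule fmat_mult_assoc)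
  show "(a + b) * c = a * c + b * c"
    by (rule fmat_eqI) (simp only: R ent_simps distrib_right sum.distrib)
  show "a * (b + c) = a * b + a * c"
    by (rule fmat_eqI) (simp only: L ent_simps distrib_left sum.distrib)
  show "r *\<^sub>R a * b = r *\<^sub>R (a * b)"
    by (rule fmat_eqI) (simp only: R ent_simps sum_distrib_left mult.assoc)
  show "a * r *\<^sub>R b = r *\<^sub>R (a * b)"
    by (rule fmat_eqI) (simp only: L ent_simps sum_distrib_left mult.left_commute)
qed

section \<open>The Frobenius inner product\<close>

definition finner :: "'a fmat \<Rightarrow> 'a fmat \<Rightarrow> real" where
  "finner A B = (\<Sum>i\<in>fsupp A. \<Sum>j\<in>fsupp A. ent A i j * ent B i j)"

lemma finner_left:
  assumes "finite K" "fsupp A \<subseteq> K"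
  shows "finner A B = (\<Sum>i\<in>K. \<Sum>j\<in>K. ent A i j * ent B i j)"
proof -
  have "finner A B = (\<Sum>i\<in>fsupp A. \<Sum>j\<in>K. ent A i j * ent B i j)"
    unfolding finner_def
    by (intro sum.cong sum.mono_neutral_left) (use assms in \<open>auto simp: ent_outside\<close>)
  also have "... = (\<Sum>i\<in>K. \<Sum>j\<in>K. ent A i j * ent B i j)"
    by (rule sum.mono_neutral_left) (use assms in \<open>auto simp: ent_outside\<close>)
  finally show ?thesis .
qed

text \<open>The definition takes its range from the first argument. Letting the second one supply it
  gives symmetry, and linearity in the first argument without merging supports.\<close>

lemma finner_right:
  assumes "finite K" "fsupp B \<subseteq> K"
  shows "finner A B = (\<Sum>i\<in>K. \<Sum>j\<in>K. ent A i j * ent B i j)"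
proof -
  define L where "L = K \<union> fsupp A"
  have L: "finite L" "K \<subseteq> L" "fsupp A \<subseteq> L" using assms by (auto simp: L_def)
  have B: "ent B i j = 0" if "i \<notin> K \<or> j \<notin> K" for i j
    using that assms by (intro ent_outside) auto
  have "finner A B = (\<Sum>i\<in>L. \<Sum>j\<in>L. ent A i j * ent B i j)"
    by (rule finner_left) (use L in auto)
  also have "... = (\<Sum>i\<in>K. \<Sum>j\<in>L. ent A i j * ent B i j)"
    by (rule sum.mono_neutral_right) (use L B in auto)
  also have "... = (\<Sum>i\<in>K. \<Sum>j\<in>K. ent A i j * ent B i j)"
    by (intro sum.cong refl sum.mono_neutral_right) (use L B in auto)
  finally show ?thesis .
qed

instantiation fmat :: (type) real_inner
begin

definition inner_fmat :: "'a fmat \<Rightarrow> 'a fmat \<Rightarrow> real" where "inner_fmat = finner"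
definition norm_fmat :: "'a fmat \<Rightarrow> real" where "norm_fmat A = sqrt (inner A A)"
definition dist_fmat :: "'a fmat \<Rightarrow> 'a fmat \<Rightarrow> real" where "dist_fmat A B = norm (A - B)"
definition sgn_fmat :: "'a fmat \<Rightarrow> 'a fmat" where "sgn_fmat A = A /\<^sub>R norm A"
definition uniformity_fmat :: "('a fmat \<times> 'a fmat) filter" where
  "uniformity_fmat = (INF e\<in>{0<..}. principal {(x, y). dist x y < e})"
definition open_fmat :: "'a fmat set \<Rightarrow> bool" where
  "open_fmat U = (\<forall>x\<in>U. \<forall>\<^sub>F (x', y) in uniformity. x' = x \<longrightarrow> y \<in> U)"

instance
proof
  fix A B C :: "'a fmat" and r :: real and U :: "'a fmat set"
  show "dist A B = norm (A - B)" by (rule dist_fmat_def)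
  show "uniformity = (INF e\<in>{0<..}. principal {(x, y). dist x (y::'a fmat) < e})"
    by (rule uniformity_fmat_def)
  show "open U = (\<forall>x\<in>U. \<forall>\<^sub>F (x', y) in uniformity. x' = x \<longrightarrow> y \<in> U)" by (rule open_fmat_def)
  show "sgn A = A /\<^sub>R norm A" by (rule sgn_fmat_def)
  show "inner A B = inner B A"
    unfolding inner_fmat_def finner_left[OF finite_fsupp order_refl, of A B]
      finner_right[OF finite_fsupp order_refl, of B A] by (simp only: mult.commute)
  show "inner (A + B) C = inner A C + inner B C"
    unfolding inner_fmat_def
    by (simp only: finner_right[OF finite_fsupp order_refl, of _ C] ent_simps distrib_right sum.distrib)
  show "inner (r *\<^sub>R A) B = r * inner A B"
    unfolding inner_fmat_def
    by (simp only: finner_right[OF finite_fsupp order_refl, of _ B] ent_simps mult.assoc sum_distrib_left)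
  show nn: "0 \<le> inner A A"
    unfolding inner_fmat_def finner_def by (intro sum_nonneg) simp
  show "(inner A A = 0) = (A = 0)"
  proof
    assume "inner A A = 0"
    then have "\<And>i j. i \<in> fsupp A \<Longrightarrow> j \<in> fsupp A \<Longrightarrow> ent A i j = 0"
      unfolding inner_fmat_def finner_def by (simp add: sum_nonneg_eq_0_iff sum_nonneg)
    then show "A = 0" by (intro fmat_eqI) (metis ent_outside ent_simps(1))
  qed (simp add: inner_fmat_def finner_def)
  show "norm A = sqrt (inner A A)" by (rule norm_fmat_def)
qed

end

lemma inner_fmat_left:
  "finite K \<Longrightarrow> fsupp A \<subseteq> K \<Longrightarrow> inner A B = (\<Sum>i\<in>K. \<Sum>j\<in>K. ent A i j * ent B i j)"
  by (simp add: inner_fmat_def finner_left)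

lemma inner_fmat_right:
  "finite K \<Longrightarrow> fsupp B \<subseteq> K \<Longrightarrow> inner A B = (\<Sum>i\<in>K. \<Sum>j\<in>K. ent A i j * ent B i j)"
  by (simp add: inner_fmat_def finner_right)

lift_definition ftr :: "'a fmat \<Rightarrow> 'a fmat" is "\<lambda>f i j. f j i"
proof -
  fix f :: "'a \<Rightarrow> 'a \<Rightarrow> real" assume "finite {p. f (fst p) (snd p) \<noteq> 0}"
  then have "finite (prod.swap ` {p. f (fst p) (snd p) \<noteq> 0})" by simp
  then show "finite {p. f (snd p) (fst p) \<noteq> 0}"
    by (rule finite_subset[rotated]) (auto simp: image_iff)
qed

lemma ent_ftr [simp]: "ent (ftr A) i j = ent A j i" by transfer simp

lemma fsupp_ftr [simp]: "fsupp (ftr A) = fsupp A"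
  unfolding fsupp_def by auto

lemma ftr_simps [simp]:
  "ftr (ftr A) = A" "ftr 0 = 0" "ftr (A + B) = ftr A + ftr B" "ftr (A - B) = ftr A - ftr B"
  "ftr (- A) = - ftr A" "ftr (c *\<^sub>R A) = c *\<^sub>R ftr A"
  by (rule fmat_eqI; simp)+

lemma ftr_mult [simp]: "ftr (A * B) = ftr B * ftr A"
  by (rule fmat_eqI) (simp add: ent_times_left[OF finite_fsupp order_refl, of A]
      ent_times_right[of "fsupp A" "ftr A"] mult.commute)

lemma ftr_sum [simp]: "ftr (\<Sum>x\<in>X. f x) = (\<Sum>x\<in>X. ftr (f x))"
  by (induct X rule: infinite_finite_induct) auto

lemma inner_ftr [simp]: "inner (ftr A) (ftr B) = inner A B"
proof -
  have "inner (ftr A) (ftr B) = (\<Sum>i\<in>fsupp A. \<Sum>j\<in>fsupp A. ent A j i * ent B j i)"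
    by (simp add: inner_fmat_left[of "fsupp A"])
  also have "... = inner A B"
    by (subst sum.swap) (simp add: inner_fmat_left[of "fsupp A"])
  finally show ?thesis .
qed

lemma norm_ftr [simp]: "norm (ftr A) = norm A"
  by (simp add: norm_eq_sqrt_inner)

lemma inner_mult_left: "inner (A * B) C = inner B (ftr A * C)" for A B C :: "'a fmat"
proof -
  obtain K where K: "finite K" "fsupp A \<subseteq> K" "fsupp B \<subseteq> K" "fsupp C \<subseteq> K"
    by (rule that[of "fsupp A \<union> fsupp B \<union> fsupp C"]) auto
  have "inner (A * B) C = (\<Sum>i\<in>K. \<Sum>j\<in>K. \<Sum>k\<in>K. ent A i k * ent B k j * ent C i j)"
    by (simp add: inner_fmat_right[OF K(1,4)] ent_times_left[OF K(1,2)] sum_distrib_right)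
  also have "... = (\<Sum>i\<in>K. \<Sum>k\<in>K. \<Sum>j\<in>K. ent A i k * ent B k j * ent C i j)"
    by (intro sum.cong refl sum.swap)
  also have "... = (\<Sum>k\<in>K. \<Sum>i\<in>K. \<Sum>j\<in>K. ent A i k * ent B k j * ent C i j)"
    by (rule sum.swap)
  also have "... = (\<Sum>k\<in>K. \<Sum>j\<in>K. \<Sum>i\<in>K. ent A i k * ent B k j * ent C i j)"
    by (intro sum.cong refl sum.swap)
  also have "... = inner B (ftr A * C)"
    by (simp add: inner_fmat_left[OF K(1,3)] ent_times_left[of K "ftr A"] K sum_distrib_left mult_ac)
  finally show ?thesis .
qed

lemma inner_mult_right: "inner (A * B) C = inner A (C * ftr B)" for A B C :: "'a fmat"
proof -
  have "inner (A * B) C = inner (ftr B * ftr A) (ftr C)"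
    using inner_ftr[of "A * B" C] by simp
  also have "... = inner (ftr A) (B * ftr C)" by (simp add: inner_mult_left)
  also have "... = inner A (C * ftr B)" using inner_ftr[of A "C * ftr B"] by simp
  finally show ?thesis .
qed

section \<open>Matrix units and coordinate projections\<close>

lift_definition fE :: "'a \<Rightarrow> 'a \<Rightarrow> 'a fmat" is "\<lambda>a b i j. if i = a \<and> j = b then 1 else 0"
proof -
  fix a b :: 'a
  have "{p. (if fst p = a \<and> snd p = b then 1 else 0) \<noteq> (0::real)} \<subseteq> {(a, b)}" by auto
  then show "finite {p. (if fst p = a \<and> snd p = b then 1 else 0) \<noteq> (0::real)}"
    by (rule finite_subset) simp
qed

lemma ent_fE [simp]: "ent (fE a b) i j = (if i = a \<and> j = b then 1 else 0)"
  by transfer simp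

lemma ftr_fE [simp]: "ftr (fE a b) = fE b a"
  by (rule fmat_eqI) auto

lemma ent_fE_times [simp]: "ent (fE a b * A) i j = (if i = a then ent A b j else 0)"
proof -
  have "ent (fE a b * A) i j = (\<Sum>k\<in>{b}. ent (fE a b) i k * ent A k j)"
    by (rule ent_times) (auto split: if_splits)
  then show ?thesis by simp
qed

lemma ent_times_fE [simp]: "ent (A * fE a b) i j = (if j = b then ent A i a else 0)"
proof -
  have "ent (A * fE a b) i j = (\<Sum>k\<in>{a}. ent A i k * ent (fE a b) k j)"
    by (rule ent_times) (auto split: if_splits)
  then show ?thesis by simp
qed

lemma fE_mult: "fE a b * fE c d = (if b = c then fE a d else 0)"
  by (rule fmat_eqI) auto

lemma inner_fE [simp]: "inner A (fE a b) = ent A a b" "inner (fE a b) A = ent A a b"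
proof -
  obtain K where K: "finite K" "a \<in> K" "b \<in> K"
    by (rule that[of "{a, b}"]) auto
  have supp: "fsupp (fE a b) \<subseteq> K"
    unfolding fsupp_def using K(2,3) by (auto split: if_splits)
  have "inner (fE a b) A = (\<Sum>i\<in>K. \<Sum>j\<in>K. ent (fE a b) i j * ent A i j)"
    by (rule inner_fmat_left[OF K(1) supp])
  also have "... = (\<Sum>i\<in>K. if i = a then ent A a b else 0)"
  proof (rule sum.cong[OF refl])
    fix i
    have "(\<Sum>j\<in>K. ent (fE a b) i j * ent A i j) = (\<Sum>j\<in>K. if j = b then (if i = a then ent A a b else 0) else 0)"
      by (rule sum.cong) auto
    then show "(\<Sum>j\<in>K. ent (fE a b) i j * ent A i j) = (if i = a then ent A a b else 0)"
      using K by simp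
  qed
  also have "... = ent A a b" using K by simp
  finally show "inner (fE a b) A = ent A a b" .
  then show "inner A (fE a b) = ent A a b" by (simp add: inner_commute)
qed

definition fId :: "'a set \<Rightarrow> 'a fmat" where "fId J = (\<Sum>i\<in>J. fE i i)"

lemma ent_fId: "finite J \<Longrightarrow> ent (fId J) i j = (if i = j \<and> i \<in> J then 1 else 0)"
  unfolding fId_def by (cases "i = j") (auto intro!: sum.neutral)

lemma ftr_fId [simp]: "ftr (fId J) = fId J"
  unfolding fId_def by simp

lemma fId_times: "finite J \<Longrightarrow> ent (fId J * A) i j = (if i \<in> J then ent A i j else 0)"
  unfolding fId_def sum_distrib_right by simp

lemma times_fId: "finite J \<Longrightarrow> ent (A * fId J) i j = (if j \<in> J then ent A i j else 0)"
  unfolding fId_def sum_distrib_left by simp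

lemma norm_fmat_sum: "finite K \<Longrightarrow> fsupp A \<subseteq> K \<Longrightarrow> (norm A)\<^sup>2 = (\<Sum>i\<in>K. \<Sum>j\<in>K. (ent A i j)\<^sup>2)"
  by (simp only: power2_norm_eq_inner) (simp only: inner_fmat_left[of K A A] power2_eq_square)

text \<open>Cauchy-Schwarz in every entry of the product; the resulting double sum factors into the
  two squared norms.\<close>

lemma norm_mult_fmat: "norm (A * B) \<le> norm A * norm (B :: 'a fmat)"
proof -
  obtain K where K: "finite K" "fsupp A \<subseteq> K" "fsupp B \<subseteq> K"
    by (rule that[of "fsupp A \<union> fsupp B"]) auto
  have supp: "fsupp (A * B) \<subseteq> K"
  proof
    fix i assume "i \<in> fsupp (A * B)"
    then obtain j where j: "ent (A * B) i j \<noteq> 0 \<or> ent (A * B) j i \<noteq> 0" unfolding fsupp_def by auto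
    have "ent (A * B) i j = 0" if "i \<notin> fsupp A"
      using that by (simp add: ent_times_def ent_outside)
    moreover have "ent (A * B) j i = 0" if "i \<notin> fsupp B"
      using that by (simp add: ent_times_def ent_outside)
    ultimately show "i \<in> K" using j K by blast
  qed
  have "(norm (A * B))\<^sup>2 = (\<Sum>i\<in>K. \<Sum>j\<in>K. (\<Sum>k\<in>K. ent A i k * ent B k j)\<^sup>2)"
    unfolding norm_fmat_sum[OF K(1) supp] ent_times_left[OF K(1,2)] ..
  also have "... \<le> (\<Sum>i\<in>K. \<Sum>j\<in>K. (\<Sum>k\<in>K. (ent A i k)\<^sup>2) * (\<Sum>k\<in>K. (ent B k j)\<^sup>2))"
    by (intro sum_mono Cauchy_Schwarz_ineq_sum)
  also have "... = (\<Sum>i\<in>K. \<Sum>k\<in>K. (ent A i k)\<^sup>2) * (\<Sum>j\<in>K. \<Sum>k\<in>K. (ent B k j)\<^sup>2)"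
    by (rule sum_product[symmetric])
  also have "... = (norm A)\<^sup>2 * (norm B)\<^sup>2"
    unfolding norm_fmat_sum[OF K(1,2)] norm_fmat_sum[OF K(1,3)]
    by (rule arg_cong[of _ _ "(*) _"], rule sum.swap)
  finally have "(norm (A * B))\<^sup>2 \<le> (norm A * norm B)\<^sup>2" by (simp add: power_mult_distrib)
  then show ?thesis by (rule power2_le_imp_le) simp
qed

section \<open>Orthonormal families and the spectral theorem\<close>

text \<open>Gaussian elimination: the last equation is either void or is solved for a pivot, which
  is then substituted into the others.\<close>

lemma underdetermined_system:
  fixes M :: "nat \<Rightarrow> 'i \<Rightarrow> real"
  assumes "finite I" "s < card I"
  shows "\<exists>x. (\<exists>i\<in>I. x i \<noteq> 0) \<and> (\<forall>b<s. (\<Sum>i\<in>I. M b i * x i) = 0)"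
  using assms
proof (induction s arbitrary: I M)
  case 0
  then have "I \<noteq> {}" by auto
  then show ?case by (intro exI[of _ "\<lambda>_. 1"]) auto
next
  case (Suc s)
  show ?case
  proof (cases "\<forall>i\<in>I. M s i = 0")
    case True
    obtain x where "\<exists>i\<in>I. x i \<noteq> 0" "\<forall>b<s. (\<Sum>i\<in>I. M b i * x i) = 0"
      using Suc.IH[OF Suc.prems(1), of M] Suc.prems(2) by auto
    then show ?thesis using True by (intro exI[of _ x]) (auto simp: less_Suc_eq)
  next
    case False
    then obtain p where p: "p \<in> I" "M s p \<noteq> 0" by auto
    \<comment> \<open>The coefficients that remain after the pivot \<open>p\<close> has been
      eliminated by means of equation \<open>s\<close>.\<close>
    define M' where "M' b i = M b i - M b p * M s i / M s p" for b i
    have "s < card (I - {p})" using Suc.prems p by simp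
    then obtain x where x: "\<exists>i\<in>I - {p}. x i \<noteq> 0" "\<forall>b<s. (\<Sum>i\<in>I - {p}. M' b i * x i) = 0"
      using Suc.IH[of "I - {p}" M'] Suc.prems(1) by auto
    \<comment> \<open>The value at the pivot is chosen such that equation \<open>s\<close>
      holds.\<close>
    define y where "y = x(p := - (\<Sum>i\<in>I - {p}. M s i * x i) / M s p)"
    have split: "(\<Sum>i\<in>I. M b i * y i) = M b p * y p + (\<Sum>i\<in>I - {p}. M b i * x i)" for b
    proof -
      have "(\<Sum>i\<in>I - {p}. M b i * y i) = (\<Sum>i\<in>I - {p}. M b i * x i)"
        by (rule sum.cong) (auto simp: y_def)
      then show ?thesis using sum.remove[OF Suc.prems(1) p(1), of "\<lambda>i. M b i * y i"] by simp
    qed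
    have "(\<Sum>i\<in>I. M b i * y i) = 0" if "b < Suc s" for b
    proof (cases "b = s")
      case True
      show ?thesis unfolding split using p True by (simp add: y_def)
    next
      case False
      then have "0 = (\<Sum>i\<in>I - {p}. M' b i * x i)" using that x(2) by simp
      also have "... = (\<Sum>i\<in>I - {p}. M b i * x i) - (\<Sum>i\<in>I - {p}. M b p / M s p * (M s i * x i))"
        unfolding M'_def sum_subtractf[symmetric] by (rule sum.cong) (auto simp: field_simps)
      also have "... = (\<Sum>i\<in>I. M b i * y i)"
        unfolding split sum_distrib_left[symmetric] using p by (simp add: y_def)
      finally show ?thesis by simp
    qed
    moreover have "\<exists>i\<in>I. y i \<noteq> 0" using x(1) by (auto simp: y_def)
    ultimately show ?thesis by blast
  qed
qed

text \<open>A family rather than a set, so that bases can be indexed by numbers, indices of tensors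
  or disjoint sums. Finiteness of the index set makes all expansions finite sums.\<close>

definition orthon :: "('i \<Rightarrow> 'v::real_inner) \<Rightarrow> 'i set \<Rightarrow> bool" where
  "orthon u A \<longleftrightarrow> finite A \<and> (\<forall>a\<in>A. \<forall>b\<in>A. inner (u a) (u b) = (if a = b then 1 else 0))"

lemma orthon_finite: "orthon u A \<Longrightarrow> finite A"
  by (simp add: orthon_def)

lemma orthon_inner: "orthon u A \<Longrightarrow> a \<in> A \<Longrightarrow> b \<in> A \<Longrightarrow> inner (u a) (u b) = (if a = b then 1 else 0)"
  by (simp add: orthon_def)

lemma orthon_norm: "orthon u A \<Longrightarrow> a \<in> A \<Longrightarrow> norm (u a) = 1"
  by (simp add: orthon_def norm_eq_sqrt_inner)

lemma orthon_inner_sum: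
  assumes "orthon u A" "b \<in> A"
  shows "inner (\<Sum>a\<in>A. c a *\<^sub>R u a) (u b) = c b" "inner (u b) (\<Sum>a\<in>A. c a *\<^sub>R u a) = c b"
proof -
  have "inner (\<Sum>a\<in>A. c a *\<^sub>R u a) (u b) = (\<Sum>a\<in>A. if a = b then c a else 0)"
    unfolding inner_sum_left by (rule sum.cong) (use assms in \<open>auto simp: orthon_inner\<close>)
  then show "inner (\<Sum>a\<in>A. c a *\<^sub>R u a) (u b) = c b"
    using assms by (simp add: orthon_def)
  then show "inner (u b) (\<Sum>a\<in>A. c a *\<^sub>R u a) = c b" by (simp add: inner_commute)
qed

lemma orthon_inner_sums:
  assumes "orthon u A"
  shows "inner (\<Sum>a\<in>A. c a *\<^sub>R u a) (\<Sum>a\<in>A. d a *\<^sub>R u a) = (\<Sum>a\<in>A. c a * d a)"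
proof -
  have "inner (\<Sum>a\<in>A. c a *\<^sub>R u a) (\<Sum>a\<in>A. d a *\<^sub>R u a) = (\<Sum>b\<in>A. d b * inner (\<Sum>a\<in>A. c a *\<^sub>R u a) (u b))"
    by (subst inner_sum_right) simp
  also have "... = (\<Sum>b\<in>A. d b * c b)"
    by (rule sum.cong) (simp_all add: orthon_inner_sum[OF assms])
  finally show ?thesis by (simp add: mult.commute)
qed

lemma orthon_norm_sum:
  assumes "orthon u A"
  shows "(norm (\<Sum>a\<in>A. c a *\<^sub>R u a))\<^sup>2 = (\<Sum>a\<in>A. (c a)\<^sup>2)"
  unfolding power2_norm_eq_inner orthon_inner_sums[OF assms] by (simp add: power2_eq_square)

section \<open>Projection onto the span of an orthonormal family\<close>

definition oproj :: "('i \<Rightarrow> 'v::real_inner) \<Rightarrow> 'i set \<Rightarrow> 'v \<Rightarrow> 'v" where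
  "oproj u A x = (\<Sum>a\<in>A. inner (u a) x *\<^sub>R u a)"

lemma oproj_inner:
  assumes "orthon u A"
  shows "inner (oproj u A x) y = (\<Sum>a\<in>A. inner (u a) x * inner (u a) y)"
  unfolding oproj_def inner_sum_left by (simp add: inner_commute)

lemma oproj_norm:
  assumes "orthon u A"
  shows "(norm (oproj u A x))\<^sup>2 = (\<Sum>a\<in>A. (inner (u a) x)\<^sup>2)"
  unfolding oproj_def by (rule orthon_norm_sum[OF assms])

lemma norm_minus_oproj:
  assumes "orthon u A"
  shows "(norm (x - oproj u A x))\<^sup>2 = (norm x)\<^sup>2 - (\<Sum>a\<in>A. (inner (u a) x)\<^sup>2)"
proof -
  have "inner (oproj u A x) x = (\<Sum>a\<in>A. (inner (u a) x)\<^sup>2)"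
    by (simp add: oproj_inner[OF assms] power2_eq_square)
  moreover have "inner (oproj u A x) (oproj u A x) = (\<Sum>a\<in>A. (inner (u a) x)\<^sup>2)"
    using oproj_norm[OF assms, of x] by (simp add: power2_norm_eq_inner)
  ultimately show ?thesis
    unfolding power2_norm_eq_inner by (simp add: inner_diff_left inner_diff_right inner_commute)
qed

lemma bessel:
  assumes "orthon u A"
  shows "(\<Sum>a\<in>A. (inner (u a) x)\<^sup>2) \<le> (norm x)\<^sup>2"
  using norm_minus_oproj[OF assms, of x] by (smt (verit) zero_le_power2)

lemma oproj_span:
  assumes "orthon u A" "x \<in> span (u ` A)"
  shows "oproj u A x = x"
proof (rule span_induct[where P = "\<lambda>x. oproj u A x = x", OF assms(2)])
    show "real_vector.subspace {x. oproj u A x = x}"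
      unfolding real_vector.subspace_def oproj_def
      by (auto simp: inner_add_right scaleR_add_left sum.distrib scaleR_sum_right[symmetric] simp flip: scaleR_scaleR)
  next
    fix x assume "x \<in> u ` A"
    then obtain b where b: "b \<in> A" "x = u b" by auto
    have "oproj u A x = (\<Sum>a\<in>A. if a = b then u b else 0)"
      unfolding oproj_def by (rule sum.cong) (use assms(1) b in \<open>auto simp: orthon_inner\<close>)
    then show "oproj u A x = x"
      using b orthon_finite[OF assms(1)] by simp
qed

lemma parseval:
  assumes "orthon u A" "x \<in> span (u ` A)"
  shows "(norm x)\<^sup>2 = (\<Sum>a\<in>A. (inner (u a) x)\<^sup>2)"
  using oproj_norm[OF assms(1), of x] oproj_span[OF assms] by simp

lemma oproj_in_span: "oproj u A x \<in> span (u ` A)"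
  unfolding oproj_def by (intro span_sum span_scale span_base) auto

text \<open>Double counting of the squared inner products between the families: Parseval with
  respect to \<open>e\<close> gives \<open>card A\<close>, Bessel with respect to \<open>u\<close>
  gives at most \<open>card B\<close>.\<close>

lemma orthon_card_le:
  assumes u: "orthon u A" and e: "orthon e B" and sub: "u ` A \<subseteq> span (e ` B)"
  shows "card A \<le> card B"
proof -
  have "real (card A) = (\<Sum>a\<in>A. (norm (u a))\<^sup>2)"
    using u by (simp add: orthon_norm)
  also have "... = (\<Sum>a\<in>A. \<Sum>b\<in>B. (inner (e b) (u a))\<^sup>2)"
    by (rule sum.cong) (use parseval[OF e] sub in auto)
  also have "... = (\<Sum>b\<in>B. \<Sum>a\<in>A. (inner (u a) (e b))\<^sup>2)"
    by (subst sum.swap) (simp add: inner_commute)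
  also have "... \<le> (\<Sum>b\<in>B. (norm (e b))\<^sup>2)"
    by (intro sum_mono bessel u)
  also have "... = real (card B)" using e by (simp add: orthon_norm)
  finally show ?thesis by simp
qed

section \<open>Eigenvectors of symmetric operators with range in a finite-dimensional span\<close>

lemma compact_unit_sphere_span:
  fixes e :: "'i \<Rightarrow> 'v::real_inner"
  assumes e: "orthon e A"
  shows "compact {x \<in> span (e ` A). norm x = 1}"
proof -
  \<comment> \<open>A cube of coefficient functions, compact by Tychonoff; coordinates outside
    \<open>A\<close> are frozen at \<open>0\<close>. The sphere is the part of its continuous image
    in a closed set.\<close>
  define box where "box = PiE UNIV (\<lambda>i. if i \<in> A then {-1..1::real} else {0})"
  define f where "f c = (\<Sum>a\<in>A. c a *\<^sub>R e a)" for c :: "'i \<Rightarrow> real"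
  have "compactin (product_topology (\<lambda>i. euclidean) UNIV) box"
    unfolding box_def compactin_PiE by auto
  then have "compact box" by (simp add: euclidean_product_topology)
  moreover have "continuous_on box f"
    unfolding f_def by (intro continuous_intros continuous_on_subset[OF continuous_on_product_coordinates]) auto
  ultimately have "compact (f ` box)" by (rule compact_continuous_image[rotated])
  moreover have "closed {x::'v. norm x = 1}"
    by (intro closed_Collect_eq continuous_intros)
  ultimately have "compact (f ` box \<inter> {x. norm x = 1})" by (rule compact_Int_closed)
  moreover have "f ` box \<inter> {x. norm x = 1} = {x \<in> span (e ` A). norm x = 1}"
  proof (intro equalityI subsetI)
    fix x assume "x \<in> f ` box \<inter> {x. norm x = 1}"
    moreover have "f c \<in> span (e ` A)" for c
      unfolding f_def by (intro span_sum span_scale span_base) auto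
    ultimately show "x \<in> {x \<in> span (e ` A). norm x = 1}" by auto
  next
    fix x assume x: "x \<in> {x \<in> span (e ` A). norm x = 1}"
    define c where "c i = (if i \<in> A then inner (e i) x else 0)" for i
    have "x = oproj e A x" using oproj_span[OF e, of x] x by simp
    also have "... = f c" unfolding f_def c_def oproj_def by (rule sum.cong) auto
    finally have "x = f c" .
    moreover have "c \<in> box"
    proof -
      have "\<bar>inner (e a) x\<bar> \<le> 1" if "a \<in> A" for a
        using Cauchy_Schwarz_ineq2[of "e a" x] orthon_norm[OF e that] x by simp
      then show ?thesis unfolding box_def c_def by (auto simp: abs_le_iff)
    qed
    ultimately show "x \<in> f ` box \<inter> {x. norm x = 1}" using x by auto
  qed
  ultimately show ?thesis by simp
qed

text \<open>The first-order condition at an extremum, without derivatives; it is applied to the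
  Rayleigh quotient.\<close>

lemma linear_coeff_zero:
  fixes a b :: real
  assumes "\<And>t. 0 \<le> 2 * t * a + t\<^sup>2 * b"
  shows "a = 0"
proof (rule ccontr)
  assume a: "a \<noteq> 0"
  \<comment> \<open>The sign is opposite to that of \<open>a\<close>, and \<open>+ 1\<close> keeps
    the denominator positive when \<open>b = 0\<close>. The quadratic is then at most
    \<open>- (a\<^sup>2 / (\<bar>b\<bar> + 1))\<close>.\<close>
  define t where "t = - a / (\<bar>b\<bar> + 1)"
  have "2 * t * a + t\<^sup>2 * b \<le> 2 * t * a + t\<^sup>2 * (\<bar>b\<bar> + 1)"
    by (intro add_left_mono mult_left_mono) auto
  also have "... = - (a\<^sup>2 / (\<bar>b\<bar> + 1))"
  proof -
    have "t * (\<bar>b\<bar> + 1) = - a" unfolding t_def by simp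
    then have "t\<^sup>2 * (\<bar>b\<bar> + 1) = - (t * a)" by (simp add: power2_eq_square mult.assoc)
    then show ?thesis unfolding t_def by (simp add: power2_eq_square)
  qed
  also have "... < 0" using a by (simp add: add_nonneg_pos)
  finally show False using assms[of t] by simp
qed

text \<open>The eigenvector is a maximiser of the Rayleigh quotient.\<close>

lemma top_eigenvector:
  fixes T :: "'v::real_inner \<Rightarrow> 'v"
  assumes e: "orthon e A" and T: "linear T" and ran: "\<And>x. T x \<in> span (e ` A)"
    and sym: "\<And>x y. inner (T x) y = inner x (T y)"
    and pos: "y \<in> span (e ` A)" "inner (T y) y > 0"
  shows "\<exists>v l. v \<in> span (e ` A) \<and> norm v = 1 \<and> l > 0 \<and> T v = l *\<^sub>R v"
proof -
  let ?S = "{x \<in> span (e ` A). norm x = 1}"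
  have y0: "y \<noteq> 0" using pos(2) by (auto simp: linear_0[OF T])
  then have ne: "y /\<^sub>R norm y \<in> ?S" using pos(1) by (simp add: span_scale)
  \<comment> \<open>On the span, \<open>T\<close> is determined by its values on the basis. This
    yields continuity although no boundedness of \<open>T\<close> is assumed.\<close>
  have "continuous_on ?S (\<lambda>x. inner (\<Sum>a\<in>A. inner (e a) x *\<^sub>R T (e a)) x)"
    by (intro continuous_intros)
  moreover have "(\<Sum>a\<in>A. inner (e a) x *\<^sub>R T (e a)) = T x" if "x \<in> ?S" for x
  proof -
    have "T x = T (oproj e A x)" using oproj_span[OF e] that by simp
    then show ?thesis unfolding oproj_def linear_sum[OF T] linear_scale[OF T] by simp
  qed
  ultimately have "continuous_on ?S (\<lambda>x. inner (T x) x)"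
    by (subst continuous_on_cong[OF refl, of _ _ "\<lambda>x. inner (\<Sum>a\<in>A. inner (e a) x *\<^sub>R T (e a)) x"]) simp_all
  then obtain v where v: "v \<in> ?S" and max: "\<And>x. x \<in> ?S \<Longrightarrow> inner (T x) x \<le> inner (T v) v"
    using continuous_attains_sup[OF compact_unit_sphere_span[OF e]] ne by blast
  define l where "l = inner (T v) v"
  have ub: "inner (T x) x \<le> l * (norm x)\<^sup>2" if "x \<in> span (e ` A)" for x
  proof (cases "x = 0")
    case True then show ?thesis by (simp add: linear_0[OF T])
  next
    case False
    then have "inner (T (x /\<^sub>R norm x)) (x /\<^sub>R norm x) \<le> l"
      unfolding l_def using that by (intro max) (simp add: span_scale)
    then have "inner (T x) x / (norm x)\<^sup>2 \<le> l"
      by (simp add: linear_scale[OF T] power2_eq_square divide_inverse mult_ac)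
    then show ?thesis using False by (simp add: field_simps)
  qed
  have "l > 0"
    using ub[OF pos(1)] pos(2) y0 by (smt (verit) mult_nonpos_nonneg zero_le_power2)
  moreover have "T v = l *\<^sub>R v"
  proof -
    \<comment> \<open>The function \<open>l * (norm x)\<^sup>2 - inner (T x) x\<close> is
      nonnegative on the span and vanishes at \<open>v\<close>; this is its first variation in the
      direction \<open>w\<close>.\<close>
    have z: "inner (l *\<^sub>R v - T v) w = 0" if w: "w \<in> span (e ` A)" for w
    proof (rule linear_coeff_zero)
      fix t :: real
      have "v + t *\<^sub>R w \<in> span (e ` A)" using v w by (auto intro: span_add span_scale)
      from ub[OF this]
      have "inner (T v + t *\<^sub>R T w) (v + t *\<^sub>R w) \<le> l * inner (v + t *\<^sub>R w) (v + t *\<^sub>R w)"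
        by (simp add: linear_add[OF T] linear_scale[OF T] power2_norm_eq_inner)
      moreover have "inner (T w) v = inner (T v) w" by (metis sym inner_commute)
      moreover have "inner v v = 1" using v by (simp add: power2_norm_eq_inner[symmetric])
      moreover have "inner (T v) v = l" by (simp add: l_def)
      ultimately show "0 \<le> 2 * t * inner (l *\<^sub>R v - T v) w + t\<^sup>2 * (l * inner w w - inner (T w) w)"
        by (simp add: inner_add_left inner_add_right inner_diff_left inner_commute power2_eq_square algebra_simps)
    qed
    have "l *\<^sub>R v - T v \<in> span (e ` A)" using v ran by (auto intro: span_diff span_scale)
    from z[OF this] show ?thesis by simp
  qed
  ultimately show ?thesis using v by blast
qed

text \<open>A longest orthonormal family of eigenvectors with positive eigenvalues is taken, the
  length being bounded by \<open>card A\<close>. If the family did not describe \<open>T\<close>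
  completely, the remainder would again be positive semidefinite and nonzero and would provide one
  more eigenvector. Zero eigenvalues are left out, so the expansion holds on the whole
  space.\<close>

theorem spectral_theorem_psd:
  fixes T :: "'v::real_inner \<Rightarrow> 'v"
  assumes e: "orthon e A" and T: "linear T" and ran: "\<And>x. T x \<in> span (e ` A)"
    and sym: "\<And>x y. inner (T x) y = inner x (T y)"
    and psd: "\<And>x. inner (T x) x \<ge> 0"
  shows "\<exists>(t::nat) u l. orthon u {..<t} \<and> u ` {..<t} \<subseteq> span (e ` A) \<and> (\<forall>a<t. l a > 0) \<and>
    (\<forall>x. T x = (\<Sum>a<t. (l a * inner (u a) x) *\<^sub>R u a))"
proof -
  define P where "P t u l \<longleftrightarrow> orthon u {..<t} \<and> u ` {..<t} \<subseteq> span (e ` A) \<and>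
    (\<forall>a<t. l a > (0::real) \<and> T (u a) = l a *\<^sub>R u a)" for t :: nat and u l
  have P0: "\<exists>u l. P 0 u l" unfolding P_def orthon_def by auto
  have bound: "t \<le> card A" if "\<exists>u l. P t u l" for t
  proof -
    obtain u l where "P t u l" using \<open>\<exists>u l. P t u l\<close> by blast
    then have "card {..<t} \<le> card A" unfolding P_def by (intro orthon_card_le[OF _ e]) auto
    then show ?thesis by simp
  qed
  define Q where "Q t \<longleftrightarrow> (\<exists>u l. P t u l)" for t
  have "Q (Greatest Q)" by (rule GreatestI_nat[of Q 0 "card A"]) (use P0 bound in \<open>auto simp: Q_def\<close>)
  then obtain t u l where P: "P t u l" and t: "t = Greatest Q" unfolding Q_def by blast
  have max: "t' \<le> t" if "\<exists>u l. P t' u l" for t'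
    unfolding t by (rule Greatest_le_nat[of Q _ "card A"]) (use that bound in \<open>auto simp: Q_def\<close>)
  have u: "orthon u {..<t}" and us: "u ` {..<t} \<subseteq> span (e ` A)"
    and l: "\<And>a. a < t \<Longrightarrow> l a > 0" and eig: "\<And>a. a < t \<Longrightarrow> T (u a) = l a *\<^sub>R u a"
    using P unfolding P_def by auto
  \<comment> \<open>The part of \<open>T\<close> not captured by the family.\<close>
  define T' where "T' x = T (x - oproj u {..<t} x)" for x
  have expand: "T x = T' x + (\<Sum>a<t. (l a * inner (u a) x) *\<^sub>R u a)" for x
    unfolding T'_def oproj_def linear_diff[OF T] linear_sum[OF T] linear_scale[OF T]
    by (simp add: eig mult.commute)
  have T'0: "T' x = 0" for x
  proof (rule ccontr)
    assume nz: "T' x \<noteq> 0"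
    have linp: "linear (\<lambda>x. x - oproj u {..<t} x)"
      unfolding oproj_def by (intro linearI) (simp_all add: inner_add_right sum.distrib scaleR_add_left scaleR_sum_right algebra_simps)
    then have T': "linear T'" unfolding T'_def using linear_compose[OF linp T] by (simp add: o_def)
    have ran': "T' x \<in> span (e ` A)" for x unfolding T'_def by (rule ran)
    have T'_alt: "T' x = T x - (\<Sum>a<t. (l a * inner (u a) x) *\<^sub>R u a)" for x using expand[of x] by simp
    have sym': "inner (T' x) y = inner x (T' y)" for x y
      unfolding T'_alt inner_diff_left inner_diff_right inner_sum_left inner_sum_right
      using sym[of x y] by (simp add: inner_commute mult_ac)
    have orth: "inner (T' x) (u b) = 0" if "b < t" for x b
    proof -
      have "inner (T' x) (u b) = inner (T x) (u b) - l b * inner (u b) x"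
        unfolding T'_alt inner_diff_left by (subst orthon_inner_sum(1)[OF u]) (use that in auto)
      also have "inner (T x) (u b) = l b * inner (u b) x"
        using eig[OF that] sym[of x "u b"] by (simp add: inner_commute)
      finally show ?thesis by simp
    qed
    have q: "inner (T' x) x = inner (T (x - oproj u {..<t} x)) (x - oproj u {..<t} x)" for x
    proof -
      have "inner (T' x) (oproj u {..<t} x) = 0"
        unfolding oproj_def inner_sum_right by (simp add: orth)
      then show ?thesis unfolding T'_def[symmetric] inner_diff_right by simp
    qed
    \<comment> \<open>A symmetric operator whose quadratic form vanishes is zero; the test vector is
      \<open>x + T' x\<close>.\<close>
    have "\<exists>y. inner (T' y) y \<noteq> 0"
    proof (rule ccontr)
      assume "\<not> ?thesis"
      then have z: "inner (T' y) y = 0" for y by blast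
      have "inner (T' (x + T' x)) (x + T' x) = 2 * inner (T' x) (T' x)"
        using z[of x] z[of "T' x"] sym'[of "T' x" x]
        by (simp add: linear_add[OF T'] inner_add_left inner_add_right inner_commute)
      then show False using z[of "x + T' x"] nz by simp
    qed
    then obtain y where "inner (T' y) y \<noteq> 0" by blast
    moreover have "inner (T' y) y \<ge> 0" unfolding q by (rule psd)
    ultimately have y: "inner (T' y) y > 0" by simp
    \<comment> \<open>The eigenvector is sought in the span, so \<open>y\<close> is replaced by its
      projection, which has the same value of the quadratic form.\<close>
    define z where "z = oproj e A y"
    have sp: "inner w (y - z) = 0" if "w \<in> span (e ` A)" for w
    proof -
      have "inner w y = inner (oproj e A w) y" using oproj_span[OF e that] by simp
      also have "... = inner w z" unfolding z_def
        using oproj_inner[OF e, of w y] oproj_inner[OF e, of y w] by (simp add: inner_commute mult.commute)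
      finally show ?thesis by (simp add: inner_diff_right)
    qed
    have "inner (T' y) y = inner (T' y) z" using sp[OF ran'[of y]] by (simp add: inner_diff_right)
    also have "... = inner (T' z) y" by (metis sym' inner_commute)
    also have "... = inner (T' z) z" using sp[OF ran'[of z]] by (simp add: inner_diff_right)
    finally have "inner (T' z) z > 0" using y by simp
    moreover have "z \<in> span (e ` A)" unfolding z_def by (rule oproj_in_span)
    ultimately obtain v m where v: "v \<in> span (e ` A)" "norm v = 1" "m > 0" "T' v = m *\<^sub>R v"
      using top_eigenvector[OF e T' ran' sym', of z] by blast
    have vu: "inner v (u b) = 0" if "b < t" for b
      using orth[OF that, of v] v by simp
    define u' where "u' = u(t := v)"
    define l' where "l' = l(t := m)"
    have "T v = m *\<^sub>R v"
      using expand[of v] v vu by (simp add: inner_commute)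
    moreover have "inner v v = 1" using v(2) by (simp add: norm_eq_1)
    ultimately have "P (Suc t) u' l'"
      unfolding P_def u'_def l'_def orthon_def using u us l eig v vu
      by (auto simp: orthon_def less_Suc_eq inner_commute)
    then show False using max[of "Suc t"] by auto
  qed
  show ?thesis using u us l expand T'0 by (intro exI[of _ t] exI[of _ u] exI[of _ l]) auto
qed

text \<open>Adding a multiple of the projection onto the span makes the operator positive definite
  there. The eigenvectors with positive eigenvalues then form a basis of the span, and the
  eigenvalues are shifted back.\<close>

corollary eigenbasis_exists:
  fixes T :: "'v::real_inner \<Rightarrow> 'v"
  assumes e: "orthon e A" and T: "linear T" and ran: "\<And>x. T x \<in> span (e ` A)"
    and sym: "\<And>x y. inner (T x) y = inner x (T y)"
    and lower: "\<And>x. inner (T x) x \<ge> - K * (norm x)\<^sup>2"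
  shows "\<exists>(t::nat) u l. t \<le> card A \<and> orthon u {..<t} \<and> u ` {..<t} \<subseteq> span (e ` A) \<and>
    (\<forall>a<t. T (u a) = l a *\<^sub>R u a) \<and> (\<forall>x\<in>span (e ` A). oproj u {..<t} x = x)"
proof -
  \<comment> \<open>\<open>K\<close> may have either sign; in any case \<open>c - K\<close> is at
    least \<open>1\<close>.\<close>
  define c where "c = \<bar>K\<bar> + 1"
  define T' where "T' x = T x + c *\<^sub>R oproj e A x" for x
  have linp: "linear (oproj e A)"
    unfolding oproj_def by (intro linearI) (simp_all add: inner_add_right sum.distrib scaleR_add_left scaleR_sum_right)
  have T': "linear T'" unfolding T'_def by (intro linear_compose_add T linear_compose_scale_right linp)
  have ran': "T' x \<in> span (e ` A)" for x
    unfolding T'_def by (intro span_add span_scale ran oproj_in_span)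
  have symp: "inner (oproj e A x) y = inner x (oproj e A y)" for x y
    using oproj_inner[OF e, of x y] oproj_inner[OF e, of y x] by (simp add: inner_commute mult.commute)
  have sym': "inner (T' x) y = inner x (T' y)" for x y
    unfolding T'_def by (simp add: inner_add_left inner_add_right sym symp)
  have q: "inner (T' x) x \<ge> (norm (oproj e A x))\<^sup>2" for x
  proof -
    let ?p = "oproj e A x"
    have pp: "oproj e A ?p = ?p" by (rule oproj_span[OF e oproj_in_span])
    have Tp: "oproj e A (T y) = T y" for y by (rule oproj_span[OF e ran])
    have "inner (T x) x = inner (T x) ?p" using symp[of "T x" x] Tp by simp
    also have "... = inner (T ?p) x" by (metis sym inner_commute)
    also have "... = inner (T ?p) ?p" using symp[of "T ?p" x] Tp by simp
    finally have "inner (T x) x \<ge> - K * (norm ?p)\<^sup>2" using lower[of ?p] by simp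
    moreover have "inner ?p x = (norm ?p)\<^sup>2" using symp[of ?p x] pp by (simp add: power2_norm_eq_inner)
    moreover have "(c - K) * (norm ?p)\<^sup>2 \<ge> 1 * (norm ?p)\<^sup>2"
      by (intro mult_right_mono) (auto simp: c_def)
    ultimately show ?thesis unfolding T'_def by (simp add: inner_add_left algebra_simps)
  qed
  obtain t u l where u: "orthon u {..<t}" "u ` {..<t} \<subseteq> span (e ` A)"
    and ex: "\<And>x. T' x = (\<Sum>a<(t::nat). (l a * inner (u a) x) *\<^sub>R u a)"
    using spectral_theorem_psd[OF e T' ran' sym'] q by (meson order_trans zero_le_power2)
  have comp: "oproj u {..<t} x = x" if x: "x \<in> span (e ` A)" for x
  proof -
    let ?y = "x - oproj u {..<t} x"
    have ys: "?y \<in> span (e ` A)"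
      using x oproj_in_span[of u "{..<t}" x] real_vector.span_minimal[OF u(2) real_vector.subspace_span]
      by (auto intro!: span_diff)
    have "inner (u a) ?y = 0" if "a < t" for a
      unfolding inner_diff_right oproj_def using orthon_inner_sum(2)[OF u(1)] that by simp
    then have "T' ?y = 0" unfolding ex by simp
    then have "norm (oproj e A ?y) = 0" using q[of ?y] by simp
    then show ?thesis using oproj_span[OF e ys] by simp
  qed
  have "T (u a) = (l a - c) *\<^sub>R u a" if a: "a < t" for a
  proof -
    have "T' (u a) = (\<Sum>b<t. if b = a then l a *\<^sub>R u a else 0)"
      unfolding ex by (rule sum.cong) (use u(1) a in \<open>auto simp: orthon_inner\<close>)
    then have "T' (u a) = l a *\<^sub>R u a" using a by simp
    moreover have "oproj e A (u a) = u a" using u(2) a by (intro oproj_span[OF e]) auto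
    ultimately show ?thesis unfolding T'_def by (simp add: algebra_simps)
  qed
  then show ?thesis using u comp orthon_card_le[OF u(1) e u(2)]
    by (intro exI[of _ t] exI[of _ u] exI[of _ "\<lambda>a. l a - c"]) auto
qed

section \<open>Concentration of sums of independent rank-one operators\<close>

text \<open>The trapezoid rule overestimates the integral of the convex function
  \<open>(2 * k + 1) * t ^ (2 * k)\<close> between \<open>y\<close> and \<open>x\<close>. The proof
  pairs the terms \<open>q\<close> and \<open>2 * k - q\<close> in the factorization of a difference
  of powers.\<close>

lemma odd_power_trapezoid:
  fixes x y :: real
  shows "(x - y) * (x ^ (2 * k + 1) - y ^ (2 * k + 1)) \<le> real (2 * k + 1) / 2 * (x - y)\<^sup>2 * (x ^ (2 * k) + y ^ (2 * k))"
proof -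
  have mono: "x ^ q * y ^ (2 * k - q) + x ^ (2 * k - q) * y ^ q \<le> x ^ (2 * k) + y ^ (2 * k)" if "q \<le> 2 * k" for q
  proof -
    \<comment> \<open>The two factors have the same sign, since powers are monotone in the absolute
      value.\<close>
    have "0 \<le> (\<bar>x\<bar> ^ q - \<bar>y\<bar> ^ q) * (\<bar>x\<bar> ^ (2 * k - q) - \<bar>y\<bar> ^ (2 * k - q))"
    proof (cases "\<bar>x\<bar> \<le> \<bar>y\<bar>")
      case True
      then show ?thesis by (intro mult_nonpos_nonpos) (auto intro: power_mono)
    next
      case False
      then show ?thesis by (intro mult_nonneg_nonneg) (auto intro: power_mono)
    qed
    then have "\<bar>x\<bar> ^ q * \<bar>y\<bar> ^ (2 * k - q) + \<bar>x\<bar> ^ (2 * k - q) * \<bar>y\<bar> ^ q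
        \<le> \<bar>x\<bar> ^ q * \<bar>x\<bar> ^ (2 * k - q) + \<bar>y\<bar> ^ q * \<bar>y\<bar> ^ (2 * k - q)"
      by (simp add: algebra_simps)
    also have "... = x ^ (2 * k) + y ^ (2 * k)"
      using that by (simp add: power_add[symmetric] power_even_abs)
    finally have "\<bar>x ^ q * y ^ (2 * k - q)\<bar> + \<bar>x ^ (2 * k - q) * y ^ q\<bar> \<le> x ^ (2 * k) + y ^ (2 * k)"
      by (simp add: abs_mult power_abs)
    then show ?thesis by linarith
  qed
  let ?s = "\<Sum>q\<le>2 * k. x ^ q * y ^ (2 * k - q)"
  \<comment> \<open>Reversing the order of summation pairs each term with its mirror image.\<close>
  have "2 * ?s = ?s + (\<Sum>q\<le>2 * k. x ^ (2 * k - q) * y ^ q)"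
    by (subst sum.nat_diff_reindex[symmetric, of _ "Suc (2 * k)", unfolded lessThan_Suc_atMost])
      (simp add: algebra_simps)
  also have "... \<le> (\<Sum>q\<le>2 * k. x ^ (2 * k) + y ^ (2 * k))"
    unfolding sum.distrib[symmetric] by (rule sum_mono) (use mono in auto)
  also have "... = real (2 * k + 1) * (x ^ (2 * k) + y ^ (2 * k))" by simp
  finally have s: "?s \<le> real (2 * k + 1) / 2 * (x ^ (2 * k) + y ^ (2 * k))" by simp
  have "x ^ (2 * k + 1) - y ^ (2 * k + 1) = (x - y) * ?s"
    using power_diff_sumr2[of x "2 * k + 1" y] by (simp add: lessThan_Suc_atMost mult_ac)
  then have "(x - y) * (x ^ (2 * k + 1) - y ^ (2 * k + 1)) = (x - y)\<^sup>2 * ?s"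
    by (simp add: power2_eq_square mult_ac)
  also have "... \<le> (x - y)\<^sup>2 * (real (2 * k + 1) / 2 * (x ^ (2 * k) + y ^ (2 * k)))"
    by (intro mult_left_mono s) auto
  finally show ?thesis by (simp add: mult_ac)
qed

text \<open>Here \<open>\<Delta>\<close> is the difference of two self-adjoint operators with eigenbases \<open>u\<close>, \<open>w\<close> and eigenvalues
  \<open>l\<close>, \<open>m\<close>. Expanding in both bases reduces the claim to the scalar inequality.\<close>

lemma two_basis_trapezoid:
  fixes \<Delta> :: "'v::real_inner \<Rightarrow> 'v"
  assumes u: "orthon u A" and w: "orthon w B"
    and uc: "\<And>x. x \<in> V \<Longrightarrow> oproj u A x = x" and wc: "\<And>x. x \<in> V \<Longrightarrow> oproj w B x = x"
    and V: "\<And>x. \<Delta> x \<in> V"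
    and sym: "\<And>x y. inner (\<Delta> x) y = inner x (\<Delta> y)"
    and diff: "\<And>a b. a \<in> A \<Longrightarrow> b \<in> B \<Longrightarrow> inner (\<Delta> (u a)) (w b) = (l a - m b) * inner (u a) (w b)"
  shows "(\<Sum>a\<in>A. l a ^ (2 * k + 1) * inner (\<Delta> (u a)) (u a)) - (\<Sum>b\<in>B. m b ^ (2 * k + 1) * inner (\<Delta> (w b)) (w b))
    \<le> real (2 * k + 1) / 2 * ((\<Sum>a\<in>A. l a ^ (2 * k) * (norm (\<Delta> (u a)))\<^sup>2) + (\<Sum>b\<in>B. m b ^ (2 * k) * (norm (\<Delta> (w b)))\<^sup>2))"
proof -
  have diff': "inner (\<Delta> (w b)) (u a) = (l a - m b) * inner (u a) (w b)" if "a \<in> A" "b \<in> B" for a b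
    using diff[OF that] sym[of "w b" "u a"] by (simp add: inner_commute)
  have n1: "(norm (\<Delta> (u a)))\<^sup>2 = (\<Sum>b\<in>B. (l a - m b)\<^sup>2 * (inner (u a) (w b))\<^sup>2)" if "a \<in> A" for a
  proof -
    have "(norm (\<Delta> (u a)))\<^sup>2 = (\<Sum>b\<in>B. (inner (w b) (\<Delta> (u a)))\<^sup>2)"
      using oproj_norm[OF w, of "\<Delta> (u a)"] wc[OF V] by simp
    also have "... = (\<Sum>b\<in>B. (l a - m b)\<^sup>2 * (inner (u a) (w b))\<^sup>2)"
      by (rule sum.cong) (use diff[OF that] in \<open>auto simp: inner_commute power_mult_distrib\<close>)
    finally show ?thesis .
  qed
  have n2: "(norm (\<Delta> (w b)))\<^sup>2 = (\<Sum>a\<in>A. (l a - m b)\<^sup>2 * (inner (u a) (w b))\<^sup>2)" if "b \<in> B" for b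
  proof -
    have "(norm (\<Delta> (w b)))\<^sup>2 = (\<Sum>a\<in>A. (inner (u a) (\<Delta> (w b)))\<^sup>2)"
      using oproj_norm[OF u, of "\<Delta> (w b)"] uc[OF V] by simp
    also have "... = (\<Sum>a\<in>A. (l a - m b)\<^sup>2 * (inner (u a) (w b))\<^sup>2)"
      by (rule sum.cong) (use diff'[OF _ that] in \<open>auto simp: inner_commute power_mult_distrib\<close>)
    finally show ?thesis .
  qed
  have d1: "inner (\<Delta> (u a)) (u a) = (\<Sum>b\<in>B. (l a - m b) * (inner (u a) (w b))\<^sup>2)" if "a \<in> A" for a
  proof -
    have "inner (\<Delta> (u a)) (u a) = inner (oproj w B (\<Delta> (u a))) (u a)" using wc[OF V] by simp
    also have "... = (\<Sum>b\<in>B. inner (w b) (\<Delta> (u a)) * inner (w b) (u a))" by (rule oproj_inner[OF w])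
    also have "... = (\<Sum>b\<in>B. (l a - m b) * (inner (u a) (w b))\<^sup>2)"
      by (rule sum.cong) (use diff[OF that] in \<open>auto simp: inner_commute power2_eq_square\<close>)
    finally show ?thesis .
  qed
  have d2: "inner (\<Delta> (w b)) (w b) = (\<Sum>a\<in>A. (l a - m b) * (inner (u a) (w b))\<^sup>2)" if "b \<in> B" for b
  proof -
    have "inner (\<Delta> (w b)) (w b) = inner (oproj u A (\<Delta> (w b))) (w b)" using uc[OF V] by simp
    also have "... = (\<Sum>a\<in>A. inner (u a) (\<Delta> (w b)) * inner (u a) (w b))" by (rule oproj_inner[OF u])
    also have "... = (\<Sum>a\<in>A. (l a - m b) * (inner (u a) (w b))\<^sup>2)"
      by (rule sum.cong) (use diff'[OF _ that] in \<open>auto simp: inner_commute power2_eq_square\<close>)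
    finally show ?thesis .
  qed
  let ?c = "\<lambda>a b. (inner (u a) (w b))\<^sup>2"
  let ?n = "2 * k + 1"
  have s1: "(\<Sum>a\<in>A. l a ^ ?n * inner (\<Delta> (u a)) (u a)) = (\<Sum>a\<in>A. \<Sum>b\<in>B. l a ^ ?n * (l a - m b) * ?c a b)"
    by (rule sum.cong) (simp_all add: d1 sum_distrib_left mult.assoc)
  have "(\<Sum>b\<in>B. m b ^ ?n * inner (\<Delta> (w b)) (w b)) = (\<Sum>b\<in>B. \<Sum>a\<in>A. m b ^ ?n * (l a - m b) * ?c a b)"
    by (rule sum.cong) (simp_all add: d2 sum_distrib_left mult.assoc)
  also have "... = (\<Sum>a\<in>A. \<Sum>b\<in>B. m b ^ ?n * (l a - m b) * ?c a b)" by (rule sum.swap)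
  finally have s2: "(\<Sum>b\<in>B. m b ^ ?n * inner (\<Delta> (w b)) (w b)) = (\<Sum>a\<in>A. \<Sum>b\<in>B. m b ^ ?n * (l a - m b) * ?c a b)" .
  have s3: "(\<Sum>a\<in>A. l a ^ (2 * k) * (norm (\<Delta> (u a)))\<^sup>2) = (\<Sum>a\<in>A. \<Sum>b\<in>B. l a ^ (2 * k) * (l a - m b)\<^sup>2 * ?c a b)"
    by (rule sum.cong) (simp_all add: n1 sum_distrib_left mult.assoc)
  have "(\<Sum>b\<in>B. m b ^ (2 * k) * (norm (\<Delta> (w b)))\<^sup>2) = (\<Sum>b\<in>B. \<Sum>a\<in>A. m b ^ (2 * k) * (l a - m b)\<^sup>2 * ?c a b)"
    by (rule sum.cong) (simp_all add: n2 sum_distrib_left mult.assoc)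
  also have "... = (\<Sum>a\<in>A. \<Sum>b\<in>B. m b ^ (2 * k) * (l a - m b)\<^sup>2 * ?c a b)" by (rule sum.swap)
  finally have s4: "(\<Sum>b\<in>B. m b ^ (2 * k) * (norm (\<Delta> (w b)))\<^sup>2) = (\<Sum>a\<in>A. \<Sum>b\<in>B. m b ^ (2 * k) * (l a - m b)\<^sup>2 * ?c a b)" .
  show ?thesis
    unfolding s1 s2 s3 s4 sum_subtractf[symmetric] sum.distrib[symmetric] sum_distrib_left
  proof (intro sum_mono)
    fix a b
    have ring: "X * p * q - Y * p * q = (p * (X - Y)) * q" "r * (X * p * q + Y * p * q) = (r * p * (X + Y)) * q"
      for X Y p q r :: real by (simp_all add: algebra_simps)
    have "((l a - m b) * (l a ^ ?n - m b ^ ?n)) * ?c a b \<le> (real ?n / 2 * (l a - m b)\<^sup>2 * (l a ^ (2 * k) + m b ^ (2 * k))) * ?c a b"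
      by (intro mult_right_mono odd_power_trapezoid) auto
    then show "l a ^ ?n * (l a - m b) * ?c a b - m b ^ ?n * (l a - m b) * ?c a b \<le>
      real ?n / 2 * (l a ^ (2 * k) * (l a - m b)\<^sup>2 * ?c a b + m b ^ (2 * k) * (l a - m b)\<^sup>2 * ?c a b)"
      unfolding ring .
  qed
qed

section \<open>Uniform samples as equally weighted lists\<close>

definition sample_lists :: "nat \<Rightarrow> 's set \<Rightarrow> 's list set" where
  "sample_lists m S = {xs. set xs \<subseteq> S \<and> length xs = m}"

lemma finite_sample_lists: "finite S \<Longrightarrow> finite (sample_lists m S)"
  unfolding sample_lists_def by (rule finite_lists_length_eq)

lemma card_sample_lists: "finite S \<Longrightarrow> card (sample_lists m S) = card S ^ m"
  unfolding sample_lists_def by (rule card_lists_length_eq)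

lemma pmf_replicate_uniform:
  assumes "finite S" "S \<noteq> {}"
  shows "pmf (replicate_pmf m (pmf_of_set S)) xs = (if xs \<in> sample_lists m S then 1 / real (card S) ^ m else 0)"
proof (induction m arbitrary: xs)
  case 0
  then show ?case by (auto simp: sample_lists_def)
next
  case (Suc m)
  have eq: "replicate_pmf (Suc m) (pmf_of_set S) = map_pmf (\<lambda>(x, xs). x # xs) (pair_pmf (pmf_of_set S) (replicate_pmf m (pmf_of_set S)))"
    by (simp add: pair_pmf_def map_bind_pmf bind_return_pmf)
  have inj: "inj (\<lambda>(x, xs). x # xs)" by (auto simp: inj_def)
  show ?case
  proof (cases xs)
    case Nil
    then have "xs \<notin> set_pmf (replicate_pmf (Suc m) (pmf_of_set S))" unfolding eq by auto
    then have "pmf (replicate_pmf (Suc m) (pmf_of_set S)) xs = 0" by (simp add: pmf_eq_0_set_pmf del: replicate_pmf.simps)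
    then show ?thesis using Nil by (auto simp: sample_lists_def)
  next
    case (Cons y ys)
    have "pmf (replicate_pmf (Suc m) (pmf_of_set S)) xs = pmf (pair_pmf (pmf_of_set S) (replicate_pmf m (pmf_of_set S))) (y, ys)"
      unfolding eq using pmf_map_inj'[OF inj, of _ "(y, ys)"] Cons by simp
    then show ?thesis using Cons assms
      by (auto simp: pmf_pair Suc.IH sample_lists_def pmf_of_set)
  qed
qed

lemma prob_replicate_uniform:
  assumes "finite S" "S \<noteq> {}"
  shows "measure_pmf.prob (replicate_pmf m (pmf_of_set S)) E = real (card (E \<inter> sample_lists m S)) / real (card S) ^ m"
proof -
  let ?p = "replicate_pmf m (pmf_of_set S)"
  have "measure_pmf.prob ?p E = measure_pmf.prob ?p (E \<inter> sample_lists m S)"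
    by (rule measure_prob_cong_0) (auto simp: pmf_replicate_uniform[OF assms])
  also have "... = (\<Sum>xs\<in>E \<inter> sample_lists m S. pmf ?p xs)"
    by (rule measure_measure_pmf_finite) (simp add: finite_sample_lists assms)
  also have "... = (\<Sum>xs\<in>E \<inter> sample_lists m S. 1 / real (card S) ^ m)"
    by (rule sum.cong) (auto simp: pmf_replicate_uniform[OF assms])
  finally show ?thesis by simp
qed

text \<open>Exchanging the entry at position \<open>t\<close> with the independent copy
  \<open>s\<close> is an involution on the pairs of a list and a copy.\<close>

lemma sum_sample_swap:
  fixes F :: "'s list \<Rightarrow> 's \<Rightarrow> real"
  assumes "finite S" "t < m"
  shows "(\<Sum>xs\<in>sample_lists m S. \<Sum>s\<in>S. F (xs[t := s]) (xs ! t)) = (\<Sum>xs\<in>sample_lists m S. \<Sum>s\<in>S. F xs s)"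
proof -
  have "(\<Sum>p\<in>sample_lists m S \<times> S. F ((fst p)[t := snd p]) (fst p ! t)) = (\<Sum>p\<in>sample_lists m S \<times> S. F (fst p) (snd p))"
  proof (rule sum.reindex_bij_witness[of _ "\<lambda>p. ((fst p)[t := snd p], fst p ! t)" "\<lambda>p. ((fst p)[t := snd p], fst p ! t)"])
    fix p assume p: "p \<in> sample_lists m S \<times> S"
    then show "((fst p)[t := snd p], fst p ! t) \<in> sample_lists m S \<times> S"
      using assms(2) by (auto simp: sample_lists_def dest!: set_update_subset_insert[THEN subsetD])
    then show "((fst p)[t := snd p], fst p ! t) \<in> sample_lists m S \<times> S" .
  qed (use assms(2) in \<open>auto simp: sample_lists_def\<close>)
  then show ?thesis by (simp add: sum.cartesian_product case_prod_beta)
qed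

section \<open>The moment method for sums of independent rank-one operators\<close>

locale gram_sampling =
  fixes S :: "'s set" and g :: "'s \<Rightarrow> 'v::real_inner" and e :: "'i \<Rightarrow> 'v" and A :: "'i set"
    and m :: nat and R K :: real
  assumes finS: "finite S" "S \<noteq> {}" and e: "orthon e A"
    and gV: "\<And>s. s \<in> S \<Longrightarrow> g s \<in> span (e ` A)"
    and gR: "\<And>s. s \<in> S \<Longrightarrow> (norm (g s))\<^sup>2 \<le> R"
    and K: "\<And>x. real m / real (card S) * (\<Sum>s\<in>S. (inner (g s) x)\<^sup>2) \<le> K * (norm x)\<^sup>2"
begin

abbreviation "c \<equiv> real m / real (card S)"
abbreviation "Ls \<equiv> sample_lists m S"

text \<open>The deviation of the sum of the sampled operators
  \<open>inner (g s) x *\<^sub>R g s\<close> from its mean. \<open>R\<close> bounds the norm of a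
  single term, \<open>K\<close> the quadratic form of the mean, and \<open>card A\<close> is the
  dimension of the space.\<close>

definition Y :: "'s list \<Rightarrow> 'v \<Rightarrow> 'v" where
  "Y xs x = (\<Sum>t<m. inner (g (xs ! t)) x *\<^sub>R g (xs ! t)) - c *\<^sub>R (\<Sum>s\<in>S. inner (g s) x *\<^sub>R g s)"

lemma Y_inner: "inner (Y xs x) y =
  (\<Sum>t<m. inner (g (xs ! t)) x * inner (g (xs ! t)) y) - c * (\<Sum>s\<in>S. inner (g s) x * inner (g s) y)"
  unfolding Y_def by (simp add: inner_diff_left inner_sum_left)

lemma Ls_nth: "xs \<in> Ls \<Longrightarrow> t < m \<Longrightarrow> xs ! t \<in> S"
  unfolding sample_lists_def using nth_mem by blast

lemma Ls_update: "xs \<in> Ls \<Longrightarrow> s \<in> S \<Longrightarrow> xs[t := s] \<in> Ls"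
  unfolding sample_lists_def using set_update_subset_insert by fastforce

lemma R_nonneg: "R \<ge> 0"
  using finS gR by (meson all_not_in_conv order_trans zero_le_power2)

lemma eigen_ex:
  assumes "xs \<in> Ls"
  shows "\<exists>d u l. d \<le> card A \<and> orthon u {..<d} \<and> u ` {..<d} \<subseteq> span (e ` A) \<and>
    (\<forall>a<d. Y xs (u a) = l a *\<^sub>R u a) \<and> (\<forall>x\<in>span (e ` A). oproj u {..<d} x = x)"
proof (rule eigenbasis_exists[OF e])
  show "linear (Y xs)"
    unfolding Y_def
    by (intro linearI) (simp_all add: inner_add_right scaleR_add_left sum.distrib scaleR_add_right
      scaleR_diff_right scaleR_sum_right mult.left_commute)
  show "Y xs x \<in> span (e ` A)" for x
    unfolding Y_def by (intro span_diff span_sum span_scale gV Ls_nth[OF assms]) auto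
  show "inner (Y xs x) y = inner x (Y xs y)" for x y
    unfolding Y_inner inner_commute[of x] by (simp add: mult.commute)
  \<comment> \<open>The sampled sum is positive semidefinite, so the negative part of the form is at
    most the mean.\<close>
  show "inner (Y xs x) x \<ge> - K * (norm x)\<^sup>2" for x
  proof -
    have "(\<Sum>t<m. (inner (g (xs ! t)) x)\<^sup>2) \<ge> 0" by (intro sum_nonneg) auto
    then show ?thesis using K[of x] by (simp add: Y_inner power2_eq_square)
  qed
qed

definition eig :: "'s list \<Rightarrow> nat \<times> (nat \<Rightarrow> 'v) \<times> (nat \<Rightarrow> real)" where
  "eig xs = (SOME (d, u, l). d \<le> card A \<and> orthon u {..<d} \<and> u ` {..<d} \<subseteq> span (e ` A) \<and>
    (\<forall>a<d. Y xs (u a) = l a *\<^sub>R u a) \<and> (\<forall>x\<in>span (e ` A). oproj u {..<d} x = x))"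

definition dd where "dd xs = fst (eig xs)"
definition uu where "uu xs = fst (snd (eig xs))"
definition ll where "ll xs = snd (snd (eig xs))"

lemma eigD:
  assumes "xs \<in> Ls"
  shows "dd xs \<le> card A" "orthon (uu xs) {..<dd xs}" "uu xs ` {..<dd xs} \<subseteq> span (e ` A)"
    "\<And>a. a < dd xs \<Longrightarrow> Y xs (uu xs a) = ll xs a *\<^sub>R uu xs a"
    "\<And>x. x \<in> span (e ` A) \<Longrightarrow> oproj (uu xs) {..<dd xs} x = x"
proof -
  have "(\<lambda>(d, u, l). d \<le> card A \<and> orthon u {..<d} \<and> u ` {..<d} \<subseteq> span (e ` A) \<and>
    (\<forall>a<d. Y xs (u a) = l a *\<^sub>R u a) \<and> (\<forall>x\<in>span (e ` A). oproj u {..<d} x = x)) (eig xs)"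
    unfolding eig_def by (rule someI_ex) (use eigen_ex[OF assms] in auto)
  then show "dd xs \<le> card A" "orthon (uu xs) {..<dd xs}" "uu xs ` {..<dd xs} \<subseteq> span (e ` A)"
    "\<And>a. a < dd xs \<Longrightarrow> Y xs (uu xs a) = ll xs a *\<^sub>R uu xs a"
    "\<And>x. x \<in> span (e ` A) \<Longrightarrow> oproj (uu xs) {..<dd xs} x = x"
    unfolding dd_def uu_def ll_def by (auto simp: case_prod_beta)
qed

text \<open>For a list in \<open>Ls\<close> and \<open>s \<in> S\<close> this is the quadratic form
  of the \<open>n\<close>-th power of \<open>Y xs\<close> at \<open>g s\<close>, written in the
  chosen eigenbasis. Likewise \<open>Sn\<close> below is the sum of the traces of the
  \<open>n\<close>-th powers over all lists.\<close>

definition Tr :: "nat \<Rightarrow> 's list \<Rightarrow> 's \<Rightarrow> real" where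
  "Tr n xs s = (\<Sum>a<dd xs. ll xs a ^ n * (inner (g s) (uu xs a))\<^sup>2)"

definition Sn :: "nat \<Rightarrow> real" where
  "Sn n = (\<Sum>xs\<in>Ls. \<Sum>a<dd xs. ll xs a ^ n)"

text \<open>Replacing one sample changes \<open>Y\<close> by a difference of two rank-one operators.
  \<open>two_basis_trapezoid\<close> compares the eigenbases before and after, and the squared norm
  of the difference costs one factor \<open>2 * R\<close>.\<close>

lemma exchange_bound:
  assumes xs: "xs \<in> Ls" and t: "t < m" and s: "s \<in> S"
  defines "ys \<equiv> xs[t := s]" and "x \<equiv> xs ! t"
  shows "(Tr (2 * k + 1) xs x - Tr (2 * k + 1) xs s) - (Tr (2 * k + 1) ys x - Tr (2 * k + 1) ys s)
    \<le> real (2 * k + 1) * R * ((Tr (2 * k) xs x + Tr (2 * k) xs s) + (Tr (2 * k) ys x + Tr (2 * k) ys s))"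
proof -
  have ys: "ys \<in> Ls" unfolding ys_def by (rule Ls_update[OF xs s])
  have x: "x \<in> S" unfolding x_def by (rule Ls_nth[OF xs t])
  define \<Delta> where "\<Delta> z = inner (g x) z *\<^sub>R g x - inner (g s) z *\<^sub>R g s" for z
  have \<Delta>Y: "\<Delta> z = Y xs z - Y ys z" for z
  proof -
    have len: "length xs = m" using xs by (simp add: sample_lists_def)
    have "(\<Sum>t'\<in>{..<m} - {t}. inner (g (ys ! t')) z *\<^sub>R g (ys ! t')) = (\<Sum>t'\<in>{..<m} - {t}. inner (g (xs ! t')) z *\<^sub>R g (xs ! t'))"
      unfolding ys_def by (rule sum.cong) auto
    then show ?thesis
      unfolding \<Delta>_def Y_def
      using sum.remove[of "{..<m}" t "\<lambda>t. inner (g (xs ! t)) z *\<^sub>R g (xs ! t)"]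
        sum.remove[of "{..<m}" t "\<lambda>t. inner (g (ys ! t)) z *\<^sub>R g (ys ! t)"] t len
      by (simp add: ys_def x_def)
  qed
  have symY: "inner (Y zs a) b = inner a (Y zs b)" for zs a b
    unfolding Y_inner inner_commute[of a] by (simp add: mult.commute)
  have trap: "(\<Sum>a\<in>{..<dd xs}. ll xs a ^ (2 * k + 1) * inner (\<Delta> (uu xs a)) (uu xs a)) - (\<Sum>b\<in>{..<dd ys}. ll ys b ^ (2 * k + 1) * inner (\<Delta> (uu ys b)) (uu ys b))
    \<le> real (2 * k + 1) / 2 * ((\<Sum>a\<in>{..<dd xs}. ll xs a ^ (2 * k) * (norm (\<Delta> (uu xs a)))\<^sup>2) + (\<Sum>b\<in>{..<dd ys}. ll ys b ^ (2 * k) * (norm (\<Delta> (uu ys b)))\<^sup>2))"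
  proof (rule two_basis_trapezoid[OF eigD(2)[OF xs] eigD(2)[OF ys] eigD(5)[OF xs] eigD(5)[OF ys]])
    show "\<Delta> z \<in> span (e ` A)" for z
      unfolding \<Delta>_def by (intro span_diff span_scale gV x s)
    show "inner (\<Delta> a) b = inner a (\<Delta> b)" for a b
      unfolding \<Delta>_def by (simp add: inner_diff_left inner_diff_right inner_commute)
    show "inner (\<Delta> (uu xs a)) (uu ys b) = (ll xs a - ll ys b) * inner (uu xs a) (uu ys b)"
      if "a \<in> {..<dd xs}" "b \<in> {..<dd ys}" for a b
      using that eigD(4)[OF xs, of a] eigD(4)[OF ys, of b]
      by (simp add: \<Delta>Y inner_diff_left symY[of ys] algebra_simps)
  qed
  have quad: "inner (\<Delta> z) z = (inner (g x) z)\<^sup>2 - (inner (g s) z)\<^sup>2" for z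
    unfolding \<Delta>_def by (simp add: inner_diff_left power2_eq_square)
  have tr: "(\<Sum>a\<in>{..<dd zs}. ll zs a ^ n * inner (\<Delta> (uu zs a)) (uu zs a)) = Tr n zs x - Tr n zs s" for zs n
    unfolding Tr_def quad by (simp add: sum_subtractf right_diff_distrib)
  \<comment> \<open>The square of a sum is at most twice the sum of the squares; each rank-one term
    contributes \<open>R\<close> times its own quadratic form.\<close>
  have nb: "(norm (\<Delta> z))\<^sup>2 \<le> 2 * R * ((inner (g x) z)\<^sup>2 + (inner (g s) z)\<^sup>2)" for z
  proof -
    have "(norm (\<Delta> z))\<^sup>2 \<le> (norm (inner (g x) z *\<^sub>R g x) + norm (inner (g s) z *\<^sub>R g s))\<^sup>2"
      unfolding \<Delta>_def by (intro power_mono norm_triangle_ineq4) auto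
    also have "... \<le> 2 * (norm (inner (g x) z *\<^sub>R g x))\<^sup>2 + 2 * (norm (inner (g s) z *\<^sub>R g s))\<^sup>2"
      using sum_squares_bound[of "norm (inner (g x) z *\<^sub>R g x)" "norm (inner (g s) z *\<^sub>R g s)"]
      by (simp add: power2_sum)
    also have "... = 2 * ((inner (g x) z)\<^sup>2 * (norm (g x))\<^sup>2) + 2 * ((inner (g s) z)\<^sup>2 * (norm (g s))\<^sup>2)"
      by (simp add: power_mult_distrib)
    also have "... \<le> 2 * ((inner (g x) z)\<^sup>2 * R) + 2 * ((inner (g s) z)\<^sup>2 * R)"
      by (intro add_mono mult_left_mono gR x s) auto
    finally show ?thesis by (simp add: algebra_simps)
  qed
  have n: "(\<Sum>a\<in>{..<dd zs}. ll zs a ^ (2 * k) * (norm (\<Delta> (uu zs a)))\<^sup>2) \<le> 2 * R * (Tr (2 * k) zs x + Tr (2 * k) zs s)" for zs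
  proof -
    have "(\<Sum>a\<in>{..<dd zs}. ll zs a ^ (2 * k) * (norm (\<Delta> (uu zs a)))\<^sup>2) \<le>
        (\<Sum>a\<in>{..<dd zs}. ll zs a ^ (2 * k) * (2 * R * ((inner (g x) (uu zs a))\<^sup>2 + (inner (g s) (uu zs a))\<^sup>2)))"
      by (intro sum_mono mult_left_mono nb) (simp add: power_mult)
    also have "... = 2 * R * (Tr (2 * k) zs x + Tr (2 * k) zs s)"
      unfolding Tr_def sum.distrib[symmetric] sum_distrib_left
      by (rule sum.cong) (simp_all add: distrib_left mult.left_commute)
    finally show ?thesis .
  qed
  have "real (2 * k + 1) / 2 * ((\<Sum>a\<in>{..<dd xs}. ll xs a ^ (2 * k) * (norm (\<Delta> (uu xs a)))\<^sup>2) + (\<Sum>b\<in>{..<dd ys}. ll ys b ^ (2 * k) * (norm (\<Delta> (uu ys b)))\<^sup>2))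
    \<le> real (2 * k + 1) / 2 * (2 * R * (Tr (2 * k) xs x + Tr (2 * k) xs s) + 2 * R * (Tr (2 * k) ys x + Tr (2 * k) ys s))"
    by (intro mult_left_mono add_mono n) auto
  also have "... = real (2 * k + 1) * R * ((Tr (2 * k) xs x + Tr (2 * k) xs s) + (Tr (2 * k) ys x + Tr (2 * k) ys s))"
  proof -
    have ring: "n / 2 * (2 * R * p + 2 * R * q) = n * R * (p + q)" for n p q :: real
      by (simp add: field_simps)
    show ?thesis by (rule ring)
  qed
  finally show ?thesis using trap unfolding tr by linarith
qed

text \<open>One factor of the power \<open>n + 1\<close> is expanded into the sampled terms and the
  mean, which makes the trace accessible to an exchange of single samples.\<close>

lemma trace_split:
  assumes "xs \<in> Ls"
  shows "(\<Sum>t<m. Tr n xs (xs ! t)) - c * (\<Sum>s\<in>S. Tr n xs s) = (\<Sum>a<dd xs. ll xs a ^ Suc n)"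
proof -
  have "(\<Sum>t<m. Tr n xs (xs ! t)) - c * (\<Sum>s\<in>S. Tr n xs s) = (\<Sum>a<dd xs. ll xs a ^ n * inner (Y xs (uu xs a)) (uu xs a))"
  proof -
    have 1: "(\<Sum>t<m. Tr n xs (xs ! t)) = (\<Sum>a<dd xs. ll xs a ^ n * (\<Sum>t<m. (inner (g (xs ! t)) (uu xs a))\<^sup>2))"
      unfolding Tr_def by (subst sum.swap) (simp only: sum_distrib_left)
    have 2: "(\<Sum>s\<in>S. Tr n xs s) = (\<Sum>a<dd xs. ll xs a ^ n * (\<Sum>s\<in>S. (inner (g s) (uu xs a))\<^sup>2))"
      unfolding Tr_def by (subst sum.swap) (simp only: sum_distrib_left)
    have "c * (\<Sum>s\<in>S. Tr n xs s) = (\<Sum>a<dd xs. ll xs a ^ n * (c * (\<Sum>s\<in>S. (inner (g s) (uu xs a))\<^sup>2)))"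
      unfolding 2 by (subst sum_distrib_left) (simp only: mult.left_commute)
    then show ?thesis
      unfolding 1 Y_inner power2_eq_square[symmetric] by (simp only: sum_subtractf[symmetric] right_diff_distrib)
  qed
  also have "... = (\<Sum>a<dd xs. ll xs a ^ Suc n)"
  proof (rule sum.cong[OF refl])
    fix a assume a: "a \<in> {..<dd xs}"
    then have "inner (uu xs a) (uu xs a) = 1" using orthon_inner[OF eigD(2)[OF assms]] by simp
    then show "ll xs a ^ n * inner (Y xs (uu xs a)) (uu xs a) = ll xs a ^ Suc n"
      using eigD(4)[OF assms] a by simp
  qed
  finally show ?thesis .
qed

text \<open>Exchanging the sample at a position for an independent one preserves the sum over all lists. Hence the trace
  of \<open>Y\<close> to the power \<open>2 k + 2\<close> is on average half the change of the power \<open>2 k + 1\<close>, tested against the exchanged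
  rank-one terms, to which \<open>exchange_bound\<close> applies.\<close>

lemma Sn_step: "Sn (2 * k + 2) \<le> real (2 * k + 1) * R * (Sn (2 * k + 1) + 2 * K * Sn (2 * k))"
proof -
  define n where "n = 2 * k + 1"
  have cS: "real (card S) > 0" using finS by (simp add: card_gt_0_iff)
  define AA where "AA t = (\<Sum>xs\<in>Ls. \<Sum>s\<in>S. Tr n xs (xs ! t) - Tr n xs s)" for t
  define BB where "BB t = (\<Sum>xs\<in>Ls. \<Sum>s\<in>S. Tr (2 * k) xs (xs ! t) + Tr (2 * k) xs s)" for t
  have AB: "AA t \<le> real n * R * BB t" if t: "t < m" for t
  proof -
    have upd: "(xs[t := s]) ! t = s" if "xs \<in> Ls" for xs s
      using that t by (simp add: sample_lists_def)
    have "AA t = (\<Sum>xs\<in>Ls. \<Sum>s\<in>S. Tr n (xs[t := s]) ((xs[t := s]) ! t) - Tr n (xs[t := s]) (xs ! t))"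
      unfolding AA_def by (rule sum_sample_swap[OF finS(1) t, symmetric])
    also have "... = (\<Sum>xs\<in>Ls. \<Sum>s\<in>S. - (Tr n (xs[t := s]) (xs ! t) - Tr n (xs[t := s]) s))"
      by (intro sum.cong refl) (simp add: upd)
    \<comment> \<open>\<open>AA t\<close> is added to its exchanged form, which is equal to it;
      termwise this is the left-hand side of \<open>exchange_bound\<close>.\<close>
    finally have "2 * AA t = (\<Sum>xs\<in>Ls. \<Sum>s\<in>S. (Tr n xs (xs ! t) - Tr n xs s) - (Tr n (xs[t := s]) (xs ! t) - Tr n (xs[t := s]) s))"
      using AA_def[of t] by (simp add: sum_subtractf sum_negf)
    also have "... \<le> (\<Sum>xs\<in>Ls. \<Sum>s\<in>S. real n * R * ((Tr (2 * k) xs (xs ! t) + Tr (2 * k) xs s) + (Tr (2 * k) (xs[t := s]) (xs ! t) + Tr (2 * k) (xs[t := s]) s)))"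
      unfolding n_def by (intro sum_mono exchange_bound t) auto
    also have "... = real n * R * (BB t + (\<Sum>xs\<in>Ls. \<Sum>s\<in>S. Tr (2 * k) (xs[t := s]) s + Tr (2 * k) (xs[t := s]) (xs ! t)))"
      unfolding BB_def by (simp add: sum_distrib_left[symmetric] sum.distrib algebra_simps)
    also have "(\<Sum>xs\<in>Ls. \<Sum>s\<in>S. Tr (2 * k) (xs[t := s]) s + Tr (2 * k) (xs[t := s]) (xs ! t))
        = (\<Sum>xs\<in>Ls. \<Sum>s\<in>S. Tr (2 * k) (xs[t := s]) ((xs[t := s]) ! t) + Tr (2 * k) (xs[t := s]) (xs ! t))"
      by (intro sum.cong refl) (simp add: upd)
    also have "... = BB t"
      unfolding BB_def by (rule sum_sample_swap[OF finS(1) t])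
    finally show ?thesis by simp
  qed
  have swap1: "(\<Sum>t<m. \<Sum>xs\<in>Ls. \<Sum>s\<in>S. Tr j xs (xs ! t)) = real (card S) * (\<Sum>xs\<in>Ls. \<Sum>t<m. Tr j xs (xs ! t))" for j
    by (subst sum.swap) (simp add: sum_distrib_left)
  have swap2: "(\<Sum>t<m. \<Sum>xs\<in>Ls. \<Sum>s\<in>S. Tr j xs s) = real (card S) * (\<Sum>xs\<in>Ls. c * (\<Sum>s\<in>S. Tr j xs s))" for j
    using cS by (simp add: sum_distrib_left)
  have "Sn (2 * k + 2) = (\<Sum>xs\<in>Ls. (\<Sum>t<m. Tr n xs (xs ! t)) - c * (\<Sum>s\<in>S. Tr n xs s))"
    unfolding Sn_def n_def by (rule sum.cong) (simp_all only: trace_split, simp_all)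
  then have "real (card S) * Sn (2 * k + 2) = (\<Sum>t<m. AA t)"
    unfolding AA_def sum_subtractf swap1 swap2 by (simp add: right_diff_distrib)
  also have "... \<le> (\<Sum>t<m. real n * R * BB t)" by (intro sum_mono AB) simp
  also have "... = real n * R * (real (card S) * (\<Sum>xs\<in>Ls. (\<Sum>t<m. Tr (2 * k) xs (xs ! t)) + c * (\<Sum>s\<in>S. Tr (2 * k) xs s)))"
    unfolding sum_distrib_left[symmetric] BB_def sum.distrib swap1 swap2 by (simp only: distrib_left)
  also have "... \<le> real n * R * (real (card S) * (\<Sum>xs\<in>Ls. (\<Sum>a<dd xs. ll xs a ^ (2 * k + 1)) + 2 * K * (\<Sum>a<dd xs. ll xs a ^ (2 * k))))"
  proof (intro mult_left_mono sum_mono)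
    fix xs assume xs: "xs \<in> Ls"
    \<comment> \<open>\<open>trace_split\<close> leaves one mean term and the target contains
      another; each is at most \<open>K\<close> times the trace of the even power, whence
      \<open>2 * K\<close>.\<close>
    have "c * (\<Sum>s\<in>S. Tr (2 * k) xs s) = (\<Sum>a<dd xs. ll xs a ^ (2 * k) * (c * (\<Sum>s\<in>S. (inner (g s) (uu xs a))\<^sup>2)))"
      unfolding Tr_def by (subst sum.swap) (simp add: sum_distrib_left mult_ac)
    also have "... \<le> (\<Sum>a<dd xs. ll xs a ^ (2 * k) * K)"
    proof (intro sum_mono mult_left_mono)
      fix a assume "a \<in> {..<dd xs}"
      then have "norm (uu xs a) = 1" using orthon_norm[OF eigD(2)[OF xs]] by blast
      then show "c * (\<Sum>s\<in>S. (inner (g s) (uu xs a))\<^sup>2) \<le> K" using K[of "uu xs a"] by simp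
    qed (simp add: power_mult)
    finally have "c * (\<Sum>s\<in>S. Tr (2 * k) xs s) \<le> K * (\<Sum>a<dd xs. ll xs a ^ (2 * k))"
      by (simp add: sum_distrib_left mult.commute)
    then show "(\<Sum>t<m. Tr (2 * k) xs (xs ! t)) + c * (\<Sum>s\<in>S. Tr (2 * k) xs s) \<le>
        (\<Sum>a<dd xs. ll xs a ^ (2 * k + 1)) + 2 * K * (\<Sum>a<dd xs. ll xs a ^ (2 * k))"
      using trace_split[OF xs, of "2 * k"] by simp
  qed (use R_nonneg cS in auto)
  also have "... = real (card S) * (real n * R * (Sn (2 * k + 1) + 2 * K * Sn (2 * k)))"
    unfolding Sn_def by (simp add: sum.distrib sum_distrib_left mult_ac)
  finally show ?thesis using cS unfolding n_def by (simp only: mult_le_cancel_left_pos)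
qed

lemma Sn_even_nonneg: "Sn (2 * k) \<ge> 0"
  unfolding Sn_def by (intro sum_nonneg) (simp add: power_mult)

text \<open>\<open>Sn_step\<close> still contains an odd moment. Once it is split between its even
  neighbours, an even moment is at most \<open>r\<^sup>2 + 4 * r * K\<close> times the previous one,
  and \<open>r\<close> is at most \<open>2 * p * R\<close> up to order \<open>2 * p\<close>.\<close>

lemma Sn_bound:
  assumes K0: "K \<ge> 0" and "k \<le> p"
  shows "Sn (2 * k) \<le> (4 * (real p)\<^sup>2 * R\<^sup>2 + 8 * real p * R * K) ^ k * (real (card S) ^ m * real (card A))"
  using assms(2)
proof (induction k)
  case 0
  have "Sn 0 = (\<Sum>xs\<in>Ls. real (dd xs))" unfolding Sn_def by simp
  also have "... \<le> (\<Sum>xs\<in>Ls. real (card A))" by (intro sum_mono) (simp add: eigD)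
  also have "... = real (card S) ^ m * real (card A)" by (simp add: card_sample_lists finS)
  finally show ?case by simp
next
  case (Suc k)
  define r where "r = real (2 * k + 1) * R"
  have r: "0 \<le> r" "r \<le> 2 * real p * R"
    unfolding r_def using Suc.prems R_nonneg by (auto intro!: mult_right_mono)
  have B0: "0 \<le> 4 * (real p)\<^sup>2 * R\<^sup>2 + 8 * real p * R * K" using R_nonneg K0 by simp
  \<comment> \<open>Completing the square in every eigenvalue; half of the highest moment is
    absorbed on the left-hand side.\<close>
  have "r * Sn (2 * k + 1) \<le> 1 / 2 * Sn (2 * k + 2) + 1 / 2 * r\<^sup>2 * Sn (2 * k)"
    unfolding Sn_def sum_distrib_left sum.distrib[symmetric]
  proof (intro sum_mono)
    fix xs a
    let ?l = "ll xs a"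
    have "0 \<le> ?l ^ (2 * k) * (?l - r)\<^sup>2" by (simp add: power_mult)
    then show "r * ?l ^ (2 * k + 1) \<le> 1 / 2 * ?l ^ (2 * k + 2) + 1 / 2 * r\<^sup>2 * ?l ^ (2 * k)"
      by (simp add: power2_eq_square algebra_simps)
  qed
  moreover have "Sn (2 * k + 2) \<le> r * Sn (2 * k + 1) + 2 * r * K * Sn (2 * k)"
    using Sn_step[of k] unfolding r_def by (simp add: algebra_simps)
  ultimately have "Sn (2 * k + 2) \<le> (r\<^sup>2 + 4 * r * K) * Sn (2 * k)" by (simp add: algebra_simps)
  also have "... \<le> (4 * (real p)\<^sup>2 * R\<^sup>2 + 8 * real p * R * K) * Sn (2 * k)"
  proof (rule mult_right_mono)
    have "r\<^sup>2 \<le> (2 * real p * R)\<^sup>2" using r by (intro power_mono) auto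
    moreover have "r * K \<le> (2 * real p * R) * K" using r K0 by (intro mult_right_mono) auto
    ultimately show "r\<^sup>2 + 4 * r * K \<le> 4 * (real p)\<^sup>2 * R\<^sup>2 + 8 * real p * R * K"
      by (simp add: power_mult_distrib)
  qed (rule Sn_even_nonneg)
  also have "... \<le> (4 * (real p)\<^sup>2 * R\<^sup>2 + 8 * real p * R * K) *
      ((4 * (real p)\<^sup>2 * R\<^sup>2 + 8 * real p * R * K) ^ k * (real (card S) ^ m * real (card A)))"
    using Suc by (intro mult_left_mono B0) auto
  finally show ?case by (simp add: mult_ac)
qed

text \<open>Stated for two vectors, so that on a product space the off-diagonal part alone can be
  tested; this is how rectangular matrices and fixed vectors are treated later.\<close>

definition bad :: "real \<Rightarrow> 's list set" where
  "bad \<tau> = {xs. \<exists>x\<in>span (e ` A). \<exists>y\<in>span (e ` A). \<bar>sum_list (map (\<lambda>s. inner (g s) x * inner (g s) y) xs)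
      - c * (\<Sum>s\<in>S. inner (g s) x * inner (g s) y)\<bar> > \<tau> * norm x * norm y}"

text \<open>In the eigenbasis the form of \<open>Y\<close> is bounded by the largest absolute
  eigenvalue times both norms. A violation forces an eigenvalue beyond \<open>\<tau>\<close>, and
  even powers of the others are nonnegative.\<close>

lemma bad_eigenvalue:
  assumes xs: "xs \<in> Ls" "xs \<in> bad \<tau>" and \<tau>: "\<tau> \<ge> 0"
  shows "\<tau> ^ (2 * p) \<le> (\<Sum>a<dd xs. ll xs a ^ (2 * p))"
proof -
  obtain x y where x: "x \<in> span (e ` A)" and y: "y \<in> span (e ` A)"
    and b: "\<bar>inner (Y xs x) y\<bar> > \<tau> * norm x * norm y"
  proof -
    have "(\<Sum>t<m. inner (g (xs ! t)) x * inner (g (xs ! t)) y) = sum_list (map (\<lambda>s. inner (g s) x * inner (g s) y) xs)" for x y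
      using xs(1) by (simp add: sum_list_sum_nth sample_lists_def lessThan_atLeast0)
    then show ?thesis using that xs(2) unfolding bad_def Y_inner by auto
  qed
  have "\<exists>a<dd xs. \<bar>ll xs a\<bar> > \<tau>"
  proof (rule ccontr)
    assume "\<not> ?thesis"
    then have small: "\<bar>ll xs a\<bar> \<le> \<tau>" if "a < dd xs" for a using that by force
    let ?u = "uu xs" and ?D = "{..<dd xs}"
    have u: "orthon ?u ?D" by (rule eigD[OF xs(1)])
    have sym: "inner (Y xs a) b = inner a (Y xs b)" for a b
      unfolding Y_inner inner_commute[of a] by (simp add: mult.commute)
    have YV: "Y xs x \<in> span (e ` A)"
      unfolding Y_def by (intro span_diff span_sum span_scale gV Ls_nth[OF xs(1)]) auto
    have "inner (Y xs x) y = (\<Sum>a\<in>?D. inner (?u a) (Y xs x) * inner (?u a) y)"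
      using oproj_inner[OF u, of "Y xs x" y] eigD(5)[OF xs(1) YV] by simp
    also have "... = (\<Sum>a\<in>?D. ll xs a * (inner (?u a) x * inner (?u a) y))"
      by (rule sum.cong) (use eigD(4)[OF xs(1)] in \<open>auto simp: sym[symmetric]\<close>)
    finally have "\<bar>inner (Y xs x) y\<bar> \<le> (\<Sum>a\<in>?D. \<bar>ll xs a * (inner (?u a) x * inner (?u a) y)\<bar>)" by simp
    also have "... \<le> (\<Sum>a\<in>?D. \<tau> * (\<bar>inner (?u a) x\<bar> * \<bar>inner (?u a) y\<bar>))"
      unfolding abs_mult by (intro sum_mono mult_right_mono small) auto
    also have "... \<le> \<tau> * (L2_set (\<lambda>a. inner (?u a) x) ?D * L2_set (\<lambda>a. inner (?u a) y) ?D)"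
      unfolding sum_distrib_left[symmetric] by (intro mult_left_mono L2_set_mult_ineq \<tau>)
    also have "... \<le> \<tau> * (norm x * norm y)"
      unfolding L2_set_def using bessel[OF u, of x] bessel[OF u, of y]
      by (intro mult_left_mono mult_mono \<tau>) (auto intro!: real_le_lsqrt sum_nonneg)
    finally show False using b by simp
  qed
  then obtain a where a: "a < dd xs" "\<bar>ll xs a\<bar> > \<tau>" by blast
  have "\<tau> ^ (2 * p) \<le> \<bar>ll xs a\<bar> ^ (2 * p)" using a \<tau> by (intro power_mono) auto
  also have "... = ll xs a ^ (2 * p)" by (simp add: power_even_abs)
  also have "... \<le> (\<Sum>a<dd xs. ll xs a ^ (2 * p))"
    by (rule member_le_sum) (use a in \<open>auto simp: power_mult\<close>)
  finally show ?thesis .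
qed

text \<open>Markov's inequality for the trace of the power \<open>2 * p\<close> of \<open>Y\<close>,
  carried out by counting lists.\<close>

theorem gram_concentration:
  assumes \<tau>: "\<tau> > 0" and K0: "K \<ge> 0"
  shows "measure_pmf.prob (replicate_pmf m (pmf_of_set S)) (bad \<tau>)
    \<le> real (card A) * ((4 * (real p)\<^sup>2 * R\<^sup>2 + 8 * real p * R * K) / \<tau>\<^sup>2) ^ p"
proof -
  let ?B = "4 * (real p)\<^sup>2 * R\<^sup>2 + 8 * real p * R * K"
  have cS: "real (card S) ^ m > 0" using finS by (simp add: card_gt_0_iff)
  have "real (card (bad \<tau> \<inter> Ls)) * \<tau> ^ (2 * p) = (\<Sum>xs\<in>bad \<tau> \<inter> Ls. \<tau> ^ (2 * p))" by simp
  also have "... \<le> (\<Sum>xs\<in>bad \<tau> \<inter> Ls. \<Sum>a<dd xs. ll xs a ^ (2 * p))"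
    by (intro sum_mono bad_eigenvalue) (use \<tau> in auto)
  also have "... \<le> Sn (2 * p)"
    unfolding Sn_def by (intro sum_mono2) (auto simp: finite_sample_lists finS power_mult intro!: sum_nonneg)
  also have "... \<le> ?B ^ p * (real (card S) ^ m * real (card A))"
    by (rule Sn_bound) (use K0 in auto)
  finally have "real (card (bad \<tau> \<inter> Ls)) / real (card S) ^ m \<le> ?B ^ p * real (card A) / \<tau> ^ (2 * p)"
    using cS \<tau> by (simp add: field_simps)
  also have "... = real (card A) * (?B / \<tau>\<^sup>2) ^ p"
    by (simp add: power_divide power_mult)
  finally show ?thesis by (simp add: prob_replicate_uniform finS)
qed

end

section \<open>Singular value decompositions and tangent spaces in matrix form\<close>

definition fproj :: "'a fmat \<Rightarrow> bool" where
  "fproj P \<longleftrightarrow> ftr P = P \<and> P * P = P"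

text \<open>Orthonormal columns indexed by \<open>J\<close>. The remaining columns vanish by
  \<open>fiso_fId\<close>, so this is a partial isometry.\<close>

definition fiso :: "'a fmat \<Rightarrow> 'a set \<Rightarrow> bool" where
  "fiso U J \<longleftrightarrow> finite J \<and> ftr U * U = fId J"

definition fdiag :: "'a set \<Rightarrow> ('a \<Rightarrow> real) \<Rightarrow> 'a fmat" where
  "fdiag J s = (\<Sum>j\<in>J. s j *\<^sub>R fE j j)"

text \<open>A bound for the operator norm. Testing with matrices \<open>x\<close> in the Frobenius
  norm amounts to testing with single columns, see \<open>fop_leI_columns\<close>.\<close>

definition fop_le :: "'a fmat \<Rightarrow> real \<Rightarrow> bool" where
  "fop_le B c \<longleftrightarrow> (\<forall>x. norm (B * x) \<le> c * norm x)"

lemma fop_leD: "fop_le B c \<Longrightarrow> norm (B * x) \<le> c * norm x"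
  by (simp add: fop_le_def)

lemma fop_le_norm: "fop_le B (norm B)"
  by (simp add: fop_le_def norm_mult_fmat)

lemma fop_le_ftr:
  assumes "fop_le B c"
  shows "fop_le (ftr B) c"
  unfolding fop_le_def
proof
  fix x
  have "(norm (ftr B * x))\<^sup>2 = inner (B * (ftr B * x)) x"
    by (simp add: power2_norm_eq_inner inner_mult_left)
  also have "... \<le> norm (B * (ftr B * x)) * norm x" by (rule norm_cauchy_schwarz)
  also have "... \<le> (c * norm (ftr B * x)) * norm x"
    by (intro mult_right_mono fop_leD assms) auto
  finally show "norm (ftr B * x) \<le> c * norm x"
    by (cases "ftr B * x = 0") (use fop_leD[OF assms, of x] in \<open>auto simp: power2_eq_square intro: order_trans[OF norm_ge_zero]\<close>)
qed

lemma fop_le_right: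
  assumes "fop_le B c"
  shows "norm (A * B) \<le> c * norm A"
  using fop_leD[OF fop_le_ftr[OF assms], of "ftr A"] norm_ftr[of "A * B"] norm_ftr[of A] by simp

lemma ftr_mult_eq_0: "ftr D * D = 0 \<Longrightarrow> D = (0 :: 'a fmat)"
proof -
  assume 0: "ftr D * D = 0"
  show "D = 0"
  proof (rule fmat_eqI)
    fix i j
    have "0 = ent (ftr D * D) j j" using 0 by simp
    also have "... = (\<Sum>k\<in>fsupp D. (ent D k j)\<^sup>2)"
      by (simp add: ent_times_right[OF finite_fsupp order_refl] power2_eq_square)
    finally have "\<forall>k\<in>fsupp D. ent D k j = 0" by (simp add: sum_nonneg_eq_0_iff)
    then show "ent D i j = ent 0 i j" using ent_outside[of i D j] by auto
  qed
qed

lemma fId_mult: "finite J \<Longrightarrow> finite J' \<Longrightarrow> fId J * fId J' = fId (J \<inter> J')"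
  by (rule fmat_eqI) (auto simp: fId_times ent_fId)

lemma fproj_fId: "finite J \<Longrightarrow> fproj (fId J)"
  by (simp add: fproj_def fId_mult)

lemma fproj_pythagoras:
  assumes "fproj P"
  shows "(norm A)\<^sup>2 = (norm (P * A))\<^sup>2 + (norm (A - P * A))\<^sup>2"
proof -
  have tr: "ftr P = P" and PP: "P * P = P" using assms by (auto simp: fproj_def)
  have PP': "P * (P * B) = P * B" for B by (simp only: mult.assoc[symmetric] PP)
  have "inner (P * A) (P * A) = inner A (P * A)" by (simp add: inner_mult_left tr PP')
  then show ?thesis
    by (simp add: power2_norm_eq_inner inner_diff_left inner_diff_right inner_commute)
qed

lemma fproj_ftr_right:
  assumes "fproj P"
  shows "norm (A * P) = norm (P * ftr A)" "norm (A - A * P) = norm (ftr A - P * ftr A)"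
  using norm_ftr[of "A * P"] norm_ftr[of "A - A * P"] assms by (simp_all add: fproj_def)

lemma fproj_pythagoras_right:
  assumes "fproj P"
  shows "(norm A)\<^sup>2 = (norm (A * P))\<^sup>2 + (norm (A - A * P))\<^sup>2"
  using fproj_pythagoras[OF assms, of "ftr A"] by (simp add: fproj_ftr_right[OF assms])

lemma fproj_contract:
  assumes "fproj P"
  shows "norm (P * A) \<le> norm A" "norm (A - P * A) \<le> norm A" "norm (A * P) \<le> norm A" "norm (A - A * P) \<le> norm A"
proof -
  have *: "norm (P * A) \<le> norm A" "norm (A - P * A) \<le> norm A" for A
    by (rule power2_le_imp_le; use fproj_pythagoras[OF assms, of A] in simp)+
  show "norm (P * A) \<le> norm A" "norm (A - P * A) \<le> norm A" "norm (A * P) \<le> norm A" "norm (A - A * P) \<le> norm A"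
    using *[of A] *[of "ftr A"] by (simp_all add: fproj_ftr_right[OF assms])
qed

lemma fisoD:
  assumes "fiso U J"
  shows "finite J" "ftr U * U = fId J" "ftr U * (U * A) = fId J * A"
proof -
  show "finite J" "ftr U * U = fId J" using assms by (auto simp: fiso_def)
  then show "ftr U * (U * A) = fId J * A" by (simp only: mult.assoc[symmetric])
qed

text \<open>The Gram matrix of the difference \<open>U * fId J - U\<close> vanishes.\<close>

lemma fiso_fId:
  assumes "fiso U J"
  shows "U * fId J = U" "fId J * ftr U = ftr U"
proof -
  note J = fisoD[OF assms]
  have I: "fId J * fId J = fId J" "fId J * (fId J * A) = fId J * A" for A
    using fId_mult[OF J(1,1)] by (simp_all only: Int_absorb mult.assoc[symmetric])
  have "ftr (U * fId J - U) * (U * fId J - U) = 0"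
    by (simp add: right_diff_distrib left_diff_distrib mult.assoc J I)
  then have "U * fId J - U = 0" by (rule ftr_mult_eq_0)
  then show 1: "U * fId J = U" by simp
  show "fId J * ftr U = ftr U" using arg_cong[OF 1, of ftr] by simp
qed

lemma fiso_fproj:
  assumes "fiso U J"
  shows "fproj (U * ftr U)"
  unfolding fproj_def
  by (simp add: mult.assoc fisoD[OF assms]) (simp only: fiso_fId[OF assms])

lemma fiso_proj_self:
  assumes "fiso U J"
  shows "U * ftr U * U = U"
  by (simp add: mult.assoc fisoD[OF assms] fiso_fId[OF assms])

lemma fiso_norm:
  assumes "fiso U J"
  shows "norm (U * A) = norm (fId J * A)"
proof -
  have "inner (U * A) (U * A) = inner (fId J * A) (fId J * A)"
    using fproj_fId[OF fisoD(1)[OF assms]]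
    by (simp add: inner_mult_left fisoD[OF assms] fproj_def) (simp add: mult.assoc[symmetric])
  then show ?thesis by (simp add: norm_eq_sqrt_inner)
qed

lemma fiso_contract:
  assumes "fiso U J"
  shows "norm (U * A) \<le> norm A" "norm (ftr U * A) \<le> norm A" "norm (A * U) \<le> norm A" "norm (A * ftr U) \<le> norm A"
proof -
  have op: "fop_le U 1"
    unfolding fop_le_def fiso_norm[OF assms]
    using fproj_contract(1)[OF fproj_fId[OF fisoD(1)[OF assms]]] by simp
  show "norm (U * A) \<le> norm A" "norm (ftr U * A) \<le> norm A" "norm (A * U) \<le> norm A" "norm (A * ftr U) \<le> norm A"
    using fop_leD[OF op, of A] fop_leD[OF fop_le_ftr[OF op], of A] fop_le_right[OF op, of A]
      fop_le_right[OF fop_le_ftr[OF op], of A] by simp_all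
qed

lemma fiso_norm_ftr:
  assumes "fiso U J"
  shows "norm (A * ftr U) = norm (A * fId J)"
  using fiso_norm[OF assms, of "ftr A"] norm_ftr[of "A * ftr U"] norm_ftr[of "A * fId J"] by simp

section \<open>Diagonal matrices and reduced singular value decompositions\<close>

lemma fdiag_times: "finite J \<Longrightarrow> ent (fdiag J s * A) i j = (if i \<in> J then s i * ent A i j else 0)"
  unfolding fdiag_def sum_distrib_right by (simp add: if_distrib[of "(*) _"] cong: if_cong)

lemma times_fdiag: "finite J \<Longrightarrow> ent (A * fdiag J s) i j = (if j \<in> J then s j * ent A i j else 0)"
  unfolding fdiag_def sum_distrib_left by (simp add: if_distrib[of "(*) _"] cong: if_cong)

lemma ent_fdiag [simp]: "finite J \<Longrightarrow> ent (fdiag J s) i j = (if i = j \<and> i \<in> J then s i else 0)"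
  unfolding fdiag_def by (cases "i = j") (auto simp: if_distrib[of "(*) _"] cong: if_cong intro: sum.neutral)

lemma ftr_fdiag [simp]: "ftr (fdiag J s) = fdiag J s"
  unfolding fdiag_def by simp

lemma fdiag_fId: "finite J \<Longrightarrow> fdiag J s * fId J = fdiag J s" "finite J \<Longrightarrow> fId J * fdiag J s = fdiag J s"
  by (rule fmat_eqI; auto simp: times_fId fId_times)+

lemma norm_mono_ent:
  assumes "\<And>i j. \<bar>ent A i j\<bar> \<le> \<bar>ent B i j\<bar>"
  shows "norm A \<le> norm (B :: 'a fmat)"
proof (rule power2_le_imp_le)
  obtain K where K: "finite K" "fsupp A \<subseteq> K" "fsupp B \<subseteq> K"
    by (rule that[of "fsupp A \<union> fsupp B"]) auto
  show "(norm A)\<^sup>2 \<le> (norm B)\<^sup>2"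
    unfolding norm_fmat_sum[OF K(1,2)] norm_fmat_sum[OF K(1,3)]
    by (intro sum_mono) (use assms in \<open>simp add: abs_le_square_iff\<close>)
qed simp

lemma fdiag_lower:
  assumes "finite J" "\<forall>j\<in>J. \<sigma> \<le> s j" "0 \<le> \<sigma>"
  shows "\<sigma> * norm (A * fId J) \<le> norm (A * fdiag J s)" "\<sigma> * norm (fId J * A) \<le> norm (fdiag J s * A)"
proof -
  have abs: "\<sigma> \<le> \<bar>s j\<bar>" if "j \<in> J" for j using assms(2) that by fastforce
  have "norm (\<sigma> *\<^sub>R (A * fId J)) \<le> norm (A * fdiag J s)"
    using assms(1,3) abs by (intro norm_mono_ent) (auto simp: times_fId times_fdiag abs_mult intro!: mult_right_mono)
  then show "\<sigma> * norm (A * fId J) \<le> norm (A * fdiag J s)" using assms(3) by simp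
  have "norm (\<sigma> *\<^sub>R (fId J * A)) \<le> norm (fdiag J s * A)"
    using assms(1,3) abs by (intro norm_mono_ent) (auto simp: fId_times fdiag_times abs_mult intro!: mult_right_mono)
  then show "\<sigma> * norm (fId J * A) \<le> norm (fdiag J s * A)" using assms(3) by simp
qed

lemma fdiag_upper:
  assumes "finite J" "\<forall>j\<in>J. \<bar>s j\<bar> \<le> \<sigma>" "0 \<le> \<sigma>"
  shows "norm (A * fdiag J s) \<le> \<sigma> * norm A" "norm (fdiag J s * A) \<le> \<sigma> * norm A"
proof -
  have "norm (A * fdiag J s) \<le> norm (\<sigma> *\<^sub>R A)"
    using assms by (intro norm_mono_ent) (auto simp: times_fdiag abs_mult intro!: mult_right_mono)
  then show "norm (A * fdiag J s) \<le> \<sigma> * norm A" using assms(3) by simp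
  have "norm (fdiag J s * A) \<le> norm (\<sigma> *\<^sub>R A)"
    using assms by (intro norm_mono_ent) (auto simp: fdiag_times abs_mult intro!: mult_right_mono)
  then show "norm (fdiag J s * A) \<le> \<sigma> * norm A" using assms(3) by simp
qed

text \<open>The reduced form: only positive singular values, in no prescribed order, and one index
  set for both factors. Two matrices of equal rank can thus share \<open>J\<close>, which makes the
  comparison of their singular values a counting argument.\<close>

definition fsvd :: "'a fmat \<Rightarrow> 'a fmat \<Rightarrow> ('a \<Rightarrow> real) \<Rightarrow> 'a fmat \<Rightarrow> 'a set \<Rightarrow> bool" where
  "fsvd X U s V J \<longleftrightarrow> fiso U J \<and> fiso V J \<and> (\<forall>j\<in>J. s j > 0) \<and> X = U * fdiag J s * ftr V"

lemma fsvdD: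
  assumes "fsvd X U s V J"
  shows "fiso U J" "fiso V J" "\<And>j. j \<in> J \<Longrightarrow> s j > 0" "X = U * fdiag J s * ftr V" "finite J"
  using assms by (auto simp: fsvd_def fiso_def)

lemma fsvd_ftr: "fsvd X U s V J \<Longrightarrow> fsvd (ftr X) V s U J"
  by (auto simp: fsvd_def mult.assoc)

lemma fsvd_proj:
  assumes "fsvd X U s V J"
  shows "U * ftr U * X = X" "X * (V * ftr V) = X"
proof -
  note D = fsvdD[OF assms]
  have "U * ftr U * X = (U * ftr U * U) * fdiag J s * ftr V" "X * (V * ftr V) = U * fdiag J s * ftr (V * ftr V * V)"
    by (simp_all add: D(4) mult.assoc)
  then show "U * ftr U * X = X" "X * (V * ftr V) = X"
    unfolding fiso_proj_self[OF D(1)] fiso_proj_self[OF D(2)] by (simp_all only: D(4))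
qed

lemma fsvd_lower:
  assumes "fsvd X U s V J" "\<forall>j\<in>J. \<sigma> \<le> s j" "0 \<le> \<sigma>"
  shows "B * fId J = B \<Longrightarrow> \<sigma> * norm B \<le> norm (B * fdiag J s * ftr V)"
proof -
  assume B: "B * fId J = B"
  note D = fsvdD[OF assms(1)]
  have "norm (B * fdiag J s * ftr V) = norm (B * fdiag J s)"
    unfolding fiso_norm_ftr[OF D(2)] by (simp add: mult.assoc fdiag_fId[OF D(5)])
  then show ?thesis using fdiag_lower(1)[OF D(5) assms(2,3), where A = B] B by simp
qed

text \<open>A bound of Wedin type. As \<open>P\<close> fixes \<open>Z\<close>, the matrix
  \<open>(U - P * U) * fdiag J s * ftr V\<close> is the part of \<open>X - Z\<close> orthogonal to
  the range of \<open>P\<close>, and multiplication by the last two factors stretches by at least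
  \<open>\<sigma>\<close>.\<close>

lemma left_space_gap:
  assumes "fsvd X U s V J" "\<forall>j\<in>J. \<sigma> \<le> s j" "0 \<le> \<sigma>" "fproj P" "P * Z = Z"
  shows "\<sigma> * norm (U - P * U) \<le> norm (X - Z)"
proof -
  note D = fsvdD[OF assms(1)]
  have "(U - P * U) * fId J = U - P * U"
    by (simp add: left_diff_distrib mult.assoc fiso_fId[OF D(1)])
  then have "\<sigma> * norm (U - P * U) \<le> norm ((U - P * U) * fdiag J s * ftr V)"
    by (rule fsvd_lower[OF assms(1-3)])
  also have "(U - P * U) * fdiag J s * ftr V = (X - Z) - P * (X - Z)"
    by (simp add: left_diff_distrib right_diff_distrib mult.assoc D(4) assms(5))
  also have "norm ... \<le> norm (X - Z)" by (rule fproj_contract[OF assms(4)])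
  finally show ?thesis .
qed

lemma right_space_gap:
  assumes "fsvd X U s V J" "\<forall>j\<in>J. \<sigma> \<le> s j" "0 \<le> \<sigma>" "fproj Q" "Z * Q = Z"
  shows "\<sigma> * norm (V - Q * V) \<le> norm (X - Z)"
proof -
  have "Q * ftr Z = ftr Z" using arg_cong[OF assms(5), of ftr] assms(4) by (simp add: fproj_def)
  from left_space_gap[OF fsvd_ftr[OF assms(1)] assms(2,3,4) this]
  show ?thesis using norm_ftr[of "X - Z"] by simp
qed

section \<open>Tangent projections\<close>

definition ftan :: "'a fmat \<Rightarrow> 'a fmat \<Rightarrow> 'a fmat \<Rightarrow> 'a fmat" where
  "ftan P Q A = P * A + A * Q - P * A * Q"

lemma ftan_linear: "linear (ftan P Q)"
  unfolding ftan_def by (intro linearI) (simp_all add: algebra_simps)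

lemma ftan_ident:
  assumes "fproj P" "fproj Q"
  shows "ftan P Q (ftan P Q A) = ftan P Q A" "inner (ftan P Q A) B = inner A (ftan P Q B)"
    "ftan P Q A = P * A + (A - P * A) * Q"
    "A - ftan P Q A = (A - P * A) - (A - P * A) * Q"
proof -
  have P: "ftr P = P" "P * P = P" "P * (P * C) = P * C" and Q: "ftr Q = Q" "Q * Q = Q" "Q * (Q * C) = Q * C" for C
    using assms by (auto simp: fproj_def mult.assoc[symmetric])
  show "ftan P Q (ftan P Q A) = ftan P Q A"
    unfolding ftan_def by (simp add: algebra_simps P Q)
  show "inner (ftan P Q A) B = inner A (ftan P Q B)"
    unfolding ftan_def inner_diff_left inner_diff_right inner_add_left inner_add_right
    by (simp add: inner_mult_left[of P A] inner_mult_right[of A Q] inner_mult_left[of "P" "A * Q"] P Q mult.assoc)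
  show "ftan P Q A = P * A + (A - P * A) * Q" "A - ftan P Q A = (A - P * A) - (A - P * A) * Q"
    unfolding ftan_def by (simp_all add: algebra_simps)
qed

text \<open>\<open>ftan P Q A\<close> is the orthogonal sum of \<open>P * A\<close> and the part of
  \<open>A * Q\<close> annihilated by \<open>P\<close>.\<close>

lemma ftan_pythagoras:
  assumes "fproj P" "fproj Q"
  shows "(norm (ftan P Q A))\<^sup>2 \<le> (norm (P * A))\<^sup>2 + (norm (A * Q))\<^sup>2"
proof -
  have P: "P * P = P" "P * (P * C) = P * C" "ftr P = P" for C using assms by (auto simp: fproj_def mult.assoc[symmetric])
  have "P * ftan P Q A = P * A" "ftan P Q A - P * ftan P Q A = A * Q - P * (A * Q)"
    unfolding ftan_def by (simp_all add: algebra_simps P)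
  then have "(norm (ftan P Q A))\<^sup>2 = (norm (P * A))\<^sup>2 + (norm (A * Q - P * (A * Q)))\<^sup>2"
    using fproj_pythagoras[OF assms(1), of "ftan P Q A"] by simp
  also have "... \<le> (norm (P * A))\<^sup>2 + (norm (A * Q))\<^sup>2"
    by (intro add_left_mono power_mono fproj_contract assms) auto
  finally show ?thesis .
qed

lemma ftan_contract:
  assumes "fproj P" "fproj Q"
  shows "norm (ftan P Q A) \<le> norm A" "norm (A - ftan P Q A) \<le> norm A"
proof -
  have "(norm (A - ftan P Q A)) \<le> norm (A - P * A)"
    unfolding ftan_ident(4)[OF assms] by (rule fproj_contract[OF assms(2)])
  also have "... \<le> norm A" by (rule fproj_contract[OF assms(1)])
  finally show "norm (A - ftan P Q A) \<le> norm A" .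
  have "(norm (ftan P Q A))\<^sup>2 = inner A (ftan P Q A)"
    using ftan_ident(1,2)[OF assms] by (metis power2_norm_eq_inner)
  also have "... \<le> norm A * norm (ftan P Q A)" by (rule norm_cauchy_schwarz)
  finally show "norm (ftan P Q A) \<le> norm A"
    by (cases "ftan P Q A = 0") (auto simp: power2_eq_square)
qed

text \<open>The left-hand side is the norm of \<open>(1 - P) X (1 - Q)\<close>, to which both projections contribute a factor of
  order \<open>X - Z\<close>.\<close>

lemma tangent_curvature:
  assumes X: "fsvd X U s V J" "\<forall>j\<in>J. \<sigma> \<le> s j" "0 < \<sigma>"
    and P: "fproj P" "P * Z = Z" and Q: "fproj Q" "Z * Q = Z"
  shows "norm (X - ftan P Q X) \<le> (norm (X - Z))\<^sup>2 / \<sigma>"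
proof -
  note D = fsvdD[OF X(1)]
  let ?B = "U - P * U"
  have XU: "U * (ftr U * X) = X" using fsvd_proj(1)[OF X(1)] by (simp add: mult.assoc)
  have 1: "X - P * X = ?B * (ftr U * X)"
    by (simp add: left_diff_distrib mult.assoc XU)
  have "X - ftan P Q X = ?B * (ftr U * (X - X * Q))"
    unfolding ftan_ident(4)[OF P(1) Q(1)] 1 by (simp add: right_diff_distrib mult.assoc)
  also have "X - X * Q = (X - Z) - (X - Z) * Q" by (simp add: left_diff_distrib Q)
  finally have "norm (X - ftan P Q X) \<le> norm ?B * norm (ftr U * ((X - Z) - (X - Z) * Q))"
    by (simp add: norm_mult_fmat)
  also have "... \<le> norm ?B * norm (X - Z)"
    by (intro mult_left_mono order_trans[OF fiso_contract(2)[OF D(1)]] fproj_contract Q) auto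
  also have "... \<le> (norm (X - Z) / \<sigma>) * norm (X - Z)"
    using left_space_gap[OF X(1,2) _ P] X(3)
    by (intro mult_right_mono) (auto simp: field_simps)
  finally show ?thesis by (simp add: power2_eq_square)
qed

text \<open>A tangent vector at \<open>Z\<close> is a sum of two terms, one with \<open>U\<close> on
  its left and one with \<open>ftr V\<close> on its right. The normal projection at \<open>X\<close>
  acts on these factors as \<open>U - P * U\<close> and \<open>V - Q * V\<close>, which the space
  gaps control; hence the factor \<open>2\<close>.\<close>

lemma tangent_tilt:
  assumes Z: "fsvd Z U s V J" "\<forall>j\<in>J. \<sigma> \<le> s j" "0 < \<sigma>"
    and P: "fproj P" "P * X = X" and Q: "fproj Q" "X * Q = X"
    and A: "ftan (U * ftr U) (V * ftr V) A = A"
  shows "norm (A - ftan P Q A) \<le> 2 * norm (Z - X) / \<sigma> * norm A"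
proof -
  note D = fsvdD[OF Z(1)]
  let ?P = "U * ftr U" and ?Q = "V * ftr V"
  let ?N = "\<lambda>A. (A - P * A) - (A - P * A) * Q"
  have pr: "fproj ?P" "fproj ?Q" using D by (auto intro: fiso_fproj)
  have A': "A = ?P * A + (A - ?P * A) * ?Q" using A ftan_ident(3)[OF pr, of A] by simp
  have e: "?N A = ?N (?P * A) + ?N ((A - ?P * A) * ?Q)"
    by (subst (1 2 3 4) A') (simp add: algebra_simps)
  have n1: "norm (?N (?P * A)) \<le> norm (Z - X) / \<sigma> * norm A"
  proof -
    have "?N (?P * A) = (U - P * U) * (ftr U * A) - (U - P * U) * (ftr U * A) * Q"
      by (simp add: algebra_simps)
    also have "norm ... \<le> norm ((U - P * U) * (ftr U * A))" by (rule fproj_contract[OF Q(1)])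
    also have "... \<le> norm (U - P * U) * norm (ftr U * A)" by (rule norm_mult_fmat)
    also have "... \<le> (norm (Z - X) / \<sigma>) * norm A"
      using left_space_gap[OF Z(1,2) _ P] Z(3) fiso_contract(2)[OF D(1), of A]
      by (intro mult_mono) (auto simp: field_simps)
    finally show ?thesis .
  qed
  have n2: "norm (?N ((A - ?P * A) * ?Q)) \<le> norm (Z - X) / \<sigma> * norm A"
  proof -
    let ?C = "(A - ?P * A) * V"
    have QT: "ftr Q = Q" using Q by (simp add: fproj_def)
    have "?N ((A - ?P * A) * ?Q) = ?C * ftr (V - Q * V) - P * (?C * ftr (V - Q * V))"
      by (simp add: algebra_simps QT)
    also have "norm ... \<le> norm (?C * ftr (V - Q * V))" by (rule fproj_contract[OF P(1)])
    also have "... \<le> norm ?C * norm (ftr (V - Q * V))" by (rule norm_mult_fmat)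
    also have "... \<le> norm A * (norm (Z - X) / \<sigma>)"
    proof (rule mult_mono)
      show "norm ?C \<le> norm A"
        using fiso_contract(3)[OF D(2)] fproj_contract(2)[OF pr(1), of A] order_trans by blast
      show "norm (ftr (V - Q * V)) \<le> norm (Z - X) / \<sigma>"
        unfolding norm_ftr using right_space_gap[OF Z(1,2) _ Q] Z(3) by (simp add: field_simps)
    qed auto
    finally show ?thesis by (simp add: mult.commute)
  qed
  have "norm (?N A) \<le> norm (Z - X) / \<sigma> * norm A + norm (Z - X) / \<sigma> * norm A"
    unfolding e by (rule order_trans[OF norm_triangle_ineq add_mono[OF n1 n2]])
  then show ?thesis unfolding ftan_ident(4)[OF P(1) Q(1)] by (simp add: field_simps)
qed

section \<open>Perturbation of singular values and best approximation\<close>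

lemma underdetermined_columns:
  assumes "finite J" "finite B" "card B < card J"
  shows "\<exists>y. y \<noteq> 0 \<and> fId J * y = y \<and> y * fE z z = y \<and> (\<forall>b\<in>B. ent (M * y) b z = 0)"
proof -
  obtain h where h: "bij_betw h {..<card B} B"
    using ex_bij_betw_nat_finite[OF assms(2)] by (auto simp: lessThan_atLeast0)
  obtain x where x: "\<exists>i\<in>J. x i \<noteq> 0" "\<forall>b<card B. (\<Sum>i\<in>J. ent M (h b) i * x i) = 0"
    using underdetermined_system[OF assms(1,3), of "\<lambda>b i. ent M (h b) i"] by blast
  define y where "y = (\<Sum>i\<in>J. x i *\<^sub>R fE i z)"
  have ent_y: "ent y i j = (if i \<in> J \<and> j = z then x i else 0)" for i j
    unfolding y_def using assms(1) by (cases "j = z") (auto simp: if_distrib[of "(*) _"] cong: if_cong)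
  have "y \<noteq> 0" using x(1) ent_y by (metis ent_simps(1))
  moreover have "fId J * y = y" by (rule fmat_eqI) (simp add: fId_times assms ent_y)
  moreover have "y * fE z z = y" by (rule fmat_eqI) (simp add: ent_y)
  moreover have "ent (M * y) b z = 0" if b: "b \<in> B" for b
  proof -
    obtain k where k: "k < card B" "b = h k" using h b by (auto simp: bij_betw_def)
    have "ent (M * y) b z = (\<Sum>i\<in>J. ent M b i * ent y i z)"
      by (rule ent_times) (use assms in \<open>auto simp: ent_y split: if_splits\<close>)
    then show ?thesis using x(2) k by (simp add: ent_y)
  qed
  ultimately show ?thesis by blast
qed

text \<open>A dimension count, as for Weyl's inequality: some combination of the right singular vectors of \<open>X\<close> in
  \<open>I\<close> is orthogonal to those of \<open>Z\<close> with singular values above \<open>b\<close>.\<close>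

lemma weyl_count:
  assumes X: "fsvd X U s V J" and Z: "fsvd Z U' s' V' J'" and I: "I \<subseteq> J" "\<forall>j\<in>I. a \<le> s j" "0 \<le> a"
    and card: "card {j \<in> J'. b < s' j} < card I" and b: "0 \<le> b" and op: "fop_le (X - Z) \<epsilon>"
  shows "a \<le> b + \<epsilon>"
proof -
  note D = fsvdD[OF X] and D' = fsvdD[OF Z]
  have fin: "finite I" using I(1) D(5) by (rule finite_subset)
  let ?B = "{j \<in> J'. b < s' j}" and ?M = "ftr V' * V"
  obtain y where y: "y \<noteq> 0" "fId I * y = y" "y * fE undefined undefined = y" "\<forall>j\<in>?B. ent (?M * y) j undefined = 0"
    using underdetermined_columns[of I ?B undefined ?M] fin card D'(5) by auto
  let ?x = "V * y" and ?t = "ftr V' * (V * y)"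
  have yJ: "fId J * y = y"
    by (subst y(2)[symmetric], subst (2) y(2)[symmetric])
      (simp only: mult.assoc[symmetric] fId_mult[OF D(5) fin], simp add: Int_absorb1 I)
  have nx: "norm ?x = norm y" using fiso_norm[OF D(2), of y] yJ by simp
  have t0: "ent ?t j q = 0" if "j \<in> ?B" for j q
  proof -
    have "ent ?t j q = (if q = undefined then ent ?t j undefined else 0)"
      by (subst y(3)[symmetric]) (simp only: mult.assoc[symmetric] ent_times_fE)
    then show ?thesis using y(4) that by (simp add: mult.assoc)
  qed
  have "norm (Z * ?x) \<le> norm (fdiag J' s' * ?t)"
    unfolding D'(4) mult.assoc by (rule fiso_contract(1)[OF D'(1)])
  \<comment> \<open>The coordinates of \<open>?t\<close> at the singular values above
    \<open>b\<close> vanish, so these values may be replaced by \<open>0\<close>.\<close>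
  also have "fdiag J' s' * ?t = fdiag J' (\<lambda>j. if b < s' j then 0 else s' j) * ?t"
    by (rule fmat_eqI) (use t0 in \<open>auto simp: fdiag_times D'(5)\<close>)
  also have "norm ... \<le> b * norm ?t"
    by (rule fdiag_upper(2)[OF D'(5) _ b]) (use D'(3) b in \<open>auto simp: less_imp_le abs_of_pos\<close>)
  also have "... \<le> b * norm y" using fiso_contract(2)[OF D'(2), of ?x] nx b by (intro mult_left_mono) auto
  finally have Zx: "norm (Z * ?x) \<le> b * norm y" .
  have "fdiag J s * y = fdiag I s * y"
    by (subst (1 2) y(2)[symmetric], rule fmat_eqI) (use I(1) in \<open>auto simp: fdiag_times fId_times D(5) fin\<close>)
  then have "a * norm y \<le> norm (fdiag J s * y)" using fdiag_lower(2)[OF fin I(2,3), of y] y(2) by simp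
  also have "... = norm (X * ?x)"
  proof -
    have "X * ?x = U * (fdiag J s * y)" by (simp add: D(4) mult.assoc fisoD[OF D(2)] yJ)
    moreover have "fId J * (fdiag J s * y) = fdiag J s * y" by (simp only: mult.assoc[symmetric] fdiag_fId[OF D(5)])
    ultimately show ?thesis by (simp add: fiso_norm[OF D(1)])
  qed
  also have "... \<le> norm (Z * ?x) + norm ((X - Z) * ?x)"
    using norm_triangle_ineq[of "Z * ?x" "(X - Z) * ?x"] by (simp add: left_diff_distrib)
  also have "... \<le> (b + \<epsilon>) * norm y" using Zx fop_leD[OF op, of ?x] nx by (simp add: distrib_right)
  finally show ?thesis using y(1) by simp
qed

text \<open>Fewer than \<open>card J\<close> singular values of \<open>Z\<close> exceed
  \<open>s j\<close>, while all of those of \<open>X\<close> are at least \<open>\<sigma>\<close>;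
  this is \<open>weyl_count\<close> with threshold \<open>s j\<close>.\<close>

lemma singular_value_perturb:
  assumes Z: "fsvd Z U s V J" and X: "fsvd X U' s' V' J" "\<forall>j\<in>J. \<sigma> \<le> s' j" "0 \<le> \<sigma>" and j: "j \<in> J"
  shows "\<sigma> - norm (Z - X) \<le> s j"
proof -
  have "card {i \<in> J. s j < s i} < card J" using fsvdD(5)[OF Z] j by (intro psubset_card_mono) auto
  from weyl_count[OF X(1) Z order_refl X(2,3) this less_imp_le[OF fsvdD(3)[OF Z j]] fop_le_norm]
  show ?thesis by (simp add: norm_minus_commute)
qed

text \<open>Vectors are matrices supported in one fixed column \<open>z\<close>. Moving the
  \<open>j\<close>-th column of \<open>A\<close> there preserves its norm.\<close>

lemma norm_columns:
  assumes "finite K" "A * fId K = A"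
  shows "(norm A)\<^sup>2 = (\<Sum>j\<in>K. (norm (A * fE j z))\<^sup>2)"
proof -
  have "(\<Sum>j\<in>K. (norm (A * fE j z))\<^sup>2) = (\<Sum>j\<in>K. inner A (A * fE j j))"
    by (rule sum.cong) (simp_all add: power2_norm_eq_inner inner_mult_right mult.assoc fE_mult)
  also have "... = inner A (A * fId K)"
    unfolding fId_def by (simp add: inner_sum_right sum_distrib_left)
  finally show ?thesis using assms(2) by (simp add: power2_norm_eq_inner)
qed

lemma fop_leI_columns:
  assumes c: "0 \<le> c" and B: "\<And>x. x * fE z z = x \<Longrightarrow> norm (B * x) \<le> c * norm x"
  shows "fop_le B c"
  unfolding fop_le_def
proof
  fix x :: "'a fmat"
  let ?K = "fsupp x"
  have K: "x * fId ?K = x" by (rule fmat_eqI) (simp add: times_fId ent_outside)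
  have "(norm (B * x))\<^sup>2 = (\<Sum>j\<in>?K. (norm (B * x * fE j z))\<^sup>2)"
    by (rule norm_columns) (simp_all add: mult.assoc K)
  also have "... \<le> (\<Sum>j\<in>?K. (c * norm (x * fE j z))\<^sup>2)"
    unfolding mult.assoc by (intro sum_mono power_mono B) (simp_all add: mult.assoc fE_mult)
  also have "... = (c * norm x)\<^sup>2"
    by (simp add: power_mult_distrib sum_distrib_left[symmetric] norm_columns[OF _ K, of z])
  finally show "norm (B * x) \<le> c * norm x" by (rule power2_le_imp_le) (use c in simp)
qed

text \<open>The extremal principle behind Ky Fan's inequality: weights in \<open>[0, 1]\<close> with
  total mass at most \<open>card J1\<close> are best spent on the indices with the largest
  \<open>a\<close>. The strict separation by \<open>\<tau>\<close> forces the indicator of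
  \<open>J1\<close> in the case of equality.\<close>

lemma weighted_sum_le_top:
  fixes a w :: "'a \<Rightarrow> real"
  assumes J: "finite J" "J1 \<subseteq> J" and w: "\<And>j. j \<in> J \<Longrightarrow> 0 \<le> w j \<and> w j \<le> 1"
    and sw: "(\<Sum>j\<in>J. w j) \<le> real (card J1)" and \<tau>: "0 < \<tau>"
    and a: "\<And>j. j \<in> J1 \<Longrightarrow> \<tau> < a j" "\<And>j. j \<in> J - J1 \<Longrightarrow> a j \<le> \<tau>"
  shows "(\<Sum>j\<in>J. a j * w j) \<le> (\<Sum>j\<in>J1. a j)"
    "(\<Sum>j\<in>J. a j * w j) = (\<Sum>j\<in>J1. a j) \<Longrightarrow> j \<in> J \<Longrightarrow> w j = (if j \<in> J1 then 1 else 0)"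
proof -
  have fin: "finite J1" using J finite_subset by blast
  have split: "(\<Sum>j\<in>J. f j) = (\<Sum>j\<in>J1. f j) + (\<Sum>j\<in>J - J1. f j)" for f :: "'a \<Rightarrow> real"
    by (metis J sum.subset_diff add.commute)
  have sw': "(\<Sum>j\<in>J - J1. w j) \<le> (\<Sum>j\<in>J1. 1 - w j)"
    using sw unfolding split[of w] by (simp add: sum_subtractf)
  have off: "(\<Sum>j\<in>J - J1. a j * w j) \<le> \<tau> * (\<Sum>j\<in>J - J1. w j)"
    unfolding sum_distrib_left by (intro sum_mono mult_right_mono a(2)) (use w in auto)
  have pos: "0 \<le> (a j - \<tau>) * (1 - w j)" if "j \<in> J1" for j
    using a(1)[OF that] w[of j] J that by (intro mult_nonneg_nonneg) auto
  have "(\<Sum>j\<in>J. a j * w j) \<le> (\<Sum>j\<in>J1. a j * w j) + \<tau> * (\<Sum>j\<in>J - J1. w j)"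
    unfolding split[of "\<lambda>j. a j * w j"] using off by simp
  also have "... = (\<Sum>j\<in>J1. a j) - (\<Sum>j\<in>J1. (a j - \<tau>) * (1 - w j)) - \<tau> * ((\<Sum>j\<in>J1. 1 - w j) - (\<Sum>j\<in>J - J1. w j))"
    by (simp add: sum_subtractf sum_distrib_left algebra_simps sum.distrib)
  finally have main: "(\<Sum>j\<in>J. a j * w j) + (\<Sum>j\<in>J1. (a j - \<tau>) * (1 - w j)) + \<tau> * ((\<Sum>j\<in>J1. 1 - w j) - (\<Sum>j\<in>J - J1. w j)) \<le> (\<Sum>j\<in>J1. a j)"
    by simp
  have n1: "0 \<le> (\<Sum>j\<in>J1. (a j - \<tau>) * (1 - w j))" by (rule sum_nonneg) (rule pos)
  have n2: "0 \<le> \<tau> * ((\<Sum>j\<in>J1. 1 - w j) - (\<Sum>j\<in>J - J1. w j))" using sw' \<tau> by simp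
  show "(\<Sum>j\<in>J. a j * w j) \<le> (\<Sum>j\<in>J1. a j)" using main n1 n2 by linarith
  assume eq: "(\<Sum>j\<in>J. a j * w j) = (\<Sum>j\<in>J1. a j)" and j: "j \<in> J"
  have z1: "(\<Sum>j\<in>J1. (a j - \<tau>) * (1 - w j)) = 0" using main n1 n2 eq by linarith
  have z1': "w j = 1" if "j \<in> J1" for j
    using z1 sum_nonneg_eq_0_iff[OF fin pos] that a(1)[OF that] by auto
  have "\<tau> * ((\<Sum>j\<in>J1. 1 - w j) - (\<Sum>j\<in>J - J1. w j)) = 0" using main n1 n2 eq by linarith
  then have "(\<Sum>j\<in>J - J1. w j) = 0" using \<tau> z1' by simp
  then have "w j = 0" if "j \<in> J - J1" for j
    using sum_nonneg_eq_0_iff[of "J - J1" w] that w J(1) by auto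
  then show "w j = (if j \<in> J1 then 1 else 0)" using z1' j by auto
qed

lemma fdiag_norm_col:
  assumes "finite J"
  shows "fdiag J s * fE j z = (if j \<in> J then s j else 0) *\<^sub>R fE j z"
  by (rule fmat_eqI) (use assms in auto)

lemma norm_fE [simp]: "norm (fE i j) = 1"
  by (simp add: norm_eq_sqrt_inner)

lemma fdiag_strict_lower:
  assumes J: "finite J" and s: "\<forall>j\<in>J. \<tau> < s j" and \<tau>: "0 \<le> \<tau>" and y: "fId J * y = y" "y \<noteq> 0"
  shows "\<tau> * norm y < norm (fdiag J s * y)"
proof -
  have "J \<noteq> {}" using y by (auto simp: fId_def)
  define \<mu> where "\<mu> = Min (s ` J)"
  have "\<mu> \<in> s ` J" unfolding \<mu>_def using J \<open>J \<noteq> {}\<close> by (intro Min_in) auto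
  then have \<mu>: "\<tau> < \<mu>" using s by auto
  have "\<mu> * norm (fId J * y) \<le> norm (fdiag J s * y)"
    by (rule fdiag_lower(2)[OF J]) (use J \<mu> \<tau> in \<open>auto simp: \<mu>_def\<close>)
  moreover have "\<tau> * norm y < \<mu> * norm y" using \<mu> y by simp
  ultimately show ?thesis unfolding y(1) by linarith
qed

lemma fsvd_restrict:
  assumes "fsvd W U s V J" "J1 \<subseteq> J"
  shows "fsvd (U * fdiag J1 s * ftr V) (U * fId J1) s (V * fId J1) J1"
proof -
  note D = fsvdD[OF assms(1)]
  have fin: "finite J1" using D(5) assms(2) finite_subset by blast
  have J1: "fId J * fId J1 = fId J1" "fId J1 * fId J1 = fId J1"
    using fId_mult[OF D(5) fin] fId_mult[OF fin fin] assms(2) by (simp_all add: Int_absorb1)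
  have "fiso (A * fId J1) J1" if "fiso A J" for A
    using fin by (simp add: fiso_def mult.assoc fisoD(3)[OF that] J1)
  moreover have "(U * fId J1) * fdiag J1 s * ftr (V * fId J1) = U * (fId J1 * fdiag J1 s * fId J1) * ftr V"
    by (simp add: mult.assoc)
  moreover have "fId J1 * fdiag J1 s * fId J1 = fdiag J1 s"
    by (simp add: fdiag_fId fin)
  ultimately show ?thesis unfolding fsvd_def using D assms(2) by auto
qed

context
  fixes W U V X U' V' :: "'a fmat" and s s' :: "'a \<Rightarrow> real" and J J' :: "'a set" and \<sigma> \<epsilon> :: real
  assumes W: "fsvd W U s V J" and X: "fsvd X U' s' V' J'" and \<sigma>: "\<forall>j\<in>J'. \<sigma> \<le> s' j"
    and op: "fop_le (W - X) \<epsilon>" and gap: "2 * \<epsilon> < \<sigma>" "0 \<le> \<epsilon>"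
begin

text \<open>Two uses of \<open>weyl_count\<close>: the levels \<open>\<sigma> / 2\<close> and
  \<open>0\<close> exclude too many large singular values of \<open>W\<close>, the levels
  \<open>\<sigma>\<close> and \<open>\<sigma> / 2\<close> too few. Both rely on
  \<open>2 * \<epsilon> < \<sigma>\<close>.\<close>

lemma top_card: "card {j \<in> J. \<sigma> / 2 < s j} = card J'"
proof (rule antisym)
  let ?J1 = "{j \<in> J. \<sigma> / 2 < s j}"
  have "{j \<in> J'. 0 < s' j} = J'" using fsvdD(3)[OF X] by auto
  then show "card ?J1 \<le> card J'"
    using weyl_count[OF W X, of ?J1 "\<sigma> / 2" 0, OF _ _ _ _ _ op] gap by (force simp: not_less[symmetric])
  have "fop_le (X - W) \<epsilon>"
    using op norm_minus_commute[of "W * _" "X * _"] unfolding fop_le_def by (simp add: left_diff_distrib)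
  then show "card J' \<le> card ?J1"
    using weyl_count[OF X W order_refl \<sigma>, of "\<sigma> / 2" \<epsilon>] gap by force
qed

text \<open>Eckart-Young with uniqueness. A competitor \<open>Y'\<close> with row space projection
  \<open>?Q\<close> has squared distance \<open>(norm W)\<^sup>2 - (norm (W * ?Q))\<^sup>2 + (norm
  (W * ?Q - Y'))\<^sup>2\<close>, and the middle term is a weighted sum of the squared singular
  values of \<open>W\<close>.\<close>

lemma best_approx_unique:
  assumes Y': "fsvd Y' U'' s'' V'' J''" and card: "card J'' \<le> card J'"
  defines "J1 \<equiv> {j \<in> J. \<sigma> / 2 < s j}"
  defines "Y \<equiv> U * fdiag J1 s * ftr V"
  shows "norm (W - Y) \<le> norm (W - Y')" "norm (W - Y') \<le> norm (W - Y) \<Longrightarrow> Y' = Y"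
proof -
  note D = fsvdD[OF W] and D'' = fsvdD[OF Y']
  have J1: "J1 \<subseteq> J" "finite J1" using D(5) by (auto simp: J1_def)
  let ?Q = "V'' * ftr V''"
  have Q: "fproj ?Q" by (rule fiso_fproj[OF D''(2)])
  have Qs: "ftr ?Q = ?Q" "?Q * ?Q = ?Q" using Q by (auto simp: fproj_def)
  have Y'Q: "Y' * ?Q = Y'" by (rule fsvd_proj[OF Y'])
  \<comment> \<open>The share of the \<open>j\<close>-th right singular vector in the competitor's
    row space; the shares sum to at most the competitor's rank.\<close>
  define w where "w j = (norm (?Q * (V * fE j j)))\<^sup>2" for j
  have nV: "norm (V * fE j j) = (if j \<in> J then 1 else 0)" for j
  proof -
    have "fId J * fE j j = (if j \<in> J then fE j j else 0)" by (rule fmat_eqI) (auto simp: fId_times ent_fId D(5))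
    then show ?thesis using fiso_norm[OF D(2), of "fE j j"] by simp
  qed
  have w01: "0 \<le> w j \<and> w j \<le> 1" if "j \<in> J" for j
    using fproj_contract(1)[OF Q, of "V * fE j j"] nV[of j] that unfolding w_def by (simp add: power_le_one)
  have sumw: "(\<Sum>j\<in>J. w j) \<le> real (card J1)"
  proof -
    have "(\<Sum>j\<in>J. w j) = (norm (?Q * V))\<^sup>2"
    proof -
      have f1: "(norm (?Q * V * fE j j))\<^sup>2 = w j" for j unfolding w_def by (simp add: mult.assoc)
      have f2: "(norm (?Q * V))\<^sup>2 = (\<Sum>j\<in>J. (norm (?Q * V * fE j undefined))\<^sup>2)"
        by (rule norm_columns[OF D(5)]) (simp add: mult.assoc fiso_fId[OF D(2)])
      have f3: "norm (A * fE j undefined) = norm (A * fE j j)" for A j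
        by (simp add: norm_eq_sqrt_inner inner_mult_right mult.assoc fE_mult)
      show ?thesis unfolding f2 by (rule sum.cong) (simp_all only: f3 f1)
    qed
    also have "... \<le> (norm (ftr V''))\<^sup>2"
    proof -
      have "norm (?Q * V) \<le> norm (ftr V'' * V)" unfolding mult.assoc by (rule fiso_contract[OF D''(2)])
      also have "... \<le> norm (ftr V'')" by (rule fiso_contract[OF D(2)])
      finally show ?thesis by (intro power_mono) auto
    qed
    also have "... = real (card J'')"
    proof -
      have "(norm V'')\<^sup>2 = inner V'' (V'' * fId J'')" by (simp add: power2_norm_eq_inner fiso_fId[OF D''(2)])
      also have "... = inner (ftr V'' * V'') (fId J'')" by (metis inner_mult_left inner_commute)
      also have "... = real (card J'')"
        unfolding fisoD(2)[OF D''(2)] by (simp add: fId_def inner_sum_left inner_sum_right) (simp add: fId_def[symmetric] ent_fId D''(5))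
      finally show ?thesis by simp
    qed
    finally show ?thesis using card top_card unfolding J1_def by linarith
  qed
  have nWQ: "(norm (W * ?Q))\<^sup>2 = (\<Sum>j\<in>J. (s j)\<^sup>2 * w j)"
  proof -
    have "W * ?Q = U * (fdiag J s * ftr V * ?Q)" by (simp add: D(4) mult.assoc)
    then have "norm (W * ?Q) = norm (fId J * (fdiag J s * ftr V * ?Q))" by (simp add: fiso_norm[OF D(1)])
    also have "... = norm (fdiag J s * (ftr V * ?Q))"
      by (simp only: mult.assoc[symmetric] fdiag_fId[OF D(5)])
    also have "... = norm (ftr (fdiag J s * (ftr V * ?Q)))" by (rule norm_ftr[symmetric])
    also have "ftr (fdiag J s * (ftr V * ?Q)) = ?Q * V * fdiag J s" by (simp add: mult.assoc)
    finally have "(norm (W * ?Q))\<^sup>2 = (\<Sum>j\<in>J. (norm (?Q * V * fdiag J s * fE j undefined))\<^sup>2)"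
      using norm_columns[OF D(5), of "?Q * V * fdiag J s" undefined] by (simp add: mult.assoc fdiag_fId[OF D(5)])
    also have "... = (\<Sum>j\<in>J. (s j)\<^sup>2 * w j)"
    proof (rule sum.cong[OF refl])
      fix j assume j: "j \<in> J"
      have "?Q * V * fdiag J s * fE j undefined = s j *\<^sub>R (?Q * (V * fE j undefined))"
        using j by (simp add: mult.assoc fdiag_norm_col[OF D(5)])
      moreover have "norm (?Q * (V * fE j undefined)) = norm (?Q * (V * fE j j))"
        by (simp only: mult.assoc[symmetric] norm_eq_sqrt_inner inner_mult_right[of _ "fE j _"])
          (simp add: mult.assoc fE_mult)
      ultimately show "(norm (?Q * V * fdiag J s * fE j undefined))\<^sup>2 = (s j)\<^sup>2 * w j"
        unfolding w_def by (simp add: power_mult_distrib)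
    qed
    finally show ?thesis .
  qed
  have nD: "(norm (U * fdiag I s * ftr V))\<^sup>2 = (\<Sum>j\<in>I. (s j)\<^sup>2)" if I: "I \<subseteq> J" for I
  proof -
    have finI: "finite I" using I D(5) finite_subset by blast
    have "norm (U * fdiag I s * ftr V) = norm (fId J * fdiag I s * fId J)"
      unfolding mult.assoc fiso_norm[OF D(1)] using fiso_norm_ftr[OF D(2), of "fId J * fdiag I s"] by (simp add: mult.assoc)
    also have "fId J * fdiag I s * fId J = fdiag I s"
      by (rule fmat_eqI) (use I finI in \<open>auto simp: times_fId fId_times D(5)\<close>)
    finally show ?thesis
      using norm_columns[OF finI, of "fdiag I s" undefined] finI
      by (simp add: fdiag_fId fdiag_norm_col)
  qed
  have WY: "W - Y = U * fdiag (J - J1) s * ftr V"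
  proof -
    have "fdiag J s - fdiag J1 s = fdiag (J - J1) s"
      by (rule fmat_eqI) (use J1 D(5) in auto)
    then show ?thesis unfolding Y_def D(4) by (metis left_diff_distrib right_diff_distrib)
  qed
  have split: "(\<Sum>j\<in>J. (s j)\<^sup>2) = (\<Sum>j\<in>J1. (s j)\<^sup>2) + (\<Sum>j\<in>J - J1. (s j)\<^sup>2)"
    by (metis J1(1) D(5) sum.subset_diff add.commute)
  have nW: "(norm W)\<^sup>2 = (\<Sum>j\<in>J. (s j)\<^sup>2)" using nD[of J] D(4) by simp
  have nWY: "(norm (W - Y))\<^sup>2 = (\<Sum>j\<in>J - J1. (s j)\<^sup>2)" unfolding WY by (rule nD) auto
  have nWY': "(norm (W - Y'))\<^sup>2 = (norm W)\<^sup>2 - (norm (W * ?Q))\<^sup>2 + (norm (W * ?Q - Y'))\<^sup>2"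
  proof -
    have "(W - Y') * ?Q = W * ?Q - Y'" "(W - Y') - (W - Y') * ?Q = W - W * ?Q"
      using Y'Q by (simp_all add: left_diff_distrib)
    then show ?thesis
      using fproj_pythagoras_right[OF Q, of "W - Y'"] fproj_pythagoras_right[OF Q, of W] by simp
  qed
  have \<sigma>2: "0 < (\<sigma> / 2)\<^sup>2" using gap by simp
  have a1: "(\<sigma> / 2)\<^sup>2 < (s j)\<^sup>2" if "j \<in> J1" for j
    using that gap unfolding J1_def by (intro power_strict_mono) auto
  have a2: "(s j)\<^sup>2 \<le> (\<sigma> / 2)\<^sup>2" if "j \<in> J - J1" for j
    using that gap D(3)[of j] unfolding J1_def by (intro power_mono) auto
  note top = weighted_sum_le_top[OF D(5) J1(1) w01 sumw \<sigma>2, of "\<lambda>j. (s j)\<^sup>2", OF _ a1 a2]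
  have le: "(\<Sum>j\<in>J. (s j)\<^sup>2 * w j) \<le> (\<Sum>j\<in>J1. (s j)\<^sup>2)" by (rule top)
  have "(norm (W - Y))\<^sup>2 \<le> (norm (W - Y'))\<^sup>2"
    unfolding nWY nWY' nW nWQ split using le zero_le_power2[of "norm (W * ?Q - Y')"] by linarith
  then show "norm (W - Y) \<le> norm (W - Y')" by (rule power2_le_imp_le) simp
  assume "norm (W - Y') \<le> norm (W - Y)"
  then have "(norm (W - Y'))\<^sup>2 \<le> (norm (W - Y))\<^sup>2" by (intro power_mono) auto
  then have le': "(\<Sum>j\<in>J1. (s j)\<^sup>2) + (norm (W * ?Q - Y'))\<^sup>2 \<le> (\<Sum>j\<in>J. (s j)\<^sup>2 * w j)"
    unfolding nWY nWY' nW nWQ split by linarith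
  have e1: "(\<Sum>j\<in>J. (s j)\<^sup>2 * w j) = (\<Sum>j\<in>J1. (s j)\<^sup>2)"
    using le le' zero_le_power2[of "norm (W * ?Q - Y')"] by linarith
  have "(norm (W * ?Q - Y'))\<^sup>2 \<le> 0" using le le' by linarith
  then have e2: "norm (W * ?Q - Y') = 0" by simp
  have wj: "w j = (if j \<in> J1 then 1 else 0)" if "j \<in> J" for j
    using top(2)[OF _ _ _ e1 that] by blast
  \<comment> \<open>Equality makes all weights \<open>0\<close> or \<open>1\<close>, so
    \<open>?Q\<close> fixes the top right singular vectors and annihilates the others.\<close>
  have QV: "?Q * V = V * fId J1"
  proof (rule fmat_eqI)
    fix i j
    have "ent (?Q * V) i j = ent (?Q * (V * fE j j)) i j" by (simp only: mult.assoc[symmetric] ent_times_fE) simp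
    also have "?Q * (V * fE j j) = V * fId J1 * fE j j"
    proof (cases "j \<in> J1")
      case True
      then have "(norm (V * fE j j - ?Q * (V * fE j j)))\<^sup>2 = 0"
        using fproj_pythagoras[OF Q, of "V * fE j j"] wj[of j] J1 nV[of j] unfolding w_def by auto
      moreover have "fId J1 * fE j j = fE j j" by (rule fmat_eqI) (use True J1 in \<open>auto simp: fId_times ent_fId\<close>)
      ultimately show ?thesis by (simp add: mult.assoc)
    next
      case False
      have "fId J1 * fE j j = 0" by (rule fmat_eqI) (use False J1 in \<open>auto simp: fId_times ent_fId\<close>)
      moreover have "?Q * (V * fE j j) = 0"
      proof (cases "j \<in> J")
        case True
        then have "w j = 0" using wj False by simp
        then show ?thesis unfolding w_def by simp
      next
        case False
        then have "V * fE j j = 0" using nV[of j] by simp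
        then show ?thesis by simp
      qed
      ultimately show ?thesis by (simp add: mult.assoc)
    qed
    also have "ent ... i j = ent (V * fId J1) i j" by simp
    finally show "ent (?Q * V) i j = ent (V * fId J1) i j" .
  qed
  have "ftr V * ?Q = ftr (?Q * V)" using Qs by simp
  also have "... = fId J1 * ftr V" unfolding QV by simp
  finally have VQ: "ftr V * ?Q = fId J1 * ftr V" .
  have "Y' = W * ?Q" using e2 by simp
  also have "... = U * (fdiag J s * fId J1) * ftr V" by (simp only: D(4) mult.assoc VQ)
  also have "fdiag J s * fId J1 = fdiag J1 s"
    by (rule fmat_eqI) (use J1 D(5) in \<open>auto simp: times_fId\<close>)
  finally show "Y' = Y" unfolding Y_def .
qed

end

text \<open>Optimality against \<open>X\<close> gives
  \<open>(norm (Y - X))\<^sup>2 \<le> 2 * inner (Y - X) (W - X)\<close>. Only the projection of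
  \<open>W - X\<close> to the column space of \<open>Y - X\<close> matters there, and on each of the
  \<open>card J\<close> basis vectors the operator bound gives \<open>\<epsilon>\<close>.\<close>

lemma best_approx_dist:
  assumes D: "fsvd (Y - X) U s V J" and op: "fop_le (W - X) \<epsilon>" and best: "norm (W - Y) \<le> norm (W - X)" and \<epsilon>: "0 \<le> \<epsilon>"
  shows "norm (Y - X) \<le> 2 * sqrt (real (card J)) * \<epsilon>"
proof -
  note S = fsvdD[OF D]
  let ?P = "U * ftr U"
  have P: "ftr ?P = ?P" by simp
  have "(norm (W - Y))\<^sup>2 \<le> (norm (W - X))\<^sup>2" using best by (intro power_mono) auto
  moreover have "W - Y = (W - X) - (Y - X)" by simp
  ultimately have 1: "(norm (Y - X))\<^sup>2 \<le> 2 * inner (Y - X) (W - X)"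
    unfolding power2_norm_eq_inner by (simp only: inner_diff_left[of "W - X"] inner_diff_right[of _ "W - X"]) (simp add: inner_commute)
  have "inner (Y - X) (W - X) = inner (Y - X) (?P * (W - X))"
    using fsvd_proj(1)[OF D] inner_mult_left[of ?P "Y - X" "W - X"] P by simp
  also have "... \<le> norm (Y - X) * norm (?P * (W - X))" by (rule norm_cauchy_schwarz)
  finally have 2: "inner (Y - X) (W - X) \<le> norm (Y - X) * norm (?P * (W - X))" .
  have 3: "norm (?P * (W - X)) \<le> sqrt (real (card J)) * \<epsilon>"
  proof -
    have "(norm (?P * (W - X)))\<^sup>2 \<le> (norm (ftr U * (W - X)))\<^sup>2"
      unfolding mult.assoc by (intro power_mono fiso_contract(1)[OF S(1)]) auto
    also have "... = (norm (ftr (W - X) * U))\<^sup>2"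
      using norm_ftr[of "ftr U * (W - X)"] by simp
    also have "... = (\<Sum>j\<in>J. (norm (ftr (W - X) * U * fE j undefined))\<^sup>2)"
      by (rule norm_columns[OF S(5)]) (simp add: mult.assoc fiso_fId[OF S(1)])
    also have "... \<le> (\<Sum>j\<in>J. \<epsilon>\<^sup>2)"
    proof (intro sum_mono power_mono)
      fix j
      have "norm (ftr (W - X) * (U * fE j undefined)) \<le> \<epsilon> * norm (U * fE j undefined)"
        by (rule fop_leD[OF fop_le_ftr[OF op]])
      also have "... \<le> \<epsilon> * 1" using fiso_contract(1)[OF S(1), of "fE j undefined"] \<epsilon> by (intro mult_left_mono) auto
      finally show "norm (ftr (W - X) * U * fE j undefined) \<le> \<epsilon>" by (simp add: mult.assoc)
    qed auto
    also have "... = (sqrt (real (card J)) * \<epsilon>)\<^sup>2" by (simp add: power_mult_distrib)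
    finally show ?thesis by (rule power2_le_imp_le) (use \<epsilon> in simp)
  qed
  have "(norm (Y - X))\<^sup>2 \<le> 2 * (norm (Y - X) * (sqrt (real (card J)) * \<epsilon>))"
    using 1 2 mult_left_mono[OF 3 norm_ge_zero[of "Y - X"]] by linarith
  then have "(norm (Y - X))\<^sup>2 \<le> (2 * sqrt (real (card J)) * \<epsilon>) * norm (Y - X)"
    by (simp add: mult_ac)
  then show ?thesis by (cases "Y = X") (use \<epsilon> in \<open>auto simp: power2_eq_square\<close>)
qed

section \<open>Trimming\<close>

text \<open>A diagonal matrix that is constant on blocks of rows. In the application
  \<open>B i\<close> collects the \<open>i\<close>-th rows of all transformed frontal slices, that
  is, one horizontal slice.\<close>

definition frow_scale :: "('i \<Rightarrow> real) \<Rightarrow> ('i \<Rightarrow> 'a set) \<Rightarrow> 'i set \<Rightarrow> 'a fmat" where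
  "frow_scale d B I = (\<Sum>i\<in>I. d i *\<^sub>R fId (B i))"

locale row_partition =
  fixes B :: "'i \<Rightarrow> 'a set" and I :: "'i set"
  assumes fin: "finite I" "\<And>i. i \<in> I \<Longrightarrow> finite (B i)"
    and disj: "\<And>i j. i \<in> I \<Longrightarrow> j \<in> I \<Longrightarrow> i \<noteq> j \<Longrightarrow> B i \<inter> B j = {}"
begin

lemma block_mult: "i \<in> I \<Longrightarrow> j \<in> I \<Longrightarrow> fId (B i) * fId (B j) = (if i = j then fId (B i) else 0)"
  using fId_mult[of "B i" "B j"] fin disj by (auto simp: fId_def)

lemma sum_blocks: "(\<Sum>i\<in>I. fId (B i)) = fId (\<Union>i\<in>I. B i)"
  unfolding fId_def by (rule sum.UNION_disjoint[symmetric]) (use fin disj in auto)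

lemma norm_blocks:
  assumes "fId (\<Union>i\<in>I. B i) * A = A"
  shows "(norm A)\<^sup>2 = (\<Sum>i\<in>I. (norm (fId (B i) * A))\<^sup>2)"
proof -
  have "(\<Sum>i\<in>I. (norm (fId (B i) * A))\<^sup>2) = (\<Sum>i\<in>I. inner A (fId (B i) * A))"
  proof (rule sum.cong[OF refl])
    fix i assume "i \<in> I"
    then have "fId (B i) * (fId (B i) * A) = fId (B i) * A"
      using block_mult[of i i] by (simp add: mult.assoc[symmetric])
    then show "(norm (fId (B i) * A))\<^sup>2 = inner A (fId (B i) * A)"
      by (simp add: power2_norm_eq_inner inner_mult_left)
  qed
  also have "... = inner A (fId (\<Union>i\<in>I. B i) * A)"
    by (simp add: sum_blocks[symmetric] inner_sum_right sum_distrib_right)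
  finally show ?thesis using assms by (simp add: power2_norm_eq_inner)
qed

lemma block_scale: "i \<in> I \<Longrightarrow> fId (B i) * (frow_scale d B I * A) = d i *\<^sub>R (fId (B i) * A)"
proof -
  assume i: "i \<in> I"
  have "fId (B i) * frow_scale d B I = (\<Sum>j\<in>I. if j = i then d i *\<^sub>R fId (B i) else 0)"
    unfolding frow_scale_def sum_distrib_left
    by (rule sum.cong) (use block_mult[OF i] in auto)
  also have "... = d i *\<^sub>R fId (B i)" using i fin(1) by simp
  finally show ?thesis by (simp add: mult.assoc[symmetric])
qed

lemma scale_block: "frow_scale d B I = fId (\<Union>i\<in>I. B i) * frow_scale d B I"
proof -
  have "fId (\<Union>i\<in>I. B i) * frow_scale d B I = (\<Sum>i\<in>I. d i *\<^sub>R (fId (\<Union>i\<in>I. B i) * fId (B i)))"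
    by (simp add: frow_scale_def sum_distrib_left)
  also have "... = (\<Sum>i\<in>I. d i *\<^sub>R fId (B i))"
  proof (rule sum.cong[OF refl])
    fix i assume i: "i \<in> I"
    then have "(\<Union>i\<in>I. B i) \<inter> B i = B i" by blast
    then show "d i *\<^sub>R (fId (\<Union>i\<in>I. B i) * fId (B i)) = d i *\<^sub>R fId (B i)"
      using i fin by (simp add: fId_mult)
  qed
  finally show ?thesis by (simp add: frow_scale_def)
qed

lemma scale_contract:
  assumes "\<And>i. i \<in> I \<Longrightarrow> 0 \<le> d i \<and> d i \<le> 1"
  shows "norm (frow_scale d B I * A) \<le> norm A"
proof (rule norm_mono_ent)
  fix a b
  show "\<bar>ent (frow_scale d B I * A) a b\<bar> \<le> \<bar>ent A a b\<bar>"
  proof (cases "\<exists>i\<in>I. a \<in> B i")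
    case True
    then obtain i where i: "i \<in> I" "a \<in> B i" by blast
    have "ent (frow_scale d B I * A) a b = ent (fId (B i) * (frow_scale d B I * A)) a b"
      using i fin by (simp add: fId_times)
    then have "ent (frow_scale d B I * A) a b = d i * ent A a b"
      using i fin by (simp add: block_scale fId_times)
    then show ?thesis using assms[OF i(1)] by (simp add: abs_mult mult_left_le_one_le)
  next
    case False
    have "ent (frow_scale d B I * A) a b = 0"
      by (subst scale_block, subst mult.assoc, subst fId_times) (use False fin in auto)
    then show ?thesis by simp
  qed
qed

text \<open>Clipping a row block to the ball of radius \<open>b\<close> is the metric projection onto that ball, so it
  moves the block at most as far as any competitor in the ball.\<close>

lemma clip_dist:
  assumes U: "fId (\<Union>i\<in>I. B i) * U = U" and C: "fId (\<Union>i\<in>I. B i) * C = C"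
    and b: "\<And>i. i \<in> I \<Longrightarrow> norm (fId (B i) * C) \<le> b"
    and d: "\<And>i. i \<in> I \<Longrightarrow> d i = min 1 (b / norm (fId (B i) * U))"
  shows "norm (U - frow_scale d B I * U) \<le> norm (U - C)"
    "i \<in> I \<Longrightarrow> norm (fId (B i) * (frow_scale d B I * U)) \<le> b"
proof -
  have part: "norm (fId (B i) * (frow_scale d B I * U)) \<le> b \<and>
      norm (fId (B i) * (U - frow_scale d B I * U)) \<le> norm (fId (B i) * (U - C))" if i: "i \<in> I" for i
  proof -
    let ?u = "fId (B i) * U"
    have b0: "0 \<le> b" using b[OF i] norm_ge_zero order_trans by blast
    have tri: "norm ?u - b \<le> norm (fId (B i) * (U - C))"
      using norm_triangle_ineq2[of ?u "fId (B i) * C"] b[OF i] by (simp add: right_diff_distrib)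
    show ?thesis
    proof (cases "norm ?u \<le> b")
      case True
      \<comment> \<open>For a zero block \<open>b / 0 = 0\<close> makes the factor \<open>0\<close>
        instead of \<open>1\<close>, and the block stays zero.\<close>
      then have "d i = 1 \<or> ?u = 0"
        unfolding d[OF i] by (cases "?u = 0") (auto simp: min_def field_simps)
      then show ?thesis using i True b0 by (auto simp: right_diff_distrib block_scale)
    next
      case False
      then have n1: "norm ?u > 0" using b0 by linarith
      have n2: "b / norm ?u < 1" using False n1 by (simp add: field_simps)
      then have n: "norm ?u > 0" "d i = b / norm ?u" unfolding d[OF i] using n1 by (simp_all add: min_def)
      have "?u - d i *\<^sub>R ?u = (1 - b / norm ?u) *\<^sub>R ?u" using n by (simp add: algebra_simps)
      then have "norm (?u - d i *\<^sub>R ?u) = \<bar>1 - b / norm ?u\<bar> * norm ?u" by simp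
      also have "... = (1 - b / norm ?u) * norm ?u" using n2 by simp
      also have "... = norm ?u - b" using n1 by (simp add: left_diff_distrib)
      finally have "norm (?u - d i *\<^sub>R ?u) = norm ?u - b" .
      then show ?thesis using tri i n b0 by (simp add: right_diff_distrib block_scale)
    qed
  qed
  show "i \<in> I \<Longrightarrow> norm (fId (B i) * (frow_scale d B I * U)) \<le> b" using part by blast
  have DU: "fId (\<Union>i\<in>I. B i) * (frow_scale d B I * U) = frow_scale d B I * U"
    using scale_block[of d] by (simp add: mult.assoc[symmetric])
  have "(norm (U - frow_scale d B I * U))\<^sup>2 = (\<Sum>i\<in>I. (norm (fId (B i) * (U - frow_scale d B I * U)))\<^sup>2)"
    by (rule norm_blocks) (simp add: right_diff_distrib U DU)
  also have "... \<le> (\<Sum>i\<in>I. (norm (fId (B i) * (U - C)))\<^sup>2)"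
    by (intro sum_mono power_mono) (use part in auto)
  also have "... = (norm (U - C))\<^sup>2"
    by (rule norm_blocks[symmetric]) (simp add: right_diff_distrib U C)
  finally show "norm (U - frow_scale d B I * U) \<le> norm (U - C)" by (rule power2_le_imp_le) simp
qed

text \<open>The competitor is the projection of \<open>U\<close> to the column space of the incoherent target.\<close>

lemma trim_factor_dist:
  assumes Z: "fsvd Z U s V J" "\<forall>j\<in>J. \<sigma> \<le> s j" "0 < \<sigma>" and X: "fsvd X U' s' V' J"
    and U: "fId (\<Union>i\<in>I. B i) * U = U" "fId (\<Union>i\<in>I. B i) * U' = U'"
    and b: "\<And>i. i \<in> I \<Longrightarrow> norm (fId (B i) * U') \<le> b"
    and d: "\<And>i. i \<in> I \<Longrightarrow> d i = min 1 (b / norm (fId (B i) * U))"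
  shows "norm (U - frow_scale d B I * U) \<le> norm (Z - X) / \<sigma>"
    "i \<in> I \<Longrightarrow> norm (fId (B i) * (frow_scale d B I * U)) \<le> b"
proof -
  note D = fsvdD[OF Z(1)] and D' = fsvdD[OF X]
  let ?C = "U' * ftr U' * U"
  have bC: "norm (fId (B i) * ?C) \<le> b" if "i \<in> I" for i
  proof -
    have "norm (fId (B i) * ?C) = norm (fId (B i) * U' * (ftr U' * U))" by (simp add: mult.assoc)
    also have "... \<le> norm (fId (B i) * U' * ftr U')"
      using fiso_contract(3)[OF D(1), of "fId (B i) * U' * ftr U'"] by (simp add: mult.assoc)
    also have "... \<le> norm (fId (B i) * U')" by (rule fiso_contract(4)[OF D'(1)])
    finally show ?thesis using b[OF that] by simp
  qed
  have CU: "fId (\<Union>i\<in>I. B i) * ?C = ?C"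
    by (metis U(2) mult.assoc)
  have "norm (U - frow_scale d B I * U) \<le> norm (U - ?C)"
    by (rule clip_dist(1)[OF U(1) CU bC d])
  also have "... \<le> norm (Z - X) / \<sigma>"
    using left_space_gap[OF Z(1,2) _ fiso_fproj[OF D'(1)] fsvd_proj(1)[OF X]] Z(3)
    by (simp add: field_simps)
  finally show "norm (U - frow_scale d B I * U) \<le> norm (Z - X) / \<sigma>" .
  show "i \<in> I \<Longrightarrow> norm (fId (B i) * (frow_scale d B I * U)) \<le> b"
    by (rule clip_dist(2)[OF U(1) CU bC d])
qed

end

text \<open>The new left singular vectors are combinations \<open>A * w\<close> of the trimmed
  columns. As \<open>A\<close> is within \<open>1 / 2\<close> of the isometry \<open>U\<close>, the
  matrix \<open>w\<close> has operator norm at most \<open>2\<close>, and so row norms at most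
  double when the columns are orthonormalized again.\<close>

lemma trim_incoherence:
  assumes U: "fiso U J" and A: "norm (U - A) \<le> \<delta>" "\<delta> \<le> 1 / 2" "A * fId J = A"
    and Zh: "fsvd Zh U' s' V' J'" "Zh = A * T"
    and R: "norm (R * A) \<le> b"
    and T: "fId J * T = T"
  shows "norm (R * U') \<le> 2 * b"
proof -
  note D = fsvdD[OF Zh(1)]
  \<comment> \<open>Obtained by solving \<open>Zh = U' * fdiag J' s' * ftr V'\<close> for
    \<open>U'\<close>.\<close>
  define w where "w = T * V' * fdiag J' (\<lambda>j. 1 / s' j)"
  have Aw: "A * w = U'"
  proof -
    have "fdiag J' s' * fdiag J' (\<lambda>j. 1 / s' j) = fId J'"
      by (rule fmat_eqI) (use D(3) in \<open>force simp: fdiag_times D(5) ent_fId\<close>)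
    then have "Zh * V' * fdiag J' (\<lambda>j. 1 / s' j) = U'"
      by (subst D(4)) (simp add: mult.assoc fisoD(3)[OF D(2)], simp add: mult.assoc[symmetric] fdiag_fId[OF D(5)] fisoD[OF D(2)] fiso_fId[OF D(1)])
    then show ?thesis unfolding w_def Zh(2) by (simp add: mult.assoc)
  qed
  have "fop_le w 2"
    unfolding fop_le_def
  proof
    fix x
    have Iw: "fId J * (w * x) = w * x" unfolding w_def by (simp add: mult.assoc[symmetric] T)
    have "norm (w * x) = norm (U * (w * x))" using fiso_norm[OF U, of "w * x"] Iw by simp
    also have "... \<le> norm (A * (w * x)) + norm ((U - A) * (w * x))"
      using norm_triangle_ineq[of "A * (w * x)" "(U - A) * (w * x)"] by (simp add: left_diff_distrib)
    also have "... \<le> norm x + 1 / 2 * norm (w * x)"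
    proof (rule add_mono)
      show "norm (A * (w * x)) \<le> norm x"
        using fiso_contract(1)[OF D(1), of x] by (simp add: mult.assoc[symmetric] Aw)
      have "norm ((U - A) * (w * x)) \<le> norm (U - A) * norm (w * x)" by (rule norm_mult_fmat)
      also have "... \<le> 1 / 2 * norm (w * x)" using A by (intro mult_right_mono) auto
      finally show "norm ((U - A) * (w * x)) \<le> 1 / 2 * norm (w * x)" .
    qed
    finally show "norm (w * x) \<le> 2 * norm x" by simp
  qed
  then have "norm (R * A * w) \<le> 2 * norm (R * A)" by (rule fop_le_right)
  then show ?thesis using R by (simp add: mult.assoc Aw)
qed

lemma singular_value_upper:
  assumes Z: "fsvd Z U s V J" and X: "fop_le X smax" and j: "j \<in> J"
  shows "s j \<le> smax + norm (Z - X)"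
proof -
  note D = fsvdD[OF Z]
  let ?x = "V * fE j j"
  have Ij: "fId J * fE j j = fE j j" by (rule fmat_eqI) (use j D(5) in \<open>auto simp: fId_times ent_fId\<close>)
  have nx: "norm ?x = 1" using fiso_norm[OF D(2), of "fE j j"] Ij by simp
  have "Z * ?x = U * (fdiag J s * (fId J * fE j j))" by (simp add: D(4) mult.assoc fisoD(3)[OF D(2)])
  also have "... = s j *\<^sub>R (U * fE j j)" unfolding Ij by (simp add: fdiag_norm_col[OF D(5)] j)
  finally have "norm (Z * ?x) = s j"
    using fiso_norm[OF D(1), of "fE j j"] Ij D(3)[OF j] by simp
  moreover have "norm (Z * ?x) \<le> norm (X * ?x) + norm ((Z - X) * ?x)"
    using norm_triangle_ineq[of "X * ?x" "(Z - X) * ?x"] by (simp add: left_diff_distrib)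
  moreover have "norm (X * ?x) \<le> smax" using fop_leD[OF X, of ?x] nx by simp
  moreover have "norm ((Z - X) * ?x) \<le> norm (Z - X)" using norm_mult_fmat[of "Z - X" ?x] nx by simp
  ultimately show ?thesis by linarith
qed

text \<open>The two factors are changed one after the other; each change passes through the diagonal
  factor, of norm at most \<open>S\<close>.\<close>

lemma trim_dist:
  assumes Z: "fsvd Z U s V J" and smax: "\<forall>j\<in>J. s j \<le> S" "0 \<le> S"
    and A: "norm (U - A) \<le> \<delta>" and B: "norm (V - DB * V) \<le> \<delta>" and DB: "\<And>C. norm (C * ftr DB) \<le> norm C"
  shows "norm (A * fdiag J s * ftr (DB * V) - Z) \<le> 2 * S * \<delta>"
proof -
  note D = fsvdD[OF Z]
  have s: "\<forall>j\<in>J. \<bar>s j\<bar> \<le> S" using smax D(3) by fastforce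
  have "A * fdiag J s * ftr (DB * V) - Z = (A - U) * fdiag J s * ftr V * ftr DB + U * fdiag J s * ftr (DB * V - V)"
    by (simp add: D(4) algebra_simps)
  also have "norm ... \<le> norm ((A - U) * fdiag J s * ftr V * ftr DB) + norm (U * fdiag J s * ftr (DB * V - V))"
    by (rule norm_triangle_ineq)
  also have "... \<le> S * \<delta> + S * \<delta>"
  proof (rule add_mono)
    have "norm ((A - U) * fdiag J s * ftr V * ftr DB) \<le> norm ((A - U) * fdiag J s * ftr V)" by (rule DB)
    also have "... \<le> norm ((A - U) * fdiag J s)" by (rule fiso_contract(4)[OF D(2)])
    also have "... \<le> S * norm (A - U)" by (rule fdiag_upper(1)[OF D(5) s smax(2)])
    also have "... \<le> S * \<delta>" using A smax by (intro mult_left_mono) (auto simp: norm_minus_commute)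
    finally show "norm ((A - U) * fdiag J s * ftr V * ftr DB) \<le> S * \<delta>" .
    have "norm (U * fdiag J s * ftr (DB * V - V)) \<le> norm (fdiag J s * ftr (DB * V - V))"
      unfolding mult.assoc by (rule fiso_contract(1)[OF D(1)])
    also have "... \<le> S * norm (ftr (DB * V - V))" by (rule fdiag_upper(2)[OF D(5) s smax(2)])
    also have "... \<le> S * \<delta>" using B smax unfolding norm_ftr by (intro mult_left_mono) (auto simp: norm_minus_commute)
    finally show "norm (U * fdiag J s * ftr (DB * V - V)) \<le> S * \<delta>" .
  qed
  finally show ?thesis by simp
qed

section \<open>One step of the conjugate gradient method\<close>

text \<open>The step in an abstract inner product space: \<open>P\<close> is the tangent projection,
  \<open>T\<close> the sampling operator, \<open>E\<close> the error \<open>X - X_l\<close>,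
  \<open>q\<close> the previous direction, and \<open>flag\<close> stands for
  \<open>l \<ge> 1\<close>. \<open>E1\<close> and \<open>E2\<close> bound the normal part of the
  error. On the tangent space \<open>T\<close> is close to \<open>\<rho>\<close>, so
  \<open>G\<close> is close to \<open>\<rho> *\<^sub>R E\<close> and \<open>\<alpha>\<close> to
  \<open>1 / \<rho>\<close>; what the previous direction adds is kept as a separate term.\<close>

lemma cg_step:
  fixes P T :: "'v::real_inner \<Rightarrow> 'v" and q E :: 'v and flag :: bool
  assumes P: "linear P" "\<And>x y. inner (P x) y = inner x (P y)" "\<And>x. P (P x) = P x"
    and T: "linear T" "\<And>x y. inner (T x) y = inner x (T y)" "\<And>x. inner (T x) x \<ge> 0"
    and rip: "\<And>x y. P x = x \<Longrightarrow> P y = y \<Longrightarrow> \<bar>inner x (T y) - \<rho> * inner x y\<bar> \<le> \<delta> * \<rho> * norm x * norm y"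
    and \<rho>: "\<rho> > 0" and \<delta>: "0 \<le> \<delta>" "\<delta> \<le> 1 / 100" and \<zeta>: "0 \<le> \<zeta>" "\<zeta> \<le> 1 / 100"
    and E1: "norm (E - P E) \<le> \<zeta> * norm E" and E2: "norm (P (T (E - P E))) \<le> \<zeta> * \<rho> * norm E"
    and k: "0 \<le> k1" "0 \<le> k2" "k1 + \<delta> < 1 - \<delta>" "k2 * (k1 + \<delta>) \<le> 1 / 3"
  defines "G \<equiv> P (T E)" and "y \<equiv> P q"
  defines "\<beta> \<equiv> (if flag \<and> inner y (T y) \<noteq> 0 \<and> \<bar>inner G y\<bar> / (norm G * norm y) \<le> k1 \<and> norm G \<le> k2 * norm y
      then - (inner G (T y) / inner y (T y)) else 0)"
  defines "Q \<equiv> G + \<beta> *\<^sub>R y"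
  defines "\<alpha> \<equiv> inner G (P Q) / inner (P Q) (T (P Q))"
  shows "G = 0 \<Longrightarrow> E = 0" "G \<noteq> 0 \<Longrightarrow> inner (P Q) (T (P Q)) \<noteq> 0"
    "norm Q \<le> 11 / 10 * \<rho> * norm E"
    "norm (E - \<alpha> *\<^sub>R Q) \<le> 1 / 20 * norm E + 7 / 20 * norm q / \<rho>"
proof -
  have PG: "P G = G" and Py: "P y = y" unfolding G_def y_def by (simp_all add: P)
  have PQ: "P Q = Q" unfolding Q_def using P(1) PG Py by (simp add: linear_add linear_scale)
  have Pc: "norm (P x) \<le> norm x" for x
  proof -
    have "(norm (P x))\<^sup>2 = inner x (P x)" using P(2)[of x "P x"] P(3) by (simp add: power2_norm_eq_inner)
    also have "... \<le> norm x * norm (P x)" by (rule norm_cauchy_schwarz)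
    finally show ?thesis by (cases "P x = 0") (auto simp: power2_eq_square)
  qed
  let ?e = "norm E"
  \<comment> \<open>The tangential part of \<open>E\<close> contributes the isometry defect
    \<open>\<delta>\<close>, its normal part the error \<open>\<zeta>\<close>.\<close>
  have GE: "norm (G - \<rho> *\<^sub>R P E) \<le> (\<delta> + \<zeta>) * \<rho> * ?e"
  proof -
    let ?x = "P (T (P E)) - \<rho> *\<^sub>R P E"
    have Px: "P ?x = ?x" using P by (simp add: linear_diff linear_scale)
    have "(norm ?x)\<^sup>2 = inner ?x (T (P E)) - \<rho> * inner ?x (P E)"
      unfolding power2_norm_eq_inner
      using P(2)[of ?x "T (P E)"] Px by (simp add: inner_diff_right)
    also have "... \<le> \<delta> * \<rho> * norm ?x * norm (P E)" using rip[OF Px P(3), of E] by linarith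
    also have "... \<le> \<delta> * \<rho> * norm ?x * ?e" using Pc[of E] \<rho> \<delta> by (intro mult_left_mono) auto
    finally have "norm ?x \<le> \<delta> * \<rho> * ?e"
      by (cases "?x = 0") (use \<rho> \<delta> in \<open>auto simp: power2_eq_square mult_ac\<close>)
    moreover have "G - \<rho> *\<^sub>R P E = ?x + P (T (E - P E))"
      unfolding G_def using P(1) T(1) by (simp add: linear_diff)
    ultimately show ?thesis
      using norm_triangle_ineq[of ?x "P (T (E - P E))"] E2 by (simp add: algebra_simps)
  qed
  have Gup: "norm G \<le> (1 + \<delta> + \<zeta>) * \<rho> * ?e"
  proof -
    have "norm G \<le> norm (G - \<rho> *\<^sub>R P E) + norm (\<rho> *\<^sub>R P E)"
      using norm_triangle_ineq[of "G - \<rho> *\<^sub>R P E" "\<rho> *\<^sub>R P E"] by simp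
    also have "norm (\<rho> *\<^sub>R P E) \<le> \<rho> * ?e" using Pc[of E] \<rho> by simp
    finally show ?thesis using GE by (simp add: algebra_simps)
  qed
  show "E = 0" if "G = 0"
  proof -
    have "\<rho> * norm (P E) \<le> (\<delta> + \<zeta>) * \<rho> * ?e" using GE that \<rho> by simp
    then have "norm (P E) \<le> (\<delta> + \<zeta>) * ?e" using \<rho> by (simp add: mult_ac)
    moreover have "?e \<le> norm (P E) + norm (E - P E)"
      using norm_triangle_ineq[of "P E" "E - P E"] by simp
    ultimately have "?e \<le> (\<delta> + 2 * \<zeta>) * ?e" using E1 by (simp add: algebra_simps)
    moreover have "(\<delta> + 2 * \<zeta>) * ?e \<le> 1 / 2 * ?e" using \<delta> \<zeta> by (intro mult_right_mono) auto
    ultimately have "?e \<le> 0" by linarith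
    then show "E = 0" by simp
  qed
  have low: "(1 - \<delta>) * \<rho> * (norm x)\<^sup>2 \<le> inner x (T x)" if "P x = x" for x
    using rip[OF that that] by (simp add: power2_norm_eq_inner[symmetric] power2_eq_square algebra_simps)
  have up: "inner x (T x) \<le> (1 + \<delta>) * \<rho> * (norm x)\<^sup>2" if "P x = x" for x
    using rip[OF that that] by (simp add: power2_norm_eq_inner[symmetric] power2_eq_square algebra_simps)
  have Tsym: "inner a (T b) = inner b (T a)" for a b using T(2)[of b a] by (simp add: inner_commute)
  let ?\<kappa> = "(k1 + \<delta>) / (1 - \<delta>)"
  have \<kappa>: "0 \<le> ?\<kappa>" "?\<kappa> < 1" using k \<delta> by (auto simp: field_simps)
  \<comment> \<open>The first restart criterion bounds the momentum relative to the gradient, the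
    second one bounds the coefficient itself.\<close>
  have b: "norm (\<beta> *\<^sub>R y) \<le> ?\<kappa> * norm G \<and> \<bar>\<beta>\<bar> \<le> ?\<kappa> * k2"
  proof (cases "\<beta> = 0")
    case True
    then show ?thesis
      using mult_nonneg_nonneg[OF \<kappa>(1) norm_ge_zero[of G]] mult_nonneg_nonneg[OF \<kappa>(1) k(2)] by simp
  next
    case False
    then have c: "inner y (T y) \<noteq> 0" "\<bar>inner G y\<bar> / (norm G * norm y) \<le> k1" "norm G \<le> k2 * norm y"
      and \<beta>: "\<beta> = - (inner G (T y) / inner y (T y))" unfolding \<beta>_def by (auto split: if_splits)
    have y0: "norm y > 0" using c(1) T(1) by (auto simp: linear_0)
    have "\<bar>inner G y\<bar> \<le> k1 * (norm G * norm y)"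
      using c(2) y0 by (cases "G = 0") (auto simp: field_simps)
    then have "\<bar>\<rho> * inner G y\<bar> \<le> \<rho> * (k1 * (norm G * norm y))"
      using \<rho> by (simp add: abs_mult)
    then have num: "\<bar>inner G (T y)\<bar> \<le> (k1 + \<delta>) * \<rho> * norm G * norm y"
      using rip[OF PG Py] by (simp add: algebra_simps)
    have den: "(1 - \<delta>) * \<rho> * (norm y)\<^sup>2 \<le> inner y (T y)" by (rule low[OF Py])
    have den0: "0 < (1 - \<delta>) * \<rho> * (norm y)\<^sup>2" using \<delta> \<rho> y0 by simp
    have "\<bar>\<beta>\<bar> = \<bar>inner G (T y)\<bar> / inner y (T y)" unfolding \<beta> using den den0 by simp
    also have "... \<le> ((k1 + \<delta>) * \<rho> * norm G * norm y) / ((1 - \<delta>) * \<rho> * (norm y)\<^sup>2)"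
      by (rule frac_le) (use num den den0 \<rho> k \<delta> in auto)
    also have "... = ?\<kappa> * (norm G / norm y)"
      using \<rho> y0 \<delta> by (simp add: power2_eq_square field_simps)
    finally have B: "\<bar>\<beta>\<bar> \<le> ?\<kappa> * (norm G / norm y)" .
    have "norm (\<beta> *\<^sub>R y) \<le> ?\<kappa> * (norm G / norm y) * norm y"
      using mult_right_mono[OF B norm_ge_zero[of y]] by (simp only: norm_scaleR)
    moreover have "norm G / norm y \<le> k2" using c(3) y0 by (simp add: field_simps)
    then have "?\<kappa> * (norm G / norm y) \<le> ?\<kappa> * k2" using \<kappa> by (intro mult_left_mono) auto
    ultimately show ?thesis using B y0 by simp
  qed
  \<comment> \<open>\<open>\<beta>\<close> makes \<open>Q\<close> conjugate to \<open>y\<close> with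
    respect to \<open>T\<close>, so the denominator of \<open>\<alpha>\<close> can be compared with
    its numerator.\<close>
  have conj: "inner Q (T Q) = inner Q (T G)"
  proof (cases "\<beta> = 0")
    case True then show ?thesis unfolding Q_def by simp
  next
    case False
    then have c: "inner y (T y) \<noteq> 0" and \<beta>: "\<beta> = - (inner G (T y) / inner y (T y))"
      unfolding \<beta>_def by (auto split: if_splits)
    have "inner Q (T y) = 0" unfolding Q_def \<beta> using c by (simp add: inner_diff_left)
    then show ?thesis
      using T(1) by (subst Q_def) (simp add: linear_add linear_scale inner_add_right)
  qed
  have QG: "norm Q \<le> 21 / 20 * norm G"
  proof -
    \<comment> \<open>\<open>Q\<close> arises from \<open>G\<close> by removing its
      \<open>T\<close>-component along \<open>y\<close>, which can only lower the energy.\<close>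
    have "inner Q (T Q) \<le> inner G (T G)"
    proof (cases "\<beta> = 0")
      case True then show ?thesis unfolding Q_def by simp
    next
      case False
      then have c: "inner y (T y) \<noteq> 0" and \<beta>: "\<beta> = - (inner G (T y) / inner y (T y))"
        unfolding \<beta>_def by (auto split: if_splits)
      have "inner Q (T Q) = inner Q (T G)" by (rule conj)
      also have "... = inner G (T G) + \<beta> * inner G (T y)"
        unfolding Q_def by (simp add: inner_add_left Tsym[of y G])
      also have "... = inner G (T G) - (inner G (T y))\<^sup>2 / inner y (T y)"
        unfolding \<beta> by (simp add: power2_eq_square)
      also have "... \<le> inner G (T G)" using T(3)[of y] by (simp add: inner_commute)
      finally show ?thesis .
    qed
    then have "(1 - \<delta>) * \<rho> * (norm Q)\<^sup>2 \<le> (1 + \<delta>) * \<rho> * (norm G)\<^sup>2"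
      using low[OF PQ] up[OF PG] by linarith
    then have "(1 - \<delta>) * (norm Q)\<^sup>2 \<le> (1 + \<delta>) * (norm G)\<^sup>2" using \<rho> by (simp add: mult_ac)
    moreover have "99 / 100 * (norm Q)\<^sup>2 \<le> (1 - \<delta>) * (norm Q)\<^sup>2" "(1 + \<delta>) * (norm G)\<^sup>2 \<le> 101 / 100 * (norm G)\<^sup>2"
      using \<delta> by (intro mult_right_mono; simp)+
    ultimately have "99 / 100 * (norm Q)\<^sup>2 \<le> 101 / 100 * (norm G)\<^sup>2" by linarith
    then have "(norm Q)\<^sup>2 \<le> (21 / 20 * norm G)\<^sup>2"
    proof -
      have pw: "(21 / 20 :: real)\<^sup>2 = 441 / 400" by (simp add: power2_eq_square)
      show ?thesis
        unfolding power_mult_distrib pw using \<open>99 / 100 * (norm Q)\<^sup>2 \<le> 101 / 100 * (norm G)\<^sup>2\<close> zero_le_power2[of "norm G"]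
        by linarith
    qed
    then show ?thesis by (rule power2_le_imp_le) simp
  qed
  have "(1 + \<delta> + \<zeta>) * (\<rho> * ?e) \<le> 51 / 50 * (\<rho> * ?e)" using \<delta> \<zeta> \<rho> by (intro mult_right_mono) auto
  then have Gup': "norm G \<le> 51 / 50 * \<rho> * ?e" using Gup by simp
  have "0 \<le> \<rho> * ?e" using \<rho> by simp
  then show Qup: "norm Q \<le> 11 / 10 * \<rho> * norm E" using QG Gup' by simp
  \<comment> \<open>Gradient and momentum cannot cancel, because
    \<open>k1 + \<delta> < 1 - \<delta>\<close> makes \<open>?\<kappa>\<close> less than
    \<open>1\<close>.\<close>
  have Q0: "Q \<noteq> 0" if "G \<noteq> 0"
  proof
    assume "Q = 0"
    then have "norm G = norm (\<beta> *\<^sub>R y)" unfolding Q_def by (metis add_eq_0_iff norm_minus_cancel)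
    then have "norm G \<le> ?\<kappa> * norm G" using b by simp
    moreover have "?\<kappa> * norm G < 1 * norm G" using \<kappa> that by (intro mult_strict_right_mono) auto
    ultimately show False by simp
  qed
  have QTQ: "0 < inner Q (T Q)" if "Q \<noteq> 0"
  proof -
    have "0 < (1 - \<delta>) * \<rho> * (norm Q)\<^sup>2" using that \<rho> \<delta> by simp
    then show ?thesis using low[OF PQ] by linarith
  qed
  show "inner (P Q) (T (P Q)) \<noteq> 0" if "G \<noteq> 0"
    unfolding PQ using QTQ[OF Q0[OF that]] by simp
  have \<alpha>: "norm ((1 - \<alpha> * \<rho>) *\<^sub>R Q) \<le> 1 / 99 * norm G"
  proof (cases "Q = 0")
    case True then show ?thesis by simp
  next
    case False
    have \<alpha>1: "1 - \<alpha> * \<rho> = (inner Q (T G) - \<rho> * inner Q G) / inner Q (T Q)"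
      unfolding \<alpha>_def PQ using QTQ[OF False] conj by (simp add: field_simps inner_commute)
    have "\<bar>1 - \<alpha> * \<rho>\<bar> \<le> (\<delta> * \<rho> * norm Q * norm G) / ((1 - \<delta>) * \<rho> * (norm Q)\<^sup>2)"
      unfolding \<alpha>1 abs_divide
      by (rule frac_le) (use rip[OF PQ PG] low[OF PQ] QTQ[OF False] \<rho> \<delta> False in auto)
    also have "... = \<delta> / (1 - \<delta>) * (norm G / norm Q)"
      using \<rho> False \<delta> by (simp add: power2_eq_square field_simps)
    finally have a2: "\<bar>1 - \<alpha> * \<rho>\<bar> \<le> \<delta> / (1 - \<delta>) * (norm G / norm Q)" .
    have "norm ((1 - \<alpha> * \<rho>) *\<^sub>R Q) \<le> \<delta> / (1 - \<delta>) * (norm G / norm Q) * norm Q"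
      using mult_right_mono[OF a2 norm_ge_zero[of Q]] by (simp only: norm_scaleR)
    also have "... = \<delta> / (1 - \<delta>) * norm G" using False by simp
    also have "... \<le> 1 / 99 * norm G" using \<delta> by (intro mult_right_mono) (auto simp: field_simps)
    finally show ?thesis .
  qed
  have bY: "norm (\<beta> *\<^sub>R y) \<le> 7 / 20 * norm q"
  proof -
    \<comment> \<open>\<open>1 / 3\<close> divided by
      \<open>1 - \<delta> \<ge> 99 / 100\<close>.\<close>
    have "?\<kappa> * k2 \<le> 7 / 20" using k \<delta> by (simp add: field_simps)
    moreover have "norm (\<beta> *\<^sub>R y) \<le> ?\<kappa> * k2 * norm y"
      using mult_right_mono[OF conjunct2[OF b] norm_ge_zero[of y]] by (simp only: norm_scaleR)
    moreover have "?\<kappa> * k2 * norm y \<le> 7 / 20 * norm y" using calculation(1) by (intro mult_right_mono) auto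
    moreover have "norm y \<le> norm q" unfolding y_def by (rule Pc)
    ultimately show ?thesis by linarith
  qed
  \<comment> \<open>Four sources of error: normal part, gradient deviation, momentum and step size.
    Those proportional to the current error add up to at most \<open>1 / 20\<close>.\<close>
  have "\<rho> *\<^sub>R (E - \<alpha> *\<^sub>R Q) = \<rho> *\<^sub>R (E - P E) - (G - \<rho> *\<^sub>R P E) - \<beta> *\<^sub>R y + (1 - \<alpha> * \<rho>) *\<^sub>R Q"
    unfolding Q_def by (simp add: algebra_simps)
  then have "norm (\<rho> *\<^sub>R (E - \<alpha> *\<^sub>R Q)) \<le> norm (\<rho> *\<^sub>R (E - P E)) + norm (G - \<rho> *\<^sub>R P E) + norm (\<beta> *\<^sub>R y) + norm ((1 - \<alpha> * \<rho>) *\<^sub>R Q)"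
    by (smt (verit) norm_triangle_ineq norm_triangle_ineq4)
  also have "... \<le> \<rho> * (\<zeta> * ?e) + (\<delta> + \<zeta>) * \<rho> * ?e + 7 / 20 * norm q + 1 / 99 * (51 / 50 * \<rho> * ?e)"
    using E1 GE bY \<alpha> Gup' \<rho> by (intro add_mono) auto
  also have "... = (2 * \<zeta> + \<delta> + 51 / 4950) * (\<rho> * ?e) + 7 / 20 * norm q" by (simp add: algebra_simps)
  also have "(2 * \<zeta> + \<delta> + 51 / 4950) * (\<rho> * ?e) \<le> 1 / 20 * (\<rho> * ?e)"
    using \<delta> \<zeta> \<rho> by (intro mult_right_mono) auto
  finally have "\<rho> * norm (E - \<alpha> *\<^sub>R Q) \<le> 1 / 20 * (\<rho> * ?e) + 7 / 20 * norm q" using \<rho> by simp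
  then show "norm (E - \<alpha> *\<^sub>R Q) \<le> 1 / 20 * norm E + 7 / 20 * norm q / \<rho>"
    using \<rho> by (simp add: field_simps)
qed

section \<open>The discrete cosine transform\<close>

text \<open>Multiplication by \<open>2 * sin a\<close> makes the sum telescope.\<close>

lemma cos_odd_sum:
  assumes "sin a \<noteq> 0" "sin (2 * real n * a) = 0"
  shows "(\<Sum>c<n. cos ((2 * real c + 1) * a)) = 0"
proof -
  have "2 * sin a * (\<Sum>c<m. cos ((2 * real c + 1) * a)) = sin (2 * real m * a)" for m
  proof (induction m)
    case (Suc m)
    have "2 * sin a * cos ((2 * real m + 1) * a) = sin (a + (2 * real m + 1) * a) + sin (a - (2 * real m + 1) * a)"
      by (simp add: sin_add sin_diff)
    also have "a - (2 * real m + 1) * a = - (2 * real m * a)" by (simp add: algebra_simps)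
    also have "a + (2 * real m + 1) * a = 2 * real (Suc m) * a" by (simp add: algebra_simps)
    finally have "2 * sin a * cos ((2 * real m + 1) * a) = sin (2 * real (Suc m) * a) - sin (2 * real m * a)" by simp
    then show ?case using Suc by (simp add: distrib_left)
  qed simp
  from this[of n] show ?thesis using assms by simp
qed

lemma cos_odd_sum_pi:
  assumes "0 < j" "j < 2 * n"
  shows "(\<Sum>c<n. cos (pi * real j * (2 * real c + 1) / (2 * real n))) = 0"
proof -
  let ?a = "pi * real j / (2 * real n)"
  have n: "n > 0" using assms by auto
  have "0 < ?a" using assms n by simp
  moreover have "?a < pi" using assms n by (simp add: field_simps)
  ultimately have "sin ?a > 0" by (rule sin_gt_zero)
  moreover have "sin (2 * real n * ?a) = 0"
  proof -
    have "2 * real n * ?a = real j * pi" using n by simp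
    then show ?thesis by (simp add: sin_npi)
  qed
  ultimately have "(\<Sum>c<n. cos ((2 * real c + 1) * ?a)) = 0" by (intro cos_odd_sum) auto
  then show ?thesis by (simp add: mult_ac)
qed

lemma dct_carrier [simp]: "dct n \<in> carrier_mat n n"
  by (simp add: dct_def)

lemma dct_entry: "k < n \<Longrightarrow> c < n \<Longrightarrow> dct n $$ (k, c) =
    sqrt ((if k = 0 then 1 else 2) / real n) * cos (pi * real k * (2 * real c + 1) / (2 * real n))"
  by (simp add: dct_def add.commute)

text \<open>The product-to-sum formula reduces the inner product of two rows to
  \<open>cos_odd_sum_pi\<close> for \<open>k - l\<close> and \<open>k + l\<close>, each of which is
  either \<open>0\<close> or strictly between \<open>0\<close> and \<open>2 * n\<close>. Ordering
  \<open>k\<close> and \<open>l\<close> keeps the difference a natural number.\<close>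

lemma dct_rows:
  assumes k: "k < n" and l: "l < n"
  shows "(\<Sum>c<n. dct n $$ (k, c) * dct n $$ (l, c)) = (if k = l then 1 else 0)"
proof -
  have n: "n > 0" using k by auto
  let ?s = "\<lambda>k. sqrt ((if k = (0::nat) then 1 else 2) / real n)"
  let ?C = "\<lambda>j. \<Sum>c<n. cos (pi * real j * (2 * real c + 1) / (2 * real n))"
  have wlog: "(\<Sum>c<n. dct n $$ (k, c) * dct n $$ (l, c)) = (if k = l then 1 else 0)" if "l \<le> k" "k < n" for k l
  proof -
    have "(\<Sum>c<n. dct n $$ (k, c) * dct n $$ (l, c)) = (\<Sum>c<n. ?s k * ?s l / 2 *
        (cos (pi * real (k - l) * (2 * real c + 1) / (2 * real n)) + cos (pi * real (k + l) * (2 * real c + 1) / (2 * real n))))"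
    proof (rule sum.cong[OF refl])
      fix c assume c: "c \<in> {..<n}"
      let ?x = "pi * real k * (2 * real c + 1) / (2 * real n)" and ?y = "pi * real l * (2 * real c + 1) / (2 * real n)"
      have "pi * real (k - l) * (2 * real c + 1) / (2 * real n) = ?x - ?y" "pi * real (k + l) * (2 * real c + 1) / (2 * real n) = ?x + ?y"
        using that by (simp_all add: of_nat_diff algebra_simps diff_divide_distrib add_divide_distrib)
      then show "dct n $$ (k, c) * dct n $$ (l, c) = ?s k * ?s l / 2 *
        (cos (pi * real (k - l) * (2 * real c + 1) / (2 * real n)) + cos (pi * real (k + l) * (2 * real c + 1) / (2 * real n)))"
        using c that by (simp add: dct_entry cos_add cos_diff)
    qed
    also have "... = ?s k * ?s l / 2 * (?C (k - l) + ?C (k + l))"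
      by (simp only: sum_distrib_left[symmetric] sum.distrib)
    also have "... = (if k = l then 1 else 0)"
    proof (cases "k = l")
      case True
      have c0: "?C (k - l) = real n" using True by simp
      have ss: "?s k * ?s k = (if k = 0 then 1 else 2) / real n"
        using n by (simp add: real_sqrt_mult_self)
      show ?thesis
      proof (cases "k = 0")
        case True
        then show ?thesis using \<open>k = l\<close> ss n by simp
      next
        case False
        then have c: "?C (k + l) = 0" using \<open>k = l\<close> that by (intro cos_odd_sum_pi) auto
        show ?thesis unfolding c0 c using \<open>k = l\<close> ss n False by simp
      qed
    next
      case False
      then have c: "?C (k + l) = 0" "?C (k - l) = 0" using that by (intro cos_odd_sum_pi; simp)+
      show ?thesis unfolding c using False by simp
    qed
    finally show ?thesis .
  qed
  show ?thesis
  proof (cases "l \<le> k")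
    case True then show ?thesis using wlog k by blast
  next
    case False
    then show ?thesis using wlog[of k l] l by (simp add: mult.commute)
  qed
qed

text \<open>A one-sided inverse of a square matrix is two-sided.\<close>

lemma dct_cols:
  assumes c: "c < n" and d: "d < n"
  shows "(\<Sum>k<n. dct n $$ (k, c) * dct n $$ (k, d)) = (if c = d then 1 else 0)"
proof -
  let ?D = "dct n"
  have "?D * transpose_mat ?D = 1\<^sub>m n"
    by (rule eq_matI) (auto simp: scalar_prod_def dct_rows lessThan_atLeast0[symmetric] carrier_matD[OF dct_carrier])
  then have "transpose_mat ?D * ?D = 1\<^sub>m n"
    by (rule mat_mult_left_right_inverse[rotated 2]) auto
  then have "(transpose_mat ?D * ?D) $$ (c, d) = (if c = d then 1 else 0)" using c d by simp
  then show ?thesis using c d by (simp add: scalar_prod_def lessThan_atLeast0 carrier_matD[OF dct_carrier])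
qed

text \<open>Flatness of the transform: a tensor with a single nonzero entry is spread over all
  slices. This is the source of the factor \<open>2 / n3\<close> in the coherence estimates.\<close>

lemma dct_abs: "k < n \<Longrightarrow> c < n \<Longrightarrow> \<bar>dct n $$ (k, c)\<bar> \<le> sqrt (2 / real n)"
proof -
  assume k: "k < n" "c < n"
  have "\<bar>dct n $$ (k, c)\<bar> \<le> sqrt ((if k = 0 then 1 else 2) / real n) * 1"
    unfolding dct_entry[OF k] abs_mult by (intro mult_mono) auto
  also have "... \<le> sqrt (2 / real n)" by (auto intro: divide_right_mono)
  finally show ?thesis .
qed

section \<open>Tensors as block diagonal matrices\<close>

type_synonym bmat = "(nat \<times> nat) fmat"

lemma tensorsD:
  assumes "A \<in> tensors n1 n2 n3"
  shows "dim_vec A = n3" "dim3 A = n3" "k < n3 \<Longrightarrow> A $ k \<in> carrier_mat n1 n2"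
    "0 < n3 \<Longrightarrow> dim1 A = n1" "0 < n3 \<Longrightarrow> dim2 A = n2"
    "k < n3 \<Longrightarrow> dim_row (A $ k) = n1" "k < n3 \<Longrightarrow> dim_col (A $ k) = n2"
  using assms by (auto simp: tensors_def dim1_def dim2_def dim3_def)

lemma tensorsI:
  assumes "dim_vec A = n3" "\<And>k. k < n3 \<Longrightarrow> A $ k \<in> carrier_mat n1 n2"
  shows "A \<in> tensors n1 n2 n3"
  using assms by (auto simp: tensors_def)

lemma tensor_eqI:
  assumes A: "A \<in> tensors n1 n2 n3" and B: "B \<in> tensors n1 n2 n3"
    and "\<And>k i j. k < n3 \<Longrightarrow> i < n1 \<Longrightarrow> j < n2 \<Longrightarrow> A $ k $$ (i, j) = B $ k $$ (i, j)"
  shows "A = B"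
proof (rule eq_vecI)
  show "dim_vec A = dim_vec B" using tensorsD[OF A] tensorsD[OF B] by simp
  fix k assume "k < dim_vec B"
  then have k: "k < n3" using tensorsD[OF B] by simp
  show "A $ k = B $ k"
    by (rule eq_matI) (use assms(3)[OF k] tensorsD[OF A] tensorsD[OF B] k in auto)
qed

context
  fixes n1 n2 n3 :: nat
  assumes n3: "0 < n3"
begin

lemma apply_tubes_tensor:
  assumes A: "A \<in> tensors n1 n2 n3" and D: "D \<in> carrier_mat n3 n3"
  shows "apply_tubes D A \<in> tensors n1 n2 n3"
    "k < n3 \<Longrightarrow> i < n1 \<Longrightarrow> j < n2 \<Longrightarrow> apply_tubes D A $ k $$ (i, j) = (\<Sum>c<n3. D $$ (k, c) * A $ c $$ (i, j))"
  using D n3 tensorsD[OF A]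
  by (auto simp: apply_tubes_def tensors_def tube_def scalar_prod_def lessThan_atLeast0)

lemma hat_tensor:
  assumes A: "A \<in> tensors n1 n2 n3"
  shows "hat A \<in> tensors n1 n2 n3"
    "k < n3 \<Longrightarrow> i < n1 \<Longrightarrow> j < n2 \<Longrightarrow> hat A $ k $$ (i, j) = (\<Sum>c<n3. dct n3 $$ (k, c) * A $ c $$ (i, j))"
  unfolding hat_def tensorsD(2)[OF A] by (rule apply_tubes_tensor[OF A], simp)+

lemma unhat_tensor:
  assumes A: "A \<in> tensors n1 n2 n3"
  shows "unhat A \<in> tensors n1 n2 n3"
    "k < n3 \<Longrightarrow> i < n1 \<Longrightarrow> j < n2 \<Longrightarrow> unhat A $ k $$ (i, j) = (\<Sum>c<n3. dct n3 $$ (c, k) * A $ c $$ (i, j))"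
proof -
  have D: "transpose_mat (dct n3) \<in> carrier_mat n3 n3" by simp
  show "unhat A \<in> tensors n1 n2 n3"
    unfolding unhat_def tensorsD(2)[OF A] by (rule apply_tubes_tensor[OF A D])
  assume k: "k < n3" "i < n1" "j < n2"
  show "unhat A $ k $$ (i, j) = (\<Sum>c<n3. dct n3 $$ (c, k) * A $ c $$ (i, j))"
    unfolding unhat_def tensorsD(2)[OF A] apply_tubes_tensor(2)[OF A D k]
    by (rule sum.cong) (use k carrier_matD[OF dct_carrier[of n3]] in auto)
qed

lemma hat_unhat:
  assumes A: "A \<in> tensors n1 n2 n3"
  shows "hat (unhat A) = A" "unhat (hat A) = A"
proof -
  have swap: "(\<Sum>c<n3. f c * (\<Sum>d<n3. g c d * h d)) = (\<Sum>d<n3. (\<Sum>c<n3. f c * g c d) * h d)" for f h :: "nat \<Rightarrow> real" and g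
    unfolding sum_distrib_left sum_distrib_right by (subst sum.swap) (simp only: mult.assoc)
  note U = unhat_tensor[OF A] and H = hat_tensor[OF A]
  show "hat (unhat A) = A"
  proof (rule tensor_eqI[OF hat_tensor(1)[OF U(1)] A])
    fix k i j assume k: "k < n3" "i < n1" "j < n2"
    have "hat (unhat A) $ k $$ (i, j) = (\<Sum>c<n3. dct n3 $$ (k, c) * (\<Sum>d<n3. dct n3 $$ (d, c) * A $ d $$ (i, j)))"
      using k by (simp add: hat_tensor(2)[OF U(1)] U(2))
    also have "... = (\<Sum>d<n3. (if d = k then 1 else 0) * A $ d $$ (i, j))"
      unfolding swap by (rule sum.cong) (use k dct_rows in auto)
    also have "... = A $ k $$ (i, j)" using k by (simp add: if_distrib[of "\<lambda>x. x * _"] cong: if_cong)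
    finally show "hat (unhat A) $ k $$ (i, j) = A $ k $$ (i, j)" .
  qed
  show "unhat (hat A) = A"
  proof (rule tensor_eqI[OF unhat_tensor(1)[OF H(1)] A])
    fix k i j assume k: "k < n3" "i < n1" "j < n2"
    have "unhat (hat A) $ k $$ (i, j) = (\<Sum>c<n3. dct n3 $$ (c, k) * (\<Sum>d<n3. dct n3 $$ (c, d) * A $ d $$ (i, j)))"
      using k by (simp add: unhat_tensor(2)[OF H(1)] H(2))
    also have "... = (\<Sum>d<n3. (if d = k then 1 else 0) * A $ d $$ (i, j))"
      unfolding swap by (rule sum.cong) (use k dct_cols in auto)
    also have "... = A $ k $$ (i, j)" using k by (simp add: if_distrib[of "\<lambda>x. x * _"] cong: if_cong)
    finally show "unhat (hat A) $ k $$ (i, j) = A $ k $$ (i, j)" .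
  qed
qed

end

definition blk :: "nat \<Rightarrow> nat \<Rightarrow> nat \<Rightarrow> (nat \<Rightarrow> nat \<Rightarrow> nat \<Rightarrow> real) \<Rightarrow> bmat" where
  "blk n1 n2 n3 f = (\<Sum>k<n3. \<Sum>i<n1. \<Sum>j<n2. f k i j *\<^sub>R fE (k, i) (k, j))"

lemma ent_blk: "ent (blk n1 n2 n3 f) (k, i) (l, j) = (if k = l \<and> k < n3 \<and> i < n1 \<and> j < n2 then f k i j else 0)"
proof -
  have eq: "ent (blk n1 n2 n3 f) (k, i) (l, j) = (\<Sum>k'<n3. \<Sum>i'<n1. \<Sum>j'<n2.
      if j' = j then if i' = i then if k' = k then if k = l then f k i j else 0 else 0 else 0 else 0)"
    unfolding blk_def ent_sum by (intro sum.cong refl) auto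
  show ?thesis
  proof (cases "k = l \<and> k < n3 \<and> i < n1 \<and> j < n2")
    case True
    then show ?thesis unfolding eq by simp
  next
    case False
    have "(\<Sum>k'<n3. \<Sum>i'<n1. \<Sum>j'<n2.
      if j' = j then if i' = i then if k' = k then if k = l then f k i j else 0 else 0 else 0 else 0) = 0"
      using False by (intro sum.neutral ballI) auto
    then show ?thesis unfolding eq using False by auto
  qed
qed

lemma inner_blk: "inner (blk n1 n2 n3 f) F = (\<Sum>k<n3. \<Sum>i<n1. \<Sum>j<n2. f k i j * ent F (k, i) (k, j))"
  unfolding blk_def by (simp add: inner_sum_left)

text \<open>The block diagonal matrix of the frontal slices in the DCT domain; rows and columns are indexed by pairs of a
  slice and an index in it. In contrast to \<open>bar\<close>, no index arithmetic is needed.\<close>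

definition Phi :: "tensor \<Rightarrow> bmat" where
  "Phi A = blk (dim1 A) (dim2 A) (dim3 A) (\<lambda>k i j. hat A $ k $$ (i, j))"

lemma Phi_tensor: "0 < n3 \<Longrightarrow> A \<in> tensors n1 n2 n3 \<Longrightarrow> Phi A = blk n1 n2 n3 (\<lambda>k i j. hat A $ k $$ (i, j))"
  by (simp add: Phi_def tensorsD)

lemma blk_eqI:
  "(\<And>k i j. k < n3 \<Longrightarrow> i < n1 \<Longrightarrow> j < n2 \<Longrightarrow> f k i j = g k i j) \<Longrightarrow> blk n1 n2 n3 f = blk n1 n2 n3 g"
  unfolding blk_def by (intro sum.cong refl) auto

lemma blk_linear:
  "blk n1 n2 n3 f + blk n1 n2 n3 g = blk n1 n2 n3 (\<lambda>k i j. f k i j + g k i j)"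
  "blk n1 n2 n3 f - blk n1 n2 n3 g = blk n1 n2 n3 (\<lambda>k i j. f k i j - g k i j)"
  "c *\<^sub>R blk n1 n2 n3 f = blk n1 n2 n3 (\<lambda>k i j. c * f k i j)"
  by (rule fmat_eqI; auto simp: ent_blk)+

lemma ftr_blk: "ftr (blk n1 n2 n3 f) = blk n2 n1 n3 (\<lambda>k i j. f k j i)"
  by (rule fmat_eqI) (auto simp: ent_blk)

lemma blk_mult: "blk a b n3 f * blk b c n3 g = blk a c n3 (\<lambda>k i j. \<Sum>l<b. f k i l * g k l j)"
proof (rule fmat_eqI)
  fix p q :: "nat \<times> nat"
  obtain k i l j where pq: "p = (k, i)" "q = (l, j)" by (metis surj_pair)
  have "ent (blk a b n3 f * blk b c n3 g) p q = (\<Sum>x\<in>{k} \<times> {..<b}. ent (blk a b n3 f) p x * ent (blk b c n3 g) x q)"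
    by (rule ent_times) (auto simp: pq ent_blk split: if_splits)
  also have "... = (\<Sum>x<b. ent (blk a b n3 f) p (k, x) * ent (blk b c n3 g) (k, x) q)"
  proof -
    have "{k} \<times> {..<b} = Pair k ` {..<b}" by auto
    then show ?thesis by (simp add: sum.reindex inj_on_def)
  qed
  also have "... = ent (blk a c n3 (\<lambda>k i j. \<Sum>l<b. f k i l * g k l j)) p q"
    by (auto simp: pq ent_blk intro!: sum.cong)
  finally show "ent (blk a b n3 f * blk b c n3 g) p q = ent (blk a c n3 (\<lambda>k i j. \<Sum>l<b. f k i l * g k l j)) p q" .
qed

lemma tensor_ops:
  assumes "A \<in> tensors n1 n2 n3" "B \<in> tensors n1 n2 n3"
  shows "A + B \<in> tensors n1 n2 n3" "A - B \<in> tensors n1 n2 n3" "c \<cdot>\<^sub>t A \<in> tensors n1 n2 n3" "tzero n1 n2 n3 \<in> tensors n1 n2 n3"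
    "k < n3 \<Longrightarrow> i < n1 \<Longrightarrow> j < n2 \<Longrightarrow> (A + B) $ k $$ (i, j) = A $ k $$ (i, j) + B $ k $$ (i, j)"
    "k < n3 \<Longrightarrow> i < n1 \<Longrightarrow> j < n2 \<Longrightarrow> (A - B) $ k $$ (i, j) = A $ k $$ (i, j) - B $ k $$ (i, j)"
    "k < n3 \<Longrightarrow> i < n1 \<Longrightarrow> j < n2 \<Longrightarrow> (c \<cdot>\<^sub>t A) $ k $$ (i, j) = c * A $ k $$ (i, j)"
    "k < n3 \<Longrightarrow> i < n1 \<Longrightarrow> j < n2 \<Longrightarrow> tzero n1 n2 n3 $ k $$ (i, j) = 0"
proof -
  note A = tensorsD[OF assms(1)] and B = tensorsD[OF assms(2)]
  show "A + B \<in> tensors n1 n2 n3" "A - B \<in> tensors n1 n2 n3" "c \<cdot>\<^sub>t A \<in> tensors n1 n2 n3" "tzero n1 n2 n3 \<in> tensors n1 n2 n3"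
    using A B by (auto intro!: tensorsI simp: tscale_def tzero_def)
  assume k: "k < n3" "i < n1" "j < n2"
  show "(A + B) $ k $$ (i, j) = A $ k $$ (i, j) + B $ k $$ (i, j)"
    "(A - B) $ k $$ (i, j) = A $ k $$ (i, j) - B $ k $$ (i, j)"
    "(c \<cdot>\<^sub>t A) $ k $$ (i, j) = c * A $ k $$ (i, j)" "tzero n1 n2 n3 $ k $$ (i, j) = 0"
    using A B k by (auto simp: tscale_def tzero_def)
qed

context
  fixes n3 :: nat
  assumes n3: "0 < n3"
begin

lemma hat_ops:
  assumes A: "A \<in> tensors n1 n2 n3" and B: "B \<in> tensors n1 n2 n3" and k: "k < n3" "i < n1" "j < n2"
  shows "hat (A + B) $ k $$ (i, j) = hat A $ k $$ (i, j) + hat B $ k $$ (i, j)"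
    "hat (A - B) $ k $$ (i, j) = hat A $ k $$ (i, j) - hat B $ k $$ (i, j)"
    "hat (c \<cdot>\<^sub>t A) $ k $$ (i, j) = c * hat A $ k $$ (i, j)"
    "hat (tzero n1 n2 n3) $ k $$ (i, j) = 0"
proof -
  note T = tensor_ops[OF A B]
  note H = hat_tensor(2)[OF n3 _ k]
  show "hat (A + B) $ k $$ (i, j) = hat A $ k $$ (i, j) + hat B $ k $$ (i, j)"
    unfolding H[OF T(1)] H[OF A] H[OF B] sum.distrib[symmetric]
    by (rule sum.cong) (use k in \<open>simp_all add: T(5) distrib_left\<close>)
  show "hat (A - B) $ k $$ (i, j) = hat A $ k $$ (i, j) - hat B $ k $$ (i, j)"
    unfolding H[OF T(2)] H[OF A] H[OF B] sum_subtractf[symmetric]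
    by (rule sum.cong) (use k in \<open>simp_all add: T(6) right_diff_distrib\<close>)
  show "hat (c \<cdot>\<^sub>t A) $ k $$ (i, j) = c * hat A $ k $$ (i, j)"
    unfolding H[OF T(3)] H[OF A] sum_distrib_left
    by (rule sum.cong) (use k in \<open>simp_all add: T(7)\<close>)
  show "hat (tzero n1 n2 n3) $ k $$ (i, j) = 0"
    unfolding H[OF T(4)] by (rule sum.neutral) (use k in \<open>simp add: T(8)\<close>)
qed

lemma Phi_ops:
  assumes A: "A \<in> tensors n1 n2 n3" and B: "B \<in> tensors n1 n2 n3"
  shows "Phi (A + B) = Phi A + Phi B" "Phi (A - B) = Phi A - Phi B" "Phi (c \<cdot>\<^sub>t A) = c *\<^sub>R Phi A"
    "Phi (tzero n1 n2 n3) = 0"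
proof -
  note T = tensor_ops(1-4)[OF A B]
  show "Phi (A + B) = Phi A + Phi B" "Phi (A - B) = Phi A - Phi B" "Phi (c \<cdot>\<^sub>t A) = c *\<^sub>R Phi A"
    unfolding Phi_tensor[OF n3 A] Phi_tensor[OF n3 B] Phi_tensor[OF n3 T(1)] Phi_tensor[OF n3 T(2)]
      Phi_tensor[OF n3 T(3)] blk_linear
    by (rule blk_eqI; simp add: hat_ops[OF A B])+
  show "Phi (tzero n1 n2 n3) = 0"
    unfolding Phi_tensor[OF n3 T(4)] by (rule fmat_eqI) (auto simp: ent_blk hat_ops[OF A B])
qed

lemma Phi_hat:
  assumes "A \<in> tensors n1 n2 n3"
  shows "Phi (unhat A) = blk n1 n2 n3 (\<lambda>k i j. A $ k $$ (i, j))"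
  using Phi_tensor[OF n3 unhat_tensor(1)[OF n3 assms]] hat_unhat(1)[OF n3 assms] by simp

lemma Phi_inj:
  assumes A: "A \<in> tensors n1 n2 n3" and B: "B \<in> tensors n1 n2 n3" and eq: "Phi A = Phi B"
  shows "A = B"
proof -
  have "hat A = hat B"
  proof (rule tensor_eqI[OF hat_tensor(1)[OF n3 A] hat_tensor(1)[OF n3 B]])
    fix k i j assume k: "k < n3" "i < n1" "j < n2"
    have "ent (Phi A) (k, i) (k, j) = ent (Phi B) (k, i) (k, j)" using eq by simp
    then show "hat A $ k $$ (i, j) = hat B $ k $$ (i, j)"
      using k by (simp add: Phi_tensor[OF n3 A] Phi_tensor[OF n3 B] ent_blk)
  qed
  then have "unhat (hat A) = unhat (hat B)" by (rule arg_cong)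
  then show ?thesis unfolding hat_unhat(2)[OF n3 A] hat_unhat(2)[OF n3 B] .
qed

text \<open>Parseval in every tube, by orthogonality of the transform.\<close>

lemma tinner_Phi:
  assumes A: "A \<in> tensors n1 n2 n3" and B: "B \<in> tensors n1 n2 n3"
  shows "tinner A B = inner (Phi A) (Phi B)"
proof -
  have cell: "(\<Sum>k<n3. hat A $ k $$ (i, j) * hat B $ k $$ (i, j)) = (\<Sum>c<n3. A $ c $$ (i, j) * B $ c $$ (i, j))"
    if ij: "i < n1" "j < n2" for i j
  proof -
    let ?a = "\<lambda>c. A $ c $$ (i, j)" and ?b = "\<lambda>c. B $ c $$ (i, j)" and ?D = "\<lambda>k c. dct n3 $$ (k, c)"
    have "(\<Sum>k<n3. hat A $ k $$ (i, j) * hat B $ k $$ (i, j)) = (\<Sum>k<n3. \<Sum>c<n3. \<Sum>d<n3. (?D k c * ?D k d) * (?a c * ?b d))"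
      by (rule sum.cong) (use ij in \<open>simp_all add: hat_tensor(2)[OF n3 A] hat_tensor(2)[OF n3 B] sum_product mult_ac\<close>)
    also have "... = (\<Sum>c<n3. \<Sum>d<n3. \<Sum>k<n3. (?D k c * ?D k d) * (?a c * ?b d))"
      by (subst sum.swap) (rule sum.cong[OF refl sum.swap])
    also have "... = (\<Sum>c<n3. \<Sum>d<n3. if d = c then ?a c * ?b c else 0)"
      unfolding sum_distrib_right[symmetric] by (intro sum.cong refl) (use dct_cols in auto)
    finally show ?thesis by simp
  qed
  have "inner (Phi A) (Phi B) = (\<Sum>k<n3. \<Sum>i<n1. \<Sum>j<n2. hat A $ k $$ (i, j) * hat B $ k $$ (i, j))"
    unfolding Phi_tensor[OF n3 A] inner_blk
    by (intro sum.cong refl) (simp add: Phi_tensor[OF n3 B] ent_blk)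
  also have "... = (\<Sum>i<n1. \<Sum>j<n2. \<Sum>k<n3. hat A $ k $$ (i, j) * hat B $ k $$ (i, j))"
    by (subst sum.swap) (rule sum.cong[OF refl sum.swap])
  also have "... = (\<Sum>i<n1. \<Sum>j<n2. \<Sum>k<n3. A $ k $$ (i, j) * B $ k $$ (i, j))"
    by (rule sum.cong[OF refl], rule sum.cong[OF refl]) (use cell in auto)
  also have "... = (\<Sum>k<n3. \<Sum>i<n1. \<Sum>j<n2. A $ k $$ (i, j) * B $ k $$ (i, j))"
    by (subst (2) sum.swap) (rule sum.cong[OF refl sum.swap])
  finally show ?thesis unfolding tinner_def using n3 by (simp add: tensorsD[OF A])
qed

lemma tnorm_Phi: "A \<in> tensors n1 n2 n3 \<Longrightarrow> tnorm A = norm (Phi A)"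
  by (simp add: tnorm_def tinner_Phi norm_eq_sqrt_inner)

lemma tprod_Phi:
  assumes A: "A \<in> tensors a b n3" and B: "B \<in> tensors b c n3"
  shows "A *\<^sub>t B \<in> tensors a c n3" "Phi (A *\<^sub>t B) = Phi A * Phi B"
proof -
  let ?C = "vec n3 (\<lambda>k. hat A $ k * hat B $ k)"
  have C: "?C \<in> tensors a c n3"
    using tensorsD[OF hat_tensor(1)[OF n3 A]] tensorsD[OF hat_tensor(1)[OF n3 B]] by (intro tensorsI) auto
  have eq: "A *\<^sub>t B = unhat ?C" unfolding tprod_def tensorsD(2)[OF A] ..
  show "A *\<^sub>t B \<in> tensors a c n3" unfolding eq by (rule unhat_tensor(1)[OF n3 C])
  have "?C $ k $$ (i, j) = (\<Sum>l<b. hat A $ k $$ (i, l) * hat B $ k $$ (l, j))" if "k < n3" "i < a" "j < c" for k i j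
    using that tensorsD[OF hat_tensor(1)[OF n3 A]] tensorsD[OF hat_tensor(1)[OF n3 B]]
    by (auto simp: scalar_prod_def lessThan_atLeast0 intro!: sum.cong)
  then show "Phi (A *\<^sub>t B) = Phi A * Phi B"
    unfolding eq Phi_hat[OF C] Phi_tensor[OF n3 A] Phi_tensor[OF n3 B] blk_mult by (intro blk_eqI)
qed

lemma ttranspose_Phi:
  assumes A: "A \<in> tensors a b n3"
  shows "ttranspose A \<in> tensors b a n3" "Phi (ttranspose A) = ftr (Phi A)"
proof -
  let ?C = "map_vec transpose_mat (hat A)"
  have C: "?C \<in> tensors b a n3"
    using tensorsD[OF hat_tensor(1)[OF n3 A]] by (intro tensorsI) auto
  show "ttranspose A \<in> tensors b a n3" unfolding ttranspose_def by (rule unhat_tensor(1)[OF n3 C])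
  show "Phi (ttranspose A) = ftr (Phi A)"
    unfolding ttranspose_def Phi_hat[OF C] Phi_tensor[OF n3 A] ftr_blk
    by (rule blk_eqI) (use tensorsD[OF hat_tensor(1)[OF n3 A]] in auto)
qed

lemma basis_tensor_in: "basis_tensor n1 n2 n3 \<omega> \<in> tensors n1 n2 n3"
  by (cases \<omega>) (auto simp: basis_tensor_def intro!: tensorsI)

lemma tinner_basis:
  assumes "Z \<in> tensors n1 n2 n3" "i < n1" "j < n2" "k < n3"
  shows "tinner (basis_tensor n1 n2 n3 (i, j, k)) Z = Z $ k $$ (i, j)"
proof -
  note E = tensorsD[OF basis_tensor_in[of n1 n2 "(i, j, k)"]]
  have "tinner (basis_tensor n1 n2 n3 (i, j, k)) Z =
     (\<Sum>c<n3. \<Sum>a<n1. \<Sum>b<n2. if b = j then if a = i \<and> c = k then Z $ k $$ (i, j) else 0 else 0)"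
    unfolding tinner_def E(2) E(4)[OF n3] E(5)[OF n3]
    by (intro sum.cong refl) (auto simp: basis_tensor_def)
  also have "... = (\<Sum>c<n3. \<Sum>a<n1. if a = i then if c = k then Z $ k $$ (i, j) else 0 else 0)"
    using assms by (intro sum.cong refl) auto
  also have "... = Z $ k $$ (i, j)" using assms by simp
  finally show ?thesis .
qed

lemma sampling_Phi:
  assumes Z: "Z \<in> tensors n1 n2 n3"
  shows "sampling_op \<Omega> Z \<in> tensors n1 n2 n3"
    "Phi (sampling_op \<Omega> Z) = sum_list (map (\<lambda>\<omega>. inner (Phi (basis_tensor n1 n2 n3 \<omega>)) (Phi Z) *\<^sub>R Phi (basis_tensor n1 n2 n3 \<omega>)) \<Omega>)"
proof -
  let ?E = "basis_tensor n1 n2 n3"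
  let ?f = "\<lambda>\<Omega>. foldr (\<lambda>\<omega> Y. tinner (?E \<omega>) Z \<cdot>\<^sub>t ?E \<omega> + Y) \<Omega> (tzero n1 n2 n3)"
  have eq: "sampling_op \<Omega> Z = ?f \<Omega>"
    unfolding sampling_op_def Let_def tensorsD(2)[OF Z] tensorsD(4)[OF Z n3] tensorsD(5)[OF Z n3] ..
  have "?f \<Omega> \<in> tensors n1 n2 n3 \<and> Phi (?f \<Omega>) = sum_list (map (\<lambda>\<omega>. inner (Phi (?E \<omega>)) (Phi Z) *\<^sub>R Phi (?E \<omega>)) \<Omega>)"
  proof (induction \<Omega>)
    case Nil
    then show ?case using tensor_ops(4)[OF Z Z] Phi_ops(4)[OF Z Z] by simp
  next
    case (Cons \<omega> \<Omega>)
    have s: "tinner (?E \<omega>) Z \<cdot>\<^sub>t ?E \<omega> \<in> tensors n1 n2 n3" by (rule tensor_ops(3)[OF basis_tensor_in basis_tensor_in])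
    have IH: "?f \<Omega> \<in> tensors n1 n2 n3" using Cons by blast
    have sc: "Phi (tinner (?E \<omega>) Z \<cdot>\<^sub>t ?E \<omega>) = tinner (?E \<omega>) Z *\<^sub>R Phi (?E \<omega>)"
      by (rule Phi_ops(3)[OF basis_tensor_in basis_tensor_in])
    show ?case
      using tensor_ops(1)[OF s IH] Cons Phi_ops(1)[OF s IH] sc
      by (simp add: tinner_Phi[OF basis_tensor_in Z])
  qed
  then show "sampling_op \<Omega> Z \<in> tensors n1 n2 n3"
    "Phi (sampling_op \<Omega> Z) = sum_list (map (\<lambda>\<omega>. inner (Phi (?E \<omega>)) (Phi Z) *\<^sub>R Phi (?E \<omega>)) \<Omega>)"
    unfolding eq by auto
qed

lemma Phi_basis:
  assumes "i < n1" "j < n2" "c < n3"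
  shows "Phi (basis_tensor n1 n2 n3 (i, j, c)) = (\<Sum>k<n3. dct n3 $$ (k, c) *\<^sub>R fE (k, i) (k, j))"
proof -
  have h: "hat (basis_tensor n1 n2 n3 (i, j, c)) $ k $$ (a, b) = (if a = i \<and> b = j then dct n3 $$ (k, c) else 0)"
    if "k < n3" "a < n1" "b < n2" for k a b
  proof -
    have "hat (basis_tensor n1 n2 n3 (i, j, c)) $ k $$ (a, b) = (\<Sum>d<n3. if d = c then (if a = i \<and> b = j then dct n3 $$ (k, c) else 0) else 0)"
      unfolding hat_tensor(2)[OF n3 basis_tensor_in that]
      by (rule sum.cong) (use that in \<open>auto simp: basis_tensor_def\<close>)
    then show ?thesis using assms by simp
  qed
  have pick: "(\<Sum>b<n2. (if b = j then d else 0) *\<^sub>R F b) = d *\<^sub>R F j" for d and F :: "nat \<Rightarrow> bmat"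
  proof -
    have "(\<Sum>b<n2. (if b = j then d else 0) *\<^sub>R F b) = (\<Sum>b<n2. if b = j then d *\<^sub>R F j else 0)"
      by (rule sum.cong) auto
    then show ?thesis using assms by simp
  qed
  have "Phi (basis_tensor n1 n2 n3 (i, j, c)) = blk n1 n2 n3 (\<lambda>k a b. if a = i \<and> b = j then dct n3 $$ (k, c) else 0)"
    unfolding Phi_tensor[OF n3 basis_tensor_in] by (rule blk_eqI) (simp add: h)
  also have "... = (\<Sum>k<n3. \<Sum>a<n1. if a = i then dct n3 $$ (k, c) *\<^sub>R fE (k, i) (k, j) else 0)"
    unfolding blk_def by (rule sum.cong[OF refl], rule sum.cong[OF refl]) (simp add: pick)
  also have "... = (\<Sum>k<n3. dct n3 $$ (k, c) *\<^sub>R fE (k, i) (k, j))"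
    using assms by (intro sum.cong refl) simp
  finally show ?thesis .
qed

lemma basis_orthon: "orthon (\<lambda>\<omega>. Phi (basis_tensor n1 n2 n3 \<omega>)) (index_set n1 n2 n3)"
  unfolding orthon_def
proof (intro conjI ballI)
  show "finite (index_set n1 n2 n3)" by (simp add: index_set_def)
  fix \<omega> \<omega>' assume "\<omega> \<in> index_set n1 n2 n3" "\<omega>' \<in> index_set n1 n2 n3"
  then obtain i j k i' j' k' where w: "\<omega> = (i, j, k)" "\<omega>' = (i', j', k')" "i < n1" "j < n2" "k < n3" "i' < n1" "j' < n2" "k' < n3"
    by (auto simp: index_set_def)
  have "inner (Phi (basis_tensor n1 n2 n3 \<omega>)) (Phi (basis_tensor n1 n2 n3 \<omega>')) = basis_tensor n1 n2 n3 \<omega>' $ k $$ (i, j)"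
    unfolding w tinner_Phi[OF basis_tensor_in basis_tensor_in, symmetric] by (rule tinner_basis[OF basis_tensor_in]) (use w in auto)
  also have "... = (if \<omega> = \<omega>' then 1 else 0)" using w by (auto simp: basis_tensor_def)
  finally show "inner (Phi (basis_tensor n1 n2 n3 \<omega>)) (Phi (basis_tensor n1 n2 n3 \<omega>')) = (if \<omega> = \<omega>' then 1 else 0)" .
qed

text \<open>The inverse transform writes each matrix unit of a diagonal block as a combination of
  the images of the entry tensors in one tube.\<close>

lemma blk_in_span: "blk n1 n2 n3 f \<in> span ((\<lambda>\<omega>. Phi (basis_tensor n1 n2 n3 \<omega>)) ` index_set n1 n2 n3)"
proof -
  have E: "fE (k, i) (k, j) = (\<Sum>c<n3. dct n3 $$ (k, c) *\<^sub>R Phi (basis_tensor n1 n2 n3 (i, j, c)))"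
    if "k < n3" "i < n1" "j < n2" for k i j
  proof -
    have "(\<Sum>c<n3. dct n3 $$ (k, c) *\<^sub>R Phi (basis_tensor n1 n2 n3 (i, j, c))) =
        (\<Sum>c<n3. \<Sum>l<n3. (dct n3 $$ (k, c) * dct n3 $$ (l, c)) *\<^sub>R fE (l, i) (l, j))"
      by (rule sum.cong) (use that in \<open>simp_all add: Phi_basis scaleR_sum_right\<close>)
    also have "... = (\<Sum>l<n3. (\<Sum>c<n3. dct n3 $$ (k, c) * dct n3 $$ (l, c)) *\<^sub>R fE (l, i) (l, j))"
      by (subst sum.swap) (simp only: scaleR_sum_left)
    also have "... = (\<Sum>l<n3. if l = k then fE (k, i) (k, j) else 0)"
      by (rule sum.cong) (use that dct_rows in auto)
    finally show ?thesis using that by simp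
  qed
  have "fE (k, i) (k, j) \<in> span ((\<lambda>\<omega>. Phi (basis_tensor n1 n2 n3 \<omega>)) ` index_set n1 n2 n3)"
    if "k < n3" "i < n1" "j < n2" for k i j
    unfolding E[OF that] by (intro span_sum span_scale span_base) (use that in \<open>auto simp: index_set_def\<close>)
  then show ?thesis
    unfolding blk_def by (intro span_sum span_scale) auto
qed

end

section \<open>Rank and singular value decompositions of the slices\<close>

text \<open>Subadditivity of the rank, one rank-one summand at a time.\<close>

lemma mat_rank_le_factor:
  assumes "M \<in> carrier_mat n m" "\<And>i j. i < n \<Longrightarrow> j < m \<Longrightarrow> M $$ (i, j) = (\<Sum>b<s. p b i * q b j)"
  shows "mat_rank M \<le> s"
  using assms
proof (induction s arbitrary: M)
  case 0
  then have "M = 0\<^sub>m n m" by (intro eq_matI) auto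
  then show ?case by (simp add: mat_rank_def vec_space.rank_0I)
next
  case (Suc s)
  define M1 where "M1 = mat n m (\<lambda>(i, j). \<Sum>b<s. p b i * q b j)"
  define M2 where "M2 = mat n m (\<lambda>(i, j). p s i * q s j)"
  have c: "M1 \<in> carrier_mat n m" "M2 \<in> carrier_mat n m" by (auto simp: M1_def M2_def)
  have M: "M = M1 + M2" by (rule eq_matI) (use Suc.prems in \<open>auto simp: M1_def M2_def\<close>)
  have "mat_rank M1 \<le> s" by (rule Suc.IH) (auto simp: M1_def)
  moreover have "vec_space.rank n M2 \<le> 1"
    by (rule vec_space.rank_le_1_product_entries[OF c(2), where f = "p s" and g = "q s"]) (auto simp: M2_def)
  moreover have "vec_space.rank n (M1 + M2) \<le> vec_space.rank n M1 + vec_space.rank n M2"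
    by (rule vec_space.rank_subadditive[OF c])
  ultimately show ?case unfolding mat_rank_def M using c by simp
qed

text \<open>The columns are expanded in a maximal independent set of columns; \<open>p\<close> lists
  the members of this set and \<open>q\<close> the coefficients.\<close>

lemma mat_rank_factor_ex:
  assumes "M \<in> carrier_mat n m"
  shows "\<exists>p q. \<forall>i<n. \<forall>j<m. M $$ (i, j) = (\<Sum>b<mat_rank M. p b i * q b j)"
proof -
  interpret vec_space "TYPE(real)" n .
  let ?C = "set (cols M)"
  have C: "?C \<subseteq> carrier_vec n" using cols_dim assms by blast
  obtain U where U: "finite U" "maximal U (\<lambda>T. T \<subseteq> ?C \<and> lin_indpt T)"
    using maximal_exists_superset[of ?C "\<lambda>T. T \<subseteq> ?C \<and> lin_indpt T" "{}"] by (auto simp: lin_dep_def)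
  have rk: "mat_rank M = card U"
    using rank_card_indpt[OF assms U(2)] assms by (simp add: mat_rank_def)
  have UC: "U \<subseteq> ?C" "lin_indpt U" using U(2) unfolding maximal_def by auto
  have inU: "c \<in> span U" if c: "c \<in> ?C" for c
  proof (rule ccontr)
    assume nin: "c \<notin> span U"
    have UV: "U \<subseteq> carrier_vec n" and cV: "c \<in> carrier_vec n" using UC(1) C c by auto
    have cU: "c \<notin> U" using nin span_mem[OF UV] by metis
    have "lin_indpt (U \<union> {c})"
      using lin_dep_iff_in_span[OF UV UC(2) cV cU] nin by metis
    moreover have "U \<union> {c} \<subseteq> ?C" using UC(1) c by simp
    ultimately have "U = U \<union> {c}" using U(2) unfolding maximal_def by (metis Un_upper1)
    then show False using cU by blast
  qed
  obtain h where h: "bij_betw h {..<card U} U"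
    using ex_bij_betw_nat_finite[OF U(1)] by (auto simp: lessThan_atLeast0)
  have "\<forall>j<m. \<exists>a. col M j = lincomb a U"
  proof (intro allI impI)
    fix j assume "j < m"
    then have "col M j \<in> ?C" using assms by (metis carrier_matD(2) cols_length cols_nth nth_mem)
    have "U \<subseteq> carrier_vec n" using UC(1) C by blast
    from finite_in_span[OF U(1) this inU[OF \<open>col M j \<in> ?C\<close>]] show "\<exists>a. col M j = lincomb a U" by metis
  qed
  then obtain a where a: "\<And>j. j < m \<Longrightarrow> col M j = lincomb (a j) U" by metis
  have entry: "M $$ (i, j) = (\<Sum>b<card U. h b $ i * a j (h b))" if "i < n" "j < m" for i j
  proof -
    have "M $$ (i, j) = lincomb (a j) U $ i" using a[OF that(2)] that assms by (metis carrier_matD index_col)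
    also have "... = (\<Sum>x\<in>U. a j x * x $ i)" by (rule lincomb_index[OF that(1)]) (use UC C in blast)
    also have "... = (\<Sum>b<card U. a j (h b) * h b $ i)" by (rule sum.reindex_bij_betw[OF h, symmetric])
    finally show ?thesis by (simp add: mult.commute)
  qed
  show ?thesis
    unfolding rk
  proof (rule exI[of _ "\<lambda>b i. h b $ i"], rule exI[of _ "\<lambda>b j. a j (h b)"], intro allI impI)
    fix i j assume "i < n" "j < m"
    then show "M $$ (i, j) = (\<Sum>b<card U. h b $ i * a j (h b))" by (rule entry)
  qed
qed

text \<open>Placed as the \<open>k\<close>-th diagonal block, so that single slices and whole
  tensors are elements of one type and the slices are cut out by coordinate projections.\<close>

definition emb :: "nat \<Rightarrow> real mat \<Rightarrow> bmat" where
  "emb k M = (\<Sum>i<dim_row M. \<Sum>j<dim_col M. M $$ (i, j) *\<^sub>R fE (k, i) (k, j))"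

lemma ent_emb: "ent (emb k M) (a, i) (b, j) = (if a = k \<and> b = k \<and> i < dim_row M \<and> j < dim_col M then M $$ (i, j) else 0)"
proof -
  have eq: "ent (emb k M) (a, i) (b, j) = (\<Sum>i'<dim_row M. \<Sum>j'<dim_col M.
      if j' = j then if i' = i then if a = k \<and> b = k then M $$ (i, j) else 0 else 0 else 0)"
    unfolding emb_def ent_sum by (intro sum.cong refl) auto
  show ?thesis
  proof (cases "a = k \<and> b = k \<and> i < dim_row M \<and> j < dim_col M")
    case True
    then show ?thesis unfolding eq by simp
  next
    case False
    have "(\<Sum>i'<dim_row M. \<Sum>j'<dim_col M.
      if j' = j then if i' = i then if a = k \<and> b = k then M $$ (i, j) else 0 else 0 else 0) = 0"
      using False by (intro sum.neutral ballI) auto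
    then show ?thesis unfolding eq using False by auto
  qed
qed

lemma inner_emb: "inner (emb k M) F = (\<Sum>i<dim_row M. \<Sum>j<dim_col M. M $$ (i, j) * ent F (k, i) (k, j))"
  unfolding emb_def by (simp add: inner_sum_left)

lemma norm_emb: "norm (emb k M) = frob_norm M"
  unfolding norm_eq_sqrt_inner frob_norm_def inner_emb
  by (rule arg_cong[of _ _ sqrt], intro sum.cong refl) (simp add: ent_emb power2_eq_square)

lemma emb_minus: "A \<in> carrier_mat n m \<Longrightarrow> B \<in> carrier_mat n m \<Longrightarrow> emb k (A - B) = emb k A - emb k B"
  by (rule fmat_eqI) (auto simp: ent_emb)

lemma emb_supp:
  assumes "M \<in> carrier_mat n m"
  shows "fId ({k} \<times> {..<n}) * emb k M = emb k M" "emb k M * fId ({k} \<times> {..<m}) = emb k M"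
  by (rule fmat_eqI, use assms in \<open>auto simp: fId_times times_fId ent_emb split: if_splits\<close>)+

lemma emb_ex:
  assumes "fId ({k} \<times> {..<n}) * F = F" "F * fId ({k} \<times> {..<m}) = F"
  shows "\<exists>M\<in>carrier_mat n m. emb k M = F"
proof (intro bexI)
  let ?M = "mat n m (\<lambda>(i, j). ent F (k, i) (k, j))"
  show "emb k ?M = F"
  proof (rule fmat_eqI)
    fix p q :: "nat \<times> nat"
    obtain a i b j where pq: "p = (a, i)" "q = (b, j)" by (metis surj_pair)
    have "ent F p q = ent (fId ({k} \<times> {..<n}) * F * fId ({k} \<times> {..<m})) p q" using assms by simp
    also have "... = ent (emb k ?M) p q" by (auto simp: pq fId_times times_fId ent_emb)
    finally show "ent (emb k ?M) p q = ent F p q" ..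
  qed
qed simp

lemma emb_inj:
  assumes "A \<in> carrier_mat n m" "B \<in> carrier_mat n m" "emb k A = emb k B"
  shows "A = B"
proof (rule eq_matI)
  fix i j assume "i < dim_row B" "j < dim_col B"
  moreover have "ent (emb k A) (k, i) (k, j) = ent (emb k B) (k, i) (k, j)" using assms(3) by simp
  ultimately show "A $$ (i, j) = B $$ (i, j)" using assms(1,2) by (simp add: ent_emb)
qed (use assms in auto)

text \<open>If \<open>M\<close> had smaller rank, the inner factor of a rank factorization would
  annihilate some \<open>V * y\<close> with \<open>y \<noteq> 0\<close> supported on
  \<open>J\<close>, although positive singular values make \<open>U * (fdiag J s * y)\<close>
  nonzero.\<close>

lemma fsvd_rank:
  assumes M: "M \<in> carrier_mat n m" and S: "fsvd (emb k M) U s V J"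
  shows "mat_rank M = card J"
proof (rule antisym)
  note D = fsvdD[OF S]
  obtain h where h: "bij_betw h {..<card J} J"
    using ex_bij_betw_nat_finite[OF D(5)] by (auto simp: lessThan_atLeast0)
  show "mat_rank M \<le> card J"
  proof (rule mat_rank_le_factor[OF M])
    fix i j assume ij: "i < n" "j < m"
    have "M $$ (i, j) = ent (U * fdiag J s * ftr V) (k, i) (k, j)"
      using D(4) ij M by (metis carrier_matD ent_emb)
    also have "... = (\<Sum>a\<in>J. ent (U * fdiag J s) (k, i) a * ent (ftr V) a (k, j))"
      by (rule ent_times) (use D(5) in \<open>auto simp: times_fdiag split: if_splits\<close>)
    also have "... = (\<Sum>a\<in>J. (s a * ent U (k, i) a) * ent V (k, j) a)"
      by (rule sum.cong) (simp_all add: times_fdiag D(5))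
    also have "... = (\<Sum>b<card J. (s (h b) * ent U (k, i) (h b)) * ent V (k, j) (h b))"
      by (rule sum.reindex_bij_betw[OF h, symmetric])
    finally show "M $$ (i, j) = (\<Sum>b<card J. (s (h b) * ent U (k, i) (h b)) * ent V (k, j) (h b))" .
  qed
  show "card J \<le> mat_rank M"
  proof (rule ccontr)
    assume "\<not> card J \<le> mat_rank M"
    obtain p q where pq: "\<And>i j. i < n \<Longrightarrow> j < m \<Longrightarrow> M $$ (i, j) = (\<Sum>b<mat_rank M. p b i * q b j)"
      using mat_rank_factor_ex[OF M] by blast
    let ?r = "mat_rank M"
    define B where "B = {k} \<times> {..<?r}"
    define Q where "Q = emb k (mat ?r m (\<lambda>(b, j). q b j))"
    define Pm where "Pm = emb k (mat n ?r (\<lambda>(i, b). p b i))"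
    have fB: "finite B" and cB: "card B = ?r" unfolding B_def by simp_all
    have X: "emb k M = Pm * Q"
    proof (rule fmat_eqI)
      fix x y :: "nat \<times> nat"
      obtain a i b j where xy: "x = (a, i)" "y = (b, j)" by (metis surj_pair)
      have "ent (Pm * Q) x y = (\<Sum>l\<in>B. ent Pm x l * ent Q l y)"
        by (rule ent_times) (auto simp: fB Pm_def Q_def B_def ent_emb xy split: if_splits)
      also have "... = (\<Sum>b'<?r. ent Pm x (k, b') * ent Q (k, b') y)"
      proof -
        have "B = Pair k ` {..<?r}" unfolding B_def by auto
        then show ?thesis by (simp add: sum.reindex inj_on_def)
      qed
      also have "... = ent (emb k M) x y"
        using M pq by (auto simp: Pm_def Q_def ent_emb xy)
      finally show "ent (emb k M) x y = ent (Pm * Q) x y" ..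
    qed
    have "card B < card J" using cB \<open>\<not> card J \<le> mat_rank M\<close> by simp
    then obtain y where y: "y \<noteq> 0" "fId J * y = y" "y * fE undefined undefined = y" "\<forall>b\<in>B. ent ((Q * V) * y) b undefined = 0"
      using underdetermined_columns[OF D(5) fB, where M = "Q * V" and z = undefined] by blast
    have "Q * (V * y) = 0"
    proof (rule fmat_eqI)
      fix a b
      have "ent (Q * (V * y)) a b = (if b = undefined then ent ((Q * V) * y) a undefined else 0)"
        by (subst y(3)[symmetric]) (simp only: mult.assoc[symmetric] ent_times_fE)
      moreover have "ent ((Q * V) * y) a undefined = 0" if "a \<notin> B"
      proof -
        have "ent Q a c = 0" for c using that unfolding Q_def B_def by (cases a; cases c) (auto simp: ent_emb)
        then show ?thesis by (simp add: mult.assoc ent_times_def)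
      qed
      ultimately show "ent (Q * (V * y)) a b = ent 0 a b" using y(4) by auto
    qed
    then have "emb k M * (V * y) = 0" by (simp add: X mult.assoc)
    moreover have "emb k M * (V * y) = U * (fdiag J s * y)"
      by (simp add: D(4) mult.assoc fisoD(3)[OF D(2)] y(2))
    moreover have "norm (U * (fdiag J s * y)) = norm (fdiag J s * y)"
      unfolding fiso_norm[OF D(1)] by (simp add: mult.assoc[symmetric] fdiag_fId[OF D(5)])
    moreover have "0 * norm y < norm (fdiag J s * y)"
      by (rule fdiag_strict_lower[OF D(5)]) (use D(3) y in auto)
    ultimately show False by simp
  qed
qed

section \<open>Construction of the singular value decomposition of a block\<close>

lemma col_inner:
  assumes "x * fE z z = x" "y * fE z z = y"
  shows "ftr x * y = inner x y *\<^sub>R fE z z"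
proof (rule fmat_eqI)
  fix a b
  have x: "fE z z * ftr x = ftr x" using arg_cong[OF assms(1), of ftr] by simp
  have "ent (ftr x * y) z z = inner (ftr x * y) (fE z z)" by simp
  also have "... = inner y (x * fE z z)" by (simp only: inner_mult_left ftr_simps(1))
  finally have zz: "ent (ftr x * y) z z = inner x y" using assms by (simp add: inner_commute)
  have "ftr x * y = fE z z * (ftr x * y) * fE z z"
    by (subst x[symmetric], subst assms(2)[symmetric]) (simp only: mult.assoc)
  then have "ent (ftr x * y) a b = (if b = z then if a = z then ent (ftr x * y) z z else 0 else 0)"
    by (metis ent_fE_times ent_times_fE)
  then show "ent (ftr x * y) a b = ent (inner x y *\<^sub>R fE z z) a b" using zz by auto
qed

text \<open>Puts the vectors \<open>u a\<close>, each stored in column \<open>z\<close>, side by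
  side into the columns \<open>(k, a)\<close>.\<close>

definition gather :: "nat \<Rightarrow> nat \<times> nat \<Rightarrow> nat \<Rightarrow> (nat \<Rightarrow> bmat) \<Rightarrow> bmat" where
  "gather k z t u = (\<Sum>a<t. u a * fE z (k, a))"

lemma gather_mult:
  assumes "\<And>a. a < t \<Longrightarrow> u a * fE z z = u a"
  shows "gather k z t w * ftr (gather k z t u) = (\<Sum>a<t. w a * ftr (u a))"
proof -
  have u: "fE z z * ftr (u a) = ftr (u a)" if "a < t" for a using arg_cong[OF assms[OF that], of ftr] by simp
  have "gather k z t w * ftr (gather k z t u) = (\<Sum>a<t. \<Sum>b<t. if b = a then w a * ftr (u a) else 0)"
    unfolding gather_def ftr_sum sum_product
  proof (intro sum.cong refl)
    fix a b assume ab: "a \<in> {..<t}" "b \<in> {..<t}"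
    have "w a * fE z (k, a) * ftr (u b * fE z (k, b)) = w a * ((fE z (k, a) * fE (k, b) z) * ftr (u b))"
      by (simp add: mult.assoc)
    then show "w a * fE z (k, a) * ftr (u b * fE z (k, b)) = (if b = a then w a * ftr (u a) else 0)"
      using ab u by (simp add: fE_mult)
  qed
  then show ?thesis by simp
qed

lemma fiso_gather:
  assumes u: "orthon u {..<t}" and col: "\<And>a. a < t \<Longrightarrow> u a * fE z z = u a"
  shows "fiso (gather k z t u) ({k} \<times> {..<t})"
proof -
  have "ftr (gather k z t u) * gather k z t u = (\<Sum>a<t. \<Sum>b<t. if b = a then fE (k, a) (k, a) else 0)"
    unfolding gather_def ftr_sum sum_product
  proof (intro sum.cong refl)
    fix a b assume ab: "a \<in> {..<t}" "b \<in> {..<t}"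
    have "ftr (u a * fE z (k, a)) * (u b * fE z (k, b)) = fE (k, a) z * (ftr (u a) * u b) * fE z (k, b)"
      by (simp add: mult.assoc)
    also have "ftr (u a) * u b = (if a = b then 1 else 0) *\<^sub>R fE z z"
      using col_inner[OF col col, of a b] ab orthon_inner[OF u ab] by simp
    finally show "ftr (u a * fE z (k, a)) * (u b * fE z (k, b)) = (if b = a then fE (k, a) (k, a) else 0)"
      by (simp add: fE_mult)
  qed
  also have "... = (\<Sum>a<t. fE (k, a) (k, a))" by simp
  also have "... = fId ({k} \<times> {..<t})"
  proof -
    have "{k} \<times> {..<t} = Pair k ` {..<t}" by auto
    then show ?thesis by (simp add: fId_def sum.reindex inj_on_def)
  qed
  finally show ?thesis by (simp add: fiso_def)
qed

lemma gather_fdiag: "gather k z t u * fdiag ({k} \<times> {..<t}) s = gather k z t (\<lambda>a. s (k, a) *\<^sub>R u a)"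
proof -
  have "fE z (k, a) * fdiag ({k} \<times> {..<t}) s = s (k, a) *\<^sub>R fE z (k, a)" if "a < t" for a
    by (rule fmat_eqI) (use that in auto)
  then show ?thesis unfolding gather_def sum_distrib_right by (intro sum.cong) (simp_all add: mult.assoc)
qed

lemma decreasing_enumeration:
  fixes l :: "nat \<Rightarrow> real"
  shows "\<exists>\<pi>. bij_betw \<pi> {..<t} {..<t} \<and> (\<forall>a b. a \<le> b \<and> b < t \<longrightarrow> l (\<pi> b) \<le> l (\<pi> a))"
proof -
  let ?xs = "sort_key (\<lambda>a. - l a) [0..<t]"
  have len: "length ?xs = t" and dist: "distinct ?xs" and set: "set ?xs = {..<t}" by auto
  have "bij_betw ((!) ?xs) {..<t} {..<t}"
    using bij_betw_nth[OF dist, of "{..<t}" "{..<t}"] len set by simp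
  moreover have "l (?xs ! b) \<le> l (?xs ! a)" if "a \<le> b" "b < t" for a b
  proof -
    have "sorted (map (\<lambda>a. - l a) ?xs)" by simp
    from sorted_nth_mono[OF this that(1)] that len show ?thesis by simp
  qed
  ultimately show ?thesis by blast
qed

text \<open>The spectral theorem for the Gram operator of the block: the singular values are the
  square roots of its eigenvalues in decreasing order, and the left vectors are the normalized
  images of the right ones.\<close>

lemma mat_svd:
  assumes M: "M \<in> carrier_mat n m"
  shows "\<exists>U s V. fsvd (emb k M) U s V ({k} \<times> {..<mat_rank M}) \<and>
    (\<forall>a b. a \<le> b \<and> b < mat_rank M \<longrightarrow> s (k, b) \<le> s (k, a)) \<and>
    fId ({k} \<times> {..<n}) * U = U \<and> fId ({k} \<times> {..<m}) * V = V"
proof -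
  define z :: "nat \<times> nat" where "z = (0, 0)"
  let ?X = "emb k M" and ?E = "fE z z"
  let ?e = "\<lambda>j. fE (k, j) z"
  let ?In = "fId ({k} \<times> {..<n})" and ?Im = "fId ({k} \<times> {..<m})"
  \<comment> \<open>The factor \<open>?E\<close> restricts the argument to a single column, so this
    is the Gram operator on vectors.\<close>
  define T where "T x = ftr ?X * (?X * (x * ?E))" for x
  have EE: "?E * ?E = ?E" by (simp add: fE_mult)
  note supp = emb_supp[OF M, of k]
  have suppT: "?Im * ftr ?X = ftr ?X" using arg_cong[OF supp(2), of ftr] by simp
  have e: "orthon ?e {..<m}" unfolding orthon_def by auto
  have in_span: "x \<in> span (?e ` {..<m})" if "?Im * x = x" "x * ?E = x" for x
  proof -
    have "x = (\<Sum>j<m. ent x (k, j) z *\<^sub>R ?e j)"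
    proof (rule fmat_eqI)
      fix a b :: "nat \<times> nat"
      obtain a1 a2 where a: "a = (a1, a2)" by (metis surj_pair)
      have "ent x a b = ent (?Im * x * ?E) a b" using that by simp
      also have "... = (if b = z \<and> a1 = k \<and> a2 < m then ent x (k, a2) z else 0)"
        by (auto simp: a fId_times)
      also have "... = (\<Sum>j<m. if j = a2 then if b = z \<and> a1 = k then ent x (k, a2) z else 0 else 0)" by auto
      also have "... = ent (\<Sum>j<m. ent x (k, j) z *\<^sub>R ?e j) a b"
        unfolding ent_sum by (rule sum.cong) (auto simp: a)
      finally show "ent x a b = ent (\<Sum>j<m. ent x (k, j) z *\<^sub>R ?e j) a b" .
    qed
    moreover have "(\<Sum>j<m. ent x (k, j) z *\<^sub>R ?e j) \<in> span (?e ` {..<m})"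
      by (intro span_sum span_scale span_base) auto
    ultimately show ?thesis by simp
  qed
  have span_supp: "?Im * x = x \<and> x * ?E = x" if "x \<in> span (?e ` {..<m})" for x
  proof -
    have "x = (\<Sum>j<m. inner (?e j) x *\<^sub>R ?e j)" using oproj_span[OF e that] unfolding oproj_def by simp
    moreover have "?Im * ?e j = ?e j" if "j < m" for j by (rule fmat_eqI) (use that in \<open>auto simp: fId_times ent_fId split: if_splits\<close>)
    then have "?Im * (\<Sum>j<m. inner (?e j) x *\<^sub>R ?e j) = (\<Sum>j<m. inner (?e j) x *\<^sub>R ?e j)"
      "(\<Sum>j<m. inner (?e j) x *\<^sub>R ?e j) * ?E = (\<Sum>j<m. inner (?e j) x *\<^sub>R ?e j)"
      unfolding sum_distrib_left sum_distrib_right by (auto intro!: sum.cong simp: fE_mult)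
    ultimately show ?thesis by metis
  qed
  have T: "linear T" unfolding T_def by (intro linearI) (simp_all add: algebra_simps)
  have sym: "inner (T x) y = inner x (T y)" for x y
  proof -
    have "inner (T x) y = inner (x * ?E) (ftr ?X * (?X * y))" unfolding T_def by (simp add: inner_mult_left)
    also have "... = inner x (ftr ?X * (?X * y) * ?E)" by (simp add: inner_mult_right)
    finally show ?thesis unfolding T_def by (simp add: mult.assoc)
  qed
  have TE: "inner (T x) x = (norm (?X * (x * ?E)))\<^sup>2" for x
  proof -
    have "T x = T x * ?E" unfolding T_def by (simp add: mult.assoc EE)
    then have "inner (T x) x = inner (T x) (x * ?E)" by (metis inner_mult_right ftr_fE)
    then show ?thesis unfolding T_def by (simp add: inner_mult_left power2_norm_eq_inner)
  qed
  have ran: "T x \<in> span (?e ` {..<m})" for x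
    by (rule in_span) (simp_all add: T_def mult.assoc[symmetric] suppT, simp add: mult.assoc EE)
  have psd: "inner (T x) x \<ge> 0" for x unfolding TE by simp
  obtain t :: nat and u l where tul: "orthon u {..<t} \<and> u ` {..<t} \<subseteq> span (?e ` {..<m}) \<and> (\<forall>a<t. l a > 0) \<and>
      (\<forall>x. T x = (\<Sum>a<t. (l a * inner (u a) x) *\<^sub>R u a))"
    using spectral_theorem_psd[OF e T ran sym psd] by (elim exE)
  have u: "orthon u {..<t}" "u ` {..<t} \<subseteq> span (?e ` {..<m})" and l: "\<And>a. a < t \<Longrightarrow> l a > 0"
    and Tx: "\<And>x. T x = (\<Sum>a<t. (l a * inner (u a) x) *\<^sub>R u a)"
    using tul by blast+
  obtain \<pi> where \<pi>: "bij_betw \<pi> {..<t} {..<t}" and dec: "\<And>a b. a \<le> b \<Longrightarrow> b < t \<Longrightarrow> l (\<pi> b) \<le> l (\<pi> a)"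
    using decreasing_enumeration[of t l] by blast
  define v where "v a = u (\<pi> a)" for a
  define \<sigma> where "\<sigma> a = sqrt (l (\<pi> a))" for a
  define w where "w a = (1 / \<sigma> a) *\<^sub>R (?X * v a)" for a
  have \<pi>t: "\<pi> a < t" if "a < t" for a using \<pi> that by (auto simp: bij_betw_def)
  have \<sigma>: "\<sigma> a > 0" if "a < t" for a unfolding \<sigma>_def using l \<pi>t that by simp
  have v: "orthon v {..<t}"
    unfolding orthon_def v_def using orthon_inner[OF u(1)] \<pi>t \<pi> by (auto simp: bij_betw_def inj_on_def)
  have vs: "?Im * v a = v a \<and> v a * ?E = v a" if "a < t" for a
    unfolding v_def by (rule span_supp) (use u(2) \<pi>t[OF that] in auto)
  have Tv: "T (v a) = (\<sigma> a)\<^sup>2 *\<^sub>R v a" if "a < t" for a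
  proof -
    have "T (v a) = (\<Sum>b<t. if b = \<pi> a then l (\<pi> a) *\<^sub>R v a else 0)"
      unfolding Tx v_def by (rule sum.cong) (use orthon_inner[OF u(1)] \<pi>t[OF that] in auto)
    then show ?thesis using \<pi>t[OF that] l[OF \<pi>t[OF that]] by (simp add: \<sigma>_def)
  qed
  have XX: "inner (?X * v a) (?X * v b) = (if a = b then (\<sigma> a)\<^sup>2 else 0)" if "a < t" "b < t" for a b
  proof -
    have "inner (?X * v a) (?X * v b) = inner (?X * (v a * ?E)) (?X * v b)" using vs[OF that(1)] by simp
    also have "... = inner (?X * v b) (?X * (v a * ?E))" by (rule inner_commute)
    also have "... = inner (v b) (T (v a))" unfolding T_def by (rule inner_mult_left)
    also have "... = (if a = b then (\<sigma> a)\<^sup>2 else 0)" using Tv[OF that(1)] orthon_inner[OF v, of b a] that by simp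
    finally show ?thesis .
  qed
  have w: "orthon w {..<t}"
    unfolding orthon_def
  proof (intro conjI ballI)
    fix a b assume ab: "a \<in> {..<t}" "b \<in> {..<t}"
    have "inner (w a) (w b) = (1 / \<sigma> a) * (1 / \<sigma> b) * inner (?X * v a) (?X * v b)" unfolding w_def by simp
    also have "... = (if a = b then 1 else 0)"
      using ab XX[of a b] \<sigma>[of a] by (auto simp: power2_eq_square)
    finally show "inner (w a) (w b) = (if a = b then 1 else 0)" .
  qed simp
  have ws: "?In * w a = w a \<and> w a * ?E = w a" if "a < t" for a
    unfolding w_def using vs[OF that] supp(1) by (simp add: mult.assoc) (simp add: mult.assoc[symmetric])
  let ?J = "{k} \<times> {..<t}"
  define U where "U = gather k z t w"
  define V where "V = gather k z t v"
  define s where "s p = \<sigma> (snd p)" for p :: "nat \<times> nat"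
  have fU: "fiso U ?J" unfolding U_def by (rule fiso_gather[OF w]) (use ws in blast)
  have fV: "fiso V ?J" unfolding V_def by (rule fiso_gather[OF v]) (use vs in blast)
  have VV: "V * ftr V = (\<Sum>a<t. v a * ftr (v a))" unfolding V_def by (rule gather_mult) (use vs in blast)
  have "U * fdiag ?J s * ftr V = (\<Sum>a<t. (s (k, a) *\<^sub>R w a) * ftr (v a))"
    unfolding U_def V_def gather_fdiag by (rule gather_mult) (use vs in blast)
  also have "... = (\<Sum>a<t. ?X * (v a * ftr (v a)))"
  proof (intro sum.cong refl)
    fix a assume "a \<in> {..<t}"
    then have "\<sigma> a \<noteq> 0" using \<sigma>[of a] by simp
    then show "(s (k, a) *\<^sub>R w a) * ftr (v a) = ?X * (v a * ftr (v a))"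
      by (simp add: s_def w_def mult.assoc)
  qed
  also have "... = ?X * (V * ftr V)" unfolding VV sum_distrib_left ..
  \<comment> \<open>Applied to a unit column \<open>x\<close>, the residue \<open>y\<close> is
    orthogonal to all eigenvectors. Thus \<open>T y = 0\<close>, and then
    \<open>?X * y = 0\<close>.\<close>
  also have "... = ?X"
  proof (rule fmat_eqI)
    fix p q
    define x where "x = fE q z"
    define y where "y = x - V * ftr V * x"
    have xE: "x * ?E = x" unfolding x_def by (simp add: fE_mult)
    have yE: "y * ?E = y" unfolding y_def by (simp add: left_diff_distrib mult.assoc xE)
    have "inner (v a) y = 0" if "a < t" for a
    proof -
      have "V * ftr V * v a = (\<Sum>b<t. v b * (ftr (v b) * v a))" unfolding VV sum_distrib_right by (simp add: mult.assoc)
      also have "... = (\<Sum>b<t. if b = a then v a else 0)"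
      proof (intro sum.cong refl)
        fix b assume b: "b \<in> {..<t}"
        have "ftr (v b) * v a = inner (v b) (v a) *\<^sub>R ?E" by (rule col_inner) (use vs b that in auto)
        then show "v b * (ftr (v b) * v a) = (if b = a then v a else 0)"
          using orthon_inner[OF v b, of a] that vs by simp
      qed
      finally have VVv: "V * ftr V * v a = v a" using that by simp
      have "inner (v a) (V * ftr V * x) = inner (V * ftr V * v a) x"
        by (simp add: inner_mult_left mult.assoc)
      then show ?thesis unfolding y_def VVv by (simp add: inner_diff_right)
    qed
    then have "inner (u a) y = 0" if "a < t" for a
      using that \<pi> unfolding v_def bij_betw_def by (metis imageE lessThan_iff)
    then have "T y = 0" unfolding Tx by simp
    then have "?X * y = 0" using TE[of y] yE by simp
    then have "?X * x = ?X * (V * ftr V) * x" unfolding y_def by (simp add: right_diff_distrib mult.assoc)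
    then have "ent (?X * x) p z = ent (?X * (V * ftr V) * x) p z" by simp
    then show "ent (?X * (V * ftr V)) p q = ent ?X p q" unfolding x_def by simp
  qed
  finally have "fsvd ?X U s V ?J"
    unfolding fsvd_def using fU fV \<sigma> by (auto simp: s_def)
  moreover have "mat_rank M = t" using fsvd_rank[OF M \<open>fsvd ?X U s V ?J\<close>] by simp
  moreover have "?In * U = U" "?Im * V = V"
    unfolding U_def V_def gather_def sum_distrib_left
    by (intro sum.cong refl; use ws vs in \<open>simp add: mult.assoc[symmetric]\<close>)+
  moreover have "s (k, b) \<le> s (k, a)" if "a \<le> b" "b < t" for a b
    unfolding s_def \<sigma>_def using dec[OF that] by simp
  ultimately show ?thesis by blast
qed

text \<open>The candidate keeps the singular values of \<open>W\<close> above
  \<open>\<sigma> / 2\<close>; by \<open>top_card\<close> there are exactly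
  \<open>mat_rank X\<close> of them.\<close>

lemma best_rank_approx_ex1:
  assumes W: "W \<in> carrier_mat n m" and X: "X \<in> carrier_mat n m"
    and S: "fsvd (emb k X) U' s' V' J'" "\<forall>j\<in>J'. \<sigma> \<le> s' j"
    and op: "fop_le (emb k W - emb k X) \<epsilon>" "2 * \<epsilon> < \<sigma>" "0 \<le> \<epsilon>"
  shows "\<exists>Y. best_rank_approx (mat_rank X) W Y \<and> mat_rank Y = mat_rank X \<and> (\<forall>Y'. best_rank_approx (mat_rank X) W Y' \<longrightarrow> Y' = Y)"
proof -
  have rX: "mat_rank X = card J'" by (rule fsvd_rank[OF X S(1)])
  obtain U s V J where WS: "fsvd (emb k W) U s V J"
    and supp: "fId ({k} \<times> {..<n}) * U = U" "fId ({k} \<times> {..<m}) * V = V"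
    using mat_svd[OF W, of k] by blast
  define J1 where "J1 = {j \<in> J. \<sigma> / 2 < s j}"
  define F where "F = U * fdiag J1 s * ftr V"
  have cJ1: "card J1 = card J'" unfolding J1_def by (rule top_card[OF WS S op])
  have suppF: "fId ({k} \<times> {..<n}) * F = F" "F * fId ({k} \<times> {..<m}) = F"
  proof -
    have "ftr V * fId ({k} \<times> {..<m}) = ftr V" using arg_cong[OF supp(2), of ftr] by simp
    then show "F * fId ({k} \<times> {..<m}) = F" unfolding F_def by (simp add: mult.assoc)
    show "fId ({k} \<times> {..<n}) * F = F" unfolding F_def by (simp add: mult.assoc[symmetric] supp)
  qed
  obtain Y where Y: "Y \<in> carrier_mat n m" "emb k Y = F" using emb_ex[OF suppF] by blast
  have J1: "J1 \<subseteq> J" unfolding J1_def by auto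
  have "fsvd (emb k Y) (U * fId J1) s (V * fId J1) J1"
    unfolding Y(2) F_def by (rule fsvd_restrict[OF WS J1])
  then have "mat_rank Y = card J1" by (rule fsvd_rank[OF Y(1)])
  then have rY: "mat_rank Y = mat_rank X" using cJ1 rX by simp
  have opt: "frob_norm (W - Y) \<le> frob_norm (W - Y')" "frob_norm (W - Y') \<le> frob_norm (W - Y) \<Longrightarrow> Y' = Y"
    if Y': "Y' \<in> carrier_mat n m" "mat_rank Y' \<le> mat_rank X" for Y'
  proof -
    obtain U'' s'' V'' where S': "fsvd (emb k Y') U'' s'' V'' ({k} \<times> {..<mat_rank Y'})"
      using mat_svd[OF Y'(1), of k] by blast
    have c: "card ({k} \<times> {..<mat_rank Y'}) \<le> card J'" using Y'(2) rX by simp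
    note B = best_approx_unique[OF WS S op S' c, folded J1_def, folded F_def, folded Y(2)]
    have n: "frob_norm (W - Z) = norm (emb k W - emb k Z)" if "Z \<in> carrier_mat n m" for Z
      using norm_emb[of k "W - Z"] emb_minus[OF W that] by simp
    show "frob_norm (W - Y) \<le> frob_norm (W - Y')" unfolding n[OF Y(1)] n[OF Y'(1)] by (rule B(1))
    assume "frob_norm (W - Y') \<le> frob_norm (W - Y)"
    then have "emb k Y' = emb k Y" unfolding n[OF Y(1)] n[OF Y'(1)] by (rule B(2))
    then show "Y' = Y" by (rule emb_inj[OF Y'(1) Y(1)])
  qed
  have "best_rank_approx (mat_rank X) W Y"
    unfolding best_rank_approx_def using W Y rY opt(1) by auto
  moreover have "Y' = Y" if "best_rank_approx (mat_rank X) W Y'" for Y'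
    by (rule opt(2)) (use that W Y rY in \<open>auto simp: best_rank_approx_def\<close>)
  ultimately show ?thesis using rY by blast
qed

section \<open>Thresholding, tangent spaces and trimming of tensors\<close>

text \<open>The positions of the nonzero singular values of all slices. The slices may have
  different ranks, hence the dependent sum.\<close>

definition Jset :: "nat vec \<Rightarrow> (nat \<times> nat) set" where
  "Jset rs = (SIGMA k:{..<dim_vec rs}. {..<rs $ k})"

lemma finite_Jset [simp]: "finite (Jset rs)"
  by (simp add: Jset_def)

lemma max_entry_ge: "k < dim_vec rs \<Longrightarrow> rs $ k \<le> max_entry rs"
  unfolding max_entry_def by (rule Max_ge) auto

lemma rank_t_dim:
  assumes "A \<in> tensors n1 n2 n3" "0 < n3"
  shows "dim_vec (rank_t A) = n3" "k < n3 \<Longrightarrow> rank_t A $ k = mat_rank (hat A $ k)"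
  using tensorsD(1)[OF hat_tensor(1)[OF assms(2,1)]] by (auto simp: rank_t_def)

context
  fixes n3 :: nat
  assumes n3: "0 < n3"
begin

lemma Phi_slice:
  assumes A: "A \<in> tensors n1 n2 n3" and k: "k < n3"
  shows "fId ({k} \<times> {..<n1}) * Phi A = emb k (hat A $ k)" "Phi A * fId ({k} \<times> {..<n2}) = emb k (hat A $ k)"
  by (rule fmat_eqI, use tensorsD(6,7)[OF hat_tensor(1)[OF n3 A] k] k in
      \<open>auto simp: fId_times times_fId Phi_tensor[OF n3 A] ent_blk ent_emb split: if_splits\<close>)+

lemma Phi_supp:
  assumes A: "A \<in> tensors n1 n2 n3"
  shows "fId ({..<n3} \<times> {..<n1}) * Phi A = Phi A" "Phi A * fId ({..<n3} \<times> {..<n2}) = Phi A"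
  by (rule fmat_eqI, auto simp: fId_times times_fId Phi_tensor[OF n3 A] ent_blk split: if_splits)+

lemma Phi_norm_slices:
  assumes A: "A \<in> tensors n1 n2 n3"
  shows "(norm (Phi A))\<^sup>2 = (\<Sum>k<n3. (norm (emb k (hat A $ k)))\<^sup>2)"
proof -
  interpret row_partition "\<lambda>k. {k} \<times> {..<n1}" "{..<n3}" by unfold_locales auto
  have "(\<Union>k\<in>{..<n3}. {k} \<times> {..<n1}) = {..<n3} \<times> {..<n1}" by auto
  then have "(norm (Phi A))\<^sup>2 = (\<Sum>k<n3. (norm (fId ({k} \<times> {..<n1}) * Phi A))\<^sup>2)"
    using norm_blocks[of "Phi A"] Phi_supp(1)[OF A] by simp
  then show ?thesis by (simp add: Phi_slice(1)[OF A])
qed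

lemma tident_Phi:
  assumes rs: "dim_vec rs = n3"
  shows "tident rs \<in> tensors (max_entry rs) (max_entry rs) n3" "Phi (tident rs) = fId (Jset rs)"
proof -
  let ?r = "max_entry rs"
  let ?T = "vec n3 (\<lambda>k. mat ?r ?r (\<lambda>(i, j). if i = j \<and> i < rs $ k then 1 else (0::real)))"
  have T: "?T \<in> tensors ?r ?r n3" by (auto intro!: tensorsI)
  have eq: "tident rs = unhat ?T" unfolding tident_def rs ..
  show "tident rs \<in> tensors ?r ?r n3" unfolding eq by (rule unhat_tensor(1)[OF n3 T])
  show "Phi (tident rs) = fId (Jset rs)"
    unfolding eq Phi_hat[OF n3 T]
    by (rule fmat_eqI) (use max_entry_ge[of _ rs] rs in \<open>force simp: ent_blk ent_fId Jset_def\<close>)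
qed

lemma svd_tprod:
  assumes U: "U \<in> tensors n1 r n3" and S: "S \<in> tensors r r n3" and V: "V \<in> tensors n2 r n3"
  shows "U *\<^sub>t S *\<^sub>t ttranspose V \<in> tensors n1 n2 n3" "Phi (U *\<^sub>t S *\<^sub>t ttranspose V) = Phi U * Phi S * ftr (Phi V)"
  using tprod_Phi[OF n3 tprod_Phi(1)[OF n3 U S] ttranspose_Phi(1)[OF n3 V]]
  by (simp_all add: tprod_Phi[OF n3 U S] ttranspose_Phi[OF n3 V])

text \<open>The slicewise decomposition becomes one reduced decomposition of the block matrix; the
  zero padding up to the common width \<open>r\<close> lies outside \<open>Jset\<close>.\<close>

lemma skinny_svd_fsvd:
  assumes A: "A \<in> tensors n1 n2 n3" and S: "is_skinny_svd A U S V"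
  defines "r \<equiv> rank_ct A"
  shows "U \<in> tensors n1 r n3" "V \<in> tensors n2 r n3" "S \<in> tensors r r n3"
    "Phi S = fdiag (Jset (rank_t A)) (\<lambda>(k, a). hat S $ k $$ (a, a))"
    "fsvd (Phi A) (Phi U) (\<lambda>(k, a). hat S $ k $$ (a, a)) (Phi V) (Jset (rank_t A))"
proof -
  note A' = tensorsD[OF A]
  let ?rs = "rank_t A"
  note rs = rank_t_dim[OF A n3]
  have S': "U \<in> tensors n1 r n3" "S \<in> tensors r r n3" "V \<in> tensors n2 r n3"
    "ttranspose U *\<^sub>t U = tident ?rs" "ttranspose V *\<^sub>t V = tident ?rs"
    "\<And>k. k < n3 \<Longrightarrow> diagonal_mat (S $ k)"
    "\<And>k i. k < n3 \<Longrightarrow> i < r \<Longrightarrow> (if i < ?rs $ k then hat S $ k $$ (i, i) > 0 else hat S $ k $$ (i, i) = 0)"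
    "A = U *\<^sub>t S *\<^sub>t ttranspose V"
    using S unfolding is_skinny_svd_def Let_def A'(2) A'(4)[OF n3] A'(5)[OF n3] r_def by auto
  show U: "U \<in> tensors n1 r n3" and V: "V \<in> tensors n2 r n3" and ST: "S \<in> tensors r r n3" using S' by auto
  have r: "r = max_entry ?rs" unfolding r_def rank_ct_def ..
  have iso: "fiso (Phi W) (Jset ?rs)" if W: "W \<in> tensors n r n3" "ttranspose W *\<^sub>t W = tident ?rs" for W n
    using arg_cong[OF W(2), of Phi] tprod_Phi(2)[OF n3 ttranspose_Phi(1)[OF n3 W(1)] W(1)]
      ttranspose_Phi(2)[OF n3 W(1)] tident_Phi(2)[OF rs(1)]
    by (simp add: fiso_def)
  let ?s = "\<lambda>(k, a). hat S $ k $$ (a, a)"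
  show PS: "Phi S = fdiag (Jset ?rs) ?s"
  proof (rule fmat_eqI)
    fix p q :: "nat \<times> nat"
    obtain k i l j where pq: "p = (k, i)" "q = (l, j)" by (metis surj_pair)
    \<comment> \<open>Diagonality is given for the slices of \<open>S\<close> itself. The transform
      acts along tubes, so a tube of zeros stays zero.\<close>
    have off: "hat S $ k $$ (i, j) = 0" if "k < n3" "i < r" "j < r" "i \<noteq> j"
    proof -
      have "S $ c $$ (i, j) = 0" if "c < n3" for c
        using S'(6)[OF that] tensorsD(6,7)[OF ST that] \<open>i < r\<close> \<open>j < r\<close> \<open>i \<noteq> j\<close> unfolding diagonal_mat_def by auto
      then show ?thesis using that by (simp add: hat_tensor(2)[OF n3 ST])
    qed
    have le: "i < r" if "k < n3" "i < ?rs $ k" using max_entry_ge[of k ?rs] rs(1) r that by simp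
    have diag: "hat S $ k $$ (i, i) = 0" if "k < n3" "i < r" "\<not> i < ?rs $ k" using S'(7)[OF that(1,2)] that by simp
    show "ent (Phi S) p q = ent (fdiag (Jset ?rs) ?s) p q"
      using off le diag rs(1) by (auto simp: pq Phi_tensor[OF n3 ST] ent_blk Jset_def)
  qed
  have "Phi A = Phi U * fdiag (Jset ?rs) ?s * ftr (Phi V)"
    using arg_cong[OF S'(8), of Phi] svd_tprod(2)[OF U ST V] PS by simp
  moreover have "?s j > 0" if j: "j \<in> Jset ?rs" for j
  proof -
    obtain k a where ka: "j = (k, a)" "k < n3" "a < ?rs $ k" using j rs(1) by (auto simp: Jset_def)
    then have "a < r" using max_entry_ge[of k ?rs] rs(1) r by simp
    then show ?thesis using S'(7)[of k a] ka by simp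
  qed
  ultimately show "fsvd (Phi A) (Phi U) ?s (Phi V) (Jset ?rs)"
    unfolding fsvd_def using iso[OF U S'(4)] iso[OF V S'(5)] by blast
qed

text \<open>Decompositions of the single slices are padded to the common width and transformed back.
  Products between different slices vanish because their supports are disjoint.\<close>

lemma skinny_svd_exists:
  assumes A: "A \<in> tensors n1 n2 n3"
  shows "\<exists>U S V. is_skinny_svd A U S V"
proof -
  let ?H = "hat A" and ?rs = "rank_t A"
  let ?D = "\<lambda>k. {k} \<times> {..<?rs $ k}"
  define r where "r = rank_ct A"
  note A' = tensorsD[OF A] and H = hat_tensor(1)[OF n3 A]
  note rs = rank_t_dim[OF A n3]
  have r: "r = max_entry ?rs" unfolding r_def rank_ct_def ..
  have le: "a < r" if "k < n3" "a < ?rs $ k" for k a using max_entry_ge[of k ?rs] rs(1) r that by simp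
  define G where "G k T \<longleftrightarrow> fsvd (emb k (?H $ k)) (fst T) (fst (snd T)) (snd (snd T)) (?D k) \<and>
    (\<forall>a b. a \<le> b \<and> b < ?rs $ k \<longrightarrow> fst (snd T) (k, b) \<le> fst (snd T) (k, a)) \<and>
    fId ({k} \<times> {..<n1}) * fst T = fst T \<and> fId ({k} \<times> {..<n2}) * snd (snd T) = snd (snd T)"
    for k and T :: "bmat \<times> (nat \<times> nat \<Rightarrow> real) \<times> bmat"
  have "\<exists>T. G k T" if k: "k < n3" for k
  proof -
    obtain U s V where "fsvd (emb k (?H $ k)) U s V (?D k) \<and>
      (\<forall>a b. a \<le> b \<and> b < ?rs $ k \<longrightarrow> s (k, b) \<le> s (k, a)) \<and>
      fId ({k} \<times> {..<n1}) * U = U \<and> fId ({k} \<times> {..<n2}) * V = V"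
      using mat_svd[OF tensorsD(3)[OF H k], of k] unfolding rs(2)[OF k] by (elim exE)
    then have "G k (U, s, V)" unfolding G_def by simp
    then show ?thesis by blast
  qed
  then obtain T where T: "\<And>k. k < n3 \<Longrightarrow> G k (T k)" by metis
  define u where "u k = fst (T k)" for k
  define s where "s k = fst (snd (T k))" for k
  define v where "v k = snd (snd (T k))" for k
  have svd: "fsvd (emb k (?H $ k)) (u k) (s k) (v k) (?D k)"
    and dec: "\<And>a b. a \<le> b \<Longrightarrow> b < ?rs $ k \<Longrightarrow> s k (k, b) \<le> s k (k, a)"
    and su: "fId ({k} \<times> {..<n1}) * u k = u k" and sv: "fId ({k} \<times> {..<n2}) * v k = v k" if "k < n3" for k
    using T[OF that] unfolding G_def u_def s_def v_def by simp_all
  \<comment> \<open>The columns from \<open>rs $ k\<close> on are filled with zeros, as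
    \<open>fiso_fId\<close> shows.\<close>
  define mk where "mk n w = unhat (vec n3 (\<lambda>k. mat n r (\<lambda>(i, a). ent (w k) (k, i) (k, a))))"
    for n and w :: "nat \<Rightarrow> bmat"
  have mk: "mk n w \<in> tensors n r n3 \<and> Phi (mk n w) = (\<Sum>k<n3. w k) \<and> ttranspose (mk n w) *\<^sub>t mk n w = tident ?rs"
    if w: "\<And>k. k < n3 \<Longrightarrow> fiso (w k) (?D k)" "\<And>k. k < n3 \<Longrightarrow> fId ({k} \<times> {..<n}) * w k = w k" for n w
  proof -
    let ?V = "vec n3 (\<lambda>k. mat n r (\<lambda>(i, a). ent (w k) (k, i) (k, a)))"
    have V: "?V \<in> tensors n r n3" by (auto intro!: tensorsI)
    have t: "mk n w \<in> tensors n r n3" unfolding mk_def by (rule unhat_tensor(1)[OF n3 V])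
    have entw: "ent (w k) (a, i) (b, j) = (if a = k \<and> b = k \<and> i < n \<and> j < ?rs $ k then ent (w k) (k, i) (k, j) else 0)"
      if "k < n3" for k a i b j
    proof -
      have "ent (w k) (a, i) (b, j) = ent (fId ({k} \<times> {..<n}) * (w k * fId (?D k))) (a, i) (b, j)"
        using fiso_fId(1)[OF w(1)[OF that]] w(2)[OF that] by simp
      then show ?thesis by (auto simp: fId_times times_fId)
    qed
    have P: "Phi (mk n w) = (\<Sum>k<n3. w k)"
      unfolding mk_def Phi_hat[OF n3 V]
    proof (rule fmat_eqI)
      fix p q :: "nat \<times> nat"
      obtain a i b j where pq: "p = (a, i)" "q = (b, j)" by (metis surj_pair)
      have "ent (\<Sum>k<n3. w k) p q = (\<Sum>k<n3. if k = a then if a = b \<and> i < n \<and> j < ?rs $ a then ent (w a) (a, i) (a, j) else 0 else 0)"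
        unfolding ent_sum pq by (rule sum.cong[OF refl]) (subst entw, auto)
      also have "... = ent (blk n r n3 (\<lambda>k i j. ?V $ k $$ (i, j))) p q"
        using entw[of a a i a j] le[of a j] by (auto simp: pq ent_blk)
      finally show "ent (blk n r n3 (\<lambda>k i j. ?V $ k $$ (i, j))) p q = ent (\<Sum>k<n3. w k) p q" ..
    qed
    have cross: "ftr (w k) * w l = (if k = l then fId (?D k) else 0)" if "k < n3" "l < n3" for k l
    proof (cases "k = l")
      case True then show ?thesis using fisoD(2)[OF w(1)[OF that(1)]] by simp
    next
      case False
      have "ftr (w k) * w l = ftr (w k) * (fId ({k} \<times> {..<n}) * (fId ({l} \<times> {..<n}) * w l))"
        using w(2)[OF that(2)] arg_cong[OF w(2)[OF that(1)], of ftr] by (simp add: mult.assoc[symmetric])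
      also have "fId ({k} \<times> {..<n}) * (fId ({l} \<times> {..<n}) * w l) = 0"
      proof -
        have "({k} \<times> {..<n}) \<inter> ({l} \<times> {..<n}) = {}" using False by auto
        then show ?thesis using fId_mult[of "{k} \<times> {..<n}" "{l} \<times> {..<n}"] by (simp add: mult.assoc[symmetric] fId_def)
      qed
      finally show ?thesis using False by simp
    qed
    have "ftr (\<Sum>k<n3. w k) * (\<Sum>k<n3. w k) = (\<Sum>k<n3. \<Sum>l<n3. if l = k then fId (?D k) else 0)"
      unfolding ftr_sum sum_product by (intro sum.cong refl) (simp add: cross)
    also have "... = (\<Sum>k<n3. fId (?D k))" by simp
    also have "... = fId (\<Union>k\<in>{..<n3}. ?D k)"
      unfolding fId_def by (rule sum.UNION_disjoint[symmetric]) auto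
    also have "(\<Union>k\<in>{..<n3}. ?D k) = Jset ?rs" unfolding Jset_def rs(1) by auto
    finally have "ftr (Phi (mk n w)) * Phi (mk n w) = Phi (tident ?rs)" unfolding P tident_Phi(2)[OF rs(1)] .
    then have "Phi (ttranspose (mk n w) *\<^sub>t mk n w) = Phi (tident ?rs)"
      using tprod_Phi(2)[OF n3 ttranspose_Phi(1)[OF n3 t] t] ttranspose_Phi(2)[OF n3 t] by simp
    then have "ttranspose (mk n w) *\<^sub>t mk n w = tident ?rs"
      by (rule Phi_inj[OF n3 tprod_Phi(1)[OF n3 ttranspose_Phi(1)[OF n3 t] t] tident_Phi(1)[OF rs(1), folded r]])
    then show ?thesis using t P by blast
  qed
  define U where "U = mk n1 u"
  define V where "V = mk n2 v"
  define SH where "SH = vec n3 (\<lambda>k. mat r r (\<lambda>(i, j). if i = j \<and> i < ?rs $ k then s k (k, i) else 0))"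
  define S where "S = unhat SH"
  have U: "U \<in> tensors n1 r n3" "Phi U = (\<Sum>k<n3. u k)" "ttranspose U *\<^sub>t U = tident ?rs"
    unfolding U_def using mk[of u n1] su fsvdD(1)[OF svd] by auto
  have V: "V \<in> tensors n2 r n3" "Phi V = (\<Sum>k<n3. v k)" "ttranspose V *\<^sub>t V = tident ?rs"
    unfolding V_def using mk[of v n2] sv fsvdD(2)[OF svd] by auto
  have SHt: "SH \<in> tensors r r n3" unfolding SH_def by (auto intro!: tensorsI)
  have S: "S \<in> tensors r r n3" unfolding S_def by (rule unhat_tensor(1)[OF n3 SHt])
  have hS: "hat S = SH" unfolding S_def by (rule hat_unhat(1)[OF n3 SHt])
  have hSe: "hat S $ k $$ (i, j) = (if i = j \<and> i < ?rs $ k then s k (k, i) else 0)" if "k < n3" "i < r" "j < r" for k i j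
    unfolding hS SH_def using that by simp
  have PS: "Phi S = (\<Sum>k<n3. fdiag (?D k) (s k))"
  proof (rule fmat_eqI)
    fix p q :: "nat \<times> nat"
    obtain a i b j where pq: "p = (a, i)" "q = (b, j)" by (metis surj_pair)
    have "ent (\<Sum>k<n3. fdiag (?D k) (s k)) p q = (\<Sum>k<n3. if k = a then if a = b \<and> i = j \<and> i < ?rs $ a then s a (a, i) else 0 else 0)"
      unfolding ent_sum pq by (rule sum.cong) auto
    also have "... = ent (Phi S) p q"
      using le[of a i] by (auto simp: pq Phi_tensor[OF n3 S] ent_blk hSe)
    finally show "ent (Phi S) p q = ent (\<Sum>k<n3. fdiag (?D k) (s k)) p q" ..
  qed
  have "Phi (U *\<^sub>t S *\<^sub>t ttranspose V) = Phi A"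
  proof -
    have JJ: "(?D k) \<inter> (?D l) = (if k = l then ?D k else {})" for k l by auto
    have II: "fId (?D k) * fId (?D l) = (if k = l then fId (?D k) else 0)" for k l
      using fId_mult[of "?D k" "?D l"] JJ[of k l] by (auto simp: fId_def)
    have "(\<Sum>k<n3. u k) * (\<Sum>l<n3. fdiag (?D l) (s l)) = (\<Sum>k<n3. \<Sum>l<n3. if l = k then u k * fdiag (?D k) (s k) else 0)"
      unfolding sum_product
    proof (intro sum.cong refl)
      fix k l assume kl: "k \<in> {..<n3}" "l \<in> {..<n3}"
      have "u k * fId (?D k) = u k" by (rule fiso_fId(1)[OF fsvdD(1)[OF svd]]) (use kl in simp)
      moreover have "fId (?D l) * fdiag (?D l) (s l) = fdiag (?D l) (s l)"
        by (rule fdiag_fId(2)) simp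
      ultimately have "u k * fdiag (?D l) (s l) = (u k * fId (?D k)) * (fId (?D l) * fdiag (?D l) (s l))"
        by (simp only:)
      also have "... = u k * ((fId (?D k) * fId (?D l)) * fdiag (?D l) (s l))"
        by (simp only: mult.assoc)
      finally show "u k * fdiag (?D l) (s l) = (if l = k then u k * fdiag (?D k) (s k) else 0)"
        unfolding II by (simp add: fdiag_fId(2))
    qed
    then have US: "Phi U * Phi S = (\<Sum>k<n3. u k * fdiag (?D k) (s k))" unfolding U(2) PS by simp
    have "Phi U * Phi S * ftr (Phi V) = (\<Sum>k<n3. \<Sum>l<n3. if l = k then u k * fdiag (?D k) (s k) * ftr (v k) else 0)"
      unfolding US V(2) ftr_sum sum_product
    proof (intro sum.cong refl)
      fix k l assume kl: "k \<in> {..<n3}" "l \<in> {..<n3}"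
      have "fId (?D l) * ftr (v l) = ftr (v l)" by (rule fiso_fId(2)[OF fsvdD(2)[OF svd]]) (use kl in simp)
      moreover have "fdiag (?D k) (s k) * fId (?D k) = fdiag (?D k) (s k)"
        by (rule fdiag_fId(1)) simp
      ultimately have "u k * fdiag (?D k) (s k) * ftr (v l) =
          u k * (fdiag (?D k) (s k) * fId (?D k)) * (fId (?D l) * ftr (v l))"
        by (simp only:)
      also have "... = u k * fdiag (?D k) (s k) * (fId (?D k) * fId (?D l)) * ftr (v l)"
        by (simp only: mult.assoc)
      finally show "u k * fdiag (?D k) (s k) * ftr (v l) = (if l = k then u k * fdiag (?D k) (s k) * ftr (v k) else 0)"
        unfolding II by (auto simp: mult.assoc fdiag_fId(1))
    qed
    also have "... = (\<Sum>k<n3. emb k (?H $ k))" by (auto intro!: sum.cong simp: fsvdD(4)[OF svd])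
    also have "... = (\<Sum>k<n3. fId ({k} \<times> {..<n1}) * Phi A)" by (rule sum.cong) (simp_all add: Phi_slice(1)[OF A])
    also have "... = fId (\<Union>k\<in>{..<n3}. {k} \<times> {..<n1}) * Phi A"
      unfolding sum_distrib_right[symmetric] fId_def by (subst sum.UNION_disjoint) auto
    also have "(\<Union>k\<in>{..<n3}. {k} \<times> {..<n1}) = {..<n3} \<times> {..<n1}" by auto
    finally show ?thesis unfolding svd_tprod(2)[OF U(1) S V(1)] Phi_supp(1)[OF A] .
  qed
  then have eqA: "A = U *\<^sub>t S *\<^sub>t ttranspose V"
    using Phi_inj[OF n3 svd_tprod(1)[OF U(1) S V(1)] A] by simp
  have diag: "diagonal_mat (S $ k)" if "k < n3" for k
    unfolding diagonal_mat_def
  proof (intro allI impI)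
    fix i j assume ij: "i < dim_row (S $ k)" "j < dim_col (S $ k)" "i \<noteq> j"
    then have ij': "i < r" "j < r" using tensorsD(6,7)[OF S that] by auto
    have "S $ k $$ (i, j) = (\<Sum>c<n3. dct n3 $$ (c, k) * SH $ c $$ (i, j))"
      unfolding S_def by (rule unhat_tensor(2)[OF n3 SHt that ij'])
    also have "... = 0" by (rule sum.neutral) (use ij ij' in \<open>auto simp: SH_def\<close>)
    finally show "S $ k $$ (i, j) = 0" .
  qed
  have pos: "if i < ?rs $ k then hat S $ k $$ (i, i) > 0 else hat S $ k $$ (i, i) = 0" if "k < n3" "i < r" for k i
    using hSe[OF that that(2)] fsvdD(3)[OF svd[OF that(1)], of "(k, i)"] by auto
  have mono: "hat S $ k $$ (j, j) \<le> hat S $ k $$ (i, i)" if "k < n3" "i \<le> j" "j < r" for k i j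
    using hSe[OF that(1,3,3)] hSe[OF that(1), of i i] that dec[OF that(1,2)] pos[OF that(1), of i]
    by (auto split: if_splits)
  have "is_skinny_svd A U S V"
    unfolding is_skinny_svd_def Let_def A'(2) A'(4)[OF n3] A'(5)[OF n3] r_def[symmetric]
    using U V S diag pos mono eqA by blast
  then show ?thesis by blast
qed

end

text \<open>With \<open>PV\<close> and \<open>sval\<close>, the factors of the decomposition
  selected by \<open>skinny_svd\<close>, hence the very ones that occur in
  \<open>tangent_proj\<close> and \<open>trim\<close>.\<close>

definition PU :: "tensor \<Rightarrow> bmat" where "PU Z = Phi (fst (skinny_svd Z))"
definition PV :: "tensor \<Rightarrow> bmat" where "PV Z = Phi (snd (snd (skinny_svd Z)))"
definition sval :: "tensor \<Rightarrow> nat \<times> nat \<Rightarrow> real" where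
  "sval Z = (\<lambda>(k, a). hat (fst (snd (skinny_svd Z))) $ k $$ (a, a))"

text \<open>The rows of the \<open>i\<close>-th horizontal slice, taken over all transformed frontal
  slices.\<close>

definition slab :: "nat \<Rightarrow> nat \<Rightarrow> (nat \<times> nat) set" where "slab n3 i = {..<n3} \<times> {i}"

lemma finite_slab [simp]: "finite (slab n3 i)" by (simp add: slab_def)

lemma row_partition_slab: "row_partition (slab n3) {..<n}"
  by unfold_locales (auto simp: slab_def)

lemma Union_slab: "(\<Union>i\<in>{..<n}. slab n3 i) = {..<n3} \<times> {..<n}"
  by (auto simp: slab_def)

lemma ent_frow_scale_times:
  "ent (frow_scale d (slab n3) {..<n} * A) (k, i) q = (if k < n3 \<and> i < n then d i * ent A (k, i) q else 0)"
proof -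
  have "ent (frow_scale d (slab n3) {..<n} * A) (k, i) q = (\<Sum>x<n. d x * (if (k, i) \<in> slab n3 x then ent A (k, i) q else 0))"
    unfolding frow_scale_def sum_distrib_right by (simp add: fId_times)
  also have "... = (\<Sum>x<n. if x = i then if k < n3 then d i * ent A (k, i) q else 0 else 0)"
    by (rule sum.cong) (auto simp: slab_def)
  finally show ?thesis by simp
qed

definition ebas :: "nat \<Rightarrow> nat \<Rightarrow> nat \<Rightarrow> nat \<Rightarrow> bmat" where
  "ebas n3 i j c = (\<Sum>k<n3. dct n3 $$ (k, c) *\<^sub>R fE (k, i) (k, j))"

lemma ftr_ebas: "ftr (ebas n3 i j c) = ebas n3 j i c"
  unfolding ebas_def by simp

lemma slab_shift: "(\<Sum>k<n3. fE (k, i) (k, j)) * (\<Sum>k<n3. fE (k, j) (k, i)) = fId (slab n3 i)"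
proof -
  have "(\<Sum>k<n3. fE (k, i) (k, j)) * (\<Sum>k<n3. fE (k, j) (k, i)) = (\<Sum>k<n3. \<Sum>l<n3. if l = k then fE (k, i) (k, i) else 0)"
    unfolding sum_product by (intro sum.cong refl) (auto simp: fE_mult)
  moreover have "slab n3 i = (\<lambda>k. (k, i)) ` {..<n3}" by (auto simp: slab_def)
  ultimately show ?thesis by (simp add: fId_def sum.reindex inj_on_def)
qed

text \<open>Multiplying a basis tensor by \<open>ftr U\<close> picks the \<open>i\<close>-th row of
  every slice of \<open>U\<close> with a coefficient of the transform, of size at most
  \<open>sqrt (2 / n3)\<close>.\<close>

lemma coherence_left:
  assumes U: "fiso U J" and c: "c < n3"
  shows "(norm (U * ftr U * ebas n3 i j c))\<^sup>2 \<le> 2 / real n3 * (norm (fId (slab n3 i) * U))\<^sup>2"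
proof -
  \<comment> \<open>Moves row \<open>i\<close> to row \<open>j\<close> in every slice; as a partial
    isometry it does not increase norms.\<close>
  define M where "M = (\<Sum>k<n3. fE (k, j) (k, i))"
  have entM: "ent (M * A) (k, j') q = (if k < n3 \<and> j' = j then ent A (k, i) q else 0)" for A k j' q
  proof -
    have "ent (M * A) (k, j') q = (\<Sum>k'<n3. if k' = k then if j' = j then ent A (k, i) q else 0 else 0)"
      unfolding M_def sum_distrib_right ent_sum by (rule sum.cong) auto
    then show ?thesis by auto
  qed
  have "ftr M * M = fId (slab n3 i)" unfolding M_def ftr_sum ftr_fE by (rule slab_shift)
  then have M: "fiso M (slab n3 i)" by (simp add: fiso_def)
  have "norm (U * ftr U * ebas n3 i j c) \<le> norm (ftr U * ebas n3 i j c)"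
    unfolding mult.assoc by (rule fiso_contract(1)[OF U])
  also have "... = norm (ebas n3 j i c * U)"
    using norm_ftr[of "ftr U * ebas n3 i j c"] by (simp add: ftr_ebas)
  also have "... \<le> norm (sqrt (2 / real n3) *\<^sub>R (M * (fId (slab n3 i) * U)))"
  proof (rule norm_mono_ent)
    fix p q :: "nat \<times> nat"
    obtain k j' where p: "p = (k, j')" by (metis surj_pair)
    have "ent (ebas n3 j i c * U) p q = (\<Sum>k'<n3. if k' = k then if j' = j then dct n3 $$ (k, c) * ent U (k, i) q else 0 else 0)"
      unfolding ebas_def sum_distrib_right ent_sum p by (rule sum.cong) auto
    then have "ent (ebas n3 j i c * U) p q = (if k < n3 \<and> j' = j then dct n3 $$ (k, c) * ent U (k, i) q else 0)" by auto
    moreover have "ent (M * (fId (slab n3 i) * U)) p q = (if k < n3 \<and> j' = j then ent U (k, i) q else 0)"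
      unfolding p entM by (auto simp: fId_times slab_def)
    ultimately show "\<bar>ent (ebas n3 j i c * U) p q\<bar> \<le> \<bar>ent (sqrt (2 / real n3) *\<^sub>R (M * (fId (slab n3 i) * U))) p q\<bar>"
      using dct_abs[of k n3 c] c by (auto simp: abs_mult intro!: mult_right_mono)
  qed
  also have "... \<le> sqrt (2 / real n3) * norm (fId (slab n3 i) * U)"
    using fiso_contract(1)[OF M, of "fId (slab n3 i) * U"] by (simp add: mult_left_mono)
  finally have "(norm (U * ftr U * ebas n3 i j c))\<^sup>2 \<le> (sqrt (2 / real n3) * norm (fId (slab n3 i) * U))\<^sup>2"
    by (intro power_mono) auto
  then show ?thesis by (simp add: power_mult_distrib)
qed

lemma coherence_right:
  assumes V: "fiso V J" and c: "c < n3"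
  shows "(norm (ebas n3 i j c * (V * ftr V)))\<^sup>2 \<le> 2 / real n3 * (norm (fId (slab n3 j) * V))\<^sup>2"
  using coherence_left[OF V c, of j i] fproj_ftr_right(1)[OF fiso_fproj[OF V], of "ebas n3 i j c"]
  by (simp add: ftr_ebas)

context
  fixes n3 :: nat
  assumes n3: "0 < n3"
begin

lemma Phi_basis_ebas:
  assumes "\<omega> \<in> index_set n1 n2 n3"
  shows "Phi (basis_tensor n1 n2 n3 \<omega>) = ebas n3 (fst \<omega>) (fst (snd \<omega>)) (snd (snd \<omega>))"
  using assms Phi_basis[OF n3] by (auto simp: index_set_def ebas_def)

lemma skinny_svd_is:
  assumes "Z \<in> tensors n1 n2 n3"
  shows "is_skinny_svd Z (fst (skinny_svd Z)) (fst (snd (skinny_svd Z))) (snd (snd (skinny_svd Z)))"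
proof -
  have "(\<lambda>(U, S, V). is_skinny_svd Z U S V) (skinny_svd Z)"
    unfolding skinny_svd_def by (rule someI_ex) (use skinny_svd_exists[OF n3 assms] in auto)
  then show ?thesis by (simp add: case_prod_beta)
qed

lemma fsvd_skinny:
  assumes Z: "Z \<in> tensors n1 n2 n3"
  shows "fsvd (Phi Z) (PU Z) (sval Z) (PV Z) (Jset (rank_t Z))"
    "fId ({..<n3} \<times> {..<n1}) * PU Z = PU Z" "fId ({..<n3} \<times> {..<n2}) * PV Z = PV Z"
  unfolding PU_def PV_def sval_def
  using skinny_svd_fsvd[OF n3 Z skinny_svd_is[OF Z]] Phi_supp(1)[OF n3] by auto

lemma ftan_tensor:
  assumes U: "U \<in> tensors n1 q n3" and V: "V \<in> tensors n2 q n3" and A: "A \<in> tensors n1 n2 n3"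
  defines "B \<equiv> U *\<^sub>t ttranspose U *\<^sub>t A + A *\<^sub>t V *\<^sub>t ttranspose V - U *\<^sub>t ttranspose U *\<^sub>t A *\<^sub>t V *\<^sub>t ttranspose V"
  shows "B \<in> tensors n1 n2 n3" "Phi B = ftan (Phi U * ftr (Phi U)) (Phi V * ftr (Phi V)) (Phi A)"
proof -
  note U' = ttranspose_Phi[OF n3 U] and V' = ttranspose_Phi[OF n3 V]
  note a1 = tprod_Phi[OF n3 U U'(1)]
  note a2 = tprod_Phi[OF n3 a1(1) A]
  note b1 = tprod_Phi[OF n3 A V]
  note b2 = tprod_Phi[OF n3 b1(1) V'(1)]
  note c1 = tprod_Phi[OF n3 a2(1) V]
  note c2 = tprod_Phi[OF n3 c1(1) V'(1)]
  note p1 = tensor_ops(1)[OF a2(1) b2(1)]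
  show "B \<in> tensors n1 n2 n3" unfolding B_def by (rule tensor_ops(2)[OF p1 c2(1)])
  show "Phi B = ftan (Phi U * ftr (Phi U)) (Phi V * ftr (Phi V)) (Phi A)"
    unfolding B_def Phi_ops(2)[OF n3 p1 c2(1)] Phi_ops(1)[OF n3 a2(1) b2(1)] a2 b2 c2 a1 b1 c1 U'(2) V'(2) ftan_def
    by (simp add: mult.assoc)
qed

lemma tangent_proj_Phi:
  assumes Z: "Z \<in> tensors n1 n2 n3" and A: "A \<in> tensors n1 n2 n3"
  shows "tangent_proj Z A \<in> tensors n1 n2 n3"
    "Phi (tangent_proj Z A) = ftan (PU Z * ftr (PU Z)) (PV Z * ftr (PV Z)) (Phi A)"
  using ftan_tensor[OF skinny_svd_fsvd(1,2)[OF n3 Z skinny_svd_is[OF Z]] A]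
  unfolding tangent_proj_def PU_def PV_def by (simp_all add: case_prod_beta)

text \<open>Up to the normalization \<open>1 / sqrt n3\<close>, \<open>evec\<close> is a matrix
  \<open>M\<close> with \<open>M * ftr M = fId (slab n3 i)\<close>, so the incoherence conditions
  are bounds on row blocks.\<close>

lemma evec_norm:
  assumes U: "U \<in> tensors n r n3" and i: "i < n"
  shows "tnorm (ttranspose U *\<^sub>t evec n n3 i) = norm (fId (slab n3 i) * Phi U) / sqrt (real n3)"
proof -
  let ?E = "vec n3 (\<lambda>k. mat n 1 (\<lambda>(a, b). if a = i then 1 / sqrt (real n3) else 0))"
  have E: "?E \<in> tensors n 1 n3" by (auto intro!: tensorsI)
  have ev: "evec n n3 i \<in> tensors n 1 n3" unfolding evec_def by (rule unhat_tensor(1)[OF n3 E])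
  define M where "M = (\<Sum>k<n3. fE (k, i) (k, 0::nat))"
  have PE: "Phi (evec n n3 i) = (1 / sqrt (real n3)) *\<^sub>R M"
    unfolding evec_def Phi_hat[OF n3 E]
  proof (rule fmat_eqI)
    fix p q :: "nat \<times> nat"
    obtain k a l b where pq: "p = (k, a)" "q = (l, b)" by (metis surj_pair)
    have "ent M p q = (\<Sum>k'<n3. if k' = k then if l = k \<and> a = i \<and> b = 0 then 1 else 0 else 0)"
      unfolding M_def ent_sum pq by (rule sum.cong) auto
    then show "ent (blk n 1 n3 (\<lambda>k i j. ?E $ k $$ (i, j))) p q = ent ((1 / sqrt (real n3)) *\<^sub>R M) p q"
      using i by (auto simp: pq ent_blk)
  qed
  have MM: "M * ftr M = fId (slab n3 i)" unfolding M_def ftr_sum ftr_fE by (rule slab_shift)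
  have "inner (ftr (Phi U) * M) (ftr (Phi U) * M) = inner (ftr (Phi U)) (ftr (Phi U) * fId (slab n3 i))"
    by (simp add: inner_mult_right[of _ M] mult.assoc MM)
  also have "... = inner (ftr (Phi U)) (ftr (Phi U) * fId (slab n3 i) * fId (slab n3 i))"
    using fId_mult[of "slab n3 i" "slab n3 i"] by (simp add: mult.assoc)
  also have "... = inner (ftr (fId (slab n3 i) * Phi U)) (ftr (fId (slab n3 i) * Phi U))"
    by (simp add: inner_mult_right[of "ftr (Phi U)" "fId (slab n3 i)"])
  finally have "norm (ftr (Phi U) * M) = norm (fId (slab n3 i) * Phi U)"
    unfolding inner_ftr by (simp add: norm_eq_sqrt_inner)
  then show ?thesis
    unfolding tnorm_Phi[OF n3 tprod_Phi(1)[OF n3 ttranspose_Phi(1)[OF n3 U] ev]]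
      tprod_Phi(2)[OF n3 ttranspose_Phi(1)[OF n3 U] ev] ttranspose_Phi(2)[OF n3 U] PE
    by (simp add: field_simps)
qed

definition clip :: "real \<Rightarrow> bmat \<Rightarrow> nat \<Rightarrow> real" where
  "clip b U i = min 1 (b / norm (fId (slab n3 i) * U))"

text \<open>The scaling factor is constant along each horizontal slice and thus commutes with the
  transform. \<open>sqrt n3\<close> compensates the normalization in
  \<open>evec_norm\<close>.\<close>

lemma trim_factor_Phi:
  assumes U: "U \<in> tensors n r n3"
  shows "trim_factor \<mu>0 \<rho> U \<in> tensors n r n3"
    "Phi (trim_factor \<mu>0 \<rho> U) = frow_scale (clip (sqrt (real n3) * sqrt (\<mu>0 * real \<rho> / real n)) (Phi U)) (slab n3) {..<n} * Phi U"
proof -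
  let ?b = "sqrt (real n3) * sqrt (\<mu>0 * real \<rho> / real n)"
  note U' = tensorsD[OF U]
  show T: "trim_factor \<mu>0 \<rho> U \<in> tensors n r n3"
    unfolding trim_factor_def using U' by (intro tensorsI) auto
  have e: "trim_factor \<mu>0 \<rho> U $ k $$ (i, j) = clip ?b (Phi U) i * U $ k $$ (i, j)" if "k < n3" "i < n" "j < r" for k i j
    unfolding trim_factor_def clip_def using U' that n3 by (simp add: evec_norm[OF U] mult.commute)
  have h: "hat (trim_factor \<mu>0 \<rho> U) $ k $$ (i, j) = clip ?b (Phi U) i * hat U $ k $$ (i, j)" if "k < n3" "i < n" "j < r" for k i j
    unfolding hat_tensor(2)[OF n3 T that] hat_tensor(2)[OF n3 U that] sum_distrib_left
    by (rule sum.cong) (use that in \<open>simp_all add: e\<close>)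
  show "Phi (trim_factor \<mu>0 \<rho> U) = frow_scale (clip ?b (Phi U)) (slab n3) {..<n} * Phi U"
  proof (rule fmat_eqI)
    fix p q :: "nat \<times> nat"
    obtain k i l j where pq: "p = (k, i)" "q = (l, j)" by (metis surj_pair)
    show "ent (Phi (trim_factor \<mu>0 \<rho> U)) p q = ent (frow_scale (clip ?b (Phi U)) (slab n3) {..<n} * Phi U) p q"
      unfolding pq ent_frow_scale_times unfolding Phi_tensor[OF n3 T] by (subst (2) Phi_tensor[OF n3 U]) (auto simp: ent_blk h)
  qed
qed

lemma trim_Phi:
  assumes Z: "Z \<in> tensors n1 n2 n3"
  shows "trim \<mu>0 \<rho> Z \<in> tensors n1 n2 n3"
    "Phi (trim \<mu>0 \<rho> Z) =
      (frow_scale (clip (sqrt (real n3) * sqrt (\<mu>0 * real \<rho> / real n1)) (PU Z)) (slab n3) {..<n1} * PU Z)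
      * fdiag (Jset (rank_t Z)) (sval Z)
      * ftr (frow_scale (clip (sqrt (real n3) * sqrt (\<mu>0 * real \<rho> / real n2)) (PV Z)) (slab n3) {..<n2} * PV Z)"
proof -
  obtain U S V where sk: "skinny_svd Z = (U, S, V)" by (cases "skinny_svd Z")
  note s = skinny_svd_fsvd[OF n3 Z skinny_svd_is[OF Z]]
  have U: "U \<in> tensors n1 (rank_ct Z) n3" and V: "V \<in> tensors n2 (rank_ct Z) n3" and S: "S \<in> tensors (rank_ct Z) (rank_ct Z) n3"
    and PS: "Phi S = fdiag (Jset (rank_t Z)) (sval Z)"
    using s(1-4) sk by (auto simp: sval_def)
  have eq: "trim \<mu>0 \<rho> Z = trim_factor \<mu>0 \<rho> U *\<^sub>t S *\<^sub>t ttranspose (trim_factor \<mu>0 \<rho> V)"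
    unfolding trim_def sk by simp
  note tU = trim_factor_Phi[OF U, of \<mu>0 \<rho>] and tV = trim_factor_Phi[OF V, of \<mu>0 \<rho>]
  show "trim \<mu>0 \<rho> Z \<in> tensors n1 n2 n3" unfolding eq by (rule svd_tprod(1)[OF n3 tU(1) S tV(1)])
  show "Phi (trim \<mu>0 \<rho> Z) =
      (frow_scale (clip (sqrt (real n3) * sqrt (\<mu>0 * real \<rho> / real n1)) (PU Z)) (slab n3) {..<n1} * PU Z)
      * fdiag (Jset (rank_t Z)) (sval Z)
      * ftr (frow_scale (clip (sqrt (real n3) * sqrt (\<mu>0 * real \<rho> / real n2)) (PV Z)) (slab n3) {..<n2} * PV Z)"
    unfolding eq svd_tprod(2)[OF n3 tU(1) S tV(1)] tU(2) tV(2) PS PU_def PV_def sk by simp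
qed

lemma slice_fsvd:
  assumes X: "X \<in> tensors n1 n2 n3" and S: "is_skinny_svd X U S V" and k: "k < n3"
  shows "fsvd (emb k (hat X $ k)) (Phi U * fId ({k} \<times> {..<rank_t X $ k})) (\<lambda>(k, a). hat S $ k $$ (a, a))
    (Phi V * fId ({k} \<times> {..<rank_t X $ k})) ({k} \<times> {..<rank_t X $ k})"
proof -
  note s = skinny_svd_fsvd[OF n3 X S] and rs = rank_t_dim[OF X n3]
  let ?s = "\<lambda>(k, a). hat S $ k $$ (a, a)" and ?J = "Jset (rank_t X)" and ?K = "{k} \<times> {..<rank_t X $ k}"
  have K: "?K \<subseteq> ?J" unfolding Jset_def using k rs(1) by auto
  note D = fsvdD[OF s(5)]
  have "fId ({k} \<times> {..<n1}) * Phi U = Phi U * fId ?K"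
  proof (rule fmat_eqI)
    fix p q :: "nat \<times> nat"
    obtain a i b j where pq: "p = (a, i)" "q = (b, j)" by (metis surj_pair)
    have "ent (Phi U) p q = (if q \<in> ?J then ent (Phi U) p q else 0)"
      using fiso_fId(1)[OF D(1)] times_fId[OF finite_Jset, of "Phi U" "rank_t X" p q] by simp
    then show "ent (fId ({k} \<times> {..<n1}) * Phi U) p q = ent (Phi U * fId ?K) p q"
      using rs(1) by (auto simp: pq fId_times times_fId Phi_tensor[OF n3 s(1)] ent_blk Jset_def)
  qed
  then have "emb k (hat X $ k) = Phi U * (fId ?K * fdiag ?J ?s) * ftr (Phi V)"
    using Phi_slice(1)[OF n3 X k] D(4) by (simp add: mult.assoc[symmetric])
  also have "fId ?K * fdiag ?J ?s = fdiag ?K ?s"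
    by (rule fmat_eqI) (use K in \<open>auto simp: fId_times\<close>)
  finally show ?thesis using fsvd_restrict[OF s(5) K] by simp
qed

lemma hat_diff_slice:
  assumes "A \<in> tensors n1 n2 n3" "B \<in> tensors n1 n2 n3" "k < n3"
  shows "emb k (hat (A - B) $ k) = emb k (hat A $ k) - emb k (hat B $ k)"
  using Phi_slice(1)[OF n3 tensor_ops(2)[OF assms(1,2)] assms(3)] Phi_slice(1)[OF n3 assms(1,3)] Phi_slice(1)[OF n3 assms(2,3)]
  by (simp add: Phi_ops[OF n3 assms(1,2)] right_diff_distrib)

text \<open>Two error bounds with different uses: the factor \<open>2\<close>, from the triangle
  inequality in each slice, serves the iterations, where the Frobenius distance is small. The other
  one serves the starting point, for which only an operator bound is known; a difference of rank at
  most \<open>2 * r\<close> in each of \<open>n3\<close> slices gives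
  \<open>8 * n3 * r\<close>.\<close>

lemma threshold_tensor:
  assumes X: "X \<in> tensors n1 n2 n3" and S: "is_skinny_svd X U S V"
    and \<sigma>: "\<forall>j\<in>Jset (rank_t X). \<sigma> \<le> (\<lambda>(k, a). hat S $ k $$ (a, a)) j"
    and W: "W \<in> tensors n1 n2 n3"
    and op: "\<And>k. k < n3 \<Longrightarrow> fop_le (emb k (hat W $ k) - emb k (hat X $ k)) \<epsilon>" and gap: "2 * \<epsilon> < \<sigma>" "0 \<le> \<epsilon>"
  shows "threshold_defined (rank_t X) W" "threshold (rank_t X) W \<in> tensors n1 n2 n3"
    "rank_t (threshold (rank_t X) W) = rank_t X"
    "norm (Phi (threshold (rank_t X) W) - Phi X) \<le> 2 * norm (Phi W - Phi X)"
    "norm (Phi (threshold (rank_t X) W) - Phi X) \<le> sqrt (8 * real n3 * real (rank_ct X)) * \<epsilon>"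
proof -
  let ?rs = "rank_t X"
  note rs = rank_t_dim[OF X n3]
  note hX = hat_tensor(1)[OF n3 X] and hW = hat_tensor(1)[OF n3 W]
  have ex: "\<exists>Y. best_rank_approx (?rs $ k) (hat W $ k) Y \<and> mat_rank Y = ?rs $ k \<and>
      (\<forall>Y'. best_rank_approx (?rs $ k) (hat W $ k) Y' \<longrightarrow> Y' = Y)" if k: "k < n3" for k
  proof -
    have "\<forall>j\<in>{k} \<times> {..<?rs $ k}. \<sigma> \<le> (\<lambda>(k, a). hat S $ k $$ (a, a)) j"
      using \<sigma> k rs(1) by (auto simp: Jset_def)
    from best_rank_approx_ex1[OF tensorsD(3)[OF hW k] tensorsD(3)[OF hX k] slice_fsvd[OF X S k] this op[OF k] gap]
    show ?thesis unfolding rs(2)[OF k] .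
  qed
  define Y where "Y k = (THE Y. best_rank_approx (?rs $ k) (hat W $ k) Y)" for k
  have Y: "best_rank_approx (?rs $ k) (hat W $ k) (Y k)" "mat_rank (Y k) = ?rs $ k" if k: "k < n3" for k
  proof -
    from ex[OF k] obtain Y0 where Y0: "best_rank_approx (?rs $ k) (hat W $ k) Y0 \<and> mat_rank Y0 = ?rs $ k \<and>
      (\<forall>Y'. best_rank_approx (?rs $ k) (hat W $ k) Y' \<longrightarrow> Y' = Y0)"
      by (rule exE)
    have "Y k = Y0" unfolding Y_def by (rule the_equality) (use Y0 in \<open>simp_all\<close>)
    then show "best_rank_approx (?rs $ k) (hat W $ k) (Y k)" "mat_rank (Y k) = ?rs $ k" using Y0 by simp_all
  qed
  show "threshold_defined ?rs W"
    unfolding threshold_defined_def tensorsD(2)[OF W]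
  proof (intro allI impI)
    fix k assume "k < n3"
    from ex[OF this] obtain Y0 where "best_rank_approx (?rs $ k) (hat W $ k) Y0 \<and> mat_rank Y0 = ?rs $ k \<and>
      (\<forall>Y'. best_rank_approx (?rs $ k) (hat W $ k) Y' \<longrightarrow> Y' = Y0)"
      by (rule exE)
    then show "\<exists>!Y. best_rank_approx (?rs $ k) (hat W $ k) Y" by (intro ex1I[of _ Y0]) simp_all
  qed
  have Yc: "Y k \<in> carrier_mat n1 n2" if "k < n3" for k
    using Y(1)[OF that] tensorsD(6,7)[OF hW that] unfolding best_rank_approx_def by simp
  have T: "vec n3 Y \<in> tensors n1 n2 n3" by (intro tensorsI) (auto simp: Yc)
  have eq: "threshold ?rs W = unhat (vec n3 Y)"
    unfolding threshold_def tensorsD(2)[OF W] Y_def ..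
  let ?H = "threshold ?rs W"
  show H: "?H \<in> tensors n1 n2 n3" unfolding eq by (rule unhat_tensor(1)[OF n3 T])
  have hH: "hat ?H $ k = Y k" if "k < n3" for k unfolding eq hat_unhat(1)[OF n3 T] using that by simp
  show "rank_t ?H = ?rs"
    by (rule eq_vecI) (use rank_t_dim[OF H n3] rs hH Y(2) in auto)
  have best: "norm (emb k (hat W $ k) - emb k (Y k)) \<le> norm (emb k (hat W $ k) - emb k (hat X $ k))" if k: "k < n3" for k
  proof -
    have "frob_norm (hat W $ k - Y k) \<le> frob_norm (hat W $ k - hat X $ k)"
      using Y(1)[OF k] tensorsD(3,6,7)[OF hX k] tensorsD(6,7)[OF hW k] rs(2)[OF k] unfolding best_rank_approx_def by auto
    then show ?thesis
      using norm_emb[of k] emb_minus[OF tensorsD(3)[OF hW k] Yc[OF k]] emb_minus[OF tensorsD(3)[OF hW k] tensorsD(3)[OF hX k]]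
      by metis
  qed
  have slices: "(norm (Phi A - Phi X))\<^sup>2 = (\<Sum>k<n3. (norm (emb k (hat A $ k) - emb k (hat X $ k)))\<^sup>2)" if A: "A \<in> tensors n1 n2 n3" for A
    using Phi_norm_slices[OF n3 tensor_ops(2)[OF A X]] by (simp add: Phi_ops[OF n3 A X] hat_diff_slice[OF A X])
  have "(norm (Phi ?H - Phi X))\<^sup>2 \<le> (\<Sum>k<n3. (2 * norm (emb k (hat W $ k) - emb k (hat X $ k)))\<^sup>2)"
    unfolding slices[OF H]
  proof (intro sum_mono power_mono)
    fix k assume "k \<in> {..<n3}"
    then show "norm (emb k (hat ?H $ k) - emb k (hat X $ k)) \<le> 2 * norm (emb k (hat W $ k) - emb k (hat X $ k))"
      using best[of k] hH[of k] norm_triangle_ineq4[of "emb k (hat W $ k) - emb k (hat X $ k)" "emb k (hat W $ k) - emb k (Y k)"]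
      by simp
  qed simp
  also have "... = (2 * norm (Phi W - Phi X))\<^sup>2"
    by (simp add: power_mult_distrib sum_distrib_left[symmetric] slices[OF W])
  finally show "norm (Phi ?H - Phi X) \<le> 2 * norm (Phi W - Phi X)" by (rule power2_le_imp_le) simp
  have "(norm (Phi ?H - Phi X))\<^sup>2 \<le> (\<Sum>k<n3. 8 * real (rank_ct X) * \<epsilon>\<^sup>2)"
    unfolding slices[OF H]
  proof (rule sum_mono)
    fix k assume "k \<in> {..<n3}"
    then have k: "k < n3" by simp
    let ?D = "Y k - hat X $ k"
    have Dc: "?D \<in> carrier_mat n1 n2" by (rule minus_carrier_mat[OF tensorsD(3)[OF hX k]])
    obtain U1 s1 V1 where D: "fsvd (emb k ?D) U1 s1 V1 ({k} \<times> {..<mat_rank ?D})" using mat_svd[OF Dc, of k] by blast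
    \<comment> \<open>The rank factorizations of both matrices are concatenated, the second one with
      a minus sign and indices shifted by \<open>?r\<close>.\<close>
    have "mat_rank ?D \<le> 2 * rank_ct X"
    proof -
      have le: "?rs $ k \<le> rank_ct X" unfolding rank_ct_def using max_entry_ge[of k ?rs] rs(1) k by simp
      obtain p q where pq: "\<forall>i<n1. \<forall>j<n2. Y k $$ (i, j) = (\<Sum>b<mat_rank (Y k). p b i * q b j)"
        using mat_rank_factor_ex[OF Yc[OF k]] by blast
      obtain p' q' where pq': "\<forall>i<n1. \<forall>j<n2. (hat X $ k) $$ (i, j) = (\<Sum>b<mat_rank (hat X $ k). p' b i * q' b j)"
        using mat_rank_factor_ex[OF tensorsD(3)[OF hX k]] by blast
      let ?r = "?rs $ k"
      have "mat_rank ?D \<le> ?r + ?r"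
      proof (rule mat_rank_le_factor[OF Dc])
        fix i j assume ij: "i < n1" "j < n2"
        have "?D $$ (i, j) = (\<Sum>b<?r. p b i * q b j) + (\<Sum>b<?r. - p' b i * q' b j)"
          using pq pq' ij Yc[OF k] tensorsD(6,7)[OF hX k] Y(2)[OF k] rs(2)[OF k] by (simp add: sum_negf)
        also have "(\<Sum>b<?r. - p' b i * q' b j) = (\<Sum>b\<in>{?r..<?r + ?r}. - p' (b - ?r) i * q' (b - ?r) j)"
          by (rule sum.reindex_bij_witness[of _ "\<lambda>b. b - ?r" "\<lambda>b. b + ?r"]) auto
        also have "(\<Sum>b<?r. p b i * q b j) = (\<Sum>b\<in>{0..<?r}. p b i * q b j)" by (simp add: lessThan_atLeast0)
        also have "(\<Sum>b\<in>{0..<?r}. p b i * q b j) + (\<Sum>b\<in>{?r..<?r + ?r}. - p' (b - ?r) i * q' (b - ?r) j) =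
           (\<Sum>b\<in>{0..<?r + ?r}. (if b < ?r then p b i else - p' (b - ?r) i) * (if b < ?r then q b j else q' (b - ?r) j))"
          by (subst sum.atLeastLessThan_concat[of 0 ?r "?r + ?r", symmetric]) (auto intro!: arg_cong2[where f = "(+)"] sum.cong)
        finally show "?D $$ (i, j) = (\<Sum>b<?r + ?r. (if b < ?r then p b i else - p' (b - ?r) i) * (if b < ?r then q b j else q' (b - ?r) j))"
          by (simp add: lessThan_atLeast0)
      qed
      then show ?thesis using le by simp
    qed
    then have cd: "real (card ({k} \<times> {..<mat_rank ?D})) \<le> 2 * real (rank_ct X)" by simp
    have e: "emb k ?D = emb k (Y k) - emb k (hat X $ k)" by (rule emb_minus[OF Yc[OF k] tensorsD(3)[OF hX k]])
    have "norm (emb k (Y k) - emb k (hat X $ k)) \<le> 2 * sqrt (real (card ({k} \<times> {..<mat_rank ?D}))) * \<epsilon>"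
      by (rule best_approx_dist[OF D[unfolded e] op[OF k] best[OF k] gap(2)])
    also have "... \<le> 2 * sqrt (2 * real (rank_ct X)) * \<epsilon>"
      using cd gap(2) by (intro mult_right_mono mult_left_mono) auto
    finally have "(norm (emb k (Y k) - emb k (hat X $ k)))\<^sup>2 \<le> (2 * sqrt (2 * real (rank_ct X)) * \<epsilon>)\<^sup>2"
      by (intro power_mono) auto
    then show "(norm (emb k (hat ?H $ k) - emb k (hat X $ k)))\<^sup>2 \<le> 8 * real (rank_ct X) * \<epsilon>\<^sup>2"
      by (simp add: hH[OF k] power_mult_distrib)
  qed
  also have "... = (sqrt (8 * real n3 * real (rank_ct X)) * \<epsilon>)\<^sup>2" by (simp add: power_mult_distrib)
  finally show "norm (Phi ?H - Phi X) \<le> sqrt (8 * real n3 * real (rank_ct X)) * \<epsilon>"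
    by (rule power2_le_imp_le) (use gap in simp)
qed

end

section \<open>Singular values of the block diagonal matrix\<close>

text \<open>For blocks of a common format, block number and inner index are quotient and remainder;
  this connects \<open>bar\<close> with the pair indices of \<open>Phi\<close>.\<close>

lemma diag_block_mat_uniform:
  assumes "set As \<subseteq> carrier_mat n m"
  shows "dim_row (diag_block_mat As) = length As * n" "dim_col (diag_block_mat As) = length As * m"
    "a < length As * n \<Longrightarrow> b < length As * m \<Longrightarrow>
      diag_block_mat As $$ (a, b) = (if a div n = b div m then (As ! (a div n)) $$ (a mod n, b mod m) else 0)"
proof -
  have "dim_row (diag_block_mat As) = length As * n \<and> dim_col (diag_block_mat As) = length As * m \<and>
    (\<forall>a b. a < length As * n \<longrightarrow> b < length As * m \<longrightarrow>
      diag_block_mat As $$ (a, b) = (if a div n = b div m then (As ! (a div n)) $$ (a mod n, b mod m) else 0))"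
    using assms
  proof (induction As)
    case Nil
    then show ?case by simp
  next
    case (Cons A As)
    have A: "A \<in> carrier_mat n m" and IH: "dim_row (diag_block_mat As) = length As * n" "dim_col (diag_block_mat As) = length As * m"
      "\<And>a b. a < length As * n \<Longrightarrow> b < length As * m \<Longrightarrow>
      diag_block_mat As $$ (a, b) = (if a div n = b div m then (As ! (a div n)) $$ (a mod n, b mod m) else 0)"
      using Cons by auto
    show ?case
    proof (intro conjI allI impI)
      show "dim_row (diag_block_mat (A # As)) = length (A # As) * n" "dim_col (diag_block_mat (A # As)) = length (A # As) * m"
        using A IH by (auto simp: Let_def)
      fix a b assume ab: "a < length (A # As) * n" "b < length (A # As) * m"
      have n: "0 < n" "0 < m" using ab by (auto intro: ccontr)
      have e: "diag_block_mat (A # As) $$ (a, b) = (if a < n then if b < m then A $$ (a, b) else 0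
          else if b < m then 0 else diag_block_mat As $$ (a - n, b - m))"
        using ab A IH by (auto simp: Let_def)
      have da: "a div n = (if a < n then 0 else Suc ((a - n) div n))" and ma: "a mod n = (if a < n then a else (a - n) mod n)"
        using n by (auto simp: div_if mod_if)
      have db: "b div m = (if b < m then 0 else Suc ((b - m) div m))" and mb: "b mod m = (if b < m then b else (b - m) mod m)"
        using n by (auto simp: div_if mod_if)
      have "\<not> a < n \<Longrightarrow> a - n < length As * n" "\<not> b < m \<Longrightarrow> b - m < length As * m" using ab by auto
      then show "diag_block_mat (A # As) $$ (a, b) =
          (if a div n = b div m then ((A # As) ! (a div n)) $$ (a mod n, b mod m) else 0)"
        unfolding e using IH(3)[of "a - n" "b - m"] by (simp add: da ma db mb)
    qed
  qed
  then show "dim_row (diag_block_mat As) = length As * n" "dim_col (diag_block_mat As) = length As * m"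
    "a < length As * n \<Longrightarrow> b < length As * m \<Longrightarrow>
      diag_block_mat As $$ (a, b) = (if a div n = b div m then (As ! (a div n)) $$ (a mod n, b mod m) else 0)"
    by auto
qed

lemma sum_div_mod: "(\<Sum>a<k * n. f (a div n, a mod n)) = (\<Sum>p\<in>{..<k} \<times> {..<n}. f p)" for n :: nat
proof (rule sum.reindex_bij_witness[of _ "\<lambda>p. fst p * n + snd p" "\<lambda>a. (a div n, a mod n)"])
  fix p assume "p \<in> {..<k} \<times> {..<n}"
  then obtain i j where p: "p = (i, j)" "i < k" "j < n" by auto
  have "i * n + j < Suc i * n" using p by simp
  also have "... \<le> k * n" using p by (intro mult_right_mono) auto
  finally show "fst p * n + snd p \<in> {..<k * n}" using p by simp
  show "((fst p * n + snd p) div n, (fst p * n + snd p) mod n) = p" using p by simp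
next
  fix a assume a: "a \<in> {..<k * n}"
  then have "0 < n" by (cases n) auto
  then show "(a div n, a mod n) \<in> {..<k} \<times> {..<n}" using a by (auto simp: less_mult_imp_div_less)
qed auto

lemma finite_singular_values:
  assumes "A \<in> carrier_mat n m"
  shows "finite (singular_values A)"
proof -
  let ?B = "transpose_mat A * A"
  have B: "?B \<in> carrier_mat m m" using assms by simp
  have "char_poly ?B \<noteq> 0" using degree_monic_char_poly[OF B] by auto
  then have "finite {k. poly (char_poly ?B) k = 0}" by (rule poly_roots_finite)
  then have f: "finite {k. eigenvalue ?B k}" by (simp add: eigenvalue_root_char_poly[OF B])
  have "singular_values A \<subseteq> sqrt ` {k. eigenvalue ?B k}"
    unfolding singular_values_def by (auto intro!: image_eqI[of _ sqrt])
  then show ?thesis using f by (meson finite_surj)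
qed

text \<open>If a dimension is zero, there are no entries to compare and any two tensors of this
  format agree.\<close>

lemma tensor_degenerate:
  assumes "X \<in> tensors n1 n2 n3" "X \<noteq> tzero n1 n2 n3"
  shows "0 < n1" "0 < n2" "0 < n3"
  using tensor_eqI[OF assms(1) tensor_ops(4)[OF assms(1) assms(1)]] assms(2) by fastforce+

context
  fixes n1 n2 n3 :: nat and X :: tensor
  assumes n3: "0 < n3" and X: "X \<in> tensors n1 n2 n3"
begin

lemma bar_entries:
  "bar X \<in> carrier_mat (n3 * n1) (n3 * n2)"
  "a < n3 * n1 \<Longrightarrow> b < n3 * n2 \<Longrightarrow> bar X $$ (a, b) = ent (Phi X) (a div n1, a mod n1) (b div n2, b mod n2)"
proof -
  let ?As = "list_of_vec (hat X)"
  note h = hat_tensor(1)[OF n3 X]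
  have l: "length ?As = n3" using tensorsD(1)[OF h] by simp
  have nth: "?As ! k = hat X $ k" if "k < n3" for k using that tensorsD(1)[OF h] by (simp add: list_of_vec_index)
  have c: "set ?As \<subseteq> carrier_mat n1 n2"
    using nth l tensorsD(3)[OF h] by (metis in_set_conv_nth subsetI)
  note d = diag_block_mat_uniform[OF c, unfolded l]
  show "bar X \<in> carrier_mat (n3 * n1) (n3 * n2)" unfolding bar_def using d(1,2) by auto
  assume ab: "a < n3 * n1" "b < n3 * n2"
  then have n: "0 < n1" "0 < n2" by (auto intro: ccontr)
  have "a div n1 < n3" using ab by (simp add: less_mult_imp_div_less)
  then show "bar X $$ (a, b) = ent (Phi X) (a div n1, a mod n1) (b div n2, b mod n2)"
    unfolding bar_def d(3)[OF ab] using n nth by (auto simp: Phi_tensor[OF n3 X] ent_blk)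
qed

text \<open>The \<open>j\<close>-th column of \<open>V\<close>, flattened by \<open>div\<close> and
  \<open>mod\<close>, is an eigenvector of the Gram matrix of \<open>bar X\<close>; it is nonzero
  because it has norm one.\<close>

lemma fsvd_singular_value:
  assumes S: "fsvd (Phi X) U s V J" and V: "fId ({..<n3} \<times> {..<n2}) * V = V" and j: "j \<in> J"
  shows "s j \<in> singular_values (bar X)"
proof -
  note D = fsvdD[OF S] and B = bar_entries(1)
  let ?I1 = "{..<n3} \<times> {..<n1}" and ?I2 = "{..<n3} \<times> {..<n2}"
  define v where "v = vec (n3 * n2) (\<lambda>b. ent V (b div n2, b mod n2) j)"
  define w where "w = vec (n3 * n1) (\<lambda>a. s j * ent U (a div n1, a mod n1) j)"
  have v: "v \<in> carrier_vec (n3 * n2)" unfolding v_def by simp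
  have supp: "ent (Phi X) p q \<noteq> 0 \<Longrightarrow> p \<in> ?I1 \<and> q \<in> ?I2" for p q
    by (cases p, cases q) (auto simp: Phi_tensor[OF n3 X] ent_blk split: if_splits)
  have XV: "Phi X * V = U * fdiag J s"
    unfolding D(4) using D(2) fdiag_fId[OF D(5)] by (simp add: mult.assoc fiso_def)
  have XU: "ftr (Phi X) * U = V * fdiag J s"
    unfolding D(4) using D(1) fdiag_fId[OF D(5)] by (simp add: mult.assoc fiso_def)
  have Bv: "bar X *\<^sub>v v = w"
  proof (rule eq_vecI)
    fix a assume "a < dim_vec w"
    then have a: "a < n3 * n1" by (simp add: w_def)
    have "(bar X *\<^sub>v v) $ a = (\<Sum>b<n3 * n2. ent (Phi X) (a div n1, a mod n1) (b div n2, b mod n2) * ent V (b div n2, b mod n2) j)"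
      using a B by (auto simp: scalar_prod_def v_def bar_entries(2) lessThan_atLeast0 intro!: sum.cong)
    also have "... = (\<Sum>q\<in>?I2. ent (Phi X) (a div n1, a mod n1) q * ent V q j)"
      by (rule sum_div_mod[of "\<lambda>q. ent (Phi X) (a div n1, a mod n1) q * ent V q j"])
    also have "... = ent (Phi X * V) (a div n1, a mod n1) j"
      using supp by (intro ent_times[symmetric]) auto
    also have "... = w $ a" unfolding XV using a j by (simp add: w_def times_fdiag[OF D(5)])
    finally show "(bar X *\<^sub>v v) $ a = w $ a" .
  qed (use B in \<open>simp add: w_def\<close>)
  have Bw: "transpose_mat (bar X) *\<^sub>v w = (s j)\<^sup>2 \<cdot>\<^sub>v v"
  proof (rule eq_vecI)
    fix b assume "b < dim_vec ((s j)\<^sup>2 \<cdot>\<^sub>v v)"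
    then have b: "b < n3 * n2" by (simp add: v_def)
    have "(transpose_mat (bar X) *\<^sub>v w) $ b = (\<Sum>a<n3 * n1. ent (Phi X) (a div n1, a mod n1) (b div n2, b mod n2) * (s j * ent U (a div n1, a mod n1) j))"
      using b B by (auto simp: scalar_prod_def w_def bar_entries(2) lessThan_atLeast0 intro!: sum.cong)
    also have "... = (\<Sum>p\<in>?I1. ent (Phi X) p (b div n2, b mod n2) * (s j * ent U p j))"
      by (rule sum_div_mod[of "\<lambda>p. ent (Phi X) p (b div n2, b mod n2) * (s j * ent U p j)"])
    also have "... = s j * (\<Sum>p\<in>?I1. ent (ftr (Phi X)) (b div n2, b mod n2) p * ent U p j)"
      by (simp add: sum_distrib_left mult_ac)
    also have "... = s j * ent (ftr (Phi X) * U) (b div n2, b mod n2) j"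
      using supp by (subst ent_times[of ?I1]) auto
    also have "... = ((s j)\<^sup>2 \<cdot>\<^sub>v v) $ b" unfolding XU using b j by (simp add: v_def times_fdiag[OF D(5)] power2_eq_square)
    finally show "(transpose_mat (bar X) *\<^sub>v w) $ b = ((s j)\<^sup>2 \<cdot>\<^sub>v v) $ b" .
  qed (use B in \<open>simp add: v_def\<close>)
  have "v \<noteq> 0\<^sub>v (n3 * n2)"
  proof
    assume v0: "v = 0\<^sub>v (n3 * n2)"
    have "ent V q j = 0" for q
    proof (cases "q \<in> ?I2")
      case True
      then obtain k i where q: "q = (k, i)" "k < n3" "i < n2" by auto
      have "k * n2 + i < n3 * n2"
      proof -
        have "k * n2 + i < Suc k * n2" using q by simp
        also have "... \<le> n3 * n2" using q by (intro mult_right_mono) auto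
        finally show ?thesis .
      qed
      then have "v $ (k * n2 + i) = 0" using v0 by simp
      then show ?thesis using \<open>k * n2 + i < n3 * n2\<close> q by (simp add: v_def)
    next
      case False
      then have "ent (fId ?I2 * V) q j = 0" by (simp add: fId_times)
      then show ?thesis unfolding V .
    qed
    then have "ent (ftr V * V) j j = 0" by (simp add: ent_times_def)
    then show False using fisoD(1,2)[OF D(2)] j by (simp add: ent_fId)
  qed
  then have "eigenvector (transpose_mat (bar X) * bar X) v ((s j)\<^sup>2)"
    unfolding eigenvector_def using v B Bv Bw by (auto simp: assoc_mult_mat_vec[of _ "n3 * n2" "n3 * n1" _ "n3 * n2"])
  then show ?thesis unfolding singular_values_def eigenvalue_def using D(3)[OF j] by force
qed

text \<open>Every \<open>s j\<close> is a nonzero element of \<open>singular_values (bar X)\<close>,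
  so the minimum and maximum of that set bracket the singular values of the decomposition.\<close>

lemma condition_bounds:
  assumes S: "fsvd (Phi X) U s V J" and V: "fId ({..<n3} \<times> {..<n2}) * V = V" and X0: "X \<noteq> tzero n1 n2 n3"
  defines "\<sigma> \<equiv> Min (singular_values (bar X) - {0})"
  shows "J \<noteq> {}" "0 < \<sigma>" "\<forall>j\<in>J. \<sigma> \<le> s j" "\<forall>j\<in>J. s j \<le> tspectral_norm X"
    "cond_number (bar X) = tspectral_norm X / \<sigma>" "1 \<le> cond_number (bar X)"
    "fop_le (Phi X) (tspectral_norm X)" "\<sigma> \<le> norm (Phi X)"
proof -
  note D = fsvdD[OF S]
  show J: "J \<noteq> {}"
  proof
    assume "J = {}"
    then have "Phi X = Phi (tzero n1 n2 n3)" using D(4) Phi_ops(4)[OF n3 X X] by (simp add: fdiag_def)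
    then show False using Phi_inj[OF n3 X tensor_ops(4)[OF X X]] X0 by simp
  qed
  let ?sv = "singular_values (bar X)"
  have f: "finite ?sv" by (rule finite_singular_values[OF bar_entries(1)])
  have s: "s j \<in> ?sv" "s j \<in> ?sv - {0}" if "j \<in> J" for j
    using fsvd_singular_value[OF S V that] D(3)[OF that] by auto
  have ne: "?sv - {0} \<noteq> {}" using J s by blast
  have "\<sigma> \<in> ?sv - {0}" unfolding \<sigma>_def by (rule Min_in) (use f ne in auto)
  then show \<sigma>: "0 < \<sigma>" unfolding singular_values_def by auto
  show l: "\<forall>j\<in>J. \<sigma> \<le> s j" unfolding \<sigma>_def using s f by (auto intro!: Min_le)
  show u: "\<forall>j\<in>J. s j \<le> tspectral_norm X" unfolding tspectral_norm_def spectral_norm_def using s f by (auto intro!: Max_ge)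
  show c: "cond_number (bar X) = tspectral_norm X / \<sigma>"
    unfolding cond_number_def tspectral_norm_def spectral_norm_def \<sigma>_def ..
  obtain j where j: "j \<in> J" using J by blast
  have "\<sigma> \<le> tspectral_norm X" using l u j by (meson order_trans)
  then show "1 \<le> cond_number (bar X)" unfolding c using \<sigma> by simp
  have t0: "0 \<le> tspectral_norm X" using \<open>\<sigma> \<le> tspectral_norm X\<close> \<sigma> by simp
  show "fop_le (Phi X) (tspectral_norm X)"
    unfolding fop_le_def
  proof
    fix x :: "bmat"
    have "norm (Phi X * x) \<le> norm (fdiag J s * (ftr V * x))"
      unfolding D(4) mult.assoc by (rule fiso_contract(1)[OF D(1)])
    also have "... \<le> tspectral_norm X * norm (ftr V * x)"
    proof (rule fdiag_upper(2)[OF D(5) _ t0], rule ballI)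
      fix j assume "j \<in> J"
      then show "\<bar>s j\<bar> \<le> tspectral_norm X" using u D(3)[of j] by simp
    qed
    also have "... \<le> tspectral_norm X * norm x"
      by (intro mult_left_mono fiso_contract(2)[OF D(2)] t0)
    finally show "norm (Phi X * x) \<le> tspectral_norm X * norm x" .
  qed
  show "\<sigma> \<le> norm (Phi X)"
    using singular_value_upper[OF S fop_le_norm[of "Phi X"] j] bspec[OF l j] by simp
qed

end

text \<open>The decomposition that witnesses incoherence is a parameter; it may differ from the one
  selected by \<open>skinny_svd\<close>.\<close>

locale incoherent_tensor =
  fixes n1 n2 n3 :: nat and X U S V :: tensor and \<mu>0 :: real
  assumes \<mu>0: "0 < \<mu>0" and X: "X \<in> tensors n1 n2 n3" and X0: "X \<noteq> tzero n1 n2 n3" and svd: "is_skinny_svd X U S V"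
    and incU: "\<forall>i<n1. tnorm (ttranspose U *\<^sub>t evec n1 n3 i) \<le> sqrt (\<mu>0 * rank_ct X / n1)"
    and incV: "\<forall>j<n2. tnorm (ttranspose V *\<^sub>t evec n2 n3 j) \<le> sqrt (\<mu>0 * rank_ct X / n2)"
begin

lemmas pos = tensor_degenerate[OF X X0]

abbreviation "rs \<equiv> rank_t X"
abbreviation "r \<equiv> rank_ct X"
abbreviation "J \<equiv> Jset rs"
definition "\<sigma> = Min (singular_values (bar X) - {0})"
abbreviation "\<kappa> \<equiv> cond_number (bar X)"
definition "sX = (\<lambda>(k, a). hat S $ k $$ (a, a))"

lemmas UV = skinny_svd_fsvd(1,2)[OF pos(3) X svd]
lemmas XS = skinny_svd_fsvd(5)[OF pos(3) X svd, folded sX_def]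
lemmas supp_UV = Phi_supp(1)[OF pos(3) UV(1)] Phi_supp(1)[OF pos(3) UV(2)]
lemmas cond = condition_bounds[OF pos(3) X XS supp_UV(2) X0, folded \<sigma>_def]

lemma dims: "dim1 X = n1" "dim2 X = n2" "dim3 X = n3" using tensorsD[OF X] pos by auto

lemma sX_lower: "\<forall>j\<in>J. \<sigma> \<le> (\<lambda>(k, a). hat S $ k $$ (a, a)) j" using cond(3) unfolding sX_def .

lemma kappa2: "1 \<le> \<kappa>\<^sup>2" using cond(6) by (simp add: one_le_power)

lemma spectral_eq: "tspectral_norm X = \<kappa> * \<sigma>" using cond(2,5) by simp

lemma rank_pos: "1 \<le> r"
proof -
  obtain k a where ka: "(k, a) \<in> J" using cond(1) by auto
  have "a < rs $ k" "k < dim_vec rs" using ka by (auto simp: Jset_def)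
  then show ?thesis unfolding rank_ct_def using max_entry_ge[of k rs] by linarith
qed

text \<open>The bounds on the row blocks of an incoherent factor, equal to the levels at which
  \<open>trim\<close> clips.\<close>

definition "b1 = sqrt (real n3) * sqrt (\<mu>0 * real r / real n1)"
definition "b2 = sqrt (real n3) * sqrt (\<mu>0 * real r / real n2)"

lemma row_bounds:
  "i < n1 \<Longrightarrow> norm (fId (slab n3 i) * Phi U) \<le> b1" "j < n2 \<Longrightarrow> norm (fId (slab n3 j) * Phi V) \<le> b2"
  using incU incV evec_norm[OF pos(3) UV(1)] evec_norm[OF pos(3) UV(2)] pos(3)
  by (auto simp: b1_def b2_def pos_divide_le_eq mult.commute)

lemma slice_dist:
  assumes Y: "Y \<in> tensors n1 n2 n3" and k: "k < n3"
  shows "norm (emb k (hat Y $ k) - emb k (hat X $ k)) \<le> norm (Phi Y - Phi X)"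
proof -
  have "norm (emb k (hat Y $ k) - emb k (hat X $ k)) = norm (fId ({k} \<times> {..<n1}) * Phi (Y - X))"
    using hat_diff_slice[OF pos(3) Y X k] Phi_slice(1)[OF pos(3) tensor_ops(2)[OF Y X] k] by simp
  also have "... \<le> norm (Phi Y - Phi X)"
    using fproj_contract(1)[OF fproj_fId[of "{k} \<times> {..<n1}"], of "Phi (Y - X)"] by (simp add: Phi_ops[OF pos(3) Y X])
  finally show ?thesis .
qed

text \<open>By \<open>top_card\<close>, each slice of \<open>Y\<close> has exactly as many singular
  values above \<open>\<sigma> / 2\<close> as the slice of \<open>X\<close> has nonzero
  ones.\<close>

lemma rank_t_lower:
  assumes Y: "Y \<in> tensors n1 n2 n3" and close: "2 * norm (Phi Y - Phi X) < \<sigma>" and k: "k < n3"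
  shows "rs $ k \<le> rank_t Y $ k"
proof -
  note h = hat_tensor(1)[OF pos(3) Y]
  obtain U1 s1 V1 where Ys: "fsvd (emb k (hat Y $ k)) U1 s1 V1 ({k} \<times> {..<mat_rank (hat Y $ k)})"
    using mat_svd[OF tensorsD(3)[OF h k], of k] by blast
  note Xs = slice_fsvd[OF pos(3) X svd k, folded sX_def]
  have K: "{k} \<times> {..<rs $ k} \<subseteq> J" unfolding Jset_def using k rank_t_dim(1)[OF X pos(3)] by auto
  have "2 * norm (emb k (hat Y $ k) - emb k (hat X $ k)) < \<sigma>" using slice_dist[OF Y k] close by simp
  then have "card {j \<in> {k} \<times> {..<mat_rank (hat Y $ k)}. \<sigma> / 2 < s1 j} = card ({k} \<times> {..<rs $ k})"
    by (intro top_card[OF Ys Xs _ fop_le_norm]) (use cond(3) K in auto)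
  moreover have "card {j \<in> {k} \<times> {..<mat_rank (hat Y $ k)}. \<sigma> / 2 < s1 j} \<le> card ({k} \<times> {..<mat_rank (hat Y $ k)})"
    by (intro card_mono) auto
  ultimately show ?thesis using rank_t_dim(2)[OF Y pos(3) k] by simp
qed

lemma rank_t_factor:
  assumes Y: "Y \<in> tensors n1 n2 n3" and A: "A \<in> tensors n1 q n3" and B: "B \<in> tensors n2 q n3"
    and eq: "Phi Y = Phi A * fdiag (Jset ts) s * ftr (Phi B)" and k: "k < n3" and ts: "dim_vec ts = n3"
  shows "rank_t Y $ k \<le> ts $ k"
proof -
  note h = hat_tensor(1)[OF pos(3) Y]
  have "mat_rank (hat Y $ k) \<le> ts $ k"
  proof (rule mat_rank_le_factor[OF tensorsD(3)[OF h k]])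
    fix i j assume ij: "i < n1" "j < n2"
    have "hat Y $ k $$ (i, j) = ent (Phi A * fdiag (Jset ts) s * ftr (Phi B)) (k, i) (k, j)"
      using ij k eq by (simp add: Phi_tensor[OF pos(3) Y] ent_blk flip: eq)
    also have "... = (\<Sum>p\<in>Jset ts. ent (Phi A * fdiag (Jset ts) s) (k, i) p * ent (ftr (Phi B)) p (k, j))"
      by (rule ent_times) (auto simp: times_fdiag split: if_splits)
    also have "... = (\<Sum>p\<in>Jset ts. s p * ent (Phi A) (k, i) p * ent (Phi B) (k, j) p)"
      by (rule sum.cong) (simp_all add: times_fdiag)
    also have "... = (\<Sum>p\<in>Pair k ` {..<ts $ k}. s p * ent (Phi A) (k, i) p * ent (Phi B) (k, j) p)"
      by (rule sum.mono_neutral_right)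
        (use k ts in \<open>auto simp: Jset_def Phi_tensor[OF pos(3) A] ent_blk split: if_splits\<close>)
    also have "... = (\<Sum>a<ts $ k. s (k, a) * ent (Phi A) (k, i) (k, a) * ent (Phi B) (k, j) (k, a))"
      by (subst sum.reindex) (auto simp: inj_on_def)
    finally show "hat Y $ k $$ (i, j) = (\<Sum>a<ts $ k. (s (k, a) * ent (Phi A) (k, i) (k, a)) * ent (Phi B) (k, j) (k, a))" .
  qed
  then show ?thesis using rank_t_dim(2)[OF Y pos(3) k] by simp
qed

text \<open>Closeness puts the singular values of \<open>Z\<close> between
  \<open>9 / 10 * \<sigma>\<close> and \<open>11 / 10 * \<kappa> * \<sigma>\<close>. Clipping moves
  each factor by at most the distance over \<open>9 / 10 * \<sigma>\<close>, so the product moves by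
  at most \<open>22 / 9 * \<kappa>\<close> times the distance. The rank survives: it cannot drop
  near \<open>X\<close> and cannot exceed the width of the factors.\<close>

lemma trim_step:
  assumes Z: "Z \<in> tensors n1 n2 n3" and rk: "rank_t Z = rs"
    and close: "100 * \<kappa> * norm (Phi Z - Phi X) \<le> \<sigma>"
  defines "Zh \<equiv> trim \<mu>0 (max_entry rs) Z"
  shows "Zh \<in> tensors n1 n2 n3" "rank_t Zh = rs"
    "norm (Phi Zh - Phi X) \<le> 5 * \<kappa> * norm (Phi Z - Phi X)"
    "i < n1 \<Longrightarrow> norm (fId (slab n3 i) * PU Zh) \<le> 2 * b1"
    "j < n2 \<Longrightarrow> norm (fId (slab n3 j) * PV Zh) \<le> 2 * b2"
proof -
  let ?z = "norm (Phi Z - Phi X)"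
  let ?s = "sval Z"
  interpret B1: row_partition "slab n3" "{..<n1}" by (rule row_partition_slab)
  interpret B2: row_partition "slab n3" "{..<n2}" by (rule row_partition_slab)
  have \<kappa>\<sigma>: "\<sigma> \<le> \<kappa> * \<sigma>" and \<kappa>z: "?z \<le> \<kappa> * ?z"
    using mult_right_mono[OF cond(6), of \<sigma>] mult_right_mono[OF cond(6), of ?z] cond(2) by simp_all
  have z: "100 * ?z \<le> \<sigma>" using \<kappa>z close by linarith
  note ZS = fsvd_skinny[OF pos(3) Z, unfolded rk]
  note D = fsvdD[OF ZS(1)]
  have lo: "\<forall>j\<in>J. 9 / 10 * \<sigma> \<le> ?s j"
  proof
    fix j assume "j \<in> J"
    from singular_value_perturb[OF ZS(1) XS cond(3) less_imp_le[OF cond(2)] this]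
    show "9 / 10 * \<sigma> \<le> ?s j" using z cond(2) by linarith
  qed
  have hi: "\<forall>j\<in>J. ?s j \<le> 11 / 10 * (\<kappa> * \<sigma>)"
  proof
    fix j assume "j \<in> J"
    from singular_value_upper[OF ZS(1) cond(7) this]
    show "?s j \<le> 11 / 10 * (\<kappa> * \<sigma>)"
      using z \<kappa>\<sigma> cond(2) unfolding spectral_eq by linarith
  qed
  define DU where "DU = frow_scale (clip n3 b1 (PU Z)) (slab n3) {..<n1}"
  define DV where "DV = frow_scale (clip n3 b2 (PV Z)) (slab n3) {..<n2}"
  have rmax: "max_entry rs = r" unfolding rank_ct_def ..
  note T = trim_Phi[OF pos(3) Z, of \<mu>0 r, folded rmax, folded Zh_def, unfolded rmax rk, folded b1_def b2_def, folded DU_def DV_def]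
  show Zh: "Zh \<in> tensors n1 n2 n3" by (rule T(1))
  let ?\<delta> = "?z / (9 / 10 * \<sigma>)"
  have s9: "0 < 9 / 10 * \<sigma>" using cond(2) by simp
  have su: "fId (\<Union>i\<in>{..<n1}. slab n3 i) * PU Z = PU Z" "fId (\<Union>i\<in>{..<n1}. slab n3 i) * Phi U = Phi U"
    "fId (\<Union>i\<in>{..<n2}. slab n3 i) * PV Z = PV Z" "fId (\<Union>i\<in>{..<n2}. slab n3 i) * Phi V = Phi V"
    using ZS(2,3) supp_UV by (simp_all add: Union_slab)
  have rb: "\<And>i. i \<in> {..<n1} \<Longrightarrow> norm (fId (slab n3 i) * Phi U) \<le> b1" "\<And>j. j \<in> {..<n2} \<Longrightarrow> norm (fId (slab n3 j) * Phi V) \<le> b2"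
    using row_bounds by auto
  have cl: "\<And>i. i \<in> {..<n1} \<Longrightarrow> clip n3 b1 (PU Z) i = min 1 (b1 / norm (fId (slab n3 i) * PU Z))"
    "\<And>i. i \<in> {..<n2} \<Longrightarrow> clip n3 b2 (PV Z) i = min 1 (b2 / norm (fId (slab n3 i) * PV Z))"
    by (simp_all add: clip_def[OF pos(3)])
  have cU: "norm (PU Z - DU * PU Z) \<le> ?\<delta>" "\<And>i. i < n1 \<Longrightarrow> norm (fId (slab n3 i) * (DU * PU Z)) \<le> b1"
    using B1.trim_factor_dist[OF ZS(1) lo s9 XS su(1,2) rb(1) cl(1), folded DU_def] by blast+
  have z': "norm (ftr (Phi Z) - ftr (Phi X)) = ?z" using norm_ftr[of "Phi Z - Phi X"] by simp
  have cV: "norm (PV Z - DV * PV Z) \<le> ?\<delta>" "\<And>j. j < n2 \<Longrightarrow> norm (fId (slab n3 j) * (DV * PV Z)) \<le> b2"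
    using B2.trim_factor_dist[OF fsvd_ftr[OF ZS(1)] lo s9 fsvd_ftr[OF XS] su(3,4) rb(2) cl(2), folded DV_def, unfolded z'] by blast+
  have "norm (C * ftr DV) \<le> norm C" for C
  proof -
    have "norm (DV * ftr C) \<le> norm (ftr C)" unfolding DV_def
      by (rule B2.scale_contract) (use \<mu>0 in \<open>auto simp: clip_def[OF pos(3)] b2_def\<close>)
    then show ?thesis using norm_ftr[of "C * ftr DV"] by simp
  qed
  from trim_dist[OF ZS(1) hi _ cU(1) cV(1) this]
  have "norm (Phi Zh - Phi Z) \<le> 2 * (11 / 10 * (\<kappa> * \<sigma>)) * ?\<delta>"
    unfolding T(2) using cond(2,6) by simp
  also have "... = (22 / 9) * (\<kappa> * ?z)" using cond(2) by simp
  finally have "norm (Phi Zh - Phi X) \<le> (22 / 9) * (\<kappa> * ?z) + ?z"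
    using norm_triangle_ineq[of "Phi Zh - Phi Z" "Phi Z - Phi X"] by simp
  also have "... \<le> 5 * \<kappa> * ?z"
    using \<kappa>z norm_ge_zero[of "Phi Z - Phi X"] by linarith
  finally show dist: "norm (Phi Zh - Phi X) \<le> 5 * \<kappa> * ?z" .
  then have "2 * norm (Phi Zh - Phi X) < \<sigma>" using close cond(2) by simp
  note lower = rank_t_lower[OF Zh this]
  have rt: "dim_vec rs = n3" by (rule rank_t_dim(1)[OF X pos(3)])
  note sk = skinny_svd_fsvd(1,2)[OF pos(3) Z skinny_svd_is[OF pos(3) Z]]
  note tf1 = trim_factor_Phi[OF pos(3) sk(1), of \<mu>0 r, folded b1_def PU_def, folded DU_def]
  note tf2 = trim_factor_Phi[OF pos(3) sk(2), of \<mu>0 r, folded b2_def PV_def, folded DV_def]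
  have upper: "rank_t Zh $ k \<le> rs $ k" if "k < n3" for k
    by (rule rank_t_factor[OF Zh tf1(1) tf2(1) _ that rt, of ?s]) (simp add: tf1(2) tf2(2) T(2))
  show rz: "rank_t Zh = rs"
    by (rule eq_vecI) (use rt rank_t_dim(1)[OF Zh pos(3)] lower upper in \<open>auto intro: antisym\<close>)
  note ZhS = fsvd_skinny(1)[OF pos(3) Zh, unfolded rz]
  have d2: "?\<delta> \<le> 1 / 2" using z cond(2) by (simp add: field_simps)
  have AJ: "DU * PU Z * fId J = DU * PU Z" "DV * PV Z * fId J = DV * PV Z"
    using fiso_fId(1)[OF D(1)] fiso_fId(1)[OF D(2)] by (simp_all add: mult.assoc)
  show "norm (fId (slab n3 i) * PU Zh) \<le> 2 * b1" if "i < n1"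
    by (rule trim_incoherence[OF D(1) cU(1) d2 AJ(1) ZhS T(2)[unfolded mult.assoc[of "DU * PU Z"]] cU(2)[OF that]])
      (use fdiag_fId(2)[OF D(5)] in \<open>simp add: mult.assoc[symmetric]\<close>)
  have "ftr (Phi Zh) = DV * PV Z * (fdiag J ?s * ftr (DU * PU Z))"
    unfolding T(2) by (simp add: mult.assoc)
  then show "norm (fId (slab n3 j) * PV Zh) \<le> 2 * b2" if "j < n2"
    by (rule trim_incoherence[OF D(2) cV(1) d2 AJ(2) fsvd_ftr[OF ZhS] _ cV(2)[OF that]])
      (use fdiag_fId(2)[OF D(5)] in \<open>simp add: mult.assoc[symmetric]\<close>)
qed

end

section \<open>Local convergence of the two procedures\<close>

locale tensor_space =
  fixes n1 n2 n3 :: nat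
  assumes pos: "0 < n1" "0 < n2" "0 < n3"
begin

abbreviation "idx \<equiv> index_set n1 n2 n3"
abbreviation "TT \<equiv> tensors n1 n2 n3"
definition "E \<omega> = Phi (basis_tensor n1 n2 n3 \<omega>)"
definition "Sop \<Omega> x = sum_list (map (\<lambda>\<omega>. inner (E \<omega>) x *\<^sub>R E \<omega>) \<Omega>)"
text \<open>The block matrices that represent tensors; \<open>E\<close> is an orthonormal basis of
  this space by \<open>VS_span\<close>.\<close>

definition "VS = Phi ` TT"
definition "vol = real n1 * real n2 * real n3"

abbreviation "Pr m \<equiv> measure_pmf.prob (uniform_samples m n1 n2 n3)"

lemma vol_pos: "0 < vol" using pos by (simp add: vol_def)

lemma idx: "finite idx" "idx \<noteq> {}" "real (card idx) = vol"
  using pos by (auto simp: index_set_def card_cartesian_product vol_def)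

lemma E_orthon: "orthon E idx"
  unfolding E_def by (rule basis_orthon[OF pos(3)])

lemma VS_span: "VS = span (E ` idx)"
proof
  show "VS \<subseteq> span (E ` idx)"
    unfolding VS_def E_def using blk_in_span[OF pos(3)] by (auto simp: Phi_tensor[OF pos(3)])
  have "real_vector.subspace VS"
    unfolding real_vector.subspace_def
  proof (intro conjI ballI allI)
    show "0 \<in> VS"
      using Phi_ops(4)[OF pos(3) tensor_ops(4) tensor_ops(4)] tensor_ops(4) basis_tensor_in[OF pos(3)]
      unfolding VS_def by (metis image_eqI)
  next
    fix x y assume "x \<in> VS" "y \<in> VS"
    then obtain A B where A: "A \<in> TT" "x = Phi A" and B: "B \<in> TT" "y = Phi B" unfolding VS_def by auto
    show "x + y \<in> VS" using tensor_ops(1)[OF A(1) B(1)] Phi_ops(1)[OF pos(3) A(1) B(1)] A B unfolding VS_def by (metis image_eqI)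
  next
    fix c x assume "x \<in> VS"
    then obtain A where A: "A \<in> TT" "x = Phi A" unfolding VS_def by auto
    show "c *\<^sub>R x \<in> VS" using tensor_ops(3)[OF A(1) A(1)] Phi_ops(3)[OF pos(3) A(1) A(1)] A unfolding VS_def by (metis image_eqI)
  qed
  then show "span (E ` idx) \<subseteq> VS"
    by (rule real_vector.span_minimal[rotated]) (use basis_tensor_in[OF pos(3)] in \<open>auto simp: VS_def E_def\<close>)
qed

lemma VS_closed: "x \<in> VS \<Longrightarrow> y \<in> VS \<Longrightarrow> x + y \<in> VS" "x \<in> VS \<Longrightarrow> y \<in> VS \<Longrightarrow> x - y \<in> VS" "x \<in> VS \<Longrightarrow> c *\<^sub>R x \<in> VS" "0 \<in> VS"
  unfolding VS_span by (auto intro: span_add span_diff span_scale span_zero)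

lemma VS_I: "A \<in> TT \<Longrightarrow> Phi A \<in> VS" unfolding VS_def by auto

lemma Sop_inner: "inner (Sop \<Omega> x) y = sum_list (map (\<lambda>\<omega>. inner (E \<omega>) x * inner (E \<omega>) y) \<Omega>)"
  unfolding Sop_def by (induction \<Omega>) (simp_all add: inner_add_left)

lemma Sop_linear: "linear (Sop \<Omega>)"
  unfolding Sop_def
  by (rule linearI; induction \<Omega>) (simp_all add: inner_add_right scaleR_add_left scaleR_add_right)

lemma Sop_sym: "inner (Sop \<Omega> x) y = inner x (Sop \<Omega> y)"
proof -
  have "inner (Sop \<Omega> x) y = inner (Sop \<Omega> y) x"
    unfolding Sop_inner by (simp add: mult.commute)
  then show ?thesis by (metis inner_commute)
qed

lemma Sop_psd: "inner (Sop \<Omega> x) x \<ge> 0"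
  unfolding Sop_inner by (induction \<Omega>) simp_all

lemma Sop_Phi: "A \<in> TT \<Longrightarrow> Sop \<Omega> (Phi A) = Phi (sampling_op \<Omega> A)"
  unfolding Sop_def E_def by (rule sampling_Phi(2)[OF pos(3), symmetric])

lemma Sop_VS: "x \<in> VS \<Longrightarrow> Sop \<Omega> x \<in> VS"
  unfolding VS_def by (auto simp: Sop_Phi sampling_Phi(1)[OF pos(3)])

lemma Sop_norm:
  assumes op: "\<forall>x\<in>VS. \<forall>y\<in>VS. \<bar>inner x (Sop \<Omega> y)\<bar> \<le> q * norm x * norm y" and x: "x \<in> VS" and q: "0 \<le> q"
  shows "norm (Sop \<Omega> x) \<le> q * norm x"
proof -
  have "(norm (Sop \<Omega> x))\<^sup>2 \<le> q * norm (Sop \<Omega> x) * norm x"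
    unfolding power2_norm_eq_inner by (rule abs_le_D1) (rule op[rule_format, OF Sop_VS[OF x] x])
  then have "norm (Sop \<Omega> x) * norm (Sop \<Omega> x) \<le> norm (Sop \<Omega> x) * (q * norm x)"
    by (simp add: power2_eq_square mult_ac)
  then show ?thesis using q by (cases "Sop \<Omega> x = 0") auto
qed

definition "Tan Z A = ftan (PU Z * ftr (PU Z)) (PV Z * ftr (PV Z)) A"

lemma Tan:
  assumes Z: "Z \<in> TT"
  shows "linear (Tan Z)" "Tan Z (Tan Z x) = Tan Z x" "inner (Tan Z x) y = inner x (Tan Z y)"
    "norm (Tan Z x) \<le> norm x" "Tan Z (Phi Z) = Phi Z" "x \<in> VS \<Longrightarrow> Tan Z x \<in> VS"
proof -
  note S = fsvd_skinny(1)[OF pos(3) Z]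
  note P = fiso_fproj[OF fsvdD(1)[OF S]] fiso_fproj[OF fsvdD(2)[OF S]]
  show "linear (Tan Z)" using ftan_linear[of "PU Z * ftr (PU Z)" "PV Z * ftr (PV Z)"] unfolding Tan_def[abs_def] by (simp add: eta_contract_eq)
  show "Tan Z (Tan Z x) = Tan Z x" "inner (Tan Z x) y = inner x (Tan Z y)" "norm (Tan Z x) \<le> norm x"
    unfolding Tan_def by (rule ftan_ident(1)[OF P] ftan_ident(2)[OF P] ftan_contract(1)[OF P])+
  show "Tan Z (Phi Z) = Phi Z" unfolding Tan_def ftan_def by (simp add: fsvd_proj[OF S])
  show "Tan Z x \<in> VS" if "x \<in> VS"
    using that tangent_proj_Phi[OF pos(3) Z] unfolding VS_def Tan_def by (auto intro: image_eqI[OF sym])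
qed

lemma Tan_Phi:
  assumes Z: "Z \<in> TT" and A: "A \<in> TT"
  shows "Phi (tangent_proj Z A) = Tan Z (Phi A)"
  unfolding Tan_def by (rule tangent_proj_Phi(2)[OF pos(3) Z A])

lemma Tan_curvature:
  assumes Z: "Z \<in> TT" and X: "fsvd X U s V J" "\<forall>j\<in>J. \<sigma> \<le> s j" "0 < \<sigma>"
  shows "norm (X - Tan Z X) \<le> (norm (X - Phi Z))\<^sup>2 / \<sigma>"
proof -
  note S = fsvd_skinny(1)[OF pos(3) Z]
  show ?thesis unfolding Tan_def
    by (rule tangent_curvature[OF X fiso_fproj[OF fsvdD(1)[OF S]] fsvd_proj(1)[OF S] fiso_fproj[OF fsvdD(2)[OF S]] fsvd_proj(2)[OF S]])
qed

end

sublocale incoherent_tensor \<subseteq> tensor_space n1 n2 n3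
  by unfold_locales (rule pos)+

context incoherent_tensor
begin

lemma threshold_step:
  assumes W: "W \<in> TT" and close: "2 * norm (Phi W - Phi X) < \<sigma>"
  shows "threshold_defined rs W" "threshold rs W \<in> TT" "rank_t (threshold rs W) = rs"
    "norm (Phi (threshold rs W) - Phi X) \<le> 2 * norm (Phi W - Phi X)"
proof -
  have op: "fop_le (emb k (hat W $ k) - emb k (hat X $ k)) (norm (Phi W - Phi X))" if "k < n3" for k
  proof -
    have "norm ((emb k (hat W $ k) - emb k (hat X $ k)) * x) \<le> norm (Phi W - Phi X) * norm x" for x
      using fop_leD[OF fop_le_norm] slice_dist[OF W that] by (rule order_trans[OF _ mult_right_mono]) simp
    then show ?thesis unfolding fop_le_def by blast
  qed
  note t = threshold_tensor[OF pos(3) X svd sX_lower W op close norm_ge_zero]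
  show "threshold_defined rs W" "threshold rs W \<in> TT" "rank_t (threshold rs W) = rs"
    "norm (Phi (threshold rs W) - Phi X) \<le> 2 * norm (Phi W - Phi X)"
    by (rule t; assumption)+
qed

text \<open>The parameter \<open>a\<close> is the inverse of the sampling ratio. The constant is such that the step from \<open>Zh\<close> halves
  the distance of the untrimmed iterate to \<open>X\<close>, as trimming loses a factor of order \<open>\<kappa>\<close>.\<close>

definition good_step :: "real \<Rightarrow> index list \<Rightarrow> tensor \<Rightarrow> bool" where
  "good_step a \<Omega> Zh \<longleftrightarrow> (let e = Phi Zh - Phi X in
     \<forall>x\<in>VS. \<bar>inner (Tan Zh x) (e - a *\<^sub>R Sop \<Omega> e)\<bar> \<le> 1 / (40 * \<kappa>) * norm x * norm e)"

text \<open>The new error consists of the normal part of \<open>e\<close>, quadratic by curvature,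
  and the sampling error on the tangent space. With \<open>norm e\<close> at most
  \<open>5 * \<kappa>\<close> times the old distance the two add up to \<open>3 / 20\<close> of it;
  thresholding doubles this, which stays below one half.\<close>

lemma init_step_bound:
  fixes mh :: real
  assumes Z: "Z \<in> TT" "rank_t Z = rs" and close: "1000 * \<kappa>\<^sup>2 * norm (Phi Z - Phi X) \<le> \<sigma>"
  defines "Zh \<equiv> trim \<mu>0 (max_entry rs) Z"
  assumes good: "good_step (vol / mh) \<Omega> Zh"
  defines "W \<equiv> init_step mh X \<Omega> Zh"
  shows "threshold_defined rs W" "threshold rs W \<in> TT" "rank_t (threshold rs W) = rs"
    "norm (Phi (threshold rs W) - Phi X) \<le> norm (Phi Z - Phi X) / 2"
    "Zh \<in> TT" "rank_t Zh = rs"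
proof -
  let ?z = "norm (Phi Z - Phi X)"
  have "100 * \<kappa> * ?z \<le> 1000 * \<kappa>\<^sup>2 * ?z"
    using cond(6) by (intro mult_right_mono) (auto simp: power2_eq_square)
  then have close': "100 * \<kappa> * ?z \<le> \<sigma>" using close by linarith
  note T = trim_step[OF Z close', folded Zh_def]
  show Zh: "Zh \<in> TT" and "rank_t Zh = rs" by (rule T)+
  define e where "e = Phi Zh - Phi X"
  have eVS: "e \<in> VS" unfolding e_def by (intro VS_closed VS_I Zh X)
  have e: "norm e \<le> 5 * \<kappa> * ?z" unfolding e_def by (rule T(3))
  let ?a = "vol / mh"
  note d = tensor_ops(2)[OF X Zh] and s = sampling_Phi(1)[OF pos(3) tensor_ops(2)[OF X Zh], of \<Omega>]
  note p = tangent_proj_Phi(1)[OF pos(3) Zh s]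
  have W: "W \<in> TT" unfolding W_def init_step_def by (rule tensor_ops(1)[OF Zh tensor_ops(3)[OF p p]])
  have "Phi W = Phi Zh + ?a *\<^sub>R Tan Zh (Sop \<Omega> (Phi X - Phi Zh))"
    unfolding W_def init_step_def dims vol_def[symmetric]
    by (simp add: Phi_ops(1)[OF pos(3) Zh tensor_ops(3)[OF p p]] Phi_ops(3)[OF pos(3) p p] Tan_Phi[OF Zh s]
        Sop_Phi[OF d, symmetric] Phi_ops(2)[OF pos(3) X Zh])
  also have "Phi X - Phi Zh = - e" by (simp add: e_def)
  also have "Tan Zh (Sop \<Omega> (- e)) = - Tan Zh (Sop \<Omega> e)"
    by (simp add: linear_neg[OF Sop_linear] linear_neg[OF Tan(1)[OF Zh]])
  \<comment> \<open>The first bracket involves only \<open>X\<close> because the tangent projection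
    at \<open>Zh\<close> fixes \<open>Zh\<close>.\<close>
  finally have W1: "Phi W - Phi X = (e - Tan Zh e) + Tan Zh (e - ?a *\<^sub>R Sop \<Omega> e)"
    by (simp add: e_def linear_diff[OF Tan(1)[OF Zh]] linear_cmul[OF Tan(1)[OF Zh]])
  have "e - Tan Zh e = - (Phi X - Tan Zh (Phi X))"
    unfolding e_def by (simp add: linear_diff[OF Tan(1)[OF Zh]] Tan(5)[OF Zh])
  then have "norm (e - Tan Zh e) = norm (Phi X - Tan Zh (Phi X))" by (simp add: norm_minus_commute)
  also have "... \<le> (norm (Phi X - Phi Zh))\<^sup>2 / \<sigma>" by (rule Tan_curvature[OF Zh XS cond(3,2)])
  also have "... = norm e * (norm e / \<sigma>)" by (simp add: e_def norm_minus_commute power2_eq_square)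
  finally have c1: "norm (e - Tan Zh e) \<le> norm e * (norm e / \<sigma>)" .
  define y where "y = Tan Zh (e - ?a *\<^sub>R Sop \<Omega> e)"
  have yVS: "y \<in> VS" unfolding y_def by (intro Tan(6)[OF Zh] VS_closed eVS Sop_VS)
  have "(norm y)\<^sup>2 = inner (Tan Zh y) (e - ?a *\<^sub>R Sop \<Omega> e)"
    unfolding power2_norm_eq_inner Tan(3)[OF Zh] by (simp add: y_def Tan(2)[OF Zh] flip: Tan(3)[OF Zh])
  also have "... \<le> 1 / (40 * \<kappa>) * norm y * norm e"
    using good yVS unfolding good_step_def Let_def e_def[symmetric] by (meson abs_le_D1)
  finally have "norm y * norm y \<le> norm y * (1 / (40 * \<kappa>) * norm e)" by (simp add: power2_eq_square mult_ac)
  then have c2: "norm y \<le> 1 / (40 * \<kappa>) * norm e"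
    using mult_left_le_imp_le[of "norm y" "norm y" "1 / (40 * \<kappa>) * norm e"] cond(6) by (cases "y = 0") simp_all
  \<comment> \<open>Together with the tolerance \<open>1 / (40 * \<kappa>)\<close> this makes
    \<open>6 / (200 * \<kappa>)\<close>, whose \<open>\<kappa>\<close> cancels the one lost by
    trimming.\<close>
  have "norm e / \<sigma> \<le> 1 / (200 * \<kappa>)"
  proof -
    have "(200 * \<kappa>) * norm e \<le> (200 * \<kappa>) * (5 * \<kappa> * ?z)" using e cond(6) by (intro mult_left_mono) auto
    also have "... = 1000 * \<kappa>\<^sup>2 * ?z" by (simp add: power2_eq_square)
    finally show ?thesis using close cond(2,6) by (simp add: field_simps)
  qed
  then have "norm e * (norm e / \<sigma>) \<le> norm e * (1 / (200 * \<kappa>))" by (intro mult_left_mono) auto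
  then have "norm (Phi W - Phi X) \<le> norm e * (1 / (200 * \<kappa>)) + 1 / (40 * \<kappa>) * norm e"
    using norm_triangle_ineq[of "e - Tan Zh e" y] c1 c2 unfolding W1 y_def by linarith
  also have "... = norm e * (6 / (200 * \<kappa>))" using cond(6) by (simp add: field_simps)
  also have "... \<le> (5 * \<kappa> * ?z) * (6 / (200 * \<kappa>))" using e cond(6) by (intro mult_right_mono) auto
  also have "... = 3 / 20 * ?z" using cond(6) by simp
  finally have WX: "norm (Phi W - Phi X) \<le> 3 / 20 * ?z" .
  have "?z \<le> \<kappa> * ?z" using mult_right_mono[OF cond(6), of ?z] by simp
  then have "100 * ?z \<le> \<sigma>" using close' by linarith
  then have c3: "2 * norm (Phi W - Phi X) < \<sigma>" using WX cond(2) norm_ge_zero[of "Phi Z - Phi X"] by linarith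
  note t = threshold_step[OF W c3]
  show "threshold_defined rs W" "threshold rs W \<in> TT" "rank_t (threshold rs W) = rs" by (rule t)+
  show "norm (Phi (threshold rs W) - Phi X) \<le> ?z / 2" using t(4) WX norm_ge_zero[of "Phi Z - Phi X"] by linarith
qed

end

section \<open>Restricted isometry near the target and the conjugate gradient iteration\<close>

context incoherent_tensor
begin

definition "TX A = ftan (Phi U * ftr (Phi U)) (Phi V * ftr (Phi V)) A"

lemma TX:
  "norm (TX x) \<le> norm x" "x \<in> VS \<Longrightarrow> TX x \<in> VS" "linear TX" "TX (TX x) = TX x" "inner (TX x) y = inner x (TX y)"
proof -
  note P = fiso_fproj[OF fsvdD(1)[OF XS]] fiso_fproj[OF fsvdD(2)[OF XS]]
  show "norm (TX x) \<le> norm x" "TX (TX x) = TX x" "inner (TX x) y = inner x (TX y)"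
    unfolding TX_def by (rule ftan_contract(1)[OF P] ftan_ident(1)[OF P] ftan_ident(2)[OF P])+
  show "linear TX" using ftan_linear[of "Phi U * ftr (Phi U)" "Phi V * ftr (Phi V)"] unfolding TX_def[abs_def] by (simp add: eta_contract_eq)
  show "TX x \<in> VS" if "x \<in> VS"
    using that ftan_tensor[OF pos(3) UV] unfolding VS_def TX_def by (auto intro: image_eqI[OF sym])
qed

text \<open>Restricted isometry at the single tangent space of \<open>X\<close>, stated as a
  bilinear deviation relative to the ratio \<open>\<rho>\<close>.\<close>

definition rip :: "index list \<Rightarrow> real \<Rightarrow> real \<Rightarrow> bool" where
  "rip \<Omega> \<rho> \<delta> \<longleftrightarrow> (\<forall>x\<in>VS. \<forall>y\<in>VS. \<bar>inner (TX x) (Sop \<Omega> (TX y)) - \<rho> * inner (TX x) (TX y)\<bar> \<le> \<delta> * \<rho> * norm x * norm y)"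

definition op_bound :: "index list \<Rightarrow> real \<Rightarrow> bool" where
  "op_bound \<Omega> q \<longleftrightarrow> (\<forall>x\<in>VS. \<forall>y\<in>VS. \<bar>inner x (Sop \<Omega> y)\<bar> \<le> q * norm x * norm y)"

context
  fixes \<Omega> :: "index list" and \<rho> q \<delta>0 \<eta> \<delta> k1 k2 :: real
  assumes rip: "rip \<Omega> \<rho> \<delta>0" and op: "op_bound \<Omega> q" and \<rho>: "0 < \<rho>" "\<rho> \<le> q"
    and \<eta>: "0 \<le> \<eta>" "\<eta> \<le> 1 / 100" and \<delta>: "\<delta>0 + 10 * \<eta> \<le> \<delta>" "0 \<le> \<delta>0" "\<delta> \<le> 1 / 100"
    and k: "0 \<le> k1" "0 \<le> k2" "k1 + \<delta> < 1 - \<delta>" "k2 * (k1 + \<delta>) \<le> 1 / 3"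
begin

context
  fixes Xl :: tensor
  assumes Xl: "Xl \<in> TT" "rank_t Xl = rs"
    and close: "q * norm (Phi X - Phi Xl) \<le> \<eta> * \<rho> * \<sigma>"
begin

lemma cg_close: "norm (Phi X - Phi Xl) \<le> \<eta> * \<sigma>"
proof -
  have "\<rho> * norm (Phi X - Phi Xl) \<le> q * norm (Phi X - Phi Xl)" using \<rho> by (intro mult_right_mono) auto
  then have "\<rho> * norm (Phi X - Phi Xl) \<le> \<rho> * (\<eta> * \<sigma>)" using close by (simp add: mult_ac)
  then show ?thesis using \<rho>(1) by simp
qed

text \<open>The iterate has singular values of at least \<open>9 / 10 * \<sigma>\<close>, so
  \<open>tangent_tilt\<close> applies with constant \<open>20 / 9\<close>, which is below
  \<open>5 / 2\<close>.\<close>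

lemma tilt:
  assumes x: "Tan Xl x = x"
  shows "norm (x - TX x) \<le> 5 / 2 * norm (Phi X - Phi Xl) / \<sigma> * norm x"
proof -
  let ?e = "norm (Phi X - Phi Xl)"
  note Z = fsvd_skinny(1)[OF pos(3) Xl(1), unfolded Xl(2)]
  have "?e \<le> 1 / 100 * \<sigma>" using cg_close mult_right_mono[OF \<eta>(2), of \<sigma>] cond(2) by linarith
  then have lo: "\<forall>j\<in>J. 9 / 10 * \<sigma> \<le> sval Xl j"
  proof (intro ballI)
    fix j assume "j \<in> J"
    from singular_value_perturb[OF Z XS cond(3) less_imp_le[OF cond(2)] this]
    show "9 / 10 * \<sigma> \<le> sval Xl j" using \<open>?e \<le> 1 / 100 * \<sigma>\<close> cond(2) by (simp add: norm_minus_commute)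
  qed
  have "norm (x - TX x) \<le> 2 * norm (Phi Xl - Phi X) / (9 / 10 * \<sigma>) * norm x"
    unfolding TX_def
    by (rule tangent_tilt[OF Z lo _ fiso_fproj[OF fsvdD(1)[OF XS]] fsvd_proj(1)[OF XS] fiso_fproj[OF fsvdD(2)[OF XS]] fsvd_proj(2)[OF XS]])
      (use cond(2) x in \<open>simp_all add: Tan_def\<close>)
  also have "... \<le> 5 / 2 * ?e / \<sigma> * norm x"
    using cond(2) by (intro mult_right_mono) (auto simp: norm_minus_commute field_simps)
  finally show ?thesis .
qed

text \<open>\<open>x\<close> and \<open>y\<close> are replaced by their projections to the tangent
  space of \<open>X\<close>, in the sampled form and in the plain one. Each of the four replacements
  costs at most \<open>q * t \<le> 5 / 2 * \<eta> * \<rho>\<close>, which explains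
  \<open>10 * \<eta>\<close> and why closeness is measured with the weight \<open>q\<close>.\<close>

lemma rip_tangent:
  assumes x: "x \<in> VS" "Tan Xl x = x" and y: "y \<in> VS" "Tan Xl y = y"
  shows "\<bar>inner x (Sop \<Omega> y) - \<rho> * inner x y\<bar> \<le> \<delta> * \<rho> * norm x * norm y"
proof -
  let ?e = "norm (Phi X - Phi Xl)" and ?n = "norm x * norm y"
  define t where "t = 5 / 2 * ?e / \<sigma>"
  have t0: "0 \<le> t" unfolding t_def using cond(2) by simp
  have qt: "q * t \<le> 5 / 2 * \<eta> * \<rho>" unfolding t_def using close cond(2) by (simp add: field_simps)
  have q0: "0 \<le> q" using \<rho> by simp
  have dx: "norm (x - TX x) \<le> t * norm x" and dy: "norm (y - TX y) \<le> t * norm y"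
    using tilt x(2) y(2) unfolding t_def by auto
  have op': "\<bar>inner a (Sop \<Omega> b)\<bar> \<le> q * norm a * norm b" if "a \<in> VS" "b \<in> VS" for a b
    using op that unfolding op_bound_def by blast
  have a1: "\<bar>inner (x - TX x) (Sop \<Omega> y)\<bar> \<le> q * t * ?n"
  proof -
    have "\<bar>inner (x - TX x) (Sop \<Omega> y)\<bar> \<le> q * norm (x - TX x) * norm y"
      by (intro op' VS_closed x y TX)
    also have "... \<le> q * (t * norm x) * norm y" using dx q0 by (intro mult_right_mono mult_left_mono) auto
    finally show ?thesis by (simp add: mult_ac)
  qed
  have a2: "\<bar>inner (TX x) (Sop \<Omega> (y - TX y))\<bar> \<le> q * t * ?n"
  proof -
    have "\<bar>inner (TX x) (Sop \<Omega> (y - TX y))\<bar> \<le> q * norm (TX x) * norm (y - TX y)"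
      by (intro op' VS_closed x y TX)
    also have "... \<le> q * norm x * (t * norm y)" using dy q0 TX(1)[of x] by (intro mult_mono) auto
    finally show ?thesis by (simp add: mult_ac)
  qed
  have b1: "\<bar>inner (x - TX x) y\<bar> \<le> t * ?n"
    using Cauchy_Schwarz_ineq2[of "x - TX x" y] mult_right_mono[OF dx norm_ge_zero[of y]] by (simp add: mult_ac)
  have b2: "\<bar>inner (TX x) (y - TX y)\<bar> \<le> t * ?n"
  proof -
    have "\<bar>inner (TX x) (y - TX y)\<bar> \<le> norm (TX x) * norm (y - TX y)" by (rule Cauchy_Schwarz_ineq2)
    also have "... \<le> norm x * (t * norm y)" using dy TX(1)[of x] by (intro mult_mono) auto
    finally show ?thesis by (simp add: mult_ac)
  qed
  have c: "\<bar>inner (TX x) (Sop \<Omega> (TX y)) - \<rho> * inner (TX x) (TX y)\<bar> \<le> \<delta>0 * \<rho> * ?n"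
    using rip x y unfolding rip_def by (simp add: mult.assoc)
  have "inner x (Sop \<Omega> y) - \<rho> * inner x y = (inner (TX x) (Sop \<Omega> (TX y)) - \<rho> * inner (TX x) (TX y))
      + inner (x - TX x) (Sop \<Omega> y) + inner (TX x) (Sop \<Omega> (y - TX y)) - \<rho> * inner (x - TX x) y - \<rho> * inner (TX x) (y - TX y)"
    by (simp add: linear_diff[OF Sop_linear] inner_diff_left inner_diff_right algebra_simps)
  moreover have "\<bar>\<rho> * inner (x - TX x) y\<bar> \<le> \<rho> * (t * ?n)" "\<bar>\<rho> * inner (TX x) (y - TX y)\<bar> \<le> \<rho> * (t * ?n)"
    using b1 b2 \<rho>(1) by (simp_all add: abs_mult)
  moreover have "\<rho> * (t * ?n) \<le> q * t * ?n" using mult_right_mono[OF \<rho>(2), of "t * ?n"] t0 by (simp add: mult.assoc)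
  ultimately have "\<bar>inner x (Sop \<Omega> y) - \<rho> * inner x y\<bar> \<le> \<delta>0 * \<rho> * ?n + 4 * (q * t * ?n)"
    using a1 a2 c unfolding abs_le_iff by linarith
  also have "... = (\<delta>0 * \<rho> + 4 * (q * t)) * ?n" by (simp add: algebra_simps)
  also have "... \<le> (\<delta> * \<rho>) * ?n"
  proof (rule mult_right_mono)
    have "\<delta>0 * \<rho> + 10 * \<eta> * \<rho> \<le> \<delta> * \<rho>" using mult_right_mono[OF \<delta>(1), of \<rho>] \<rho>(1) by (simp add: distrib_right)
    then show "\<delta>0 * \<rho> + 4 * (q * t) \<le> \<delta> * \<rho>" using qt by linarith
  qed simp
  finally show ?thesis by (simp add: mult.assoc)
qed

text \<open>Transfers \<open>cg_step\<close> to tensors: all scalars of the algorithm are inner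
  products that \<open>Phi\<close> preserves.\<close>

lemma cg_tensor_step:
  fixes l :: nat
  assumes Qp: "Qp \<in> TT"
  defines "Q \<equiv> cg_dir k1 k2 \<Omega> X l Xl Qp"
  defines "W \<equiv> cg_update \<Omega> X Xl Q"
  shows "cg_stopped \<Omega> X Xl \<Longrightarrow> Xl = X" "Q \<in> TT" "W \<in> TT"
    "\<not> cg_stopped \<Omega> X Xl \<Longrightarrow> cg_alpha_den \<Omega> Xl Q \<noteq> 0"
    "norm (Phi Q) \<le> 11 / 10 * \<rho> * norm (Phi X - Phi Xl)"
    "norm (Phi X - Phi W) \<le> 1 / 20 * norm (Phi X - Phi Xl) + 7 / 20 * norm (Phi Qp) / \<rho>"
proof -
  \<comment> \<open>Composing with the projection onto \<open>VS\<close> turns the tangent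
    projection into one of the whole matrix space whose fixed points represent tensors, as
    \<open>cg_step\<close> requires.\<close>
  define \<pi> where "\<pi> = oproj E idx"
  define P where "P x = Tan Xl (\<pi> x)" for x
  have piV: "\<pi> x \<in> VS" for x unfolding \<pi>_def VS_span by (rule oproj_in_span)
  have pi_id: "\<pi> x = x" if "x \<in> VS" for x using that unfolding \<pi>_def VS_span by (rule oproj_span[OF E_orthon])
  have pi_sym: "inner (\<pi> x) y = inner x (\<pi> y)" for x y
  proof -
    have "inner (\<pi> x) y = inner (\<pi> y) x" unfolding \<pi>_def oproj_inner[OF E_orthon] by (simp add: mult.commute)
    then show ?thesis by (metis inner_commute)
  qed
  have pi_lin: "linear \<pi>" unfolding \<pi>_def oproj_def
    by (rule linearI) (simp_all add: inner_add_right scaleR_add_left sum.distrib scaleR_sum_right)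
  note T = Tan[OF Xl(1)]
  have P_VS: "P x \<in> VS" for x unfolding P_def by (intro T(6) piV)
  have P_id: "P x = Tan Xl x" if "x \<in> VS" for x unfolding P_def by (simp add: pi_id that)
  have P1: "linear P" unfolding P_def using linear_compose[OF pi_lin T(1)] by (simp add: o_def)
  have P2: "inner (P x) y = inner x (P y)" for x y
  proof -
    have "inner (P x) y = inner (\<pi> (Tan Xl (\<pi> x))) y" unfolding P_def by (simp add: pi_id[OF T(6)[OF piV]])
    also have "... = inner (\<pi> x) (Tan Xl (\<pi> y))" by (simp add: pi_sym T(3))
    also have "... = inner x (\<pi> (Tan Xl (\<pi> y)))" by (rule pi_sym)
    also have "... = inner x (P y)" unfolding P_def by (simp add: pi_id[OF T(6)[OF piV]])
    finally show ?thesis .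
  qed
  have P3: "P (P x) = P x" for x unfolding P_id[OF P_VS] unfolding P_def by (rule T(2))
  have rip': "\<bar>inner x (Sop \<Omega> y) - \<rho> * inner x y\<bar> \<le> \<delta> * \<rho> * norm x * norm y" if "P x = x" "P y = y" for x y
    using that P_VS[of x] P_VS[of y] P_id[of x] P_id[of y] by (intro rip_tangent) auto
  define e where "e = Phi X - Phi Xl"
  define p where "p = Phi Qp"
  have eV: "e \<in> VS" unfolding e_def by (intro VS_closed VS_I X Xl)
  have q0: "0 \<le> q" using \<rho> by simp
  have eq: "e - P e = Phi X - Tan Xl (Phi X)"
    unfolding P_id[OF eV] by (simp add: e_def linear_diff[OF T(1)] T(5))
  have "norm (e - P e) \<le> (norm e)\<^sup>2 / \<sigma>"
    unfolding eq unfolding e_def by (rule Tan_curvature[OF Xl(1) XS cond(3,2)])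
  then have eP: "norm (e - P e) \<le> norm e / \<sigma> * norm e" by (simp add: power2_eq_square)
  have E1: "norm (e - P e) \<le> \<eta> * norm e"
  proof -
    have "norm e / \<sigma> \<le> \<eta>" using cg_close cond(2) by (simp add: e_def pos_divide_le_eq)
    from mult_right_mono[OF this norm_ge_zero[of e]] eP show ?thesis by linarith
  qed
  \<comment> \<open>The normal part is quadratic in the error; this compensates the possibly large
    norm \<open>q\<close> of the sampling operator.\<close>
  have E2: "norm (P (Sop \<Omega> (e - P e))) \<le> \<eta> * \<rho> * norm e"
  proof -
    have v: "e - P e \<in> VS" by (intro VS_closed eV P_VS)
    have "norm (P (Sop \<Omega> (e - P e))) \<le> norm (Sop \<Omega> (e - P e))" unfolding P_id[OF Sop_VS[OF v]] by (rule T(4))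
    also have "... \<le> q * norm (e - P e)" by (rule Sop_norm[OF op[unfolded op_bound_def] v q0])
    also have "... \<le> q * (norm e / \<sigma> * norm e)" by (intro mult_left_mono eP q0)
    also have "... = (q * norm e / \<sigma>) * norm e" by simp
    also have "... \<le> (\<eta> * \<rho>) * norm e" using close cond(2) by (intro mult_right_mono) (auto simp: e_def pos_divide_le_eq)
    finally show ?thesis .
  qed
  have \<delta>0': "0 \<le> \<delta>" using \<delta> \<eta>(1) by linarith
  define G where "G = P (Sop \<Omega> e)"
  define y where "y = P p"
  define \<beta> where "\<beta> = (if l \<ge> 1 \<and> inner y (Sop \<Omega> y) \<noteq> 0 \<and> \<bar>inner G y\<bar> / (norm G * norm y) \<le> k1 \<and> norm G \<le> k2 * norm y
      then - (inner G (Sop \<Omega> y) / inner y (Sop \<Omega> y)) else 0)"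
  define Q' where "Q' = G + \<beta> *\<^sub>R y"
  define \<alpha> where "\<alpha> = inner G (P Q') / inner (P Q') (Sop \<Omega> (P Q'))"
  note step1 = cg_step(1)[OF P1 P2 P3 Sop_linear Sop_sym Sop_psd rip' \<rho>(1) \<delta>0' \<delta>(3) \<eta> E1 E2 k, folded G_def]
  note step = cg_step(2-4)[where flag = "l \<ge> 1" and q = p, OF P1 P2 P3 Sop_linear Sop_sym Sop_psd rip' \<rho>(1) \<delta>0' \<delta>(3) \<eta> E1 E2 k,
      folded G_def y_def, folded \<beta>_def, folded Q'_def, folded \<alpha>_def]
  note d = tensor_ops(2)[OF X Xl(1)]
  note s = sampling_Phi(1)[OF pos(3) d, of \<Omega>]
  have g: "cg_grad \<Omega> X Xl \<in> TT" unfolding cg_grad_def by (rule tangent_proj_Phi(1)[OF pos(3) Xl(1) s])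
  have Phig: "Phi (cg_grad \<Omega> X Xl) = G"
    unfolding cg_grad_def G_def Tan_Phi[OF Xl(1) s] Sop_Phi[OF d, symmetric] Phi_ops(2)[OF pos(3) X Xl(1)] e_def[symmetric]
    by (rule P_id[OF Sop_VS[OF eV], symmetric])
  have tP: "tangent_proj Xl A \<in> TT" "Phi (tangent_proj Xl A) = P (Phi A)" if "A \<in> TT" for A
    using tangent_proj_Phi(1)[OF pos(3) Xl(1) that] Tan_Phi[OF Xl(1) that] P_id[OF VS_I[OF that]] by auto
  note sP = sampling_Phi(1)[OF pos(3), where \<Omega> = \<Omega>]
  have den: "tinner A (sampling_op \<Omega> B) = inner (Phi A) (Sop \<Omega> (Phi B))" if "A \<in> TT" "B \<in> TT" for A B
    unfolding tinner_Phi[OF pos(3) that(1) sP[OF that(2)]] Sop_Phi[OF that(2)] ..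
  have b: "cg_beta k1 k2 \<Omega> X l Xl Qp = \<beta>"
    unfolding cg_beta_def Let_def \<beta>_def
    by (simp add: den[OF tP(1)[OF Qp] tP(1)[OF Qp]] den[OF g tP(1)[OF Qp]] tinner_Phi[OF pos(3) g tP(1)[OF Qp]]
      tnorm_Phi[OF pos(3) g] tnorm_Phi[OF pos(3) tP(1)[OF Qp]] tP(2)[OF Qp] Phig y_def p_def)
  note sc = tensor_ops(3)[OF tP(1)[OF Qp] tP(1)[OF Qp], of \<beta>]
  show Q: "Q \<in> TT" unfolding Q_def cg_dir_def b by (rule tensor_ops(1)[OF g sc])
  have PhiQ: "Phi Q = Q'"
    unfolding Q_def cg_dir_def b Phi_ops(1)[OF pos(3) g sc] Phi_ops(3)[OF pos(3) tP(1)[OF Qp] tP(1)[OF Qp]] Phig tP(2)[OF Qp] Q'_def y_def p_def ..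
  have ad: "cg_alpha_den \<Omega> Xl Q = inner (P Q') (Sop \<Omega> (P Q'))"
    unfolding cg_alpha_den_def den[OF tP(1)[OF Q] tP(1)[OF Q]] tP(2)[OF Q] PhiQ ..
  have al: "tinner (cg_grad \<Omega> X Xl) (tangent_proj Xl Q) / cg_alpha_den \<Omega> Xl Q = \<alpha>"
    unfolding ad \<alpha>_def tinner_Phi[OF pos(3) g tP(1)[OF Q]] Phig tP(2)[OF Q] PhiQ ..
  note sQ = tensor_ops(3)[OF Q Q, of \<alpha>]
  show W: "W \<in> TT" unfolding W_def cg_update_def al by (rule tensor_ops(1)[OF Xl(1) sQ])
  have PhiW: "Phi W = Phi Xl + \<alpha> *\<^sub>R Q'"
    unfolding W_def cg_update_def al Phi_ops(1)[OF pos(3) Xl(1) sQ] Phi_ops(3)[OF pos(3) Q Q] PhiQ ..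
  have st: "cg_stopped \<Omega> X Xl \<longleftrightarrow> G = 0"
    unfolding cg_stopped_def dims Phig[symmetric]
    using Phi_inj[OF pos(3) g tensor_ops(4)[OF X X]] Phi_ops(4)[OF pos(3) X X] by auto
  show "Xl = X" if "cg_stopped \<Omega> X Xl"
  proof -
    have "e = 0" using step1 st that by blast
    then show ?thesis using Phi_inj[OF pos(3) Xl(1) X] by (simp add: e_def)
  qed
  show "cg_alpha_den \<Omega> Xl Q \<noteq> 0" if "\<not> cg_stopped \<Omega> X Xl"
    unfolding ad using step(1) st that by blast
  show "norm (Phi Q) \<le> 11 / 10 * \<rho> * norm (Phi X - Phi Xl)" unfolding PhiQ e_def[symmetric] by (rule step(2))
  have eW: "Phi X - Phi W = e - \<alpha> *\<^sub>R Q'" unfolding PhiW e_def by simp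
  show "norm (Phi X - Phi W) \<le> 1 / 20 * norm (Phi X - Phi Xl) + 7 / 20 * norm (Phi Qp) / \<rho>"
    unfolding eW e_def[symmetric] p_def[symmetric] by (rule step(3))
qed

end

text \<open>Error and previous direction decrease together. A step leaves
  \<open>1 / 20 + 7 / 20 * 11 / 9 = 43 / 90\<close> of the bound; after the doubling by thresholding
  this is still below \<open>24 / 25\<close>.\<close>

lemma cg_converges:
  assumes X0: "X0 \<in> TT" "rank_t X0 = rs" and close: "q * norm (Phi X - Phi X0) \<le> \<eta> * \<rho> * \<sigma>"
  shows "cg_well_defined k1 k2 rs \<Omega> X X0" "tconverges (cg_iter k1 k2 rs \<Omega> X X0) X"
proof -
  let ?e0 = "norm (Phi X - Phi X0)" and ?\<theta> = "24 / 25 :: real"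
  let ?st = "cg_state k1 k2 rs \<Omega> X X0"
  have q0: "0 \<le> q" using \<rho> by simp
  have e0: "100 * ?e0 \<le> \<sigma>" using cg_close[OF X0 close] mult_right_mono[OF \<eta>(2), of \<sigma>] cond(2) by linarith
  have near: "q * norm (Phi X - Phi Xl) \<le> \<eta> * \<rho> * \<sigma>" if "norm (Phi X - Phi Xl) \<le> ?\<theta> ^ l * ?e0" for Xl l
  proof -
    have "?\<theta> ^ l * ?e0 \<le> 1 * ?e0" by (intro mult_right_mono power_le_one) auto
    then have "q * norm (Phi X - Phi Xl) \<le> q * ?e0" using that q0 by (intro mult_left_mono) auto
    then show ?thesis using close by linarith
  qed
  \<comment> \<open>The constant \<open>11 / 9\<close> exceeds \<open>11 / 10\<close> divided by
    \<open>24 / 25\<close>, so the bound on the direction reproduces itself. Once \<open>X\<close>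
    is reached the state is frozen and the direction no longer shrinks, hence the
    disjunction.\<close>
  define I where "I l s \<longleftrightarrow> fst s \<in> TT \<and> rank_t (fst s) = rs \<and> snd s \<in> TT \<and>
    norm (Phi X - Phi (fst s)) \<le> ?\<theta> ^ l * ?e0 \<and> (fst s = X \<or> norm (Phi (snd s)) \<le> 11 / 9 * \<rho> * ?\<theta> ^ l * ?e0)" for l s
  \<comment> \<open>An iterate equal to \<open>X\<close> counts as stopped; otherwise the direction
    bound may be used.\<close>
  have stX: "cg_stopped \<Omega> X X"
  proof -
    note d = tensor_ops(2)[OF X X]
    note s = sampling_Phi(1)[OF pos(3) d, of \<Omega>]
    have g: "cg_grad \<Omega> X X \<in> TT" unfolding cg_grad_def by (rule tangent_proj_Phi(1)[OF pos(3) X s])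
    have "Phi (cg_grad \<Omega> X X) = Tan X (Sop \<Omega> 0)"
      unfolding cg_grad_def Tan_Phi[OF X s] Sop_Phi[OF d, symmetric] Phi_ops(2)[OF pos(3) X X] by simp
    then have "Phi (cg_grad \<Omega> X X) = Phi (tzero n1 n2 n3)"
      by (simp add: linear_0[OF Sop_linear] linear_0[OF Tan(1)[OF X]] Phi_ops(4)[OF pos(3) X X])
    then show ?thesis unfolding cg_stopped_def dims by (rule Phi_inj[OF pos(3) g tensor_ops(4)[OF X X]])
  qed
  have step: "I (Suc l) (?st (Suc l)) \<and> (\<not> cg_stopped \<Omega> X (fst (?st l)) \<longrightarrow>
      (let Q = cg_dir k1 k2 \<Omega> X l (fst (?st l)) (snd (?st l)) in
        cg_alpha_den \<Omega> (fst (?st l)) Q \<noteq> 0 \<and> threshold_defined rs (cg_update \<Omega> X (fst (?st l)) Q)))"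
    if I: "I l (?st l)" for l
  proof -
    obtain Xl Qp where s: "?st l = (Xl, Qp)" by (cases "?st l")
    have Xl: "Xl \<in> TT" "rank_t Xl = rs" and Qp: "Qp \<in> TT"
      and el: "norm (Phi X - Phi Xl) \<le> ?\<theta> ^ l * ?e0" and ql: "Xl = X \<or> norm (Phi Qp) \<le> 11 / 9 * \<rho> * ?\<theta> ^ l * ?e0"
      using I unfolding I_def s by auto
    note c1 = cg_tensor_step(1)[OF Xl near[OF el] Qp] and c = cg_tensor_step(2-6)[OF Xl near[OF el] Qp, of l]
    show ?thesis
    proof (cases "cg_stopped \<Omega> X Xl")
      case True
      have "Xl = X" by (rule c1[OF True])
      then have "I (Suc l) (Xl, Qp)" unfolding I_def using Xl Qp by simp
      then show ?thesis using True by (simp add: s)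
    next
      case False
      define Q where "Q = cg_dir k1 k2 \<Omega> X l Xl Qp"
      define W where "W = cg_update \<Omega> X Xl Q"
      note c' = c[folded Q_def, folded W_def]
      define d where "d = ?\<theta> ^ l * ?e0"
      have d: "0 \<le> d" "d \<le> ?e0"
        using mult_right_mono[OF power_le_one[of ?\<theta> l], of ?e0] by (simp_all add: d_def)
      have ql': "norm (Phi Qp) / \<rho> \<le> 11 / 9 * d"
        using ql False stX \<rho>(1) by (auto simp: pos_divide_le_eq mult_ac d_def)
      have We: "norm (Phi X - Phi W) \<le> 43 / 90 * d"
        using c'(5) el[folded d_def] ql' by (simp add: algebra_simps)
      have "2 * norm (Phi W - Phi X) < \<sigma>"
      proof -
        have "2 * norm (Phi X - Phi W) \<le> d" using We d(1) by simp
        then show ?thesis using e0 d cond(2) by (simp add: norm_minus_commute)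
      qed
      note t = threshold_step[OF c'(2) this]
      have "norm (Phi X - Phi (threshold rs W)) \<le> ?\<theta> * d"
        using t(4) We d unfolding norm_minus_commute[of "Phi X"] by linarith
      then have e1: "norm (Phi X - Phi (threshold rs W)) \<le> ?\<theta> ^ Suc l * ?e0" by (simp add: d_def mult.assoc)
      have "norm (Phi Q) \<le> 11 / 10 * \<rho> * d"
        using c'(4) mult_left_mono[OF el[folded d_def], of "11 / 10 * \<rho>"] \<rho>(1) by linarith
      also have "... \<le> 11 / 9 * \<rho> * (?\<theta> * d)"
        using \<rho>(1) d(1) by (simp add: mult_ac)
      also have "... = 11 / 9 * \<rho> * ?\<theta> ^ Suc l * ?e0" by (simp add: d_def)
      finally have "I (Suc l) (threshold rs W, Q)"
        unfolding I_def using t c'(1) e1 by simp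
      then show ?thesis using False c'(3) t(1) by (simp add: s Let_def Q_def W_def)
    qed
  qed
  have I0: "I 0 (?st 0)"
    unfolding I_def using X0 tensor_ops(4)[OF X X] Phi_ops(4)[OF pos(3) X X] \<rho>(1) by (simp add: dims)
  have I: "I l (?st l)" for l
  proof (induction l)
    case (Suc l)
    then show ?case using step by blast
  qed (rule I0)
  have rsd: "dim_vec rs = n3" by (rule rank_t_dim(1)[OF X pos(3)])
  show "cg_well_defined k1 k2 rs \<Omega> X X0"
    unfolding cg_well_defined_def
  proof
    fix l
    have "fst (?st l) \<in> manifold (dim1 X) (dim2 X) rs"
      using I[of l] unfolding I_def manifold_def dims rsd by simp
    then show "case ?st l of (Xl, Qp) \<Rightarrow> Xl \<in> manifold (dim1 X) (dim2 X) rs \<and>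
       (\<not> cg_stopped \<Omega> X Xl \<longrightarrow> (let Q = cg_dir k1 k2 \<Omega> X l Xl Qp in
           cg_alpha_den \<Omega> Xl Q \<noteq> 0 \<and> threshold_defined rs (cg_update \<Omega> X Xl Q)))"
      using step[OF I[of l]] by (simp add: case_prod_beta)
  qed
  have b: "tnorm (cg_iter k1 k2 rs \<Omega> X X0 l - X) \<le> ?\<theta> ^ l * ?e0" "0 \<le> tnorm (cg_iter k1 k2 rs \<Omega> X X0 l - X)" for l
  proof -
    have A: "cg_iter k1 k2 rs \<Omega> X X0 l \<in> TT" "norm (Phi X - Phi (cg_iter k1 k2 rs \<Omega> X X0 l)) \<le> ?\<theta> ^ l * ?e0"
      using I[of l] unfolding I_def cg_iter_def by auto
    have "tnorm (cg_iter k1 k2 rs \<Omega> X X0 l - X) = norm (Phi X - Phi (cg_iter k1 k2 rs \<Omega> X X0 l))"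
      unfolding tnorm_Phi[OF pos(3) tensor_ops(2)[OF A(1) X]] Phi_ops(2)[OF pos(3) A(1) X] by (rule norm_minus_commute)
    then show "tnorm (cg_iter k1 k2 rs \<Omega> X X0 l - X) \<le> ?\<theta> ^ l * ?e0" "0 \<le> tnorm (cg_iter k1 k2 rs \<Omega> X X0 l - X)" using A(2) by simp_all
  qed
  have lim: "(\<lambda>l. ?\<theta> ^ l * ?e0) \<longlonglongrightarrow> 0"
    by (rule tendsto_mult_left_zero[OF LIMSEQ_power_zero]) simp
  show "tconverges (cg_iter k1 k2 rs \<Omega> X X0) X"
    unfolding tconverges_def
    by (rule tendsto_sandwich[OF always_eventually always_eventually tendsto_const lim]) (rule allI, rule b)+
qed

end

end

section \<open>Deviation of the sampling operator from its mean\<close>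

lemma exp_4_le: "exp (4::real) \<le> 55"
proof -
  have "exp (4::real) = exp 1 ^ 4" by (simp flip: exp_of_nat_mult)
  also have "... \<le> (272 / 100) ^ 4" using e_less_272 by (intro power_mono) auto
  also have "... \<le> (55::real)" by (simp add: power_divide)
  finally show ?thesis .
qed

text \<open>The factor exceeds \<open>exp 4\<close>, which turns the bound of \<open>gram_concentration\<close> into a fourth power.\<close>

definition tail :: "nat \<Rightarrow> real \<Rightarrow> real \<Rightarrow> real" where
  "tail p R K = 55 * (4 * (real p)\<^sup>2 * R\<^sup>2 + 8 * real p * R * K)"

text \<open>With the base of the \<open>p\<close>-th power below \<open>exp (- 4)\<close>, an order
  \<open>p\<close> of at least \<open>ln N\<close> yields a fourth power of
  \<open>N\<close>.\<close>

lemma (in gram_sampling) gram_prob: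
  assumes \<tau>: "\<tau> > 0" and K0: "K \<ge> 0" and N: "1 < N" "ln N \<le> real p"
    and small: "tail p R K \<le> \<tau>\<^sup>2"
  shows "measure_pmf.prob (replicate_pmf m (pmf_of_set S)) (bad \<tau>) \<le> real (card A) * N powr (- 4)"
proof -
  let ?q = "(4 * (real p)\<^sup>2 * R\<^sup>2 + 8 * real p * R * K) / \<tau>\<^sup>2"
  have "0 \<le> 8 * real p * R * K" using R_nonneg K0 by simp
  then have q0: "0 \<le> ?q" by (intro divide_nonneg_nonneg add_nonneg_nonneg) auto
  have "?q \<le> 1 / 55" using small \<tau> by (simp add: tail_def field_simps)
  also have "... \<le> exp (- 4)" using exp_4_le by (simp add: exp_minus field_simps)
  finally have "?q ^ p \<le> exp (- 4) ^ p" using q0 by (intro power_mono)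
  also have "... = exp (- 4 * real p)" by (simp flip: exp_of_nat_mult add: mult.commute)
  also have "... \<le> exp (- 4 * ln N)" using N by simp
  also have "... = N powr (- 4)" using N by (simp add: powr_def)
  finally show ?thesis
    using gram_concentration[OF \<tau> K0, of p] mult_left_mono[of "?q ^ p" "N powr (- 4)" "real (card A)"] by simp
qed

text \<open>Product spaces carry the dilation argument: a form in two different kinds of vectors is
  the off-diagonal part of a Gram operator on pairs.\<close>

lemma orthon_prod:
  assumes u: "orthon u A" and w: "orthon w B"
  shows "orthon (case_sum (\<lambda>a. (u a, 0)) (\<lambda>b. (0, w b))) (A <+> B)"
  unfolding orthon_def using orthon_finite[OF u] orthon_finite[OF w] orthon_inner[OF u] orthon_inner[OF w]
  by (auto simp: inner_prod_def split: sum.splits)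

lemma span_prod:
  fixes u :: "'a \<Rightarrow> 'v::real_inner" and w :: "'b \<Rightarrow> 'w::real_inner"
  assumes x: "x \<in> span (u ` A)" and y: "y \<in> span (w ` B)"
  shows "(x, y) \<in> span (case_sum (\<lambda>a. (u a, 0)) (\<lambda>b. (0, w b)) ` (A <+> B))"
proof -
  let ?e = "case_sum (\<lambda>a. (u a, 0)) (\<lambda>b. (0, w b)) ` (A <+> B)"
  have "span (u ` A) \<subseteq> {x. (x, 0) \<in> span ?e}"
  proof (rule span_minimal)
    show "u ` A \<subseteq> {x. (x, 0) \<in> span ?e}" by (auto intro!: span_base rev_image_eqI[of "Inl _"])
    show "real_vector.subspace {x. (x, 0) \<in> span ?e}"
      by (intro real_vector.subspaceI; clarsimp)
        (metis span_zero zero_prod_def, metis add_Pair add_0_left span_add, metis scaleR_Pair scaleR_zero_right span_scale)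
  qed
  moreover have "span (w ` B) \<subseteq> {y. (0, y) \<in> span ?e}"
  proof (rule span_minimal)
    show "w ` B \<subseteq> {y. (0, y) \<in> span ?e}" by (auto intro!: span_base rev_image_eqI[of "Inr _"])
    show "real_vector.subspace {y. (0, y) \<in> span ?e}"
      by (intro real_vector.subspaceI; clarsimp)
        (metis span_zero zero_prod_def, metis add_Pair add_0_left span_add, metis scaleR_Pair scaleR_zero_right span_scale)
  qed
  ultimately have "(x, 0) \<in> span ?e" "(0, y) \<in> span ?e" using x y by auto
  then have "(x, 0) + (0, y) \<in> span ?e" by (rule span_add)
  then show ?thesis by simp
qed

context tensor_space
begin

lemma E_parseval:
  assumes "x \<in> VS"
  shows "(\<Sum>\<omega>\<in>idx. inner (E \<omega>) x * inner (E \<omega>) y) = inner x y"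
  using oproj_inner[OF E_orthon, of x y] oproj_span[OF E_orthon, of x] assms by (simp add: VS_span)

lemma E_VS: "\<omega> \<in> idx \<Longrightarrow> E \<omega> \<in> VS"
  unfolding E_def by (intro VS_I basis_tensor_in pos)

text \<open>\<open>gram_concentration\<close> for
  \<open>g \<omega> = sqrt (vol / m) *\<^sub>R F (E \<omega>)\<close>. With this normalization the
  mean form is \<open>inner (F x) (F y)\<close>, so \<open>K = 1\<close> works for a contraction
  \<open>F\<close>.\<close>

lemma sampling_deviation:
  fixes F :: "bmat \<Rightarrow> bmat"
  assumes F: "\<And>x y. inner (F x) y = inner x (F y)" "\<And>x. norm (F x) \<le> norm x" "\<And>x. x \<in> VS \<Longrightarrow> F x \<in> VS" "linear F"
    and m: "0 < m" and R: "\<forall>\<omega>\<in>idx. vol / real m * (norm (F (E \<omega>)))\<^sup>2 \<le> R"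
    and \<tau>: "\<tau> > 0" and N: "1 < N" "ln N \<le> real p" and small: "tail p R 1 \<le> \<tau>\<^sup>2"
  shows "Pr m
      {\<Omega>. \<not> (\<forall>x\<in>VS. \<forall>y\<in>VS. \<bar>inner (F x) (Sop \<Omega> (F y)) - real m / vol * inner (F x) (F y)\<bar> \<le> \<tau> * (real m / vol) * norm x * norm y)}
    \<le> vol * N powr (- 4)"
proof -
  define a where "a = vol / real m"
  have a: "0 < a" "real m / vol = 1 / a" unfolding a_def using vol_pos m by auto
  define g where "g \<omega> = sqrt a *\<^sub>R F (E \<omega>)" for \<omega>
  have gg: "inner (g \<omega>) x * inner (g \<omega>) y = a * (inner (E \<omega>) (F x) * inner (E \<omega>) (F y))" for \<omega> x y
    using a(1) by (simp add: g_def F(1) mult.commute mult.left_commute)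
  have cs: "real m / real (card idx) * (\<Sum>\<omega>\<in>idx. inner (g \<omega>) x * inner (g \<omega>) y) = inner (F x) (F y)" if "x \<in> VS" for x y
    unfolding gg sum_distrib_left[symmetric] E_parseval[OF F(3)[OF that]] idx(3) using a by simp
  interpret gram_sampling idx g E idx m R 1
  proof
    show "finite idx" "idx \<noteq> {}" "orthon E idx" by (fact idx E_orthon)+
    fix \<omega> assume w: "\<omega> \<in> idx"
    show "g \<omega> \<in> span (E ` idx)" unfolding g_def VS_span[symmetric] by (intro VS_closed F(3) E_VS w)
    show "(norm (g \<omega>))\<^sup>2 \<le> R" using R w a by (simp add: g_def power_mult_distrib a_def[symmetric])
  next
    fix x :: "bmat"
    have "(\<Sum>\<omega>\<in>idx. (inner (g \<omega>) x)\<^sup>2) = a * (\<Sum>\<omega>\<in>idx. (inner (E \<omega>) (F x))\<^sup>2)"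
      using gg[of _ x x] by (simp add: power2_eq_square sum_distrib_left)
    also have "... \<le> a * (norm x)\<^sup>2"
    proof (rule mult_left_mono)
      have "(\<Sum>\<omega>\<in>idx. (inner (E \<omega>) (F x))\<^sup>2) \<le> (norm (F x))\<^sup>2" by (rule bessel[OF E_orthon])
      also have "... \<le> (norm x)\<^sup>2" using F(2) by (intro power_mono) auto
      finally show "(\<Sum>\<omega>\<in>idx. (inner (E \<omega>) (F x))\<^sup>2) \<le> (norm x)\<^sup>2" .
    qed (use a in simp)
    finally have s: "(\<Sum>\<omega>\<in>idx. (inner (g \<omega>) x)\<^sup>2) \<le> a * (norm x)\<^sup>2" .
    show "real m / real (card idx) * (\<Sum>\<omega>\<in>idx. (inner (g \<omega>) x)\<^sup>2) \<le> 1 * (norm x)\<^sup>2"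
      unfolding idx(3) a(2) using mult_left_mono[OF s, of "1 / a"] a(1) by simp
  qed
  let ?G = "\<lambda>\<Omega>. \<forall>x\<in>VS. \<forall>y\<in>VS. \<bar>inner (F x) (Sop \<Omega> (F y)) - real m / vol * inner (F x) (F y)\<bar> \<le> \<tau> * (real m / vol) * norm x * norm y"
  have "{\<Omega>. \<not> ?G \<Omega>} \<subseteq> bad \<tau>"
  proof
    fix \<Omega> assume "\<Omega> \<in> {\<Omega>. \<not> ?G \<Omega>}"
    then obtain x y where xy: "x \<in> VS" "y \<in> VS" and
      gt: "\<not> \<bar>inner (F x) (Sop \<Omega> (F y)) - real m / vol * inner (F x) (F y)\<bar> \<le> \<tau> * (real m / vol) * norm x * norm y" by blast
    have s: "sum_list (map (\<lambda>\<omega>. inner (g \<omega>) x * inner (g \<omega>) y) \<Omega>) = a * inner (F x) (Sop \<Omega> (F y))"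
      unfolding gg Sop_sym[symmetric] Sop_inner by (rule sum_list_const_mult)
    have "\<bar>a * (inner (F x) (Sop \<Omega> (F y)) - real m / vol * inner (F x) (F y))\<bar> > a * (\<tau> * (real m / vol) * norm x * norm y)"
      using mult_strict_left_mono[OF gt[unfolded not_le] a(1)] by (simp only: abs_mult abs_of_pos[OF a(1)])
    then have "\<bar>sum_list (map (\<lambda>\<omega>. inner (g \<omega>) x * inner (g \<omega>) y) \<Omega>) - real m / real (card idx) * (\<Sum>\<omega>\<in>idx. inner (g \<omega>) x * inner (g \<omega>) y)\<bar>
        > \<tau> * norm x * norm y"
      unfolding s cs[OF xy(1)] a(2) using a(1) by (simp add: right_diff_distrib)
    then show "\<Omega> \<in> bad \<tau>" unfolding bad_def using xy unfolding VS_span by blast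
  qed
  then have "Pr m {\<Omega>. \<not> ?G \<Omega>}
      \<le> Pr m (bad \<tau>)"
    by (intro measure_pmf.finite_measure_mono) auto
  also have "... \<le> real (card idx) * N powr (- 4)"
    unfolding uniform_samples_def by (rule gram_prob[OF \<tau> _ N]) (use small in simp_all)
  finally show ?thesis unfolding idx(3) .
qed

end

context incoherent_tensor
begin

abbreviation "NN \<equiv> real (max n1 n2) * real n3"

text \<open>Bounds the dimension factor of the tails, so that a fourth power of \<open>NN\<close>
  leaves a square.\<close>

lemma vol_le: "vol \<le> NN\<^sup>2"
proof -
  have "(real n1 * real n2) * (real n3 * 1) \<le> (real (max n1 n2) * real (max n1 n2)) * (real n3 * real n3)"
    using pos(3) by (intro mult_mono) auto
  then show ?thesis by (simp add: vol_def power2_eq_square mult_ac)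
qed

text \<open>In the level \<open>b1\<close> the factor \<open>n3\<close> cancels against
  \<open>2 / n3\<close>, and \<open>vol / n1\<close> is at most \<open>NN\<close>; likewise for
  \<open>b2\<close>.\<close>

lemma coherence_bound:
  assumes "\<omega> \<in> idx" and A: "fiso A J'" "\<And>i. i < n1 \<Longrightarrow> norm (fId (slab n3 i) * A) \<le> c * b1"
    and B: "fiso B J''" "\<And>j. j < n2 \<Longrightarrow> norm (fId (slab n3 j) * B) \<le> c' * b2" and c: "0 \<le> c" "0 \<le> c'"
  shows "vol * (norm (A * ftr A * E \<omega>))\<^sup>2 \<le> 2 * c\<^sup>2 * (\<mu>0 * r * NN)"
    "vol * (norm (E \<omega> * (B * ftr B)))\<^sup>2 \<le> 2 * c'\<^sup>2 * (\<mu>0 * r * NN)"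
proof -
  obtain i j k where w: "\<omega> = (i, j, k)" "i < n1" "j < n2" "k < n3" using assms(1) by (auto simp: index_set_def)
  have E: "E \<omega> = ebas n3 i j k" unfolding E_def using Phi_basis_ebas[OF pos(3) assms(1)] by (simp add: w)
  have "vol * (norm (A * ftr A * E \<omega>))\<^sup>2 \<le> vol * (2 / real n3 * (norm (fId (slab n3 i) * A))\<^sup>2)"
    unfolding E by (intro mult_left_mono coherence_left[OF A(1) w(4)]) (use vol_pos in simp)
  also have "... \<le> vol * (2 / real n3 * (c * b1)\<^sup>2)"
    using A(2)[OF w(2)] vol_pos by (intro mult_left_mono power_mono) auto
  also have "... = 2 * c\<^sup>2 * (\<mu>0 * r * (real n2 * real n3))"
    using pos \<mu>0 by (simp add: power_mult_distrib b1_def vol_def field_simps)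
  also have "... \<le> 2 * c\<^sup>2 * (\<mu>0 * r * NN)"
    using \<mu>0 by (intro mult_left_mono mult_right_mono) auto
  finally show "vol * (norm (A * ftr A * E \<omega>))\<^sup>2 \<le> 2 * c\<^sup>2 * (\<mu>0 * r * NN)" .
  have "vol * (norm (E \<omega> * (B * ftr B)))\<^sup>2 \<le> vol * (2 / real n3 * (norm (fId (slab n3 j) * B))\<^sup>2)"
    unfolding E by (intro mult_left_mono coherence_right[OF B(1) w(4)]) (use vol_pos in simp)
  also have "... \<le> vol * (2 / real n3 * (c' * b2)\<^sup>2)"
    using B(2)[OF w(3)] vol_pos by (intro mult_left_mono power_mono) auto
  also have "... = 2 * c'\<^sup>2 * (\<mu>0 * r * (real n1 * real n3))"
    using pos \<mu>0 by (simp add: power_mult_distrib b2_def vol_def field_simps)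
  also have "... \<le> 2 * c'\<^sup>2 * (\<mu>0 * r * NN)"
    using \<mu>0 by (intro mult_left_mono mult_right_mono) auto
  finally show "vol * (norm (E \<omega> * (B * ftr B)))\<^sup>2 \<le> 2 * c'\<^sup>2 * (\<mu>0 * r * NN)" .
qed

lemma rip_prob:
  assumes m: "0 < m" and \<tau>: "\<tau> > 0" and N: "1 < N" "ln N \<le> real p"
    and R: "R = 4 * (\<mu>0 * r * NN) / real m" and small: "tail p R 1 \<le> \<tau>\<^sup>2"
  shows "Pr m {\<Omega>. \<not> rip \<Omega> (real m / vol) \<tau>} \<le> vol * N powr (- 4)"
  unfolding rip_def
proof (rule sampling_deviation[OF TX(5) TX(1) TX(2) TX(3) m _ \<tau> N small])
  show "\<forall>\<omega>\<in>idx. vol / real m * (norm (TX (E \<omega>)))\<^sup>2 \<le> R"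
  proof
    fix \<omega> assume w: "\<omega> \<in> idx"
    note U = fsvdD(1)[OF XS] and V = fsvdD(2)[OF XS]
    have rb: "i < n1 \<Longrightarrow> norm (fId (slab n3 i) * Phi U) \<le> 1 * b1" "i < n2 \<Longrightarrow> norm (fId (slab n3 i) * Phi V) \<le> 1 * b2" for i
      using row_bounds by auto
    have "vol * (norm (TX (E \<omega>)))\<^sup>2 \<le> vol * ((norm (Phi U * ftr (Phi U) * E \<omega>))\<^sup>2 + (norm (E \<omega> * (Phi V * ftr (Phi V))))\<^sup>2)"
      unfolding TX_def using vol_pos by (intro mult_left_mono ftan_pythagoras fiso_fproj[OF U] fiso_fproj[OF V]) auto
    also have "... \<le> 4 * (\<mu>0 * r * NN)"
      using coherence_bound[OF w U rb(1) V rb(2)] by (simp add: distrib_left)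
    finally show "vol / real m * (norm (TX (E \<omega>)))\<^sup>2 \<le> R" unfolding R using m by (simp add: field_simps)
  qed
qed

text \<open>The case where \<open>F\<close> is the identity and \<open>R = vol / m\<close> is the
  squared norm of one rescaled term. With \<open>t = p * (vol / m)\<close> the tail is
  \<open>220 * t\<^sup>2 + 440 * t\<close>, below the square of \<open>30 * (t + 1)\<close>;
  multiplying by the ratio and adding the mean gives \<open>31\<close> and
  \<open>30\<close>.\<close>

lemma op_bound_prob:
  assumes m: "0 < m" and N: "1 < N" "ln N \<le> real p" and q: "31 * (real m / vol) + 30 * real p \<le> q"
  shows "Pr m {\<Omega>. \<not> op_bound \<Omega> q} \<le> vol * N powr (- 4)"
proof -
  let ?\<tau> = "30 * (real p * (vol / real m) + 1)"
  have v: "0 < vol / real m" using vol_pos m by simp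
  have n: "0 \<le> real p * (vol / real m)" using v by (intro mult_nonneg_nonneg) auto
  let ?B = "{\<Omega>. \<not> (\<forall>x\<in>VS. \<forall>y\<in>VS. \<bar>inner x (Sop \<Omega> y) - real m / vol * inner x y\<bar> \<le> ?\<tau> * (real m / vol) * norm x * norm y)}"
  have b: "Pr m ?B \<le> vol * N powr (- 4)"
  proof (rule sampling_deviation[where F = "\<lambda>x. x" and R = "vol / real m", OF _ _ _ _ m _ _ N])
    show "\<forall>\<omega>\<in>idx. vol / real m * (norm (E \<omega>))\<^sup>2 \<le> vol / real m" using orthon_norm[OF E_orthon] by simp
    show "0 < ?\<tau>" using n by simp
    have quad: "220 * t\<^sup>2 + 440 * t \<le> 900 * t\<^sup>2 + 1800 * t + 900" if "0 \<le> t" for t :: real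
      using that zero_le_power2[of t] by linarith
    have "tail p (vol / real m) 1 = 220 * (real p * (vol / real m))\<^sup>2 + 440 * (real p * (vol / real m))"
      by (simp add: tail_def power_mult_distrib power_divide)
    also have "... \<le> 900 * (real p * (vol / real m))\<^sup>2 + 1800 * (real p * (vol / real m)) + 900"
      by (rule quad[OF n])
    also have "... = ?\<tau>\<^sup>2" by (simp add: power2_eq_square algebra_simps)
    finally show "tail p (vol / real m) 1 \<le> ?\<tau>\<^sup>2" .
  qed (auto intro: module_hom_ident)
  have "{\<Omega>. \<not> op_bound \<Omega> q} \<subseteq> ?B"
  proof (rule Collect_mono, rule impI, erule contrapos_nn)
    fix \<Omega> assume g: "\<forall>x\<in>VS. \<forall>y\<in>VS. \<bar>inner x (Sop \<Omega> y) - real m / vol * inner x y\<bar> \<le> ?\<tau> * (real m / vol) * norm x * norm y"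
    show "op_bound \<Omega> q"
      unfolding op_bound_def
    proof (intro ballI)
      fix x y assume xy: "x \<in> VS" "y \<in> VS"
      have "\<bar>inner x (Sop \<Omega> y)\<bar> \<le> \<bar>inner x (Sop \<Omega> y) - real m / vol * inner x y\<bar> + real m / vol * \<bar>inner x y\<bar>"
        using abs_triangle_ineq[of "inner x (Sop \<Omega> y) - real m / vol * inner x y" "real m / vol * inner x y"] vol_pos
        by (simp add: abs_mult)
      also have "... \<le> ?\<tau> * (real m / vol) * norm x * norm y + real m / vol * (norm x * norm y)"
        using g xy Cauchy_Schwarz_ineq2[of x y] vol_pos by (intro add_mono mult_left_mono) auto
      also have "... = (31 * (real m / vol) + 30 * real p) * (norm x * norm y)"
        using vol_pos m by (simp add: field_simps)
      also have "... \<le> q * (norm x * norm y)" using q by (intro mult_right_mono) auto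
      finally show "\<bar>inner x (Sop \<Omega> y)\<bar> \<le> q * norm x * norm y" by (simp add: mult.assoc)
    qed
  qed
  then have "Pr m {\<Omega>. \<not> op_bound \<Omega> q} \<le> Pr m ?B"
    by (rule measure_pmf.finite_measure_mono) simp
  then show ?thesis using b by (rule order_trans)
qed

end

section \<open>Deviation at the starting point\<close>

context tensor_space
begin

lemma tnorm_inf_ge:
  assumes X: "X \<in> TT" and "\<omega> \<in> idx"
  shows "\<bar>inner (E \<omega>) (Phi X)\<bar> \<le> tnorm_inf X"
proof -
  obtain i j k where w: "\<omega> = (i, j, k)" "i < n1" "j < n2" "k < n3" using assms(2) by (auto simp: index_set_def)
  have "inner (E \<omega>) (Phi X) = X $ k $$ (i, j)"
    unfolding E_def tinner_Phi[OF pos(3) basis_tensor_in[OF pos(3)] X, symmetric] w(1)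
    by (rule tinner_basis[OF pos(3) X w(2-4)])
  moreover have "\<bar>X $ k $$ (i, j)\<bar> \<le> tnorm_inf X"
  proof -
    have d: "dim1 X = n1" "dim2 X = n2" "dim3 X = n3" using tensorsD[OF X] pos by auto
    have "{\<bar>X $ k $$ (i, j)\<bar> | i j k. i < n1 \<and> j < n2 \<and> k < n3} = (\<lambda>(i, j, k). \<bar>X $ k $$ (i, j)\<bar>) ` idx"
      by (force simp: index_set_def)
    then have "finite {\<bar>X $ k $$ (i, j)\<bar> | i j k. i < n1 \<and> j < n2 \<and> k < n3}" using idx(1) by simp
    then show ?thesis unfolding tnorm_inf_def d by (rule Max_ge) (use w in auto)
  qed
  ultimately show ?thesis by simp
qed

lemma sum_idx_fst: "(\<Sum>\<omega>\<in>idx. f (fst \<omega>)) = real n2 * real n3 * (\<Sum>i<n1. f i)"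
  "(\<Sum>\<omega>\<in>idx. f (fst (snd \<omega>))) = real n1 * real n3 * (\<Sum>j<n2. f j)" for f :: "nat \<Rightarrow> real"
proof -
  have "(\<Sum>\<omega>\<in>idx. f (fst \<omega>)) = (\<Sum>i<n1. \<Sum>q\<in>{..<n2} \<times> {..<n3}. f i)"
    unfolding index_set_def sum.cartesian_product by (rule sum.cong) auto
  then show "(\<Sum>\<omega>\<in>idx. f (fst \<omega>)) = real n2 * real n3 * (\<Sum>i<n1. f i)" by (simp add: sum_distrib_left card_cartesian_product)
  have "(\<Sum>\<omega>\<in>idx. f (fst (snd \<omega>))) = (\<Sum>i<n1. \<Sum>q\<in>{..<n2} \<times> {..<n3}. f (fst q))"
    unfolding index_set_def sum.cartesian_product by (rule sum.cong) auto
  also have "... = real n1 * (\<Sum>j<n2. \<Sum>c<n3. f j)"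
  proof -
    have c: "(\<Sum>q\<in>{..<n2} \<times> {..<n3}. f (fst q)) = (\<Sum>j<n2. \<Sum>c<n3. f j)"
      unfolding sum.cartesian_product by (rule sum.cong) auto
    show ?thesis unfolding c by simp
  qed
  finally show "(\<Sum>\<omega>\<in>idx. f (fst (snd \<omega>))) = real n1 * real n3 * (\<Sum>j<n2. f j)" by (simp add: sum_distrib_left mult_ac)
qed

text \<open>In slice \<open>k\<close> a sample contributes a multiple \<open>w \<omega>\<close> of a
  matrix unit. As the slice is rectangular, pairs of a row vector and a column vector are used,
  whence the dimension \<open>n1 + n2\<close>. \<open>h\<close> bounds \<open>w\<close>; for fixed
  row or column the two free indices of the sum range over at most \<open>NN\<close> values, which
  gives \<open>K\<close>.\<close>

lemma start_slice_prob:
  fixes X :: tensor and \<tau> :: real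
  assumes X: "X \<in> TT" and k: "k < n3" and m: "0 < m"
    and \<tau>: "\<tau> > 0" and N: "1 < N" "ln N \<le> real p"
    and h: "h = tnorm_inf X * sqrt (2 / real n3)" and R: "R = 2 * (vol / real m) * h" and K: "K = 2 * h * (real (max n1 n2) * real n3)"
    and small: "tail p R K \<le> \<tau>\<^sup>2"
  shows "Pr m
      {\<Omega>. \<not> fop_le (emb k (hat ((vol / real m) \<cdot>\<^sub>t sampling_op \<Omega> X) $ k) - emb k (hat X $ k)) \<tau>}
    \<le> real (n1 + n2) * N powr (- 4)"
proof -
  define a where "a = vol / real m"
  have a: "0 < a" "real m / vol = 1 / a" unfolding a_def using vol_pos m by auto
  define z :: "nat \<times> nat" where "z = (0, 0)"
  define w where "w \<omega> = inner (E \<omega>) (Phi X) * dct n3 $$ (k, snd (snd \<omega>))" for \<omega>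
  have h0: "0 \<le> h"
  proof -
    have "(0, 0, 0) \<in> idx" using pos by (simp add: index_set_def)
    from tnorm_inf_ge[OF X this] show ?thesis unfolding h by (intro mult_nonneg_nonneg) auto
  qed
  have K0: "0 \<le> K" using h0 by (simp add: K)
  have wh: "\<bar>w \<omega>\<bar> \<le> h" if "\<omega> \<in> idx" for \<omega>
    unfolding w_def h abs_mult
    by (intro mult_mono tnorm_inf_ge[OF X that] dct_abs k) (use that in \<open>auto simp: index_set_def intro: order_trans[OF _ tnorm_inf_ge[OF X that]]\<close>)
  \<comment> \<open>The square root splits the weight between both components and the sign goes to
    the second one. The product of the two off-diagonal tests is then \<open>a * w \<omega>\<close>
    times an entry of each vector.\<close>
  define g where "g \<omega> = (sqrt (a * \<bar>w \<omega>\<bar>) *\<^sub>R fE (k, fst \<omega>) z, (sgn (w \<omega>) * sqrt (a * \<bar>w \<omega>\<bar>)) *\<^sub>R fE (k, fst (snd \<omega>)) z)" for \<omega> :: index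
  define e where "e = case_sum (\<lambda>i. (fE (k, i) z, 0)) (\<lambda>j. (0 :: bmat, fE (k, j) z))"
  define A where "A = {..<n1} <+> {..<n2}"
  have o: "orthon (\<lambda>i. fE (k, i) z) {..<n}" for n unfolding orthon_def by simp
  have gi: "inner (g \<omega>) (x, y) = sqrt (a * \<bar>w \<omega>\<bar>) * (ent x (k, fst \<omega>) z + sgn (w \<omega>) * ent y (k, fst (snd \<omega>)) z)" for \<omega> x y
    unfolding g_def by (simp add: inner_prod_def distrib_left mult_ac)
  interpret gram_sampling idx g e A m R K
  proof
    show "finite idx" "idx \<noteq> {}" by (fact idx)+
    show "orthon e A" unfolding e_def A_def by (rule orthon_prod[OF o o])
    fix \<omega> assume wI: "\<omega> \<in> idx"
    then have "fst \<omega> < n1" "fst (snd \<omega>) < n2" by (auto simp: index_set_def)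
    then show "g \<omega> \<in> span (e ` A)" unfolding g_def e_def A_def
      by (intro span_prod span_scale span_base imageI) auto
    have "(norm (g \<omega>))\<^sup>2 \<le> a * \<bar>w \<omega>\<bar> + a * \<bar>w \<omega>\<bar>"
      unfolding g_def norm_Pair using a(1) by (auto simp: power_mult_distrib abs_mult sgn_real_def)
    also have "... \<le> R" unfolding R a_def[symmetric] using wh[OF wI] a(1) by simp
    finally show "(norm (g \<omega>))\<^sup>2 \<le> R" .
  next
    fix xy :: "bmat \<times> bmat"
    obtain x y where xy: "xy = (x, y)" by (cases xy)
    have b: "(\<Sum>i<n. (ent v (k, i) z)\<^sup>2) \<le> (norm v)\<^sup>2" for n v
      using bessel[OF o, where x = v] by (simp add: inner_commute)
    have "(\<Sum>\<omega>\<in>idx. (inner (g \<omega>) xy)\<^sup>2) \<le> (\<Sum>\<omega>\<in>idx. 2 * a * h * ((ent x (k, fst \<omega>) z)\<^sup>2 + (ent y (k, fst (snd \<omega>)) z)\<^sup>2))"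
    proof (rule sum_mono)
      fix \<omega> assume wI: "\<omega> \<in> idx"
      let ?u = "ent x (k, fst \<omega>) z" and ?v = "ent y (k, fst (snd \<omega>)) z"
      have "(?u + sgn (w \<omega>) * ?v)\<^sup>2 \<le> 2 * (?u\<^sup>2 + ?v\<^sup>2)"
        using zero_le_power2[of "?u - ?v"] zero_le_power2[of "?u + ?v"]
        by (simp add: sgn_real_def power2_sum power2_diff)
      then have "(a * \<bar>w \<omega>\<bar>) * (?u + sgn (w \<omega>) * ?v)\<^sup>2 \<le> (a * h) * (2 * (?u\<^sup>2 + ?v\<^sup>2))"
        using wh[OF wI] a(1) h0 by (intro mult_mono) auto
      then show "(inner (g \<omega>) xy)\<^sup>2 \<le> 2 * a * h * (?u\<^sup>2 + ?v\<^sup>2)"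
        unfolding xy gi using a(1) by (simp add: power_mult_distrib mult_ac)
    qed
    also have "... = 2 * a * h * (real n2 * real n3 * (\<Sum>i<n1. (ent x (k, i) z)\<^sup>2) + real n1 * real n3 * (\<Sum>j<n2. (ent y (k, j) z)\<^sup>2))"
      unfolding sum_distrib_left[symmetric] sum.distrib sum_idx_fst(1)[of "\<lambda>i. (ent x (k, i) z)\<^sup>2"] sum_idx_fst(2)[of "\<lambda>j. (ent y (k, j) z)\<^sup>2"] ..
    also have "... \<le> 2 * a * h * ((real (max n1 n2) * real n3) * (norm x)\<^sup>2 + (real (max n1 n2) * real n3) * (norm y)\<^sup>2)"
      using a(1) h0 by (intro mult_left_mono add_mono mult_mono mult_right_mono b sum_nonneg) auto
    also have "... = a * (K * (norm xy)\<^sup>2)" unfolding K xy norm_Pair by (simp add: algebra_simps)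
    finally have s: "(\<Sum>\<omega>\<in>idx. (inner (g \<omega>) xy)\<^sup>2) \<le> a * (K * (norm xy)\<^sup>2)" .
    show "real m / real (card idx) * (\<Sum>\<omega>\<in>idx. (inner (g \<omega>) xy)\<^sup>2) \<le> K * (norm xy)\<^sup>2"
      unfolding idx(3) a(2) using mult_left_mono[OF s, of "1 / a"] a(1) by simp
  qed
  let ?W = "\<lambda>\<Omega>. (vol / real m) \<cdot>\<^sub>t sampling_op \<Omega> X"
  have "\<Omega> \<in> bad \<tau>" if \<Omega>: "set \<Omega> \<subseteq> idx" and nf: "\<not> fop_le (emb k (hat (?W \<Omega>) $ k) - emb k (hat X $ k)) \<tau>" for \<Omega>
  proof (rule ccontr)
    assume nb: "\<Omega> \<notin> bad \<tau>"
    note sX = sampling_Phi(1)[OF pos(3) X, of \<Omega>]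
    note WX = tensor_ops(3)[OF sX sX, of a]
    define I1 where "I1 = fId ({k} \<times> {..<n1})"
    define D where "D = a *\<^sub>R Sop \<Omega> (Phi X) - Phi X"
    have B: "emb k (hat (?W \<Omega>) $ k) - emb k (hat X $ k) = I1 * D"
      unfolding Phi_slice(1)[OF pos(3) WX k, folded a_def, symmetric] a_def[symmetric] Phi_slice(1)[OF pos(3) X k, symmetric] I1_def D_def
        Phi_ops(3)[OF pos(3) sX sX] Sop_Phi[OF X, symmetric]
      by (simp only: right_diff_distrib[symmetric])
    have fI: "fproj (fId ({k} \<times> {..<n}))" for n :: nat by (rule fproj_fId) simp
    have "fop_le (I1 * D) \<tau>"
    proof (rule fop_leI_columns)
      show "0 \<le> \<tau>" using \<tau> by simp
      fix x :: "bmat" assume xz: "x * fE z z = x"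
      define y where "y = I1 * D * x"
      have yz: "y * fE z z = y" unfolding y_def by (simp add: xz mult.assoc)
      \<comment> \<open>The rank-one test matrix \<open>y * ftr x\<close> in block \<open>k\<close>.
        With \<open>y = I1 * D * x\<close> its inner product with \<open>D\<close> is the square of
        \<open>norm y\<close>.\<close>
      define F where "F = I1 * (y * ftr x)"
      have col: "ent v p q \<noteq> 0 \<Longrightarrow> q = z" if "v * fE z z = v" for v p q
        using ent_times_fE[of v z z p q] that by (auto split: if_splits)
      have entF: "ent F (l, i) (l, j) = (if l = k \<and> i < n1 then ent y (k, i) z * ent x (k, j) z else 0)" for l i j
      proof -
        have "ent (y * ftr x) (l, i) (l, j) = (\<Sum>q\<in>{z}. ent y (l, i) q * ent (ftr x) q (l, j))"
          by (rule ent_times) (use col[OF yz] in auto)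
        then show ?thesis unfolding F_def I1_def by (auto simp: fId_times)
      qed
      have EF: "inner (E \<omega>) F = dct n3 $$ (k, snd (snd \<omega>)) * (ent y (k, fst \<omega>) z * ent x (k, fst (snd \<omega>)) z)" if "\<omega> \<in> idx" for \<omega>
      proof -
        have "fst \<omega> < n1" using that by (auto simp: index_set_def)
        then have "inner (E \<omega>) F = (\<Sum>l<n3. if l = k then dct n3 $$ (k, snd (snd \<omega>)) * (ent y (k, fst \<omega>) z * ent x (k, fst (snd \<omega>)) z) else 0)"
          unfolding E_def Phi_basis_ebas[OF pos(3) that] ebas_def inner_sum_left by (intro sum.cong) (auto simp: entF)
        then show ?thesis using k by simp
      qed
      let ?x1 = "(fId ({k} \<times> {..<n1}) * y, 0 :: bmat)" and ?x2 = "(0 :: bmat, fId ({k} \<times> {..<n2}) * x)"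
      have col_span: "fId ({k} \<times> {..<n}) * v \<in> span ((\<lambda>i. fE (k, i) z) ` {..<n})" if v: "v * fE z z = v" for v n
      proof -
        have "fId ({k} \<times> {..<n}) * v = (\<Sum>i<n. ent v (k, i) z *\<^sub>R fE (k, i) z)"
        proof (rule fmat_eqI)
          fix p q :: "nat \<times> nat"
          obtain l i where p: "p = (l, i)" by (cases p)
          have "ent (\<Sum>i<n. ent v (k, i) z *\<^sub>R fE (k, i) z) p q = (\<Sum>i'<n. if i' = i then if l = k \<and> q = z then ent v (k, i) z else 0 else 0)"
            unfolding ent_sum p by (rule sum.cong) auto
          then show "ent (fId ({k} \<times> {..<n}) * v) p q = ent (\<Sum>i<n. ent v (k, i) z *\<^sub>R fE (k, i) z) p q"
            using col[OF v, of p q] by (auto simp: p fId_times)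
        qed
        then show ?thesis by (simp only:) (intro span_sum span_scale span_base imageI)
      qed
      have sp: "?x1 \<in> span (e ` A)" "?x2 \<in> span (e ` A)"
        unfolding e_def A_def by (intro span_prod col_span xz yz span_zero)+
      have gxy: "inner (g \<omega>) ?x1 * inner (g \<omega>) ?x2 = a * (inner (E \<omega>) (Phi X) * inner (E \<omega>) F)" if wI: "\<omega> \<in> idx" for \<omega>
      proof -
        have "fst \<omega> < n1" "fst (snd \<omega>) < n2" using wI by (auto simp: index_set_def)
        then have "inner (g \<omega>) ?x1 * inner (g \<omega>) ?x2 = (sqrt (a * \<bar>w \<omega>\<bar>))\<^sup>2 * sgn (w \<omega>) * (ent y (k, fst \<omega>) z * ent x (k, fst (snd \<omega>)) z)"
          unfolding gi by (simp add: fId_times power2_eq_square del: real_sqrt_mult_self real_sqrt_mult)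
        also have "(sqrt (a * \<bar>w \<omega>\<bar>))\<^sup>2 * sgn (w \<omega>) = a * w \<omega>" using a(1) by (simp add: abs_mult_sgn mult.assoc)
        finally show ?thesis unfolding EF[OF wI] w_def by (simp add: mult_ac)
      qed
      have s2: "real m / real (card idx) * (\<Sum>\<omega>\<in>idx. inner (g \<omega>) ?x1 * inner (g \<omega>) ?x2) = inner (Phi X) F"
        unfolding idx(3) a(2) using a(1) by (simp add: gxy sum_distrib_left[symmetric] E_parseval[OF VS_I[OF X]])
      have "sum_list (map (\<lambda>\<omega>. inner (g \<omega>) ?x1 * inner (g \<omega>) ?x2) \<Omega>) = sum_list (map (\<lambda>\<omega>. a * (inner (E \<omega>) (Phi X) * inner (E \<omega>) F)) \<Omega>)"
        using \<Omega> gxy by (intro arg_cong[where f = sum_list] map_cong) auto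
      also have "... = a * inner (Sop \<Omega> (Phi X)) F" unfolding Sop_inner by (rule sum_list_const_mult)
      finally have s1: "sum_list (map (\<lambda>\<omega>. inner (g \<omega>) ?x1 * inner (g \<omega>) ?x2) \<Omega>) = a * inner (Sop \<Omega> (Phi X)) F" .
      have "\<bar>inner D F\<bar> = \<bar>sum_list (map (\<lambda>\<omega>. inner (g \<omega>) ?x1 * inner (g \<omega>) ?x2) \<Omega>)
          - real m / real (card idx) * (\<Sum>\<omega>\<in>idx. inner (g \<omega>) ?x1 * inner (g \<omega>) ?x2)\<bar>"
        unfolding s1 s2 D_def by (simp add: inner_diff_left)
      also have "... \<le> \<tau> * norm ?x1 * norm ?x2"
      proof (rule ccontr)
        assume "\<not> ?thesis"
        then have "\<Omega> \<in> bad \<tau>" unfolding bad_def by (intro CollectI bexI[OF _ sp(1)] bexI[OF _ sp(2)]) simp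
        then show False using nb by simp
      qed
      also have "... \<le> \<tau> * norm y * norm x"
        using \<tau> fproj_contract(1)[OF fI[of n1], of y] fproj_contract(1)[OF fI[of n2], of x]
        by (intro mult_mono) (auto simp: norm_Pair)
      finally have "\<bar>inner D F\<bar> \<le> \<tau> * norm y * norm x" .
      moreover have "inner D F = norm y * norm y"
      proof -
        have "inner D F = inner (I1 * D) (y * ftr x)" unfolding F_def inner_mult_left by (simp add: I1_def)
        also have "... = inner y y" unfolding y_def by (rule inner_mult_right[symmetric])
        finally show ?thesis by (simp add: power2_norm_eq_inner flip: power2_eq_square)
      qed
      ultimately have "norm y * norm y \<le> norm y * (\<tau> * norm x)" by (simp add: mult_ac)
      then show "norm (I1 * D * x) \<le> \<tau> * norm x"
        unfolding y_def[symmetric] using mult_left_le_imp_le[of "norm y" "norm y" "\<tau> * norm x"] \<tau> by (cases "y = 0") simp_all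
    qed
    then show False using nf unfolding B by blast
  qed
  then have "Pr m {\<Omega>. \<not> fop_le (emb k (hat (?W \<Omega>) $ k) - emb k (hat X $ k)) \<tau>}
      \<le> Pr m (bad \<tau>)"
    by (intro measure_pmf.finite_measure_mono_AE) (auto simp: AE_measure_pmf_iff uniform_samples_def set_replicate_pmf idx)
  also have "... \<le> real (card A) * N powr (- 4)"
    unfolding uniform_samples_def by (rule gram_prob[OF \<tau> K0 N small])
  also have "card A = n1 + n2" unfolding A_def by (simp add: card_Plus)
  finally show ?thesis .
qed

end

section \<open>Deviation in a resampled step\<close>

context incoherent_tensor
begin

text \<open>The error \<open>e\<close> itself has small entries: its part in the column space of
  \<open>Zh\<close> is controlled by the incoherence of \<open>Zh\<close>, and the rest equals
  \<open>P * Phi X - Phi X\<close>, whose row space is that of \<open>X\<close>. The levels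
  \<open>2 * b1\<close> and \<open>b2\<close> give \<open>8 + 2\<close>, doubled by squaring a sum
  of two terms.\<close>

lemma difference_coherence:
  assumes Zh: "Zh \<in> TT"
    and rU: "\<And>i. i < n1 \<Longrightarrow> norm (fId (slab n3 i) * PU Zh) \<le> 2 * b1" and rV: "\<And>j. j < n2 \<Longrightarrow> norm (fId (slab n3 j) * PV Zh) \<le> 2 * b2"
    and w: "\<omega> \<in> idx"
  defines "e \<equiv> Phi Zh - Phi X"
  shows "vol * (norm (Tan Zh (E \<omega>)))\<^sup>2 \<le> 16 * (\<mu>0 * r * NN)"
    "vol * (inner (E \<omega>) e)\<^sup>2 \<le> 20 * (\<mu>0 * r * NN) * (norm e)\<^sup>2"
proof -
  let ?X = "\<mu>0 * r * NN"
  note ZS = fsvd_skinny(1)[OF pos(3) Zh]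
  note U' = fsvdD(1)[OF ZS] and V' = fsvdD(2)[OF ZS] and V0 = fsvdD(2)[OF XS]
  define P where "P = PU Zh * ftr (PU Zh)"
  define Q where "Q = Phi V * ftr (Phi V)"
  have P: "fproj P" and Q: "fproj Q" unfolding P_def Q_def by (intro fiso_fproj[OF U'] fiso_fproj[OF V0])+
  have two: "(0::real) \<le> 2" "(0::real) \<le> 1" by simp_all
  have rb: "j < n2 \<Longrightarrow> norm (fId (slab n3 j) * Phi V) \<le> 1 * b2" for j using row_bounds by simp
  note c = coherence_bound[OF w U' rU V' rV two(1) two(1)]
  note c0 = coherence_bound[OF w U' rU V0 rb two]
  have "vol * (norm (Tan Zh (E \<omega>)))\<^sup>2 \<le> vol * ((norm (PU Zh * ftr (PU Zh) * E \<omega>))\<^sup>2 + (norm (E \<omega> * (PV Zh * ftr (PV Zh))))\<^sup>2)"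
    unfolding Tan_def using vol_pos by (intro mult_left_mono ftan_pythagoras fiso_fproj[OF U'] fiso_fproj[OF V']) auto
  then show "vol * (norm (Tan Zh (E \<omega>)))\<^sup>2 \<le> 16 * ?X" using c by (simp add: distrib_left)
  have PZ: "P * Phi Zh = Phi Zh" unfolding P_def by (rule fsvd_proj(1)[OF ZS])
  have XQ: "Phi X * Q = Phi X" unfolding Q_def by (rule fsvd_proj(2)[OF XS])
  have eP: "e - P * e = P * Phi X - Phi X" unfolding e_def by (simp add: right_diff_distrib PZ)
  have eQ: "(e - P * e) * Q = e - P * e" unfolding eP by (simp add: left_diff_distrib mult.assoc XQ)
  have "inner (E \<omega>) e = inner (E \<omega>) (P * e) + inner (E \<omega>) ((e - P * e) * Q)"
    unfolding eQ by (simp add: inner_diff_right)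
  also have "inner (E \<omega>) (P * e) = inner (P * E \<omega>) e"
    using P inner_mult_left[of P "E \<omega>" e] by (simp add: fproj_def)
  also have "inner (E \<omega>) ((e - P * e) * Q) = inner (E \<omega> * Q) (e - P * e)"
    using Q inner_mult_right[of "E \<omega>" Q "e - P * e"] by (simp add: fproj_def)
  finally have s: "inner (E \<omega>) e = inner (P * E \<omega>) e + inner (E \<omega> * Q) (e - P * e)" .
  have "\<bar>inner (E \<omega>) e\<bar> \<le> norm (P * E \<omega>) * norm e + norm (E \<omega> * Q) * norm (e - P * e)"
    unfolding s by (intro order_trans[OF abs_triangle_ineq] add_mono Cauchy_Schwarz_ineq2)
  also have "... \<le> norm (P * E \<omega>) * norm e + norm (E \<omega> * Q) * norm e"
    by (intro add_mono mult_left_mono fproj_contract(2)[OF P]) auto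
  finally have "\<bar>inner (E \<omega>) e\<bar> \<le> (norm (P * E \<omega>) + norm (E \<omega> * Q)) * norm e" by (simp add: distrib_right)
  then have "(inner (E \<omega>) e)\<^sup>2 \<le> ((norm (P * E \<omega>) + norm (E \<omega> * Q)) * norm e)\<^sup>2"
    by (intro abs_le_square_iff[THEN iffD1]) simp
  also have "... \<le> (2 * ((norm (P * E \<omega>))\<^sup>2 + (norm (E \<omega> * Q))\<^sup>2)) * (norm e)\<^sup>2"
    unfolding power_mult_distrib using zero_le_power2[of "norm (P * E \<omega>) - norm (E \<omega> * Q)"]
    by (intro mult_right_mono) (simp_all add: power2_sum power2_diff)
  finally have "vol * (inner (E \<omega>) e)\<^sup>2 \<le> vol * ((2 * ((norm (P * E \<omega>))\<^sup>2 + (norm (E \<omega> * Q))\<^sup>2)) * (norm e)\<^sup>2)"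
    using vol_pos by (intro mult_left_mono) auto
  also have "... = (2 * (vol * (norm (P * E \<omega>))\<^sup>2 + vol * (norm (E \<omega> * Q))\<^sup>2)) * (norm e)\<^sup>2" by (simp add: algebra_simps)
  also have "... \<le> 20 * ?X * (norm e)\<^sup>2"
    using c0 unfolding P_def Q_def by (intro mult_right_mono) auto
  finally show "vol * (inner (E \<omega>) e)\<^sup>2 \<le> 20 * ?X * (norm e)\<^sup>2" .
qed

text \<open>The sampling error pairs the fixed vector \<open>e\<close> with every tangent vector.
  The fixed direction is represented by one extra real coordinate; squared norms \<open>16\<close>
  and \<open>20\<close> add up to \<open>36\<close>, and combining the two coordinates doubles the
  mean bound to \<open>2\<close>.\<close>

lemma step_prob:
  assumes Zh: "Zh \<in> TT"
    and rU: "\<And>i. i < n1 \<Longrightarrow> norm (fId (slab n3 i) * PU Zh) \<le> 2 * b1" and rV: "\<And>j. j < n2 \<Longrightarrow> norm (fId (slab n3 j) * PV Zh) \<le> 2 * b2"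
    and m: "0 < m" and N: "1 < N" "ln N \<le> real p"
    and R: "R = 36 * (\<mu>0 * r * NN) / real m" and small: "tail p R 2 \<le> (1 / (40 * \<kappa>))\<^sup>2"
  shows "Pr m {\<Omega>. \<not> good_step (vol / real m) \<Omega> Zh} \<le> 2 * vol * N powr (- 4)"
proof -
  define a where "a = vol / real m"
  have a: "0 < a" "real m / vol = 1 / a" unfolding a_def using vol_pos m by auto
  define e where "e = Phi Zh - Phi X"
  have eV: "e \<in> VS" unfolding e_def by (intro VS_closed VS_I Zh X)
  define \<tau> where "\<tau> = 1 / (40 * \<kappa>)"
  have \<tau>: "0 < \<tau>" unfolding \<tau>_def using cond(6) by simp
  have gs: "good_step a \<Omega> Zh \<longleftrightarrow> (\<forall>x\<in>VS. \<bar>inner (Tan Zh x) (e - a *\<^sub>R Sop \<Omega> e)\<bar> \<le> \<tau> * norm x * norm e)" for \<Omega>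
    unfolding good_step_def Let_def e_def \<tau>_def ..
  show ?thesis
  proof (cases "e = 0")
    case True
    then have "good_step a \<Omega> Zh" for \<Omega> unfolding gs by (simp add: linear_0[OF Sop_linear])
    then show ?thesis using vol_pos by (simp add: a_def)
  next
    case False
    note T = Tan[OF Zh]
    \<comment> \<open>Testing with \<open>(x, 0)\<close> and \<open>(0, 1)\<close> isolates the
      product of the tangential coefficient and the normalized entry of \<open>e\<close>.\<close>
    define g where "g \<omega> = (sqrt a *\<^sub>R Tan Zh (E \<omega>), sqrt a * (inner (E \<omega>) e / norm e))" for \<omega>
    define b where "b = case_sum (\<lambda>\<omega>. (E \<omega>, 0::real)) (\<lambda>u::unit. (0 :: bmat, 1::real))"
    define A where "A = idx <+> {()}"
    have o1: "orthon (\<lambda>u::unit. 1::real) {()}" unfolding orthon_def by simp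
    have gi: "inner (g \<omega>) (x, t) = sqrt a * (inner (E \<omega>) (Tan Zh x) + inner (E \<omega>) e / norm e * t)" for \<omega> x t
      unfolding g_def by (simp add: inner_prod_def T(3) distrib_left mult_ac)
    interpret gram_sampling idx g b A m R 2
    proof
      show "finite idx" "idx \<noteq> {}" by (fact idx)+
      show "orthon b A" unfolding b_def A_def by (rule orthon_prod[OF E_orthon o1])
      fix \<omega> assume w: "\<omega> \<in> idx"
      have "(t::real) \<in> span ((\<lambda>u::unit. 1) ` {()})" for t
        using span_scale[OF span_base[of "1::real" "{1}"], of t] by simp
      then show "g \<omega> \<in> span (b ` A)" unfolding g_def b_def A_def VS_span[symmetric]
        by (intro span_prod) (auto simp: VS_span[symmetric] intro!: VS_closed T(6) E_VS w)
      note c = difference_coherence[OF Zh rU rV w, folded e_def]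
      have "vol * (inner (E \<omega>) e / norm e)\<^sup>2 \<le> 20 * (\<mu>0 * r * NN)"
        using c(2) False by (simp add: power_divide pos_divide_le_eq)
      then have "vol * ((norm (Tan Zh (E \<omega>)))\<^sup>2 + (inner (E \<omega>) e / norm e)\<^sup>2) \<le> 36 * (\<mu>0 * r * NN)"
        using c(1) unfolding distrib_left by linarith
      then have "a * ((norm (Tan Zh (E \<omega>)))\<^sup>2 + (inner (E \<omega>) e / norm e)\<^sup>2) \<le> R"
        unfolding R a_def using m by (simp add: divide_right_mono)
      moreover have "(norm (sqrt a *\<^sub>R v, sqrt a * t))\<^sup>2 = a * ((norm v)\<^sup>2 + t\<^sup>2)" for v :: "bmat" and t :: real
        using a(1) by (simp add: norm_Pair power_mult_distrib distrib_left)
      ultimately show "(norm (g \<omega>))\<^sup>2 \<le> R" unfolding g_def by (simp only:)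
    next
      fix xt :: "bmat \<times> real"
      obtain x t where xt: "xt = (x, t)" by (cases xt)
      have "(\<Sum>\<omega>\<in>idx. (inner (g \<omega>) xt)\<^sup>2) \<le> (\<Sum>\<omega>\<in>idx. a * (2 * ((inner (E \<omega>) (Tan Zh x))\<^sup>2 + (t / norm e)\<^sup>2 * (inner (E \<omega>) e)\<^sup>2)))"
      proof (rule sum_mono)
        fix \<omega>
        let ?u = "inner (E \<omega>) (Tan Zh x)" and ?v = "inner (E \<omega>) e / norm e * t"
        have "(?u + ?v)\<^sup>2 \<le> 2 * (?u\<^sup>2 + ?v\<^sup>2)" using zero_le_power2[of "?u - ?v"] by (simp add: power2_sum power2_diff)
        then have "a * (?u + ?v)\<^sup>2 \<le> a * (2 * (?u\<^sup>2 + ?v\<^sup>2))" using a(1) by (intro mult_left_mono) auto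
        moreover have "?v\<^sup>2 = (t / norm e)\<^sup>2 * (inner (E \<omega>) e)\<^sup>2" by (simp add: power_mult_distrib power_divide)
        ultimately show "(inner (g \<omega>) xt)\<^sup>2 \<le> a * (2 * (?u\<^sup>2 + (t / norm e)\<^sup>2 * (inner (E \<omega>) e)\<^sup>2))"
          unfolding xt gi using a(1) by (simp add: power_mult_distrib)
      qed
      also have "... = a * (2 * ((\<Sum>\<omega>\<in>idx. (inner (E \<omega>) (Tan Zh x))\<^sup>2) + (t / norm e)\<^sup>2 * (\<Sum>\<omega>\<in>idx. (inner (E \<omega>) e)\<^sup>2)))"
        by (simp only: sum_distrib_left[symmetric] sum.distrib)
      also have "... \<le> a * (2 * ((norm x)\<^sup>2 + (t / norm e)\<^sup>2 * (norm e)\<^sup>2))"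
      proof (intro mult_left_mono add_mono)
        show "(\<Sum>\<omega>\<in>idx. (inner (E \<omega>) (Tan Zh x))\<^sup>2) \<le> (norm x)\<^sup>2"
          by (rule order_trans[OF bessel[OF E_orthon] power_mono[OF T(4)]]) simp
        show "(\<Sum>\<omega>\<in>idx. (inner (E \<omega>) e)\<^sup>2) \<le> (norm e)\<^sup>2" by (rule bessel[OF E_orthon])
      qed (use a in simp_all)
      also have "... = a * (2 * (norm xt)\<^sup>2)" using False by (simp add: xt norm_Pair power_divide)
      finally have s: "(\<Sum>\<omega>\<in>idx. (inner (g \<omega>) xt)\<^sup>2) \<le> a * (2 * (norm xt)\<^sup>2)" .
      show "real m / real (card idx) * (\<Sum>\<omega>\<in>idx. (inner (g \<omega>) xt)\<^sup>2) \<le> 2 * (norm xt)\<^sup>2"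
        unfolding idx(3) a(2) using mult_left_mono[OF s, of "1 / a"] a(1) by simp
    qed
    have "{\<Omega>. \<not> good_step a \<Omega> Zh} \<subseteq> bad \<tau>"
    proof
      fix \<Omega> assume "\<Omega> \<in> {\<Omega>. \<not> good_step a \<Omega> Zh}"
      then obtain x where x: "x \<in> VS" and gt: "\<tau> * norm x * norm e < \<bar>inner (Tan Zh x) (e - a *\<^sub>R Sop \<Omega> e)\<bar>"
        unfolding gs by force
      let ?x = "(x, 0::real)" and ?y = "(0 :: bmat, 1::real)"
      have gxy: "inner (g \<omega>) ?x * inner (g \<omega>) ?y = (a / norm e) * (inner (E \<omega>) e * inner (E \<omega>) (Tan Zh x))" for \<omega>
        unfolding gi using a(1) by (simp add: linear_0[OF T(1)] mult_ac)
      have s1: "sum_list (map (\<lambda>\<omega>. inner (g \<omega>) ?x * inner (g \<omega>) ?y) \<Omega>) = (a / norm e) * inner (Sop \<Omega> e) (Tan Zh x)"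
        unfolding gxy Sop_inner by (rule sum_list_const_mult)
      have s2: "real m / real (card idx) * (\<Sum>\<omega>\<in>idx. inner (g \<omega>) ?x * inner (g \<omega>) ?y) = inner e (Tan Zh x) / norm e"
        unfolding gxy sum_distrib_left[symmetric] E_parseval[OF eV] idx(3) a(2) using a(1) by simp
      have sp: "?x \<in> span (b ` A)" "?y \<in> span (b ` A)"
        unfolding b_def A_def by (intro span_prod; use x VS_span in \<open>auto intro: span_zero span_base\<close>)+
      have "inner (Tan Zh x) (e - a *\<^sub>R Sop \<Omega> e) = - (norm e) * ((a / norm e) * inner (Sop \<Omega> e) (Tan Zh x) - inner e (Tan Zh x) / norm e)"
        using False by (simp add: inner_diff_right inner_commute[of "Tan Zh x"] right_diff_distrib)
      then have "\<tau> * norm x * norm e < norm e * \<bar>(a / norm e) * inner (Sop \<Omega> e) (Tan Zh x) - inner e (Tan Zh x) / norm e\<bar>"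
        using gt by (simp only: abs_mult abs_minus_cancel abs_norm_cancel)
      then have "norm e * (\<tau> * norm x) < norm e * \<bar>(a / norm e) * inner (Sop \<Omega> e) (Tan Zh x) - inner e (Tan Zh x) / norm e\<bar>"
        by (simp only: mult_ac)
      then have "\<tau> * norm ?x * norm ?y < \<bar>sum_list (map (\<lambda>\<omega>. inner (g \<omega>) ?x * inner (g \<omega>) ?y) \<Omega>)
          - real m / real (card idx) * (\<Sum>\<omega>\<in>idx. inner (g \<omega>) ?x * inner (g \<omega>) ?y)\<bar>"
        unfolding s1 s2 using False by (simp only: mult_less_cancel_left_pos[of "norm e"] zero_less_norm_iff norm_Pair) simp
      then show "\<Omega> \<in> bad \<tau>" unfolding bad_def using sp by blast
    qed
    then have "Pr m {\<Omega>. \<not> good_step a \<Omega> Zh} \<le> Pr m (bad \<tau>)"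
      by (rule measure_pmf.finite_measure_mono) simp
    also have "... \<le> real (card A) * N powr (- 4)"
      unfolding uniform_samples_def by (rule gram_prob[OF \<tau> _ N]) (use small in \<open>simp_all add: \<tau>_def\<close>)
    also have "... \<le> 2 * vol * N powr (- 4)"
    proof (rule mult_right_mono)
      have "real (card A) = vol + 1" unfolding A_def by (simp add: card_Plus idx)
      moreover have "1 \<le> vol" using idx by (metis Suc_leI card_gt_0_iff of_nat_1 of_nat_le_iff One_nat_def)
      ultimately show "real (card A) \<le> 2 * vol" by simp
    qed simp
    finally show ?thesis unfolding a_def .
  qed
qed

end

section \<open>Independence of the groups and recovery\<close>

lemma card_initial_Suc:
  "card (A \<inter> {..<Suc m}) = (if 0 \<in> A then 1 else 0) + card ({j. Suc j \<in> A} \<inter> {..<m})"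
proof -
  have "A \<inter> {..<Suc m} = (if 0 \<in> A then {0} else {}) \<union> Suc ` ({j. Suc j \<in> A} \<inter> {..<m})"
  proof (rule Set.set_eqI)
    show "x \<in> A \<inter> {..<Suc m} \<longleftrightarrow> x \<in> (if 0 \<in> A then {0} else {}) \<union> Suc ` ({j. Suc j \<in> A} \<inter> {..<m})" for x
      by (cases x) auto
  qed
  also have "card ... = card (if 0 \<in> A then {0::nat} else {}) + card (Suc ` ({j. Suc j \<in> A} \<inter> {..<m}))"
    by (intro card_Un_disjoint) auto
  also have "card (Suc ` ({j. Suc j \<in> A} \<inter> {..<m})) = card ({j. Suc j \<in> A} \<inter> {..<m})"
    by (rule card_image) simp
  finally show ?thesis by simp
qed

text \<open>The entries at the positions in \<open>A\<close> and the remaining ones are independent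
  samples.\<close>

lemma replicate_pmf_split:
  "map_pmf (\<lambda>xs. (nths xs A, nths xs (- A))) (replicate_pmf m p) =
    pair_pmf (replicate_pmf (card (A \<inter> {..<m})) p) (replicate_pmf (card (- A \<inter> {..<m})) p)"
proof (induction m arbitrary: A)
  case 0
  then show ?case by (simp add: pair_return_pmf1)
next
  case (Suc m)
  let ?A = "{j. Suc j \<in> A}"
  let ?P = "pair_pmf (replicate_pmf (card (?A \<inter> {..<m})) p) (replicate_pmf (card (- ?A \<inter> {..<m})) p)"
  have c: "{j. Suc j \<in> - A} = - ?A" by auto
  have "map_pmf (\<lambda>xs. (nths xs A, nths xs (- A))) (replicate_pmf (Suc m) p) =
      bind_pmf p (\<lambda>x. map_pmf (\<lambda>(u, v). if 0 \<in> A then (x # u, v) else (u, x # v))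
        (map_pmf (\<lambda>xs. (nths xs ?A, nths xs (- ?A))) (replicate_pmf m p)))"
    by (cases "0 \<in> A") (simp_all add: map_pmf_def bind_assoc_pmf bind_return_pmf nths_Cons Collect_neg_eq)
  also have "... = bind_pmf p (\<lambda>x. map_pmf (\<lambda>(u, v). if 0 \<in> A then (x # u, v) else (u, x # v)) ?P)"
    unfolding Suc.IH ..
  also have "... = pair_pmf (replicate_pmf (card (A \<inter> {..<Suc m})) p) (replicate_pmf (card (- A \<inter> {..<Suc m})) p)"
  proof (cases "0 \<in> A")
    case True
    then show ?thesis unfolding card_initial_Suc c
      by (simp add: pair_pmf_def map_pmf_def bind_assoc_pmf bind_return_pmf)
  next
    case False
    have "bind_pmf p (\<lambda>x. bind_pmf (replicate_pmf (card (?A \<inter> {..<m})) p) (\<lambda>u. bind_pmf (replicate_pmf (card (- ?A \<inter> {..<m})) p) (\<lambda>v. return_pmf (u, x # v))))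
        = bind_pmf (replicate_pmf (card (?A \<inter> {..<m})) p) (\<lambda>u. bind_pmf p (\<lambda>x. bind_pmf (replicate_pmf (card (- ?A \<inter> {..<m})) p) (\<lambda>v. return_pmf (u, x # v))))"
      by (rule bind_commute_pmf)
    then show ?thesis using False unfolding card_initial_Suc c
      by (simp add: pair_pmf_def map_pmf_def bind_assoc_pmf bind_return_pmf)
  qed
  finally show ?case .
qed

lemma prob_pair_le:
  assumes "\<And>y. measure_pmf.prob p {x. P x y} \<le> \<delta>"
  shows "measure_pmf.prob (pair_pmf p q) {(x, y). P x y} \<le> \<delta>"
proof -
  have \<delta>: "0 \<le> \<delta>" using assms[of undefined] measure_nonneg[of p] by (rule order_trans[rotated])
  have "pair_pmf p q = bind_pmf q (\<lambda>y. map_pmf (\<lambda>x. (x, y)) p)"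
    unfolding pair_pmf_def map_pmf_def by (rule bind_commute_pmf)
  then have "emeasure (pair_pmf p q) {(x, y). P x y} = (\<integral>\<^sup>+ y. emeasure p {x. P x y} \<partial>q)"
    by (simp add: emeasure_bind_pmf vimage_def)
  also have "... \<le> (\<integral>\<^sup>+ y. ennreal \<delta> \<partial>q)"
    by (intro nn_integral_mono) (simp add: measure_pmf.emeasure_eq_measure assms ennreal_leI)
  also have "... = ennreal \<delta>" by (simp add: measure_pmf.emeasure_space_1)
  finally show ?thesis using \<delta> by (simp add: measure_pmf.emeasure_eq_measure)
qed

lemma prob_split_le:
  assumes "\<And>v. measure_pmf.prob (replicate_pmf (card (A \<inter> {..<m})) p) {u. P u v} \<le> \<delta>"
  shows "measure_pmf.prob (replicate_pmf m p) {xs. P (nths xs A) (nths xs (- A))} \<le> \<delta>"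
proof -
  have "measure_pmf.prob (replicate_pmf m p) {xs. P (nths xs A) (nths xs (- A))} =
      measure_pmf.prob (map_pmf (\<lambda>xs. (nths xs A, nths xs (- A))) (replicate_pmf m p)) {(x, y). P x y}"
    by (simp add: vimage_def)
  then show ?thesis unfolding replicate_pmf_split using prob_pair_le[OF assms] by simp
qed

text \<open>The positions in \<open>C\<close> are renumbered by their rank within \<open>A\<close>.
  Hence all earlier groups are functions of the complement of the current one.\<close>

lemma nths_sub:
  assumes "C \<subseteq> A"
  shows "nths xs C = nths (nths xs A) ((\<lambda>i. card {i' \<in> A. i' < i}) ` C)"
proof -
  let ?r = "\<lambda>i. card {i' \<in> A. i' < i}"
  have mono: "?r i < ?r j" if "i \<in> A" "i < j" for i j
    by (rule psubset_card_mono) (use that in auto)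
  have "{i \<in> A. \<exists>j\<in>?r ` C. ?r i = j} = C"
  proof
    show "{i \<in> A. \<exists>j\<in>?r ` C. ?r i = j} \<subseteq> C"
    proof
      fix i assume "i \<in> {i \<in> A. \<exists>j\<in>?r ` C. ?r i = j}"
      then obtain c where c: "i \<in> A" "c \<in> C" "?r i = ?r c" by auto
      then have "c \<in> A" using assms by auto
      then have "i = c" using mono[of i c] mono[of c i] c by (cases i c rule: linorder_cases) auto
      then show "i \<in> C" using c by simp
    qed
  qed (use assms in auto)
  then show ?thesis unfolding nths_nths by simp
qed

lemma init_iter_cong:
  assumes "\<forall>j\<le>l. f j = g j"
  shows "init_iter \<mu> rs mh X f l = init_iter \<mu> rs mh X g l"
  using assms by (induction l) auto

context incoherent_tensor
begin

definition start_good :: "real \<Rightarrow> index list \<Rightarrow> real \<Rightarrow> bool" where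
  "start_good a \<Omega> \<epsilon> \<longleftrightarrow> (\<forall>k<n3. fop_le (emb k (hat (a \<cdot>\<^sub>t sampling_op \<Omega> X) $ k) - emb k (hat X $ k)) \<epsilon>)"

text \<open>The weight \<open>\<kappa>\<^sup>2\<close> is that of \<open>init_step_bound\<close>:
  one factor is lost by trimming, the other is demanded by the relative accuracy of the tangent
  step.\<close>

definition near :: "real \<Rightarrow> tensor \<Rightarrow> bool" where
  "near d Z \<longleftrightarrow> Z \<in> TT \<and> rank_t Z = rs \<and> \<kappa>\<^sup>2 * norm (Phi Z - Phi X) \<le> d * \<sigma>"

lemma init_start_near:
  assumes good: "start_good (vol / mh) \<Omega> \<epsilon>" and \<epsilon>: "0 \<le> \<epsilon>" "\<kappa>\<^sup>2 * sqrt (8 * real n3 * real r) * \<epsilon> \<le> c0 * \<sigma>" and c0: "c0 \<le> 1 / 1000"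
  shows "threshold_defined rs (init_start mh X \<Omega>)" "near c0 (threshold rs (init_start mh X \<Omega>))"
proof -
  note sX = sampling_Phi(1)[OF pos(3) X, of \<Omega>]
  have W: "init_start mh X \<Omega> = (vol / mh) \<cdot>\<^sub>t sampling_op \<Omega> X" unfolding init_start_def dims vol_def ..
  have Wt: "init_start mh X \<Omega> \<in> TT" unfolding W by (rule tensor_ops(3)[OF sX sX])
  have op: "k < n3 \<Longrightarrow> fop_le (emb k (hat (init_start mh X \<Omega>) $ k) - emb k (hat X $ k)) \<epsilon>" for k
    using good unfolding start_good_def W by blast
  have "1 \<le> real n3 * real r" using mult_mono[of 1 "real n3" 1 "real r"] pos(3) rank_pos by simp
  then have "2 \<le> sqrt (8 * real n3 * real r)" by (intro real_le_rsqrt) simp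
  then have "1 * 2 * \<epsilon> \<le> \<kappa>\<^sup>2 * sqrt (8 * real n3 * real r) * \<epsilon>" using kappa2 \<epsilon>(1) by (intro mult_right_mono mult_mono) auto
  moreover have "c0 * \<sigma> \<le> 1 / 1000 * \<sigma>" using c0 cond(2) by (intro mult_right_mono) auto
  ultimately have gap: "2 * \<epsilon> < \<sigma>" using \<epsilon>(2) cond(2) by linarith
  note t = threshold_tensor[OF pos(3) X svd sX_lower Wt op gap \<epsilon>(1)]
  show "threshold_defined rs (init_start mh X \<Omega>)" by (rule t(1))
  have "\<kappa>\<^sup>2 * norm (Phi (threshold rs (init_start mh X \<Omega>)) - Phi X) \<le> \<kappa>\<^sup>2 * (sqrt (8 * real n3 * real r) * \<epsilon>)"
    by (rule mult_left_mono[OF t(5)]) auto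
  then show "near c0 (threshold rs (init_start mh X \<Omega>))" unfolding near_def using t(2,3) \<epsilon>(2) by (simp add: mult.assoc)
qed

lemma near_step:
  fixes mh :: real
  assumes Z: "near d Z" and d: "d \<le> 1 / 1000"
  defines "Zh \<equiv> trim \<mu>0 (max_entry rs) Z"
  assumes good: "good_step (vol / mh) \<Omega> Zh"
  shows "threshold_defined rs (init_step mh X \<Omega> Zh)" "near (d / 2) (threshold rs (init_step mh X \<Omega> Zh))" "Zh \<in> manifold n1 n2 rs"
proof -
  have Zt: "Z \<in> TT" "rank_t Z = rs" and z: "\<kappa>\<^sup>2 * norm (Phi Z - Phi X) \<le> d * \<sigma>" using Z unfolding near_def by auto
  have "d * \<sigma> \<le> 1 / 1000 * \<sigma>" using d cond(2) by (intro mult_right_mono) auto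
  then have "1000 * \<kappa>\<^sup>2 * norm (Phi Z - Phi X) \<le> \<sigma>" using z by simp
  note s = init_step_bound[OF Zt this, folded Zh_def, OF good]
  show "threshold_defined rs (init_step mh X \<Omega> Zh)" by (rule s(1))
  show "Zh \<in> manifold n1 n2 rs" unfolding manifold_def using s(5,6) rank_t_dim(1)[OF X pos(3)] by simp
  have "\<kappa>\<^sup>2 * norm (Phi (threshold rs (init_step mh X \<Omega> Zh)) - Phi X) \<le> \<kappa>\<^sup>2 * (norm (Phi Z - Phi X) / 2)"
    by (rule mult_left_mono[OF s(4)]) auto
  then show "near (d / 2) (threshold rs (init_step mh X \<Omega> Zh))" unfolding near_def using s(2,3) z by simp
qed

text \<open>Good steps are demanded only from near iterates. Each failure event then includes the
  nearness of its iterate, so its probability can be bounded with that iterate fixed.\<close>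

lemma init_converges:
  fixes mh :: real
  assumes start: "start_good (vol / mh) (\<Omega>s 0) \<epsilon>" and \<epsilon>: "0 \<le> \<epsilon>" "\<kappa>\<^sup>2 * sqrt (8 * real n3 * real r) * \<epsilon> \<le> c0 * \<sigma>" and c0: "0 \<le> c0" "c0 \<le> 1 / 1000"
  defines "Z \<equiv> init_iter \<mu>0 rs mh X \<Omega>s"
  assumes steps: "\<forall>l<L. near (c0 * (1 / 2) ^ l) (Z l) \<longrightarrow> good_step (vol / mh) (\<Omega>s (Suc l)) (trim \<mu>0 (max_entry rs) (Z l))"
  shows "init_well_defined \<mu>0 rs mh X \<Omega>s L" "near (c0 * (1 / 2) ^ L) (Z L)"
proof -
  note s0 = init_start_near[OF start \<epsilon> c0(2)]
  have d: "c0 * (1 / 2) ^ l \<le> 1 / 1000" for l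
    using mult_mono[OF c0(2) power_le_one[of "1 / 2 :: real" l]] by simp
  have near: "near (c0 * (1 / 2) ^ l) (Z l)" if "l \<le> L" for l
    using that
  proof (induction l)
    case 0
    then show ?case using s0(2) by (simp add: Z_def)
  next
    case (Suc l)
    then have n: "near (c0 * (1 / 2) ^ l) (Z l)" by simp
    have "good_step (vol / mh) (\<Omega>s (Suc l)) (trim \<mu>0 (max_entry rs) (Z l))" using steps Suc.prems n by auto
    from near_step(2)[OF n d this] show ?case by (simp add: Z_def)
  qed
  show "near (c0 * (1 / 2) ^ L) (Z L)" by (rule near) simp
  show "init_well_defined \<mu>0 rs mh X \<Omega>s L"
    unfolding init_well_defined_def dims Let_def
  proof (intro conjI allI impI)
    show "threshold_defined rs (init_start mh X (\<Omega>s 0))" by (rule s0(1))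
    fix l assume l: "l < L"
    then have n: "near (c0 * (1 / 2) ^ l) (Z l)" by (intro near) simp
    have "good_step (vol / mh) (\<Omega>s (Suc l)) (trim \<mu>0 (max_entry rs) (Z l))" using steps l n by auto
    note s = near_step(1,3)[OF n d this]
    show "trim \<mu>0 (max_entry rs) (init_iter \<mu>0 rs mh X \<Omega>s l) \<in> manifold n1 n2 rs"
      "threshold_defined rs (init_step mh X (\<Omega>s (Suc l)) (trim \<mu>0 (max_entry rs) (init_iter \<mu>0 rs mh X \<Omega>s l)))"
      using s unfolding Z_def by auto
  qed
qed

text \<open>A union bound with a deterministic complement. In units of \<open>NN powr (- 2)\<close>
  the start costs \<open>2\<close>, each of the \<open>L\<close> steps \<open>2\<close>, and the two
  properties of the full list \<open>1\<close> each. The full list reuses all groups, which is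
  harmless as those properties concern \<open>X\<close> and the sampling operator alone.\<close>

lemma recovery:
  fixes m L m' p :: nat and G :: "nat \<Rightarrow> nat set" and k1 k2 \<delta>0 \<delta> \<eta> \<epsilon> c0 :: real
  assumes G: "equal_groups m L G" and m': "m = m' * (L + 1)" "0 < m'" and N: "1 < NN" "ln NN \<le> real p"
    and \<delta>0: "0 < \<delta>0" and rip_small: "tail p (4 * (\<mu>0 * r * NN) / real m) 1 \<le> \<delta>0\<^sup>2"
    and step_small: "tail p (36 * (\<mu>0 * r * NN) / real m') 2 \<le> (1 / (40 * \<kappa>))\<^sup>2"
    and h: "h = tnorm_inf X * sqrt (2 / real n3)" and \<epsilon>: "0 < \<epsilon>" "\<kappa>\<^sup>2 * sqrt (8 * real n3 * real r) * \<epsilon> \<le> c0 * \<sigma>"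
    and start_small: "tail p (2 * (vol / real m') * h) (2 * h * NN) \<le> \<epsilon>\<^sup>2"
    and c0: "0 \<le> c0" "c0 \<le> 1 / 1000"
    and basin: "(31 * (real m / vol) + 30 * real p) * (c0 * (1 / 2) ^ L) \<le> \<eta> * (real m / vol)"
    and \<eta>: "0 \<le> \<eta>" "\<eta> \<le> 1 / 100" and \<delta>: "\<delta>0 + 10 * \<eta> \<le> \<delta>" "\<delta> \<le> 1 / 100"
    and k: "0 \<le> k1" "0 \<le> k2" "k1 + \<delta> < 1 - \<delta>" "k2 * (k1 + \<delta>) \<le> 1 / 3"
  shows "Pr m {\<Omega>. recovers \<mu>0 k1 k2 X L G \<Omega>} \<ge> 1 - 4 * real (L + 1) * NN powr (- 2)"
proof -
  define a where "a = vol / real m'"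
  define \<rho> where "\<rho> = real m / vol"
  define q where "q = 31 * \<rho> + 30 * real p"
  have m: "0 < m" using m' by simp
  have "0 < \<rho>" unfolding \<rho>_def using m vol_pos by simp
  then have \<rho>: "0 < \<rho>" "\<rho> \<le> q" unfolding q_def by auto
  have mh: "real m / real (L + 1) = real m'" using m'(1) by (simp add: field_simps)
  let ?M = "uniform_samples m n1 n2 n3"
  let ?Z = "\<lambda>\<Omega>s l. init_iter \<mu>0 rs (real m') X \<Omega>s l"
  let ?T = "trim \<mu>0 (max_entry rs)"
  define B0 where "B0 = {\<Omega>. \<not> start_good a (nths \<Omega> (G 0)) \<epsilon>}"
  define B where "B l = {\<Omega>. near (c0 * (1 / 2) ^ l) (?Z (\<lambda>l. nths \<Omega> (G l)) l) \<and> \<not> good_step a (nths \<Omega> (G (Suc l))) (?T (?Z (\<lambda>l. nths \<Omega> (G l)) l))}" for l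
  define R where "R = {\<Omega>. \<not> rip \<Omega> \<rho> \<delta>0}"
  define P where "P = {\<Omega>. \<not> op_bound \<Omega> q}"
  have cG: "card (G l \<inter> {..<m}) = m'" if "l \<le> L" for l
  proof -
    have "G l \<subseteq> {..<m}" using G that unfolding equal_groups_def by blast
    then have "G l \<inter> {..<m} = G l" by blast
    moreover have "card (G l) * (L + 1) = m' * (L + 1)" using G that m'(1) unfolding equal_groups_def by simp
    ultimately show ?thesis by (simp only: mult_cancel2) simp
  qed
  have pR: "measure_pmf.prob ?M R \<le> vol * NN powr (- 4)"
    unfolding R_def \<rho>_def by (rule rip_prob[OF m \<delta>0 N refl rip_small])
  have pP: "measure_pmf.prob ?M P \<le> vol * NN powr (- 4)"
    unfolding P_def by (rule op_bound_prob[OF m N]) (simp add: q_def \<rho>_def)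
  have p0: "measure_pmf.prob ?M B0 \<le> real n3 * (real (n1 + n2) * NN powr (- 4))"
    unfolding B0_def uniform_samples_def
  proof (rule prob_split_le[where P = "\<lambda>u v. \<not> start_good a u \<epsilon>" and A = "G 0"])
    let ?F = "\<lambda>k. {\<Omega>. \<not> fop_le (emb k (hat ((vol / real m') \<cdot>\<^sub>t sampling_op \<Omega> X) $ k) - emb k (hat X $ k)) \<epsilon>}"
    have "{u. \<not> start_good a u \<epsilon>} = (\<Union>k\<in>{..<n3}. ?F k)" unfolding start_good_def a_def by auto
    then have "Pr m' {u. \<not> start_good a u \<epsilon>} \<le> (\<Sum>k<n3. Pr m' (?F k))"
      using measure_pmf.finite_measure_subadditive_finite[of "{..<n3}" ?F "uniform_samples m' n1 n2 n3"] by simp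
    also have "... \<le> (\<Sum>k<n3. real (n1 + n2) * NN powr (- 4))"
      by (intro sum_mono start_slice_prob[OF X _ m'(2) \<epsilon>(1) N h refl refl start_small]) simp
    finally show "measure_pmf.prob (replicate_pmf (card (G 0 \<inter> {..<m})) (pmf_of_set idx)) {u. \<not> start_good a u \<epsilon>} \<le> real n3 * (real (n1 + n2) * NN powr (- 4))"
      unfolding cG[OF le0] uniform_samples_def sum_constant card_lessThan .
  qed
  have pB: "measure_pmf.prob ?M (B l) \<le> 2 * vol * NN powr (- 4)" if l: "l < L" for l
  proof -
    let ?A = "G (Suc l)"
    have sub: "G j \<subseteq> - ?A" if "j \<le> l" for j
    proof -
      have "disjoint_family_on G {..L}" using G unfolding equal_groups_def by simp
      from disjoint_family_onD[OF this, of j "Suc l"] have "G j \<inter> G (Suc l) = {}" using l that by simp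
      then show ?thesis by blast
    qed
    \<comment> \<open>Recovers the earlier groups from the complementary sublist \<open>v\<close>,
      so that the iterate is fixed when the current group is drawn.\<close>
    define f where "f v j = nths v ((\<lambda>i. card {i' \<in> - ?A. i' < i}) ` G j)" for v :: "index list" and j
    have Z: "?Z (\<lambda>l. nths \<Omega> (G l)) l = ?Z (f (nths \<Omega> (- ?A))) l" for \<Omega>
      unfolding f_def by (rule init_iter_cong) (intro allI impI nths_sub sub)
    show ?thesis
      unfolding B_def Z uniform_samples_def
    proof (rule prob_split_le[where A = "?A" and P = "\<lambda>u v. near (c0 * (1 / 2) ^ l) (?Z (f v) l) \<and> \<not> good_step a u (?T (?Z (f v) l))"])
      fix v
      let ?Y = "?Z (f v) l"
      show "measure_pmf.prob (replicate_pmf (card (?A \<inter> {..<m})) (pmf_of_set idx)) {u. near (c0 * (1 / 2) ^ l) ?Y \<and> \<not> good_step a u (?T ?Y)} \<le> 2 * vol * NN powr (- 4)"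
      proof (cases "near (c0 * (1 / 2) ^ l) ?Y")
        case False
        then show ?thesis using vol_pos by simp
      next
        case True
        have "c0 * (1 / 2) ^ l \<le> 1 / 1000" using mult_mono[OF c0(2) power_le_one[of "1 / 2 :: real" l]] by simp
        then have "c0 * (1 / 2) ^ l * \<sigma> \<le> 1 / 1000 * \<sigma>" using cond(2) by (intro mult_right_mono) auto
        then have "1000 * (\<kappa>\<^sup>2 * norm (Phi ?Y - Phi X)) \<le> \<sigma>" and Y: "?Y \<in> TT" "rank_t ?Y = rs" using True unfolding near_def by auto
        moreover have "\<kappa> * 1 * norm (Phi ?Y - Phi X) \<le> \<kappa> * \<kappa> * norm (Phi ?Y - Phi X)"
          using cond(6) by (intro mult_right_mono mult_left_mono) auto
        moreover have "0 \<le> \<kappa> * \<kappa> * norm (Phi ?Y - Phi X)" by simp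
        ultimately have "100 * \<kappa> * norm (Phi ?Y - Phi X) \<le> \<sigma>" unfolding power2_eq_square by linarith
        note t = trim_step[OF Y this]
        have "{u. near (c0 * (1 / 2) ^ l) ?Y \<and> \<not> good_step a u (?T ?Y)} = {u. \<not> good_step (vol / real m') u (?T ?Y)}" using True by (simp add: a_def)
        then show ?thesis
          using step_prob[OF t(1,4,5) m'(2) N refl step_small] cG[of "Suc l"] l by (simp add: uniform_samples_def)
      qed
    qed
  qed
  have good: "recovers \<mu>0 k1 k2 X L G \<Omega>" if len: "length \<Omega> = m" and no: "\<Omega> \<notin> B0 \<union> (\<Union>l\<in>{..<L}. B l) \<union> R \<union> P" for \<Omega>
  proof -
    let ?\<Omega>s = "\<lambda>l. nths \<Omega> (G l)"
    have st: "start_good (vol / real m') (?\<Omega>s 0) \<epsilon>" using no unfolding B0_def a_def by simp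
    have steps: "\<forall>l<L. near (c0 * (1 / 2) ^ l) (?Z ?\<Omega>s l) \<longrightarrow> good_step (vol / real m') (?\<Omega>s (Suc l)) (?T (?Z ?\<Omega>s l))"
      using no unfolding B_def a_def by auto
    have rp: "rip \<Omega> \<rho> \<delta>0" and op: "op_bound \<Omega> q" using no unfolding R_def P_def by auto
    note i = init_converges[OF st less_imp_le[OF \<epsilon>(1)] \<epsilon>(2) c0 steps]
    define X0 where "X0 = ?Z ?\<Omega>s L"
    have X0: "X0 \<in> TT" "rank_t X0 = rs" and d: "\<kappa>\<^sup>2 * norm (Phi X0 - Phi X) \<le> c0 * (1 / 2) ^ L * \<sigma>"
      using i(2) unfolding near_def X0_def by auto
    have q0: "0 \<le> q" using \<rho> by simp
    have "1 * norm (Phi X0 - Phi X) \<le> \<kappa>\<^sup>2 * norm (Phi X0 - Phi X)" using kappa2 by (intro mult_right_mono) auto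
    then have "norm (Phi X - Phi X0) \<le> c0 * (1 / 2) ^ L * \<sigma>" using d by (simp add: norm_minus_commute)
    then have "q * norm (Phi X - Phi X0) \<le> q * (c0 * (1 / 2) ^ L * \<sigma>)" using q0 by (intro mult_left_mono)
    also have "... \<le> \<eta> * \<rho> * \<sigma>" using mult_right_mono[OF basin, of \<sigma>] cond(2) by (simp add: q_def \<rho>_def mult.assoc)
    finally have close: "q * norm (Phi X - Phi X0) \<le> \<eta> * \<rho> * \<sigma>" .
    note c = cg_converges[OF rp op \<rho> \<eta> \<delta>(1) less_imp_le[OF \<delta>0] \<delta>(2) k X0 close]
    show ?thesis
      unfolding recovers_def Let_def len mh using i(1) c unfolding X0_def by blast
  qed
  let ?F = "B0 \<union> (\<Union>l\<in>{..<L}. B l) \<union> R \<union> P"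
  have NN4: "vol * NN powr (- 4) \<le> NN powr (- 2)" "real n3 * (real (n1 + n2) * NN powr (- 4)) \<le> 2 * NN powr (- 2)"
  proof -
    have mul: "x * NN powr (- 4) \<le> c * NN powr (- 2)" if "x \<le> c * NN\<^sup>2" for x c
    proof -
      have "NN\<^sup>2 * NN powr (- 4) = NN powr (- 2)" using N(1) by (simp flip: powr_numeral powr_add)
      then show ?thesis using mult_right_mono[OF that, of "NN powr (- 4)"] by (simp add: mult.assoc)
    qed
    show "vol * NN powr (- 4) \<le> NN powr (- 2)" using mul[of vol 1] vol_le by simp
    have "real n3 * real (n1 + n2) \<le> real n3 * (2 * real (max n1 n2))" by (intro mult_left_mono) auto
    also have "... = 2 * NN" by simp
    also have "... \<le> 2 * NN\<^sup>2"
    proof -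
      have "2 * t \<le> 2 * t\<^sup>2" if "1 < t" for t :: real using that by (simp add: power2_eq_square)
      then show ?thesis using N(1) by blast
    qed
    finally show "real n3 * (real (n1 + n2) * NN powr (- 4)) \<le> 2 * NN powr (- 2)"
      using mul[of "real n3 * real (n1 + n2)" 2] by (simp only: mult.assoc)
  qed
  have "measure_pmf.prob ?M ?F \<le> measure_pmf.prob ?M B0 + (\<Sum>l<L. measure_pmf.prob ?M (B l)) + measure_pmf.prob ?M R + measure_pmf.prob ?M P"
    by (intro order_trans[OF measure_Un_le] add_mono order_refl measure_pmf.finite_measure_subadditive_finite) auto
  also have "... \<le> 2 * NN powr (- 2) + (\<Sum>l<L. 2 * NN powr (- 2)) + NN powr (- 2) + NN powr (- 2)"
  proof (intro add_mono sum_mono order_trans[OF p0 NN4(2)] order_trans[OF pR NN4(1)] order_trans[OF pP NN4(1)])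
    fix l assume "l \<in> {..<L}"
    then show "measure_pmf.prob ?M (B l) \<le> 2 * NN powr (- 2)" using pB[of l] NN4(1) by simp
  qed
  also have "... \<le> 4 * real (L + 1) * NN powr (- 2)" by (simp add: algebra_simps)
  finally have F: "measure_pmf.prob ?M ?F \<le> 4 * real (L + 1) * NN powr (- 2)" .
  have "measure_pmf.prob ?M (- ?F) \<le> measure_pmf.prob ?M {\<Omega>. recovers \<mu>0 k1 k2 X L G \<Omega>}"
    by (intro measure_pmf.finite_measure_mono_AE) (auto simp: AE_measure_pmf_iff uniform_samples_def set_replicate_pmf intro!: good)
  moreover have "measure_pmf.prob ?M (- ?F) = 1 - measure_pmf.prob ?M ?F"
    using measure_pmf.prob_compl[of ?F ?M] by (simp add: Compl_eq_Diff_UNIV)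
  ultimately show ?thesis using F by simp
qed

end

section \<open>Choice of the numerical constants\<close>

lemma gamma_bounds:
  fixes k1 k2 \<epsilon>0 :: real
  assumes k: "k1 \<ge> 0" "k2 \<ge> 0" and \<epsilon>0: "0 < \<epsilon>0" and A: "(1 - 4 * \<epsilon>0) - k1 * (1 + 4 * \<epsilon>0) > 0"
    and \<gamma>: "gamma1 k1 k2 \<epsilon>0 + gamma2 k1 k2 \<epsilon>0 < 1"
  shows "\<epsilon>0 < 1 / 22" "k1 < 1 - 4 * \<epsilon>0" "3 * (k1 * k2) + 12 * (k2 * \<epsilon>0) < 1"
proof -
  define y where "y = k1 * (1 + 4 * \<epsilon>0)"
  define A where "A = (1 - 4 * \<epsilon>0) - y"
  have y0: "k1 \<le> y" using mult_left_mono[of 1 "1 + 4 * \<epsilon>0" k1] k \<epsilon>0 by (simp add: y_def)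
  have A0: "0 < A" using A by (simp add: A_def y_def)
  then have y1: "y < 1 - 4 * \<epsilon>0" by (simp add: A_def)
  have q: "0 < 1 - 4 * \<epsilon>0" using y0 y1 k by linarith
  show "k1 < 1 - 4 * \<epsilon>0" using y0 y1 by linarith
  define w where "w = 3 * (k1 * k2) + 12 * (k2 * \<epsilon>0)"
  have w0: "0 \<le> w" using k \<epsilon>0 by (simp add: w_def)
  \<comment> \<open>The fractions with denominator \<open>1 - 4 * \<epsilon>0\<close> combine to
    one; both remaining summands are nonnegative, so each is below \<open>1\<close>.\<close>
  have "gamma1 k1 k2 \<epsilon>0 + gamma2 k1 k2 \<epsilon>0 = (18 * \<epsilon>0 - 10 * \<epsilon>0 * y) / A + w / (1 - 4 * \<epsilon>0)"
    unfolding gamma1_def gamma2_def A_def y_def w_def by (simp add: add_divide_distrib[symmetric] algebra_simps)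
  then have s: "(18 * \<epsilon>0 - 10 * \<epsilon>0 * y) / A + w / (1 - 4 * \<epsilon>0) < 1" using \<gamma> by simp
  have "10 * \<epsilon>0 * y \<le> 10 * \<epsilon>0 * 1" using y1 \<epsilon>0 by (intro mult_left_mono) auto
  then have n: "0 \<le> 18 * \<epsilon>0 - 10 * \<epsilon>0 * y" using \<epsilon>0 by linarith
  then have "0 \<le> (18 * \<epsilon>0 - 10 * \<epsilon>0 * y) / A" using A0 by simp
  then have "w / (1 - 4 * \<epsilon>0) < 1" using s by linarith
  then have "w < 1 - 4 * \<epsilon>0" using q by simp
  then show "3 * (k1 * k2) + 12 * (k2 * \<epsilon>0) < 1" using \<epsilon>0 by (simp add: w_def)
  have "0 \<le> w / (1 - 4 * \<epsilon>0)" using w0 q by simp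
  then have "(18 * \<epsilon>0 - 10 * \<epsilon>0 * y) / A < 1" using s by linarith
  then have t: "18 * \<epsilon>0 - 10 * \<epsilon>0 * y < 1 - 4 * \<epsilon>0 - y" using A0 by (simp add: A_def)
  \<comment> \<open>For \<open>10 * \<epsilon>0 \<le> 1\<close> the terms in \<open>y\<close> only
    strengthen \<open>22 * \<epsilon>0 < 1\<close>; otherwise \<open>y < 3 / 5\<close> contradicts
    the inequality.\<close>
  show "\<epsilon>0 < 1 / 22"
  proof (cases "10 * \<epsilon>0 \<le> 1")
    case True
    have "0 \<le> y * (1 - 10 * \<epsilon>0)" using True y0 k by (intro mult_nonneg_nonneg) auto
    then show ?thesis using t by (simp add: algebra_simps)
  next
    case False
    have "y * (10 * \<epsilon>0 - 1) \<le> 1 * (3 / 2)" using False y1 q \<epsilon>0 y0 k by (intro mult_mono) auto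
    moreover have "y * (10 * \<epsilon>0 - 1) \<le> (3 / 5) * (10 * \<epsilon>0 - 1)" using False y1 \<epsilon>0 by (intro mult_right_mono) auto
    ultimately show ?thesis using t False q by (simp add: algebra_simps)
  qed
qed

text \<open>\<open>L \<ge> 6 * \<Lambda>\<close> and \<open>6 * ln 2 \<ge> 4\<close> give
  \<open>(1 / 2) ^ L \<le> exp (- \<Lambda>)\<close>, which is at most
  \<open>36 * \<epsilon>0 / n\<close> since \<open>ln n \<ge> 2 / 3\<close>.\<close>

lemma log_factor_bounds:
  fixes \<beta> n \<epsilon>0 :: real
  assumes \<beta>: "1 < \<beta>" and n: "2 \<le> n" and \<epsilon>0: "0 < \<epsilon>0" "\<epsilon>0 < 1 / 22"
  defines "\<Lambda> \<equiv> ln (\<beta> * n * ln n / (24 * \<epsilon>0))"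
  defines "L \<equiv> nat \<lceil>6 * \<Lambda>\<rceil>"
  shows "1 / 6 \<le> \<Lambda>" "real (L + 1) \<le> 18 * \<Lambda>" "n * (1 / 2) ^ L \<le> 36 * \<epsilon>0"
proof -
  have ln2: "2 / 3 \<le> ln (2::real)" by (rule ln2_ge_two_thirds)
  have lnn: "2 / 3 \<le> ln n" using ln2 n ln_le_cancel_iff[of 2 n] by linarith
  define x where "x = \<beta> * n * ln n / (24 * \<epsilon>0)"
  have b: "n * (2 / 3) \<le> \<beta> * n * ln n"
  proof -
    have "1 * n * (2 / 3) \<le> \<beta> * n * ln n" using \<beta> n lnn by (intro mult_mono) auto
    then show ?thesis by simp
  qed
  have x: "n * (2 / 3) / (24 * \<epsilon>0) \<le> x" unfolding x_def using b \<epsilon>0 by (intro divide_right_mono) auto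
  \<comment> \<open>From \<open>n \<ge> 2\<close> and \<open>\<epsilon>0 < 1 / 22\<close>. Then
    \<open>\<Lambda> \<ge> 1 - 9 / 11 \<ge> 1 / 6\<close>, which absorbs the rounding and the extra
    group into \<open>18 * \<Lambda>\<close>.\<close>
  have "11 / 9 \<le> n * (2 / 3) / (24 * \<epsilon>0)"
    using n \<epsilon>0 by (simp add: pos_le_divide_eq)
  then have x1: "11 / 9 \<le> x" using x by linarith
  have "ln (inverse x) \<le> inverse x - 1" using x1 by (intro ln_le_minus_one) simp
  moreover have "inverse x \<le> inverse (11 / 9)" using x1 by (intro le_imp_inverse_le) auto
  ultimately show \<Lambda>: "1 / 6 \<le> \<Lambda>" unfolding \<Lambda>_def x_def[symmetric] using x1 by (simp add: ln_inverse)
  have "real L < 6 * \<Lambda> + 1" unfolding L_def using \<Lambda> by linarith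
  then show "real (L + 1) \<le> 18 * \<Lambda>" using \<Lambda> by simp
  have "6 * \<Lambda> \<le> real L" unfolding L_def using \<Lambda> by linarith
  have "(1 / 2 :: real) ^ L = exp (- (real L * ln 2))" by (simp add: exp_minus exp_of_nat_mult power_one_over inverse_eq_divide)
  also have "... \<le> exp (- \<Lambda>)"
  proof -
    have "6 * \<Lambda> * (2 / 3) \<le> real L * ln 2" using \<open>6 * \<Lambda> \<le> real L\<close> ln2 \<Lambda> by (intro mult_mono) auto
    then show ?thesis using \<Lambda> by simp
  qed
  also have "... = inverse x" unfolding \<Lambda>_def x_def[symmetric] using x1 by (simp add: exp_minus)
  also have "... \<le> inverse (n * (2 / 3) / (24 * \<epsilon>0))" using x n \<epsilon>0 by (intro le_imp_inverse_le) auto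
  finally have "n * (1 / 2) ^ L \<le> n * inverse (n * (2 / 3) / (24 * \<epsilon>0))" using n by (intro mult_left_mono) auto
  also have "... = 36 * \<epsilon>0" using n by simp
  finally show "n * (1 / 2) ^ L \<le> 36 * \<epsilon>0" .
qed

lemma tail_small:
  assumes "0 \<le> real p * R" "real p * R \<le> 1" "55 * (4 + 8 * K) * (real p * R) \<le> d"
  shows "tail p R K \<le> d"
proof -
  have "(real p * R) * (real p * R) \<le> (real p * R) * 1" by (intro mult_left_mono assms)
  then have "(real p)\<^sup>2 * R\<^sup>2 \<le> real p * R" by (simp add: power2_eq_square mult_ac)
  then show ?thesis using assms(3) by (simp add: tail_def algebra_simps)
qed

context incoherent_tensor
begin

text \<open>Comparing the maximal entry with the Frobenius norm shows that joint incoherence forces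
  \<open>\<mu>1\<^sup>2 * r * \<kappa>\<^sup>2 \<ge> 1\<close>. The sample size is therefore at
  least of order \<open>NN * p\<close>, whatever \<open>\<mu>0\<close> is.\<close>

lemma joint_incoherence_lower:
  assumes joint: "tnorm_inf X \<le> \<mu>1 * sqrt (real r / vol) * tspectral_norm X" and \<mu>1: "0 < \<mu>1"
  shows "vol * (tnorm_inf X)\<^sup>2 \<le> \<mu>1\<^sup>2 * real r * \<kappa>\<^sup>2 * \<sigma>\<^sup>2" "1 \<le> \<mu>1\<^sup>2 * (real r)\<^sup>2 * \<kappa> ^ 6"
proof -
  have M0: "0 \<le> tnorm_inf X"
  proof -
    have "(0, 0, 0) \<in> idx" using pos by (simp add: index_set_def)
    from tnorm_inf_ge[OF X this] show ?thesis by simp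
  qed
  have "(tnorm_inf X)\<^sup>2 \<le> (\<mu>1 * sqrt (real r / vol) * (\<kappa> * \<sigma>))\<^sup>2"
    using joint M0 unfolding spectral_eq by (intro power_mono)
  then have "vol * (tnorm_inf X)\<^sup>2 \<le> vol * (\<mu>1 * sqrt (real r / vol) * (\<kappa> * \<sigma>))\<^sup>2" using vol_pos by (intro mult_left_mono) auto
  also have "... = \<mu>1\<^sup>2 * real r * \<kappa>\<^sup>2 * \<sigma>\<^sup>2" using vol_pos by (simp add: power_mult_distrib)
  finally show u: "vol * (tnorm_inf X)\<^sup>2 \<le> \<mu>1\<^sup>2 * real r * \<kappa>\<^sup>2 * \<sigma>\<^sup>2" .
  have "(norm (Phi X))\<^sup>2 = (\<Sum>\<omega>\<in>idx. (inner (E \<omega>) (Phi X))\<^sup>2)"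
    using parseval[OF E_orthon] VS_I[OF X] by (simp add: VS_span)
  also have "... \<le> (\<Sum>\<omega>\<in>idx. (tnorm_inf X)\<^sup>2)"
    using tnorm_inf_ge[OF X] by (intro sum_mono) (metis abs_ge_zero power2_abs power_mono)
  also have "... = vol * (tnorm_inf X)\<^sup>2" using idx by simp
  finally have "(norm (Phi X))\<^sup>2 \<le> vol * (tnorm_inf X)\<^sup>2" .
  moreover have "\<sigma>\<^sup>2 \<le> (norm (Phi X))\<^sup>2" using cond(2,8) by (intro power_mono) auto
  ultimately have "1 * \<sigma>\<^sup>2 \<le> (\<mu>1\<^sup>2 * real r * \<kappa>\<^sup>2) * \<sigma>\<^sup>2" using u by simp
  then have "1 \<le> \<mu>1\<^sup>2 * real r * \<kappa>\<^sup>2" using cond(2) by (simp only: mult_le_cancel_right_pos zero_less_power)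
  also have "... \<le> \<mu>1\<^sup>2 * (real r)\<^sup>2 * \<kappa> ^ 6"
    using rank_pos cond(6) by (intro mult_mono mult_left_mono power_increasing self_le_power) auto
  finally show "1 \<le> \<mu>1\<^sup>2 * (real r)\<^sup>2 * \<kappa> ^ 6" .
qed

text \<open>The budget is \<open>\<delta>0 = \<epsilon>0 / 20\<close> for the isometry at
  \<open>X\<close> and \<open>\<eta> = \<epsilon>0 / 200\<close> for the basin, so that
  \<open>\<delta>0 + 10 * \<eta> = \<epsilon>0 / 10\<close> is the isometry constant near
  \<open>X\<close>.\<close>

lemma recovery_from_sample_size:
  fixes m L m' p :: nat and G :: "nat \<Rightarrow> nat set" and k1 k2 \<epsilon>0 \<mu>1 n b :: real
  assumes G: "equal_groups m L G" and m': "m = m' * (L + 1)" and N: "1 < NN" "ln NN \<le> real p"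
    and joint: "tnorm_inf X \<le> \<mu>1 * sqrt (real r / vol) * tspectral_norm X" and \<mu>1: "0 < \<mu>1"
    and \<epsilon>0: "0 < \<epsilon>0" "\<epsilon>0 < 1 / 22" and k: "0 \<le> k1" "0 \<le> k2" "k1 < 1 - 4 * \<epsilon>0" "3 * (k1 * k2) + 12 * (k2 * \<epsilon>0) < 1"
    and b: "b = 2 * 10 ^ 15" and p0: "0 < p"
    and size: "b * (\<mu>0 * real r * \<kappa>\<^sup>2 / \<epsilon>0\<^sup>2) * NN * real p \<le> real m'" "b * (\<mu>1\<^sup>2 * (real r)\<^sup>2 * \<kappa> ^ 6) * NN * real p \<le> real m'"
    and n: "2 \<le> n" "real (min n1 n2) \<le> n" and L: "n * (1 / 2) ^ L \<le> 36 * \<epsilon>0"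
  shows "Pr m {\<Omega>. recovers \<mu>0 k1 k2 X L G \<Omega>} \<ge> 1 - 4 * real (L + 1) * NN powr (- 2)"
proof -
  note jl = joint_incoherence_lower[OF joint \<mu>1]
  have bp: "b * NN * real p \<le> real m'"
  proof -
    have "b * 1 * NN * real p \<le> b * (\<mu>1\<^sup>2 * (real r)\<^sup>2 * \<kappa> ^ 6) * NN * real p"
      using jl(2) N(1) by (intro mult_right_mono mult_left_mono) (auto simp: b)
    then show ?thesis using size(2) by simp
  qed
  have "0 < b * NN * real p" using N(1) p0 by (simp add: b)
  then have m0: "0 < m'" using bp by simp
  have mm: "real m' \<le> real m" using m' by simp
  define x where "x = real p * (\<mu>0 * r * NN) / real m'"
  have x0: "0 \<le> x" unfolding x_def using \<mu>0 N(1) by simp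
  have xk: "b * (x * \<kappa>\<^sup>2) \<le> \<epsilon>0\<^sup>2"
    using size(1) m0 \<epsilon>0 by (simp add: x_def field_simps)
  have "x * 1 \<le> x * \<kappa>\<^sup>2" using kappa2 x0 by (intro mult_left_mono)
  then have xb: "b * x \<le> \<epsilon>0\<^sup>2" using xk by (simp add: b)
  have \<epsilon>1: "\<epsilon>0\<^sup>2 \<le> 1" using \<epsilon>0 by (simp add: power_le_one)
  have rip_small: "tail p (4 * (\<mu>0 * r * NN) / real m) 1 \<le> (\<epsilon>0 / 20)\<^sup>2"
  proof (rule tail_small)
    have "real p * (4 * (\<mu>0 * r * NN) / real m) \<le> real p * (4 * (\<mu>0 * r * NN) / real m')"
      using mm m0 \<mu>0 N(1) by (intro mult_left_mono divide_left_mono) auto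
    also have "... = 4 * x" by (simp add: x_def mult_ac)
    finally have le: "real p * (4 * (\<mu>0 * r * NN) / real m) \<le> 4 * x" .
    show "0 \<le> real p * (4 * (\<mu>0 * r * NN) / real m)" using \<mu>0 N(1) by simp
    show "real p * (4 * (\<mu>0 * r * NN) / real m) \<le> 1" using le xb x0 \<epsilon>1 by (simp add: b)
    have "55 * (4 + 8 * 1) * (real p * (4 * (\<mu>0 * r * NN) / real m)) \<le> 55 * (4 + 8 * 1) * (4 * x)" using le by (intro mult_left_mono) auto
    also have "... \<le> (\<epsilon>0 / 20)\<^sup>2" using xb x0 by (simp add: b power_divide)
    finally show "55 * (4 + 8 * 1) * (real p * (4 * (\<mu>0 * r * NN) / real m)) \<le> (\<epsilon>0 / 20)\<^sup>2" .
  qed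
  have step_small: "tail p (36 * (\<mu>0 * r * NN) / real m') 2 \<le> (1 / (40 * \<kappa>))\<^sup>2"
  proof (rule tail_small)
    have e: "real p * (36 * (\<mu>0 * r * NN) / real m') = 36 * x" by (simp add: x_def mult_ac)
    show "0 \<le> real p * (36 * (\<mu>0 * r * NN) / real m')" "real p * (36 * (\<mu>0 * r * NN) / real m') \<le> 1"
      unfolding e using xb x0 \<epsilon>1 by (simp_all add: b)
    have "1600 * (55 * (4 + 8 * 2) * (36 * x)) * \<kappa>\<^sup>2 \<le> 1" using xk \<epsilon>1 x0 mult_nonneg_nonneg[of x "\<kappa>\<^sup>2"] by (simp add: b)
    then show "55 * (4 + 8 * 2) * (real p * (36 * (\<mu>0 * r * NN) / real m')) \<le> (1 / (40 * \<kappa>))\<^sup>2"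
      unfolding e using cond(6) by (simp add: power_divide power_mult_distrib pos_le_divide_eq mult_ac)
  qed
  \<comment> \<open>Small enough that \<open>17 * 36 * c0 \<le> 1 / 200\<close>, as the basin
    requires.\<close>
  define c0 :: real where "c0 = 1 / 200000"
  define h where "h = tnorm_inf X * sqrt (2 / real n3)"
  define \<epsilon> where "\<epsilon> = c0 * \<sigma> / (\<kappa>\<^sup>2 * sqrt (8 * real n3 * real r))"
  have nr: "0 < real n3 * real r" using pos(3) rank_pos by simp
  have \<epsilon>: "0 < \<epsilon>" "\<kappa>\<^sup>2 * sqrt (8 * real n3 * real r) * \<epsilon> \<le> c0 * \<sigma>"
    unfolding \<epsilon>_def using cond(2,6) nr by (auto simp: c0_def)
  have start_small: "tail p (2 * (vol / real m') * h) (2 * h * NN) \<le> \<epsilon>\<^sup>2"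
  proof -
    define u where "u = \<sigma>\<^sup>2 / (real n3 * real r * \<kappa> ^ 4)"
    define g where "g = \<mu>1\<^sup>2 * (real r)\<^sup>2 * \<kappa> ^ 6"
    have u0: "0 \<le> u" unfolding u_def by simp
    have g1: "1 \<le> g" unfolding g_def by (rule jl(2))
    have "vol * h\<^sup>2 = vol * (tnorm_inf X)\<^sup>2 * (2 / real n3)" by (simp add: h_def power_mult_distrib)
    also have "... \<le> \<mu>1\<^sup>2 * real r * \<kappa>\<^sup>2 * \<sigma>\<^sup>2 * (2 / real n3)" by (intro mult_right_mono jl(1)) simp
    also have "... = 2 * (g * u)"
      using nr cond(6) by (simp add: g_def u_def field_simps power2_eq_square eval_nat_numeral)
    finally have vh: "vol * h\<^sup>2 \<le> 2 * (g * u)" .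
    define y where "y = g * NN * real p / real m'"
    have y0: "0 \<le> y" unfolding y_def using g1 N(1) by simp
    have yb: "b * y \<le> 1" using size(2) m0 unfolding g_def[symmetric] by (simp add: y_def pos_divide_le_eq mult_ac)
    have t1: "4 * (real p)\<^sup>2 * (2 * (vol / real m') * h)\<^sup>2 \<le> 32 * (y * u)"
    proof -
      have "4 * (real p)\<^sup>2 * (2 * (vol / real m') * h)\<^sup>2 = 16 * ((real p / real m')\<^sup>2 * vol) * (vol * h\<^sup>2)"
        by (simp add: power_mult_distrib power_divide power2_eq_square)
      also have "... \<le> 16 * ((real p / real m')\<^sup>2 * NN\<^sup>2) * (2 * (g * u))"
        by (rule mult_mono[OF _ vh]) (use vol_le vol_pos in \<open>auto intro!: mult_left_mono\<close>)
      also have "... \<le> 16 * ((real p / real m')\<^sup>2 * NN\<^sup>2) * (2 * (g * g * u))"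
        using g1 u0 by (intro mult_left_mono mult_right_mono) auto
      also have "... = 32 * (y * (y * u))" by (simp add: y_def power2_eq_square)
      also have "... \<le> 32 * (y * (1 * u))" using yb y0 u0 by (intro mult_left_mono mult_right_mono) (auto simp: b)
      finally show ?thesis by simp
    qed
    have t2: "8 * real p * (2 * (vol / real m') * h) * (2 * h * NN) \<le> 64 * (y * u)"
    proof -
      have "8 * real p * (2 * (vol / real m') * h) * (2 * h * NN) = 32 * (real p * NN / real m') * (vol * h\<^sup>2)"
        by (simp add: power2_eq_square)
      also have "... \<le> 32 * (real p * NN / real m') * (2 * (g * u))" using N(1) by (intro mult_left_mono vh) auto
      also have "... = 64 * (y * u)" by (simp add: y_def)
      finally show ?thesis .
    qed
    have "tail p (2 * (vol / real m') * h) (2 * h * NN) \<le> 55 * (32 * (y * u) + 64 * (y * u))"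
      unfolding tail_def by (intro mult_left_mono add_mono t1 t2) simp
    also have "... = 55 * 96 * y * u" by simp
    \<comment> \<open>The start dictates the constant: \<open>55 * 96 / b\<close> must not exceed
      \<open>c0\<^sup>2 / 8\<close>, which is just met by \<open>b = 2 * 10 ^ 15\<close>.\<close>
    also have "... \<le> (c0\<^sup>2 / 8) * u" using yb y0 by (intro mult_right_mono u0) (simp add: b c0_def power_divide)
    also have "... = \<epsilon>\<^sup>2"
      using nr cond(6) by (simp add: \<epsilon>_def u_def power_divide power_mult_distrib flip: power_mult)
    finally show ?thesis .
  qed
  have basin: "(31 * (real m / vol) + 30 * real p) * (c0 * (1 / 2) ^ L) \<le> \<epsilon>0 / 200 * (real m / vol)"
  proof -
    \<comment> \<open>\<open>vol\<close> is \<open>NN\<close> times the smaller of \<open>n1\<close>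
      and \<open>n2\<close>, while \<open>m\<close> is at least of order \<open>NN * p\<close>; this
      is the factor \<open>n\<close> that the initialization has to beat.\<close>
    have "real p \<le> n / 30 * (real m / vol)"
    proof -
      have "vol = real (min n1 n2) * NN" by (simp add: vol_def min_def max_def)
      then have "real p * vol = real (min n1 n2) * (NN * real p)" by simp
      also have "... \<le> n * (NN * real p)" using n N(1) by (intro mult_right_mono) auto
      also have "... \<le> n * (real m / 30)"
      proof (rule mult_left_mono)
        have "30 * (NN * real p) \<le> b * NN * real p" using N(1) by (simp add: b mult.assoc)
        then show "NN * real p \<le> real m / 30" using bp mm by linarith
      qed (use n in simp)
      finally show ?thesis using vol_pos by (simp add: pos_le_divide_eq)
    qed
    then have "31 * (real m / vol) + 30 * real p \<le> 31 * (real m / vol) + n * (real m / vol)" by simp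
    also have "... \<le> (17 * n) * (real m / vol)"
      unfolding distrib_right[symmetric] using n vol_pos by (intro mult_right_mono) auto
    finally have "(31 * (real m / vol) + 30 * real p) * (c0 * (1 / 2) ^ L) \<le> ((17 * n) * (real m / vol)) * (c0 * (1 / 2) ^ L)"
      by (intro mult_right_mono) (auto simp: c0_def)
    also have "... = (17 * c0) * (real m / vol) * (n * (1 / 2) ^ L)" by simp
    also have "... \<le> (17 * c0) * (real m / vol) * (36 * \<epsilon>0)" using L vol_pos by (intro mult_left_mono) (auto simp: c0_def)
    also have "... \<le> \<epsilon>0 / 200 * (real m / vol)" using \<epsilon>0 vol_pos by (simp add: c0_def field_simps)
    finally show ?thesis .
  qed
  have kk: "k2 * (k1 + \<epsilon>0 / 10) \<le> 1 / 3"
  proof -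
    have "0 \<le> k2 * \<epsilon>0" using k \<epsilon>0 by simp
    moreover have "k2 * (k1 + \<epsilon>0 / 10) = k1 * k2 + (k2 * \<epsilon>0) / 10" by (simp add: algebra_simps)
    ultimately show ?thesis using k(4) by linarith
  qed
  show ?thesis
    by (rule recovery[OF G m' m0 N _ rip_small step_small h_def \<epsilon> start_small _ _ basin _ _ _ _ k(1,2) _ kk])
      (use \<epsilon>0 k in \<open>simp_all add: c0_def\<close>)
qed

end

theorem theorem4p10:
  shows "\<exists>C::real>0. \<forall>\<beta>::real>1. \<exists>c1::real>0. \<exists>c2::real>0.
    \<forall>(n1::nat) (n2::nat) (n3::nat) (X::tensor) (\<mu>0::real) (\<mu>1::real)
      (k1::real) (k2::real) (\<epsilon>0::real) (m::nat) (L::nat) (G::nat \<Rightarrow> nat set).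
    (let n = Max {n1, n2, n3};
         N = real (max n1 n2) * real n3;
         r = real (rank_ct X);
         \<kappa> = cond_number (bar X)
     in
       X \<in> tensors n1 n2 n3 \<and> X \<noteq> tzero n1 n2 n3 \<and>
       \<mu>0 > 0 \<and> tensor_incoherent \<mu>0 X \<and>
       \<mu>1 > 0 \<and> joint_incoherent \<mu>1 X \<and>
       n \<ge> 2 \<and>
       k1 \<ge> 0 \<and> k2 \<ge> 0 \<and> 0 < \<epsilon>0 \<and> \<epsilon>0 < 1 \<and>
       (1 - 4 * \<epsilon>0) - k1 * (1 + 4 * \<epsilon>0) > 0 \<and>
       gamma1 k1 k2 \<epsilon>0 + gamma2 k1 k2 \<epsilon>0 < 1 \<and>
       L = nat \<lceil>6 * ln (\<beta> * real n * ln (real n) / (24 * \<epsilon>0))\<rceil> \<and>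
       m \<le> n1 * n2 * n3 \<and> (L + 1) dvd m \<and> equal_groups m L G \<and>
       real m \<ge> C * max (\<mu>0 * r * \<kappa>\<^sup>2 / \<epsilon>0\<^sup>2) (\<mu>1\<^sup>2 * r\<^sup>2 * \<kappa> ^ 6)
                  * \<beta> * N * ln N * ln (\<beta> * real n * ln (real n) / (24 * \<epsilon>0))
       \<longrightarrow>
       measure_pmf.prob (uniform_samples m n1 n2 n3) {\<Omega>. recovers \<mu>0 k1 k2 X L G \<Omega>}
         \<ge> 1 - c1 * real (L + 1) * N powr (- c2))"
proof -
  have main: "measure_pmf.prob (uniform_samples m n1 n2 n3) {\<Omega>. recovers \<mu>0 k1 k2 X L G \<Omega>}
         \<ge> 1 - 4 * real (L + 1) * (real (max n1 n2) * real n3) powr (- 2)"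
    if \<beta>: "1 < \<beta>" and X: "X \<in> tensors n1 n2 n3" "X \<noteq> tzero n1 n2 n3"
      and \<mu>0: "\<mu>0 > 0" and inc: "tensor_incoherent \<mu>0 X" and \<mu>1: "\<mu>1 > 0" and joint: "joint_incoherent \<mu>1 X"
      and n2: "Max {n1, n2, n3} \<ge> 2" and k: "k1 \<ge> 0" "k2 \<ge> 0" and \<epsilon>0: "0 < \<epsilon>0"
      and A: "(1 - 4 * \<epsilon>0) - k1 * (1 + 4 * \<epsilon>0) > 0" and \<gamma>: "gamma1 k1 k2 \<epsilon>0 + gamma2 k1 k2 \<epsilon>0 < 1"
      and L: "L = nat \<lceil>6 * ln (\<beta> * real (Max {n1, n2, n3}) * ln (real (Max {n1, n2, n3})) / (24 * \<epsilon>0))\<rceil>"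
      and dv: "(L + 1) dvd m" and G: "equal_groups m L G"
      and m: "real m \<ge> 10 ^ 17 * max (\<mu>0 * real (rank_ct X) * (cond_number (bar X))\<^sup>2 / \<epsilon>0\<^sup>2) (\<mu>1\<^sup>2 * (real (rank_ct X))\<^sup>2 * cond_number (bar X) ^ 6)
                  * \<beta> * (real (max n1 n2) * real n3) * ln (real (max n1 n2) * real n3)
                  * ln (\<beta> * real (Max {n1, n2, n3}) * ln (real (Max {n1, n2, n3})) / (24 * \<epsilon>0))"
    for \<beta> \<mu>0 \<mu>1 k1 k2 \<epsilon>0 :: real and n1 n2 n3 m L :: nat and X G
  proof -
    note pos = tensor_degenerate[OF X]
    have dims: "dim1 X = n1" "dim2 X = n2" "dim3 X = n3" using tensorsD[OF X(1)] pos by auto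
    obtain U S V where svd: "is_skinny_svd X U S V"
      and iU: "\<forall>i<n1. tnorm (ttranspose U *\<^sub>t evec n1 n3 i) \<le> sqrt (\<mu>0 * rank_ct X / n1)"
      and iV: "\<forall>j<n2. tnorm (ttranspose V *\<^sub>t evec n2 n3 j) \<le> sqrt (\<mu>0 * rank_ct X / n2)"
      using inc unfolding tensor_incoherent_def dims by blast
    interpret incoherent_tensor n1 n2 n3 X U S V \<mu>0
      by unfold_locales (fact \<mu>0 X svd iU iV)+
    note gb = gamma_bounds[OF k \<epsilon>0 A \<gamma>]
    define n where "n = Max {n1, n2, n3}"
    have nle: "n1 \<le> n" "n2 \<le> n" "n3 \<le> n" unfolding n_def by auto
    have n': "2 \<le> real n" using n2 unfolding n_def by simp
    define \<Lambda> where "\<Lambda> = ln (\<beta> * real n * ln (real n) / (24 * \<epsilon>0))"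
    note lf = log_factor_bounds[OF \<beta> n' \<epsilon>0 gb(1), folded \<Lambda>_def]
    have L': "L = nat \<lceil>6 * \<Lambda>\<rceil>" unfolding L \<Lambda>_def n_def ..
    have nN: "real n \<le> NN"
    proof -
      have "n = max n1 n2 \<or> n = n3" unfolding n_def by auto
      moreover have "max n1 n2 * 1 \<le> max n1 n2 * n3" "1 * n3 \<le> max n1 n2 * n3" using pos by (intro mult_le_mono; simp)+
      ultimately have "n \<le> max n1 n2 * n3" by auto
      then show ?thesis by (metis of_nat_le_iff of_nat_mult)
    qed
    then have N2: "2 \<le> NN" using n' by linarith
    then have lnN: "2 / 3 \<le> ln NN" using ln2_ge_two_thirds ln_le_cancel_iff[of 2 NN] by linarith
    \<comment> \<open>Rounding up costs at most the factor \<open>5 / 2\<close>, because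
      \<open>ln NN \<ge> 2 / 3\<close>.\<close>
    define p where "p = nat \<lceil>ln NN\<rceil>"
    have p: "ln NN \<le> real p" "real p \<le> 5 / 2 * ln NN" "0 < p" unfolding p_def using lnN by linarith+
    obtain m' where m': "m = m' * (L + 1)" using dv by (metis dvd_def mult.commute)
    define M where "M = max (\<mu>0 * real r * \<kappa>\<^sup>2 / \<epsilon>0\<^sup>2) (\<mu>1\<^sup>2 * (real r)\<^sup>2 * \<kappa> ^ 6)"
    have M0: "0 \<le> M" unfolding M_def by (rule order_trans[OF _ max.cobounded2]) simp
    have "10 ^ 17 * M * \<beta> * NN * ln NN * \<Lambda> \<le> real m" using m unfolding M_def \<Lambda>_def n_def .
    also have "... \<le> real m' * (18 * \<Lambda>)" unfolding m' using lf(2) unfolding L'[symmetric] of_nat_mult by (intro mult_left_mono) auto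
    finally have "(10 ^ 17 * M * \<beta> * NN * ln NN) * \<Lambda> \<le> (18 * real m') * \<Lambda>" by (simp add: mult_ac)
    then have "10 ^ 17 * M * \<beta> * NN * ln NN \<le> 18 * real m'" using lf(1) by (simp only: mult_le_cancel_right_pos)
    moreover have "(10 ^ 17 * M * NN * ln NN) * 1 \<le> (10 ^ 17 * M * NN * ln NN) * \<beta>" using \<beta> M0 N2 lnN by (intro mult_left_mono) auto
    moreover have "(M * NN) * real p \<le> (M * NN) * (5 / 2 * ln NN)" using M0 N2 p(2) by (intro mult_left_mono) auto
    \<comment> \<open>\<open>10 ^ 17\<close> divided by \<open>18 * 5 / 2\<close>, the losses from
      \<open>L + 1\<close> and from rounding \<open>p\<close>, is still above
      \<open>2 * 10 ^ 15\<close>.\<close>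
    ultimately have size: "2 * 10 ^ 15 * (M * NN * real p) \<le> real m'"
      using mult_nonneg_nonneg[of "M * NN" "real p"] M0 N2 by (simp add: mult_ac)
    have sz: "2 * 10 ^ 15 * t * NN * real p \<le> real m'" if "t \<le> M" for t
    proof -
      have "2 * 10 ^ 15 * t * NN * real p \<le> 2 * 10 ^ 15 * M * NN * real p" using that N2 by (intro mult_right_mono mult_left_mono) auto
      then show ?thesis using size by (simp add: mult.assoc)
    qed
    show ?thesis
    proof (rule recovery_from_sample_size[OF G m' _ p(1) _ \<mu>1 \<epsilon>0 gb(1) k gb(2,3) refl p(3) sz sz n'])
      show "1 < NN" using N2 by simp
      show "tnorm_inf X \<le> \<mu>1 * sqrt (real r / vol) * tspectral_norm X"
        using joint unfolding joint_incoherent_def dims vol_def .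
      show "real (min n1 n2) \<le> real n" using nle by simp
      show "real n * (1 / 2) ^ L \<le> 36 * \<epsilon>0" using lf(3) unfolding L' .
    qed (simp_all add: M_def)
  qed
  show ?thesis
    unfolding Let_def
    by (intro exI[of _ "10 ^ 17 :: real"] conjI allI impI exI[of _ "4::real"] exI[of _ "2::real"]) (simp, simp, simp, elim conjE, rule main, assumption+)
qed

end
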